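(* Let $\mathbf{F}$ be a symbol system on a finite-dimensional complex vector space $W$ and let $M(\mathbf{F})\subset\mathbb{P}V_{\mathbf F}$ be the associated Euler-symmetric projective variety. If $M(\mathbf{F})$ is nonsingular, then the base loci $\mathbf{Bs}(\mathbf{F})\subset\mathbb{P}W$ is nonsingular.
   Context: Everything is over $\mathbb{C}$; $\mathbb{P}V$ is the projective space of one-dimensional subspaces of $V$. Symbol systems. Regard $\mathrm{Sym}^kW^*$ as the space of symmetric $k$-linear forms on $W$. For $w\in W$, the contraction $\iota_w:\mathrm{Sym}^{k+1}W^*\to\mathrm{Sym}^kW^*$ is $\iota_w\varphi(w_1,\dots,w_k)=\varphi(w,w_1,\dots,w_k)$, with $\iota_w(\mathrm{Sym}^0W^* )=0$. A subspace $\mathbf{F}=\bigoplus_{k\ge0}F^k\subset\bigoplus_{k\ge0}\mathrm{Sym}^kW^*$ (with $F^k\subset\mathrm{Sym}^kW^*$) satisfying $F^0=\mathbb{C}$, $F^1=W^*$, $F^r\ne0$ and $F^{r+i}=0$ for all $i\ge1$ (where $r\geq 1$) is a symbol system of rank $r$ if $\iota_w\mathbf{F}\subset\mathbf{F}$ for all $w\in W$. The variety $M(\mathbf{F})$. For $w\in W$ let $\iota_w^k\in(F^k)^*$ be the functional $\varphi\mapsto\varphi(w,\dots,w)$. Put $V_{\mathbf F}:=\mathbb{C}\oplus W\oplus(F^2)^*\oplus\cdots\oplus(F^r)^*$. $M(\mathbf{F})\subset\mathbb{P}V_{\mathbf F}$ is the proper image (closure of the image) of the rational map $\phi_{\mathbf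 F}:\mathbb{P}(\mathbb{C}\oplus W)\dashrightarrow\mathbb{P}V_{\mathbf F}$, $[t:w]\mapsto[t^r:t^{r-1}w:t^{r-2}\iota_w^2:\cdots:t\,\iota_w^{r-1}:\iota_w^r]$. Base loci. $\mathbf{Bs}(F^k)\subset\mathbb{P}W$ is the projective algebraic subset (with its reduced structure) with affine cone $\{w\in W\mid\varphi(w,\dots,w)=0\text{ for all }\varphi\in F^k\}$. One has $\mathbf{Bs}(F^k)\subset\mathbf{Bs}(F^{k+1})$, $\mathbf{Bs}(F^1)=\emptyset$, $\mathbf{Bs}(F^{r+1})=\mathbb{P}W$. The order of $\mathbf{F}$ is the largest natural number $m$ with $\mathbf{Bs}(F^m)=\emptyset$, and the base loci of $\mathbf{F}$ is the nonempty projective algebraic subset $\mathbf{Bs}(\mathbf{F}):=\mathbf{Bs}(F^{m+1})\subset\mathbb{P}W$. It is not required to be connected or irreducible. *)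

theory Defs
  imports
    Complex_Main
    "HOL-Library.Function_Algebras"
    "HOL-Library.Product_Plus"
    "HOL-Library.Multiset"
    "HOL-Library.Extended_Nat"
begin

text \<open>
  Throughout, \<open>s :: complex \<Rightarrow> 'v \<Rightarrow> 'v\<close> is the scalar multiplication of a complex vector space
  and \<open>V\<close> is a linear subspace of it, regarded as a vector space in its own right.
\<close>

section \<open>Symmetric multilinear forms\<close>

text \<open>
  A symmetric \<open>k\<close>-linear form on \<open>V\<close> is a function on lists of vectors that vanishes, by
  convention, on every list that is not a list of \<open>k\<close> elements of \<open>V\<close>. The value at the empty
  list identifies \<open>sym_forms s V 0\<close> with the complex numbers.
\<close>

definition sym_forms ::
  "(complex \<Rightarrow> 'v \<Rightarrow> 'v) \<Rightarrow> 'v::ab_group_add set \<Rightarrow> nat \<Rightarrow> ('v list \<Rightarrow> complex) set" where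
  "sym_forms s V k = {\<phi>.
     (\<forall>vs. \<not> (length vs = k \<and> set vs \<subseteq> V) \<longrightarrow> \<phi> vs = 0) \<and>
     (\<forall>us vs. mset us = mset vs \<longrightarrow> \<phi> us = \<phi> vs) \<and>
     (\<forall>us vs. \<forall>x\<in>V. \<forall>y\<in>V. \<forall>a b. set us \<subseteq> V \<and> set vs \<subseteq> V \<and> length us + 1 + length vs = k \<longrightarrow>
        \<phi> (us @ (s a x + s b y) # vs) = a * \<phi> (us @ x # vs) + b * \<phi> (us @ y # vs))}"

definition contract :: "'v \<Rightarrow> ('v list \<Rightarrow> complex) \<Rightarrow> 'v list \<Rightarrow> complex" where
  "contract w \<phi> = (\<lambda>vs. \<phi> (w # vs))"

definition fun_scale :: "complex \<Rightarrow> ('a \<Rightarrow> complex) \<Rightarrow> 'a \<Rightarrow> complex" where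
  "fun_scale c f = (\<lambda>x. c * f x)"

text \<open>The dual of a space \<open>U\<close> of functions; functionals are extended by zero outside \<open>U\<close>.\<close>

definition dual_space :: "('a \<Rightarrow> complex) set \<Rightarrow> (('a \<Rightarrow> complex) \<Rightarrow> complex) set" where
  "dual_space U = {\<xi>. (\<forall>f. f \<notin> U \<longrightarrow> \<xi> f = 0) \<and>
     (\<forall>f\<in>U. \<forall>g\<in>U. \<xi> (f + g) = \<xi> f + \<xi> g) \<and> (\<forall>f\<in>U. \<forall>c. \<xi> (fun_scale c f) = c * \<xi> f)}"


section \<open>Projective algebraic subsets\<close>

text \<open>Points of projective space are the one-dimensional subspaces themselves.\<close>

definition proj_space :: "(complex \<Rightarrow> 'v \<Rightarrow> 'v) \<Rightarrow> 'v::ab_group_add set \<Rightarrow> 'v set set" where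
  "proj_space s V = {module.span s {v} | v. v \<in> V \<and> v \<noteq> 0}"

text \<open>
  Homogeneous polynomials of degree \<open>d\<close> on \<open>V\<close> are the functions \<open>v \<mapsto> \<phi>(v, \<dots>, v)\<close> with \<open>\<phi>\<close> a
  symmetric \<open>d\<close>-linear form. A system of them is a set of pairs \<open>(d, \<phi>)\<close>.
\<close>

definition proj_zeros ::
  "(complex \<Rightarrow> 'v \<Rightarrow> 'v) \<Rightarrow> 'v::ab_group_add set \<Rightarrow> (nat \<times> ('v list \<Rightarrow> complex)) set \<Rightarrow> 'v set set" where
  "proj_zeros s V S = {x \<in> proj_space s V. \<forall>(d, \<phi>)\<in>S. \<forall>v\<in>x. \<phi> (replicate d v) = 0}"

definition zariski_closed ::
  "(complex \<Rightarrow> 'v \<Rightarrow> 'v) \<Rightarrow> 'v::ab_group_add set \<Rightarrow> 'v set set \<Rightarrow> bool" where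
  "zariski_closed s V X \<longleftrightarrow> (\<exists>S \<subseteq> (SIGMA d:UNIV. sym_forms s V d). X = proj_zeros s V S)"

definition zariski_closure ::
  "(complex \<Rightarrow> 'v \<Rightarrow> 'v) \<Rightarrow> 'v::ab_group_add set \<Rightarrow> 'v set set \<Rightarrow> 'v set set" where
  "zariski_closure s V A = \<Inter>{X. zariski_closed s V X \<and> A \<subseteq> X}"

definition irreducible_closed ::
  "(complex \<Rightarrow> 'v \<Rightarrow> 'v) \<Rightarrow> 'v::ab_group_add set \<Rightarrow> 'v set set \<Rightarrow> bool" where
  "irreducible_closed s V Z \<longleftrightarrow> zariski_closed s V Z \<and> Z \<noteq> {} \<and>
     (\<forall>A B. zariski_closed s V A \<and> zariski_closed s V B \<and> Z = A \<union> B \<longrightarrow> Z = A \<or> Z = B)"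

text \<open>
  The Krull dimension of the local ring of \<open>X\<close> at the point \<open>x\<close>: its prime ideals correspond to
  the irreducible closed subsets of \<open>X\<close> through \<open>x\<close>.
\<close>

definition local_dim ::
  "(complex \<Rightarrow> 'v \<Rightarrow> 'v) \<Rightarrow> 'v::ab_group_add set \<Rightarrow> 'v set set \<Rightarrow> 'v set \<Rightarrow> enat" where
  "local_dim s V X x = Sup {enat n | n. \<exists>Z :: nat \<Rightarrow> 'v set set.
     (\<forall>i\<le>n. irreducible_closed s V (Z i) \<and> x \<in> Z i \<and> Z i \<subseteq> X) \<and> (\<forall>i<n. Z i \<subset> Z (Suc i))}"

text \<open>
  The affine tangent space of \<open>X\<close> (with its reduced structure, so that all homogeneous polynomials
  vanishing on \<open>X\<close> are used) at \<open>x\<close>. The differential of \<open>v \<mapsto> \<phi>(v, \<dots>, v)\<close> at \<open>v\<close> is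
  \<open>u \<mapsto> (d + 1) \<phi>(u, v, \<dots>, v)\<close>, where \<open>d + 1\<close> is the degree. The Zariski tangent space of \<open>X\<close>
  at \<open>x\<close> is \<open>Hom(x, T/x)\<close> with \<open>T\<close> the affine tangent space, so its dimension is \<open>dim T - 1\<close>.
\<close>

definition affine_tangent_space ::
  "(complex \<Rightarrow> 'v \<Rightarrow> 'v) \<Rightarrow> 'v::ab_group_add set \<Rightarrow> 'v set set \<Rightarrow> 'v set \<Rightarrow> 'v set" where
  "affine_tangent_space s V X x = {u \<in> V. \<forall>d. \<forall>\<phi> \<in> sym_forms s V (Suc d).
     (\<forall>y\<in>X. \<forall>v\<in>y. \<phi> (replicate (Suc d) v) = 0) \<longrightarrow> (\<forall>v\<in>x. \<phi> (u # replicate d v) = 0)}"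

text \<open>
  Regularity of all local rings: the Zariski tangent space has dimension \<open>local_dim\<close> at each
  point. No irreducibility or equidimensionality is required.
\<close>

definition nonsingular ::
  "(complex \<Rightarrow> 'v \<Rightarrow> 'v) \<Rightarrow> 'v::ab_group_add set \<Rightarrow> 'v set set \<Rightarrow> bool" where
  "nonsingular s V X \<longleftrightarrow> (\<forall>x\<in>X.
     enat (vector_space.dim s (affine_tangent_space s V X x)) = local_dim s V X x + 1)"


section \<open>Symbol systems\<close>

text \<open>
  The graded subspace is given by its homogeneous components \<open>F k\<close>. Forms of degree zero need no
  clause in the contraction axiom, since \<open>contract w\<close> kills them.
\<close>

definition symbol_system ::
  "(complex \<Rightarrow> 'w \<Rightarrow> 'w) \<Rightarrow> (nat \<Rightarrow> ('w::ab_group_add list \<Rightarrow> complex) set) \<Rightarrow> nat \<Rightarrow> bool" where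
  "symbol_system s F r \<longleftrightarrow> 1 \<le> r \<and>
     (\<forall>k. F k \<subseteq> sym_forms s UNIV k \<and> module.subspace fun_scale (F k)) \<and>
     F 0 = sym_forms s UNIV 0 \<and> F 1 = sym_forms s UNIV 1 \<and>
     F r \<noteq> {0} \<and> (\<forall>i\<ge>1. F (r + i) = {0}) \<and>
     (\<forall>w k. contract w ` F (Suc k) \<subseteq> F k)"

definition power_functional ::
  "(nat \<Rightarrow> ('w list \<Rightarrow> complex) set) \<Rightarrow> nat \<Rightarrow> 'w \<Rightarrow> ('w list \<Rightarrow> complex) \<Rightarrow> complex" where
  "power_functional F k w = (\<lambda>\<phi>. if \<phi> \<in> F k then \<phi> (replicate k w) else 0)"

text \<open>
  The space \<open>\<complex> \<oplus> W \<oplus> (F 2)\<^sup>* \<oplus> \<dots> \<oplus> (F r)\<^sup>*\<close>: in \<open>(t, w, \<xi>)\<close> the component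
  in the dual of \<open>F k\<close> is \<open>\<xi> k\<close>, and \<open>\<xi> k = 0\<close> for \<open>k\<close> outside \<open>{2..r}\<close>.
\<close>

type_synonym 'w symbol_vec = "complex \<times> 'w \<times> (nat \<Rightarrow> ('w list \<Rightarrow> complex) \<Rightarrow> complex)"

definition symbol_scale ::
  "(complex \<Rightarrow> 'w \<Rightarrow> 'w) \<Rightarrow> complex \<Rightarrow> 'w symbol_vec \<Rightarrow> 'w symbol_vec" where
  "symbol_scale s c = (\<lambda>(t, w, \<xi>). (c * t, s c w, \<lambda>k. fun_scale c (\<xi> k)))"

definition symbol_space ::
  "(nat \<Rightarrow> ('w list \<Rightarrow> complex) set) \<Rightarrow> nat \<Rightarrow> 'w symbol_vec set" where
  "symbol_space F r = {(t, w, \<xi>). \<forall>k. if k \<in> {2..r} then \<xi> k \<in> dual_space (F k) else \<xi> k = 0}"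

definition symbol_map ::
  "(complex \<Rightarrow> 'w \<Rightarrow> 'w) \<Rightarrow> (nat \<Rightarrow> ('w list \<Rightarrow> complex) set) \<Rightarrow> nat \<Rightarrow> complex \<Rightarrow> 'w \<Rightarrow> 'w symbol_vec" where
  "symbol_map s F r t w = (t ^ r, s (t ^ (r - 1)) w,
     \<lambda>k. if k \<in> {2..r} then fun_scale (t ^ (r - k)) (power_functional F k w) else 0)"

text \<open>The rational map is defined at \<open>[t : w]\<close> exactly if \<open>symbol_map\<close> does not vanish there.\<close>

definition euler_symmetric_variety ::
  "(complex \<Rightarrow> 'w \<Rightarrow> 'w) \<Rightarrow> (nat \<Rightarrow> ('w::ab_group_add list \<Rightarrow> complex) set) \<Rightarrow> nat \<Rightarrow>
     'w symbol_vec set set" where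
  "euler_symmetric_variety s F r = zariski_closure (symbol_scale s) (symbol_space F r)
     {module.span (symbol_scale s) {symbol_map s F r t w} | t w.
        (t, w) \<noteq> 0 \<and> symbol_map s F r t w \<noteq> 0}"

definition base_locus ::
  "(complex \<Rightarrow> 'w \<Rightarrow> 'w) \<Rightarrow> (nat \<Rightarrow> ('w::ab_group_add list \<Rightarrow> complex) set) \<Rightarrow> nat \<Rightarrow> 'w set set" where
  "base_locus s F k = proj_zeros s UNIV ({k} \<times> F k)"

definition symbol_order ::
  "(complex \<Rightarrow> 'w \<Rightarrow> 'w) \<Rightarrow> (nat \<Rightarrow> ('w::ab_group_add list \<Rightarrow> complex) set) \<Rightarrow> nat" where
  "symbol_order s F = (GREATEST m. base_locus s F m = {})"

definition base_loci ::
  "(complex \<Rightarrow> 'w \<Rightarrow> 'w) \<Rightarrow> (nat \<Rightarrow> ('w::ab_group_add list \<Rightarrow> complex) set) \<Rightarrow> 'w set set" where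
  "base_loci s F = base_locus s F (symbol_order s F + 1)"

end

theory Submission
  imports
    Defs
    "HOL-Analysis.Continuum_Not_Denumerable"
    "HOL-Computational_Algebra.Fundamental_Theorem_Algebra"
    "HOL-Library.FuncSet"
begin

text \<open>
  Let \<open>m\<close> be the order of the symbol system and \<open>span {w}\<close> a point of the base loci. As \<open>t\<close> tends
  to 0, the point \<open>symbol_map s F r t w\<close> of \<open>M\<close> tends to the point whose only component is the
  one of weight \<open>m\<close>, since \<open>w\<close> annihilates the components of higher weight. The tangent spaces
  along this curve degenerate into the tangent space \<open>T\<close> of \<open>M\<close> at the limit; as \<open>M\<close> is nonsingular
  of dimension at most \<open>dim W\<close> there, they fill \<open>T\<close>. Hence \<open>T\<close> is annihilated by all coordinates of
  weight above \<open>m + 1\<close> and by those combinations of the coordinates of weight \<open>m + 1\<close> that belong to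
  forms with vanishing differential at \<open>w\<close>. A form on the ambient space that vanishes on \<open>M\<close> can be
  split by weights; if its differential at the limit point is such a coordinate \<open>\<phi>\<close>, then one of
  its weight components writes \<open>\<phi>(v, \<dots>, v)\<close> as a combination of equations in \<open>F k\<close>, \<open>k > m\<close>,
  where the equations of no greater weight have coefficients vanishing at \<open>w\<close>. As in Nakayama's
  lemma, it follows that at \<open>w\<close> all equations of the base loci are generated by elements of
  \<open>F (m + 1)\<close> with linearly independent differentials, so that the base loci are nonsingular at \<open>w\<close>.

  The dimension theory this requires is obtained for functions on a vector space: a local ring has
  dimension at most its embedding dimension, and equations with independent differentials
  lower the dimension by at most their number, because the ideals of the formal germs they cut
  out are prime.
\<close>

section \<open>Rings of functions and the basis theorem\<close>

text \<open>The base loci are defined by \<open>F (m + 1)\<close> alone, but a relation found at the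
  limit point mixes all weights above \<open>m\<close>, because a fixed total weight can be
  distributed over the factors of a product of coordinates in many ways. Hence all weights
  \<open>k > m\<close> are handled together: terms with a factor heavier than \<open>k\<close> are
  covered by descent, weights being bounded by \<open>r\<close>, and in all remaining terms the
  coefficient vanishes at \<open>w\<close> and gains an order of vanishing. Smoothness of
  \<open>M\<close> enters only as \<open>dim T \<le> dim W + 1\<close>; the dimension of
  \<open>M\<close> itself is bounded through its parametrization by \<open>t\<close> and
  \<open>W\<close>. Local dimension is given by chains of irreducible closed sets, so local rings
  and completions are avoided: a formal germ is represented by the polynomial functions that its
  equations generate up to every finite order. Krull's intersection theorem shows that this whole
  ideal vanishes on an irreducible closed set through the point on which the equations vanish, which
  serves the upper bound; the Nullstellensatz supplies points that make zero sets irreducible, which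
  serves the lower bound.\<close>

definition subring_of :: "'r::comm_ring_1 set \<Rightarrow> bool" where
  "subring_of A \<longleftrightarrow> 1 \<in> A \<and> (\<forall>x\<in>A. \<forall>y\<in>A. x - y \<in> A \<and> x * y \<in> A)"

text \<open>Everything is relative to a subset \<open>A\<close> of the ambient ring type, because
  the rings of interest consist of the polynomial functions among all functions.\<close>

definition ideal_of :: "'r::comm_ring_1 set \<Rightarrow> 'r set \<Rightarrow> bool" where
  "ideal_of A I \<longleftrightarrow> I \<subseteq> A \<and> 0 \<in> I \<and> (\<forall>x\<in>I. \<forall>y\<in>I. x + y \<in> I) \<and> (\<forall>a\<in>A. \<forall>x\<in>I. a * x \<in> I)"

definition prime_of :: "'r::comm_ring_1 set \<Rightarrow> 'r set \<Rightarrow> bool" where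
  "prime_of A P \<longleftrightarrow> ideal_of A P \<and> 1 \<notin> P \<and> (\<forall>x\<in>A. \<forall>y\<in>A. x * y \<in> P \<longrightarrow> x \<in> P \<or> y \<in> P)"

definition acc :: "'r::comm_ring_1 set \<Rightarrow> bool" where
  "acc A \<longleftrightarrow> (\<forall>I. (\<forall>k::nat. ideal_of A (I k) \<and> I k \<subseteq> I (Suc k)) \<longrightarrow> (\<exists>K. \<forall>k\<ge>K. I k = I K))"

lemma subring_of_closed:
  assumes "subring_of A"
  shows "1 \<in> A" "0 \<in> A" "x \<in> A \<Longrightarrow> y \<in> A \<Longrightarrow> x + y \<in> A" "x \<in> A \<Longrightarrow> y \<in> A \<Longrightarrow> x - y \<in> A"
    "x \<in> A \<Longrightarrow> y \<in> A \<Longrightarrow> x * y \<in> A" "x \<in> A \<Longrightarrow> - x \<in> A" "x \<in> A \<Longrightarrow> x ^ n \<in> A"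
proof -
  show 1: "1 \<in> A" and diff: "x \<in> A \<Longrightarrow> y \<in> A \<Longrightarrow> x - y \<in> A"
    and mult: "x \<in> A \<Longrightarrow> y \<in> A \<Longrightarrow> x * y \<in> A" for x y
    using assms by (auto simp: subring_of_def)
  show 0: "0 \<in> A" using diff[OF 1 1] by simp
  show neg: "x \<in> A \<Longrightarrow> - x \<in> A" for x using diff[OF 0, of x] by simp
  show "x \<in> A \<Longrightarrow> y \<in> A \<Longrightarrow> x + y \<in> A" using diff[of x "-y"] neg[of y] by simp
  show "x \<in> A \<Longrightarrow> x ^ n \<in> A" by (induction n) (auto intro: 1 mult)
qed

lemma subring_of_sum:
  assumes "subring_of A" "\<And>i. i \<in> S \<Longrightarrow> f i \<in> A"
  shows "sum f S \<in> A"
  using assms(2)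
  by (induction S rule: infinite_finite_induct) (auto intro: subring_of_closed[OF assms(1)])

lemma ideal_of_closed:
  assumes "ideal_of A I"
  shows "0 \<in> I" "x \<in> I \<Longrightarrow> y \<in> I \<Longrightarrow> x + y \<in> I" "a \<in> A \<Longrightarrow> x \<in> I \<Longrightarrow> a * x \<in> I"
    "x \<in> I \<Longrightarrow> x \<in> A"
  using assms by (auto simp: ideal_of_def)

lemma ideal_of_diff:
  assumes "subring_of A" "ideal_of A I" "x \<in> I" "y \<in> I"
  shows "x - y \<in> I"
proof -
  have "- 1 \<in> A" using subring_of_closed(1,6)[OF assms(1)] by blast
  then have "- 1 * y \<in> I" by (rule ideal_of_closed(3)[OF assms(2)]) fact
  then have "x + (- 1 * y) \<in> I" by (rule ideal_of_closed(2)[OF assms(2,3)])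
  then show ?thesis by simp
qed

lemma ideal_of_sum:
  assumes "ideal_of A I" "\<And>i. i \<in> S \<Longrightarrow> f i \<in> I"
  shows "sum f S \<in> I"
  using assms(2)
  by (induction S rule: infinite_finite_induct) (auto intro: ideal_of_closed[OF assms(1)])

text \<open>Otherwise every member of \<open>C\<close> above \<open>I\<close> would have a strictly
  larger one, and dependent choice would produce an ascending chain that never stops.\<close>

lemma acc_maximal:
  assumes "acc A" "I \<in> C" "\<And>J. J \<in> C \<Longrightarrow> ideal_of A J"
  obtains M where "M \<in> C" "I \<subseteq> M" "\<And>N. N \<in> C \<Longrightarrow> M \<subseteq> N \<Longrightarrow> N = M"
proof (rule ccontr)
  assume no: "\<not> thesis"
  have "\<exists>f. \<forall>n. (f n \<in> C \<and> I \<subseteq> f n) \<and> f n \<subset> f (Suc n)"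
  proof (rule dependent_nat_choice)
    show "\<exists>x. x \<in> C \<and> I \<subseteq> x" using assms(2) by blast
  next
    fix x n assume "x \<in> C \<and> I \<subseteq> x"
    then show "\<exists>y. (y \<in> C \<and> I \<subseteq> y) \<and> x \<subset> y" using no that by (metis dual_order.trans psubsetI)
  qed
  then obtain f where f: "\<And>n. f n \<in> C" "\<And>n::nat. f n \<subset> f (Suc n)" by blast
  then have "\<exists>K. \<forall>k\<ge>K. f k = f K" using assms(1,3) unfolding acc_def by (metis psubset_imp_subset)
  then show False using f(2) by (metis le_Suc_eq order_refl psubset_eq)
qed

text \<open>Here \<open>n\<close> is only a formal degree: the leading coefficient \<open>c n\<close> may vanish.\<close>

definition lead_ideal :: "'r::comm_ring_1 set \<Rightarrow> 'r \<Rightarrow> nat \<Rightarrow> 'r set \<Rightarrow> 'r set" where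
  "lead_ideal A x n I = {c n | c. (\<forall>i. c i \<in> A) \<and> (\<Sum>i\<le>n. c i * x ^ i) \<in> I}"

lemma lead_ideal_mono: "I \<subseteq> J \<Longrightarrow> lead_ideal A x n I \<subseteq> lead_ideal A x n J"
  by (auto simp: lead_ideal_def)

lemma ideal_of_lead_ideal:
  assumes A: "subring_of A" and B: "subring_of B" "A \<subseteq> B" and I: "ideal_of B I"
  shows "ideal_of A (lead_ideal A x n I)"
  unfolding ideal_of_def
proof (intro conjI ballI)
  show "lead_ideal A x n I \<subseteq> A" by (auto simp: lead_ideal_def)
  show "0 \<in> lead_ideal A x n I"
    unfolding lead_ideal_def
    by (rule CollectI, rule exI[of _ "\<lambda>_. 0"]) (simp add: subring_of_closed(2)[OF A] ideal_of_closed(1)[OF I])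
next
  fix a b assume "a \<in> lead_ideal A x n I" "b \<in> lead_ideal A x n I"
  then obtain c d where c: "a = c n" "\<forall>i. c i \<in> A" "(\<Sum>i\<le>n. c i * x ^ i) \<in> I"
    and d: "b = d n" "\<forall>i. d i \<in> A" "(\<Sum>i\<le>n. d i * x ^ i) \<in> I" by (auto simp: lead_ideal_def)
  have "(\<Sum>i\<le>n. (c i + d i) * x ^ i) = (\<Sum>i\<le>n. c i * x ^ i) + (\<Sum>i\<le>n. d i * x ^ i)"
    by (simp add: distrib_right sum.distrib)
  then show "a + b \<in> lead_ideal A x n I"
    unfolding lead_ideal_def
    by (intro CollectI exI[of _ "\<lambda>i. c i + d i"])
      (use c d in \<open>auto intro: subring_of_closed(3)[OF A] ideal_of_closed(2)[OF I]\<close>)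
next
  fix a b assume a: "a \<in> A" and "b \<in> lead_ideal A x n I"
  then obtain d where d: "b = d n" "\<forall>i. d i \<in> A" "(\<Sum>i\<le>n. d i * x ^ i) \<in> I"
    by (auto simp: lead_ideal_def)
  have "(\<Sum>i\<le>n. (a * d i) * x ^ i) = a * (\<Sum>i\<le>n. d i * x ^ i)"
    by (simp add: sum_distrib_left mult.assoc)
  moreover have "a \<in> B" using a B by auto
  ultimately show "a * b \<in> lead_ideal A x n I"
    unfolding lead_ideal_def
    by (intro CollectI exI[of _ "\<lambda>i. a * d i"])
      (use a d in \<open>auto intro: subring_of_closed(5)[OF A] ideal_of_closed(3)[OF I]\<close>)
qed

text \<open>Multiplication by \<open>x\<close> raises the formal degree and keeps the leading
  coefficient.\<close>

lemma lead_ideal_Suc: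
  assumes A: "subring_of A" and I: "ideal_of B I" and x: "x \<in> B"
  shows "lead_ideal A x n I \<subseteq> lead_ideal A x (Suc n) I"
proof
  fix a assume "a \<in> lead_ideal A x n I"
  then obtain c where c: "a = c n" "\<forall>i. c i \<in> A" "(\<Sum>i\<le>n. c i * x ^ i) \<in> I"
    by (auto simp: lead_ideal_def)
  define d where "d = (\<lambda>i. case i of 0 \<Rightarrow> 0 | Suc j \<Rightarrow> c j)"
  have "(\<Sum>i\<le>Suc n. d i * x ^ i) = x * (\<Sum>i\<le>n. c i * x ^ i)"
    unfolding sum.atMost_Suc_shift by (simp add: d_def sum_distrib_left mult_ac)
  then have "(\<Sum>i\<le>Suc n. d i * x ^ i) \<in> I" using ideal_of_closed(3)[OF I x c(3)] by simp
  moreover have "\<forall>i. d i \<in> A" using c subring_of_closed(2)[OF A] by (auto simp: d_def split: nat.split)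
  moreover have "d (Suc n) = a" by (simp add: d_def c)
  ultimately show "a \<in> lead_ideal A x (Suc n) I" unfolding lead_ideal_def by blast
qed

text \<open>An element of \<open>J\<close> has the same leading coefficient as some element of
  \<open>I\<close> of the same formal degree; their difference has smaller formal degree, and
  induction applies to it.\<close>

lemma ideal_eq_of_lead_ideal_eq:
  assumes A: "subring_of A" "subring_of B" "A \<subseteq> B"
    and gen: "\<And>b. b \<in> B \<Longrightarrow> \<exists>n c. (\<forall>i. c i \<in> A) \<and> b = (\<Sum>i\<le>n. c i * x ^ i)"
    and I: "ideal_of B I" "ideal_of B J" "I \<subseteq> J"
    and eq: "\<And>n. lead_ideal A x n I = lead_ideal A x n J"
  shows "I = J"
proof
  have key: "(\<forall>i. c i \<in> A) \<Longrightarrow> (\<Sum>i<n. c i * x ^ i) \<in> J \<Longrightarrow> (\<Sum>i<n. c i * x ^ i) \<in> I" for n c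
  proof (induction n arbitrary: c)
    case 0 then show ?case using ideal_of_closed(1)[OF I(1)] by simp
  next
    case (Suc n)
    then have "c n \<in> lead_ideal A x n J" unfolding lead_ideal_def
      by (auto simp: lessThan_Suc_atMost)
    then have "c n \<in> lead_ideal A x n I" using eq by simp
    then obtain d where d: "c n = d n" "\<forall>i. d i \<in> A" "(\<Sum>i\<le>n. d i * x ^ i) \<in> I"
      by (auto simp: lead_ideal_def)
    have split: "(\<Sum>i<Suc n. c i * x ^ i) - (\<Sum>i\<le>n. d i * x ^ i) = (\<Sum>i<n. (c i - d i) * x ^ i)"
      using d(1) by (simp add: lessThan_Suc_atMost[symmetric] left_diff_distrib sum_subtractf)
    have "(\<Sum>i<n. (c i - d i) * x ^ i) \<in> J"
      unfolding split[symmetric] by (rule ideal_of_diff[OF A(2) I(2)]) (use Suc.prems d I in auto)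
    then have "(\<Sum>i<n. (c i - d i) * x ^ i) \<in> I"
      using Suc.IH[of "\<lambda>i. c i - d i"] Suc.prems d subring_of_closed(4)[OF A(1)] by auto
    then have "(\<Sum>i<n. (c i - d i) * x ^ i) + (\<Sum>i\<le>n. d i * x ^ i) \<in> I"
      using d(3) ideal_of_closed(2)[OF I(1)] by blast
    then show ?case unfolding split[symmetric] by simp
  qed
  show "J \<subseteq> I"
  proof
    fix z assume z: "z \<in> J"
    then obtain n c where "\<forall>i. c i \<in> A" "z = (\<Sum>i\<le>n. c i * x ^ i)"
      using gen[OF ideal_of_closed(4)[OF I(2) z]] by blast
    then show "z \<in> I" using key[of c "Suc n"] z by (simp add: lessThan_Suc_atMost)
  qed
qed (rule I)

text \<open>Hilbert's basis theorem: the leading ideals increase in both indices, so the diagonal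
  controls all but finitely many of them.\<close>

lemma acc_extension:
  assumes A: "subring_of A" "subring_of B" "A \<subseteq> B" "acc A" and x: "x \<in> B"
    and gen: "\<And>b. b \<in> B \<Longrightarrow> \<exists>n c. (\<forall>i. c i \<in> A) \<and> b = (\<Sum>i\<le>n. c i * x ^ i)"
  shows "acc B"
  unfolding acc_def
proof (intro allI impI)
  fix I assume "\<forall>k::nat. ideal_of B (I k) \<and> I k \<subseteq> I (Suc k)"
  then have I: "\<And>k. ideal_of B (I k)" and ISuc: "\<And>k. I k \<subseteq> I (Suc k)" by blast+
  define L where "L n k = lead_ideal A x n (I k)" for n k
  have idL: "ideal_of A (L n k)" for n k unfolding L_def by (rule ideal_of_lead_ideal[OF A(1,2,3) I])
  have Imono: "I k \<subseteq> I l" if "k \<le> l" for k l by (rule lift_Suc_mono_le[of I, OF ISuc that])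
  have Lk: "L n k \<subseteq> L n l" if "k \<le> l" for n k l
    unfolding L_def using Imono[OF that] by (rule lead_ideal_mono)
  have Ln: "L n k \<subseteq> L p k" if "n \<le> p" for n p k
    unfolding L_def
    by (rule lift_Suc_mono_le[of "\<lambda>n. lead_ideal A x n (I k)", OF lead_ideal_Suc[OF A(1) I x] that])
  have ex: "\<exists>K. \<forall>k\<ge>K. L n k = L n K" for n
    using A(4)[unfolded acc_def, rule_format, of "L n"] idL Lk[of _ "Suc _"] by simp
  have "L k k \<subseteq> L (Suc k) (Suc k)" for k
    using Lk[of k "Suc k" k] Ln[of k "Suc k" "Suc k"] by simp
  then have "\<exists>K. \<forall>k\<ge>K. L k k = L K K"
    using A(4)[unfolded acc_def, rule_format, of "\<lambda>k. L k k"] idL by simp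
  then obtain K where K: "\<And>k. k \<ge> K \<Longrightarrow> L k k = L K K" by blast
  from ex obtain N where N: "\<And>n k. k \<ge> N n \<Longrightarrow> L n k = L n (N n)" by metis
  \<comment> \<open>Beyond \<open>M\<close> the diagonal is stationary and so are the finitely many
    rows \<open>n \<le> K\<close>; the remaining rows are controlled by the diagonal.\<close>
  define M where "M = Max (insert K (N ` {..K}))"
  have MK: "M \<ge> K" and MN: "M \<ge> N n" if "n \<le> K" for n
    using that by (auto simp: M_def le_max_iff_disj)
  have stab: "L n k = L n M" if k: "k \<ge> M" for n k
  proof (cases "n \<le> K")
    case True
    then show ?thesis using N MN k by (metis order.trans)
  next
    case False
    \<comment> \<open>\<open>L n k\<close> lies between \<open>L K K\<close> and the diagonal entry
      at \<open>max n k\<close>, which are equal.\<close>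
    have 1: "L n k = L K K" if "k \<ge> K" for k
    proof -
      have "L K K \<subseteq> L n k" using False that Lk Ln by (meson nat_le_linear order.trans)
      moreover have "L n k \<subseteq> L (max n k) (max n k)" using Lk Ln by (meson max.cobounded1 max.cobounded2 order.trans)
      ultimately show ?thesis using K[of "max n k"] that by auto
    qed
    have "M \<ge> K" using MK[of 0] by simp
    then show ?thesis using 1 k by auto
  qed
  have "I M = I k" if "k \<ge> M" for k
    by (rule ideal_eq_of_lead_ideal_eq[OF A(1,2,3) gen I[of M] I[of k] Imono[OF that]])
      (use stab[OF that] in \<open>simp_all add: L_def\<close>)
  then show "\<exists>K. \<forall>k\<ge>K. I k = I K" by metis
qed

section \<open>Algebras of functions with finitely many generators\<close>

inductive_set alg :: "('a \<Rightarrow> complex) set \<Rightarrow> ('a \<Rightarrow> complex) set" for X where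
  const: "(\<lambda>_. c) \<in> alg X"
| gen: "x \<in> X \<Longrightarrow> x \<in> alg X"
| add: "f \<in> alg X \<Longrightarrow> g \<in> alg X \<Longrightarrow> f + g \<in> alg X"
| mult: "f \<in> alg X \<Longrightarrow> g \<in> alg X \<Longrightarrow> f * g \<in> alg X"

lemma subring_alg: "subring_of (alg X)"
proof -
  have "f - g \<in> alg X" if "f \<in> alg X" "g \<in> alg X" for f g
  proof -
    have "f + (\<lambda>_. - 1) * g \<in> alg X" using that by (auto intro: alg.add alg.mult alg.const)
    moreover have "f + (\<lambda>_. - 1) * g = f - g" by (auto simp: fun_eq_iff)
    ultimately show ?thesis by simp
  qed
  moreover have "1 \<in> alg X" using alg.const[of 1 X] by (simp add: one_fun_def)
  ultimately show ?thesis by (auto simp: subring_of_def alg.mult)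
qed

lemmas alg_closed = subring_of_closed[OF subring_alg]

lemma alg_mono: "f \<in> alg X \<Longrightarrow> X \<subseteq> Y \<Longrightarrow> f \<in> alg Y"
  by (induction rule: alg.induct) (auto intro: alg.intros)

lemma alg_scale: "f \<in> alg X \<Longrightarrow> fun_scale c f \<in> alg X"
proof -
  assume "f \<in> alg X"
  then have "(\<lambda>_. c) * f \<in> alg X" by (auto intro: alg.mult alg.const)
  then show ?thesis by (simp add: fun_scale_def times_fun_def)
qed

text \<open>The polynomial expressions in \<open>x\<close> form a set \<open>E\<close> closed under
  sums and products; for sums, both coefficient sequences are first padded with zeros to a common
  length.\<close>

lemma alg_insert_expand:
  assumes "b \<in> alg (insert x X)"
  shows "\<exists>n c. (\<forall>i. c i \<in> alg X) \<and> b = (\<Sum>i\<le>n. c i * x ^ i)"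
proof -
  define E where "E = {(\<Sum>i\<le>n. c i * x ^ i) | n c. \<forall>i. c i \<in> alg X}"
  have EI: "(\<Sum>i\<le>n. c i * x ^ i) \<in> E" if "\<And>i. c i \<in> alg X" for n c
    using that unfolding E_def by blast
  have EE: "\<exists>n c. f = (\<Sum>i\<le>n. c i * x ^ i) \<and> (\<forall>i. c i \<in> alg X)" if "f \<in> E" for f
    using that unfolding E_def by blast
  have pad: "\<exists>c. (\<forall>i. c i \<in> alg X) \<and> (\<forall>N\<ge>n. (\<Sum>i\<le>N. c i * x ^ i) = (\<Sum>i\<le>n. d i * x ^ i))"
    if "\<forall>i. d i \<in> alg X" for n d
  proof (intro exI[of _ "\<lambda>i. if i \<le> n then d i else 0"] conjI allI impI)
    fix N assume "n \<le> N"
    have "(\<Sum>i\<le>N. (if i \<le> n then d i else 0) * x ^ i) = (\<Sum>i\<in>{..n}. (if i \<le> n then d i else 0) * x ^ i)"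
      using \<open>n \<le> N\<close> by (intro sum.mono_neutral_right) auto
    then show "(\<Sum>i\<le>N. (if i \<le> n then d i else 0) * x ^ i) = (\<Sum>i\<le>n. d i * x ^ i)" by simp
  qed (use that alg_closed(2) in auto)
  have Eadd: "f + g \<in> E" if fE: "f \<in> E" and gE: "g \<in> E" for f g
  proof -
    obtain n c where c: "f = (\<Sum>i\<le>n. c i * x ^ i)" "\<forall>i. c i \<in> alg X" using EE[OF fE] by blast
    obtain m d where d: "g = (\<Sum>i\<le>m. d i * x ^ i)" "\<forall>i. d i \<in> alg X" using EE[OF gE] by blast
    obtain c' where c': "\<forall>i. c' i \<in> alg X" "\<forall>N\<ge>n. (\<Sum>i\<le>N. c' i * x ^ i) = f"
      using pad[OF c(2), of n] c(1) by auto
    obtain d' where d': "\<forall>i. d' i \<in> alg X" "\<forall>N\<ge>m. (\<Sum>i\<le>N. d' i * x ^ i) = g"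
      using pad[OF d(2), of m] d(1) by auto
    have "f + g = (\<Sum>i\<le>max n m. (c' i + d' i) * x ^ i)"
      using c'(2) d'(2) by (simp add: distrib_right sum.distrib)
    then show ?thesis using EI[of "\<lambda>i. c' i + d' i"] c' d' alg_closed(3) by metis
  qed
  have Escale: "a * f \<in> E" if aX: "a \<in> alg X" and fE: "f \<in> E" for a f
  proof -
    obtain n c where c: "f = (\<Sum>i\<le>n. c i * x ^ i)" "\<forall>i. c i \<in> alg X" using EE[OF fE] by blast
    have "a * f = (\<Sum>i\<le>n. (a * c i) * x ^ i)" by (simp add: c sum_distrib_left mult.assoc)
    then show ?thesis using EI[of "\<lambda>i. a * c i"] c aX alg_closed(5) by metis
  qed
  have Ex: "x * f \<in> E" if fE: "f \<in> E" for f
  proof -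
    obtain n c where c: "f = (\<Sum>i\<le>n. c i * x ^ i)" "\<forall>i. c i \<in> alg X" using EE[OF fE] by blast
    define d where "d = (\<lambda>i. case i of 0 \<Rightarrow> 0 | Suc j \<Rightarrow> c j)"
    have "(\<Sum>i\<le>Suc n. d i * x ^ i) = x * f"
      unfolding sum.atMost_Suc_shift by (simp add: d_def c sum_distrib_left mult_ac)
    moreover have "d i \<in> alg X" for i using c alg_closed(2) by (auto simp: d_def split: nat.split)
    ultimately show ?thesis using EI[of d "Suc n"] by simp
  qed
  have Ealg: "a \<in> E" if "a \<in> alg X" for a using EI[of "\<lambda>_. a" 0] that by simp
  have Exn: "x ^ i * f \<in> E" if "f \<in> E" for f i
    using that by (induction i) (auto simp: Ex mult.assoc)
  have Emult: "f * g \<in> E" if fE: "f \<in> E" and gE: "g \<in> E" for f g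
  proof -
    obtain n c where c: "f = (\<Sum>i\<le>n. c i * x ^ i)" "\<forall>i. c i \<in> alg X" using EE[OF fE] by blast
    have "(\<Sum>i\<le>m. c i * x ^ i) * g \<in> E" for m
    proof (induction m)
      case 0
      have "(\<Sum>i\<le>0. c i * x ^ i) * g = c 0 * g" by simp
      then show ?case using Escale[OF c(2)[rule_format] gE, of 0] by metis
    next
      case (Suc m)
      have "c (Suc m) * (x ^ Suc m * g) \<in> E" by (rule Escale[OF c(2)[rule_format] Exn[OF gE]])
      then show ?case using Eadd[OF Suc] by (simp only: sum.atMost_Suc distrib_right mult.assoc)
    qed
    then show ?thesis using c by simp
  qed
  have "b \<in> E" using assms
  proof induction
    case (gen z)
    then show ?case
    proof
      assume "z = x"
      moreover have "x * 1 \<in> E" by (rule Ex[OF Ealg[OF alg_closed(1)]])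
      ultimately show ?thesis by simp
    qed (auto intro: Ealg alg.gen)
  next
    case (add f g) show ?case by (rule Eadd[OF add.IH])
  next
    case (mult f g) show ?case by (rule Emult[OF mult.IH])
  qed (rule Ealg[OF alg.const])
  then show ?thesis by (auto simp: E_def)
qed

text \<open>Hilbert's basis theorem adjoins one generator at a time. Without generators only the
  constants remain, a field, whose ideals are zero and everything.\<close>

lemma acc_alg:
  assumes "finite X"
  shows "acc (alg X)"
  using assms
proof induction
  case empty
  have const: "\<exists>c. f = (\<lambda>_. c)" if "f \<in> alg {}" for f :: "'a \<Rightarrow> complex"
    using that by induction (auto simp: plus_fun_def times_fun_def)
  have full: "I = alg {}" if I: "ideal_of (alg {}) I" "f \<in> I" "f \<noteq> 0" for I and f :: "'a \<Rightarrow> complex"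
  proof -
    obtain c where c: "f = (\<lambda>_. c)" using const ideal_of_closed(4)[OF I(1,2)] by blast
    then have "c \<noteq> 0" using I by (auto simp: zero_fun_def)
    have "(\<lambda>_. d) \<in> I" for d
    proof -
      have "(\<lambda>_. d / c) * f \<in> I" using I by (intro ideal_of_closed(3)[OF I(1)] alg.const)
      then show ?thesis using c \<open>c \<noteq> 0\<close> by (simp add: times_fun_def)
    qed
    then have "alg {} \<subseteq> I" using const by (metis subsetI)
    moreover have "I \<subseteq> alg {}" using I(1) by (simp add: ideal_of_def)
    ultimately show ?thesis by (rule subset_antisym[rotated])
  qed
  show ?case unfolding acc_def
  proof (intro allI impI)
    fix I assume I: "\<forall>k::nat. ideal_of (alg ({} :: ('a \<Rightarrow> complex) set)) (I k) \<and> I k \<subseteq> I (Suc k)"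
    have Imono: "I k \<subseteq> I l" if "k \<le> l" for k l by (rule lift_Suc_mono_le[of I, OF _ that]) (use I in simp)
    show "\<exists>K. \<forall>k\<ge>K. I k = I K"
    proof (cases "\<exists>K f. f \<in> I K \<and> f \<noteq> 0")
      case True
      then obtain K f where "f \<in> I K" "f \<noteq> 0" by blast
      then have "I k = alg {}" if "k \<ge> K" for k using full[of "I k" f] I Imono[OF that] by blast
      then have "\<forall>k\<ge>K. I k = I K" by simp
      then show ?thesis by blast
    next
      case False
      have "0 \<in> I k" for k using I ideal_of_closed(1) by blast
      then have "I k = {0}" for k using False by blast
      then show ?thesis by simp
    qed
  qed
next
  case (insert x X)
  show ?case
  proof (rule acc_extension[of "alg X" _ x])
    show "alg X \<subseteq> alg (insert x X)" using alg_mono[of _ X "insert x X"] by blast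
    show "\<exists>n c. (\<forall>i. c i \<in> alg X) \<and> b = (\<Sum>i\<le>n. c i * x ^ i)" if "b \<in> alg (insert x X)" for b
      using alg_insert_expand[OF that] .
  qed (use insert.IH in \<open>auto intro: subring_alg alg.gen\<close>)
qed

section \<open>Chains of prime ideals\<close>

interpretation fun_space: vector_space "fun_scale :: complex \<Rightarrow> ('a \<Rightarrow> complex) \<Rightarrow> 'a \<Rightarrow> complex"
  by unfold_locales (auto simp: fun_scale_def fun_eq_iff algebra_simps)

lemma fun_scale_apply: "fun_scale c f x = c * f x"
  by (simp add: fun_scale_def)

lemma sum_fun_apply: "(\<Sum>i\<in>T. f i) x = (\<Sum>i\<in>T. f i x)" for f :: "'i \<Rightarrow> 'x \<Rightarrow> complex"
  by (induction T rule: infinite_finite_induct) auto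

lemma power_fun_apply: "(f ^ n) x = f x ^ n" for f :: "'x \<Rightarrow> complex"
  by (induction n) auto

lemmas fun_apply = plus_fun_apply times_fun_apply zero_fun_apply one_fun_apply fun_scale_apply

text \<open>Induction rules eta-expand functions, after which the pointwise laws would unfold the ring
  operations under the abstraction.\<close>

declare fun_apply [simp del] minus_apply [simp del]

text \<open>Stated for an indexed family, since repetitions may occur: a repetition is itself a
  relation, and otherwise the family is a set too large to be independent.\<close>

lemma (in vector_space) family_dependent:
  assumes S: "finite S" and I: "finite I" "card S < card I" and u: "\<And>i. i \<in> I \<Longrightarrow> u i \<in> span S"
  shows "\<exists>c. (\<exists>i\<in>I. c i \<noteq> 0) \<and> (\<Sum>i\<in>I. c i *s u i) = 0"
proof (cases "inj_on u I")
  case False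
  then obtain i j where ij: "i \<in> I" "j \<in> I" "i \<noteq> j" "u i = u j" by (auto simp: inj_on_def)
  define c where "c k = (if k = i then 1 else if k = j then - 1 else 0 :: 'a)" for k
  have "(\<Sum>k\<in>I. c k *s u k) = (\<Sum>k\<in>{i, j}. c k *s u k)"
    by (rule sum.mono_neutral_right) (use I ij in \<open>auto simp: c_def\<close>)
  also have "\<dots> = 0" using ij by (simp add: c_def)
  finally show ?thesis using ij by (intro exI[of _ c]) (auto simp: c_def)
next
  case True
  have "dependent (u ` I)"
  proof (rule ccontr)
    assume "independent (u ` I)"
    then have "card (u ` I) \<le> card S"
      using independent_span_bound[OF S] u by blast
    then show False using card_image[OF True] I by simp
  qed
  then obtain T d v where T: "finite T" "T \<subseteq> u ` I" "(\<Sum>v\<in>T. d v *s v) = 0" "v \<in> T" "d v \<noteq> 0"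
    unfolding dependent_explicit by blast
  define c where "c i = (if u i \<in> T then d (u i) else 0)" for i
  have "(\<Sum>i\<in>I. c i *s u i) = (\<Sum>v\<in>u ` I. (if v \<in> T then d v else 0) *s v)"
    unfolding sum.reindex[OF True] by (simp add: c_def)
  also have "\<dots> = (\<Sum>v\<in>T. (if v \<in> T then d v else 0) *s v)"
    by (rule sum.mono_neutral_right) (use I T in auto)
  also have "\<dots> = 0" using T(3) by simp
  finally have "(\<Sum>i\<in>I. c i *s u i) = 0" .
  moreover obtain i where "i \<in> I" "v = u i" using T by blast
  ultimately show ?thesis using T by (intro exI[of _ c]) (auto simp: c_def)
qed

section \<open>Counting monomials\<close>

definition monomials :: "('a \<Rightarrow> complex) set \<Rightarrow> nat \<Rightarrow> ('a \<Rightarrow> complex) set" where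
  "monomials X N = (\<lambda>a. \<Prod>x\<in>X. x ^ a x) ` (PiE X (\<lambda>_. {..N}))"

lemma finite_monomials: "finite X \<Longrightarrow> finite (monomials X N)"
  by (simp add: monomials_def finite_PiE)

text \<open>Bounding each exponent separately, not the total degree, makes the number of exponents a
  plain power; distinct exponents may define the same function, whence only an inequality.\<close>

lemma card_monomials:
  assumes "finite X"
  shows "card (monomials X N) \<le> (N + 1) ^ card X"
proof -
  have "card (monomials X N) \<le> card (PiE X (\<lambda>_. {..N}))"
    unfolding monomials_def by (rule card_image_le) (simp add: assms finite_PiE)
  also have "\<dots> = (N + 1) ^ card X" using assms by (simp add: card_PiE)
  finally show ?thesis .
qed

lemma monomialsI:
  assumes "\<And>x. x \<in> X \<Longrightarrow> a x \<le> N"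
  shows "(\<Prod>x\<in>X. x ^ a x) \<in> monomials X N"
proof -
  have "(\<Prod>x\<in>X. x ^ a x) = (\<Prod>x\<in>X. x ^ restrict a X x)" by (rule prod.cong) auto
  moreover have "restrict a X \<in> PiE X (\<lambda>_. {..N})" using assms by auto
  ultimately show ?thesis unfolding monomials_def by blast
qed

lemma monomials_mono: "N \<le> M \<Longrightarrow> monomials X N \<subseteq> monomials X M"
  unfolding monomials_def by (intro image_mono PiE_mono) auto

lemma monomials_mult:
  assumes "f \<in> monomials X N" "g \<in> monomials X M"
  shows "f * g \<in> monomials X (N + M)"
proof -
  obtain a b where a: "f = (\<Prod>x\<in>X. x ^ a x)" "a \<in> PiE X (\<lambda>_. {..N})"
    and b: "g = (\<Prod>x\<in>X. x ^ b x)" "b \<in> PiE X (\<lambda>_. {..M})" using assms by (auto simp: monomials_def)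
  have "f * g = (\<Prod>x\<in>X. x ^ (a x + b x))" by (simp add: a b prod.distrib power_add)
  also have "\<dots> \<in> monomials X (N + M)"
    by (rule monomialsI) (use a b in \<open>auto simp: PiE_def Pi_def intro: add_mono\<close>)
  finally show ?thesis .
qed

lemma fun_scale_mult: "fun_scale c f * g = fun_scale c (f * g)" "f * fun_scale c g = fun_scale c (f * g)"
  by (auto simp: fun_eq_iff fun_apply)

lemma span_monomials_mult:
  assumes "f \<in> fun_space.span (monomials X N)" "g \<in> fun_space.span (monomials X M)"
  shows "f * g \<in> fun_space.span (monomials X (N + M))"
  using assms(1)
proof (induction rule: fun_space.span_induct_alt)
  case base then show ?case by (simp add: fun_space.span_zero)
next
  case (step c h f)
  have "h * g \<in> fun_space.span (monomials X (N + M))"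
    using assms(2)
  proof (induction rule: fun_space.span_induct_alt)
    case base then show ?case by (simp add: fun_space.span_zero)
  next
    case inner: (step d k g)
    have "h * k \<in> monomials X (N + M)" using monomials_mult[OF step(1) inner(1)] .
    then show ?case using inner(2)
      by (simp add: distrib_left fun_scale_mult fun_space.span_add fun_space.span_scale fun_space.span_base)
  qed
  then show ?case using step(2)
    by (simp add: distrib_right fun_scale_mult fun_space.span_add fun_space.span_scale)
qed

lemma one_in_monomials: "1 \<in> monomials X N"
  using monomialsI[of X "\<lambda>_. 0" N] by simp

lemma gen_in_monomials:
  assumes "finite X" "z \<in> X"
  shows "z \<in> monomials X 1"
proof -
  have "(\<Prod>x\<in>X. x ^ (if x = z then 1 else 0)) = (\<Prod>x\<in>{z}. x ^ (if x = z then 1 else 0))"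
    by (rule prod.mono_neutral_right) (use assms in auto)
  then show ?thesis using monomialsI[of X "\<lambda>x. if x = z then 1 else 0" 1] by auto
qed

lemma span_monomials_mono: "N \<le> M \<Longrightarrow> f \<in> fun_space.span (monomials X N) \<Longrightarrow> f \<in> fun_space.span (monomials X M)"
  using fun_space.span_mono[OF monomials_mono] by blast

lemma alg_in_span_monomials:
  assumes "finite X" "f \<in> alg X"
  shows "\<exists>N. f \<in> fun_space.span (monomials X N)"
  using assms(2)
proof induction
  case (const c)
  have "fun_scale c (1 :: 'a \<Rightarrow> complex) \<in> fun_space.span (monomials X 0)"
    by (intro fun_space.span_scale fun_space.span_base one_in_monomials)
  moreover have "fun_scale c (1 :: 'a \<Rightarrow> complex) = (\<lambda>_. c)" by (simp add: fun_scale_def fun_apply)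
  ultimately show ?case by metis
next
  case (gen x)
  then show ?case using gen_in_monomials[OF assms(1)] fun_space.span_base by blast
next
  case (add f g)
  then obtain N M where "f \<in> fun_space.span (monomials X N)" "g \<in> fun_space.span (monomials X M)" by blast
  then have "f \<in> fun_space.span (monomials X (max N M))" "g \<in> fun_space.span (monomials X (max N M))"
    using span_monomials_mono max.cobounded1 max.cobounded2 by blast+
  then show ?case using fun_space.span_add by blast
next
  case (mult f g)
  then show ?case using span_monomials_mult by blast
qed

lemma span_monomials_power:
  assumes "f \<in> fun_space.span (monomials X N)"
  shows "f ^ k \<in> fun_space.span (monomials X (k * N))"
proof (induction k)
  case 0 then show ?case by (simp add: fun_space.span_base one_in_monomials)
next
  case (Suc k) then show ?case using span_monomials_mult[OF assms Suc] by simp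
qed

text \<open>The factors come as a list because elements attached to a chain of primes are ordered
  and are removed from the front in inductions.\<close>

definition list_monomial :: "'r::comm_ring_1 list \<Rightarrow> nat list \<Rightarrow> 'r" where
  "list_monomial gs as = prod_list (map2 (\<lambda>g a. g ^ a) gs as)"

lemma list_monomial_simps [simp]:
  "list_monomial [] as = 1" "list_monomial (g # gs) (a # as) = g ^ a * list_monomial gs as"
  by (auto simp: list_monomial_def)

definition exponents :: "nat \<Rightarrow> nat \<Rightarrow> nat list set" where
  "exponents k D = {as. set as \<subseteq> {..<D} \<and> length as = k}"

lemma finite_exponents: "finite (exponents k D)"
  by (simp add: exponents_def finite_lists_length_eq)

lemma card_exponents: "card (exponents k D) = D ^ k"
  by (simp add: exponents_def card_lists_length_eq)

lemma sum_exponents_Suc: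
  "(\<Sum>as\<in>exponents (Suc k) D. f as) = (\<Sum>j<D. \<Sum>bs\<in>exponents k D. f (j # bs))"
proof -
  have "exponents (Suc k) D = (\<lambda>(j, bs). j # bs) ` ({..<D} \<times> exponents k D)"
    by (auto simp: exponents_def length_Suc_conv image_iff)
  then have "(\<Sum>as\<in>exponents (Suc k) D. f as) = (\<Sum>(j, bs)\<in>{..<D} \<times> exponents k D. f (j # bs))"
    by (simp add: sum.reindex inj_on_def case_prod_unfold)
  then show ?thesis by (simp add: sum.cartesian_product)
qed

lemma list_monomial_alg:
  assumes "set gs \<subseteq> alg X"
  shows "list_monomial gs as \<in> alg X"
  using assms
proof (induction gs arbitrary: as)
  case Nil then show ?case by (simp add: alg_closed(1))
next
  case (Cons g gs)
  then show ?case by (cases as) (auto simp: list_monomial_def alg_closed(1,7) intro!: alg.mult)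
qed

text \<open>Elements separating consecutive primes of a chain are algebraically independent modulo the
  smallest prime: reduce modulo the next prime, then cancel the first element.\<close>

lemma prime_chain_independent:
  fixes P :: "nat \<Rightarrow> ('a \<Rightarrow> complex) set"
  assumes "\<And>i. i \<le> length gs \<Longrightarrow> prime_of (alg X) (P i)"
    and "\<And>i. i < length gs \<Longrightarrow> P i \<subseteq> P (Suc i) \<and> gs ! i \<in> P (Suc i) \<and> gs ! i \<notin> P i"
    and "(\<Sum>as\<in>exponents (length gs) D. fun_scale (c as) (list_monomial gs as)) \<in> P 0"
    and "as \<in> exponents (length gs) D"
  shows "c as = 0"
  using assms
proof (induction gs arbitrary: P c as)
  case Nil
  have P: "ideal_of (alg X) (P 0)" "1 \<notin> P 0" using Nil.prems(1)[of 0] by (auto simp: prime_of_def)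
  have "exponents 0 D = {[]}" by (auto simp: exponents_def)
  then have "fun_scale (c []) 1 \<in> P 0" and as: "as = []" using Nil.prems(3,4) by auto
  show ?case
  proof (rule ccontr)
    assume "c as \<noteq> 0"
    then have nz: "c [] \<noteq> 0" using as by simp
    have "(\<lambda>_. 1 / c []) * fun_scale (c []) 1 \<in> P 0"
      by (rule ideal_of_closed(3)[OF P(1)]) (auto intro: alg.const \<open>fun_scale (c []) 1 \<in> P 0\<close>)
    moreover have "(\<lambda>_. 1 / c []) * fun_scale (c []) (1 :: 'a \<Rightarrow> complex) = 1" using nz by (auto simp: fun_eq_iff fun_apply)
    ultimately show False using P(2) by simp
  qed
next
  case (Cons g gs)
  have P0: "ideal_of (alg X) (P 0)" and P0p: "\<And>x y. x \<in> alg X \<Longrightarrow> y \<in> alg X \<Longrightarrow> x * y \<in> P 0 \<Longrightarrow> x \<in> P 0 \<or> y \<in> P 0"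
    using Cons.prems(1)[of 0] by (auto simp: prime_of_def)
  have P1: "ideal_of (alg X) (P 1)" using Cons.prems(1)[of 1] by (auto simp: prime_of_def)
  have P01: "P 0 \<subseteq> P 1" "g \<in> P 1" "g \<notin> P 0" using Cons.prems(2)[of 0] by auto
  have Pi: "ideal_of (alg X) (P i)" if "i \<le> length (g # gs)" for i
    using Cons.prems(1)[OF that] by (simp add: prime_of_def)
  have gX: "(g # gs) ! i \<in> alg X" if "i < length (g # gs)" for i
    using Cons.prems(2)[OF that] that ideal_of_closed(4)[OF Pi[of "Suc i"]] by simp
  then have gsX: "set (g # gs) \<subseteq> alg X" by (metis in_set_conv_nth subsetI)
  have g: "g \<in> alg X" using gsX by simp
  define m where "m bs = list_monomial gs bs" for bs
  have m: "m bs \<in> alg X" for bs unfolding m_def using gsX by (intro list_monomial_alg) auto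
  \<comment> \<open>The induction hypothesis for \<open>gs\<close>, along the chain that starts at
    \<open>P 1\<close>.\<close>
  have tail: "d bs = 0" if "(\<Sum>bs\<in>exponents (length gs) D. fun_scale (d bs) (m bs)) \<in> P 1"
    "bs \<in> exponents (length gs) D" for d bs
  proof (rule Cons.IH[of "\<lambda>i. P (Suc i)" d bs])
    show "prime_of (alg X) (P (Suc i))" if "i \<le> length gs" for i using Cons.prems(1)[of "Suc i"] that by simp
    show "P (Suc i) \<subseteq> P (Suc (Suc i)) \<and> gs ! i \<in> P (Suc (Suc i)) \<and> gs ! i \<notin> P (Suc i)" if "i < length gs" for i
      using Cons.prems(2)[of "Suc i"] that by simp
  qed (use that in \<open>simp_all add: m_def\<close>)
  \<comment> \<open>Induction on the number of powers of \<open>g\<close>: the sum is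
    \<open>Q + g * R\<close> with \<open>Q\<close> free of \<open>g\<close>. Modulo
    \<open>P 1\<close> only \<open>Q\<close> survives, so its coefficients vanish, and
    \<open>g \<notin> P 0\<close> leaves \<open>R \<in> P 0\<close>.\<close>
  have key: "(\<Sum>j<N. \<Sum>bs\<in>exponents (length gs) D. fun_scale (e j bs) (g ^ j * m bs)) \<in> P 0 \<Longrightarrow>
    j < N \<Longrightarrow> bs \<in> exponents (length gs) D \<Longrightarrow> e j bs = 0" for N e j bs
  proof (induction N arbitrary: e j)
    case 0 then show ?case by simp
  next
    case (Suc N)
    define R where "R = (\<Sum>j<N. \<Sum>bs\<in>exponents (length gs) D. fun_scale (e (Suc j) bs) (g ^ j * m bs))"
    define Q where "Q = (\<Sum>bs\<in>exponents (length gs) D. fun_scale (e 0 bs) (m bs))"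
    have R: "R \<in> alg X" unfolding R_def
      by (intro subring_of_sum[OF subring_alg] alg_scale alg.mult alg_closed(7) g m)
    have eq: "(\<Sum>j<Suc N. \<Sum>bs\<in>exponents (length gs) D. fun_scale (e j bs) (g ^ j * m bs)) = Q + g * R"
      unfolding sum.lessThan_Suc_shift Q_def R_def
      by (simp add: sum_distrib_left fun_scale_mult mult.assoc)
    have QR: "Q + g * R \<in> P 0" using Suc.prems(1) unfolding eq .
    have gR: "g * R \<in> P 1" using ideal_of_closed(3)[OF P1 R P01(2)] by (simp add: mult.commute)
    have "Q + g * R - g * R \<in> P 1"
      by (rule ideal_of_diff[OF subring_alg P1 _ gR]) (use QR P01 in blast)
    then have "Q \<in> P 1" by simp
    then have e0: "e 0 bs = 0" if "bs \<in> exponents (length gs) D" for bs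
      using tail[of "e 0"] that unfolding Q_def by blast
    have "Q = 0" unfolding Q_def by (rule sum.neutral) (use e0 in \<open>auto simp: fun_eq_iff fun_apply\<close>)
    then have "R \<in> P 0" using QR P0p[OF g R] P01(3) by auto
    then have "e (Suc j) bs = 0" if "j < N" for j
      using Suc.IH[of "\<lambda>j. e (Suc j)" j] that Suc.prems(3) unfolding R_def by blast
    then show ?case using e0 Suc.prems(2,3) by (cases j) auto
  qed
  obtain j bs where as: "as = j # bs" "j < D" "bs \<in> exponents (length gs) D"
    using Cons.prems(4) by (cases as) (auto simp: exponents_def)
  show ?case unfolding as(1)
    by (rule key[of "\<lambda>j bs. c (j # bs)" D, OF _ as(2,3)])
      (use Cons.prems(3) in \<open>simp add: sum_exponents_Suc m_def\<close>)
qed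

text \<open>As a function of \<open>D\<close> the left side grows like \<open>D ^ n\<close>, the
  right side is \<open>D ^ k\<close>.\<close>

lemma power_count_bound:
  fixes k E n :: nat
  assumes "n < k"
  obtains D where "(k * D * E + 1) ^ n < D ^ k"
proof
  \<comment> \<open>The left side is at most \<open>(k * E + 1) ^ n * D ^ n\<close>, so
    \<open>D\<close> has to exceed the constant \<open>(k * E + 1) ^ n\<close>.\<close>
  define D where "D = (k * E + 1) ^ n + 1"
  have "k * D * E + 1 \<le> (k * E + 1) * D" by (simp add: D_def algebra_simps)
  then have "(k * D * E + 1) ^ n \<le> ((k * E + 1) * D) ^ n" by (rule power_mono) simp
  also have "\<dots> = (k * E + 1) ^ n * D ^ n" by (rule power_mult_distrib)
  also have "\<dots> < D * D ^ n" by (rule mult_strict_right_mono) (auto simp: D_def)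
  also have "\<dots> = D ^ Suc n" by simp
  also have "\<dots> \<le> D ^ k" by (rule power_increasing) (use assms in \<open>auto simp: D_def\<close>)
  finally show "(k * D * E + 1) ^ n < D ^ k" .
qed

text \<open>There are \<open>D ^ length gs\<close> monomials in \<open>gs\<close> with exponents
  below \<open>D\<close>, but after composition with \<open>\<Psi>\<close> they lie in the span of
  at most \<open>(length gs * D * E + 1) ^ card Y\<close> monomials in \<open>Y\<close>. The map
  \<open>\<Psi>\<close> is a parametrization: the identity bounds the dimension of the ambient
  space, \<open>symbol_map\<close> that of \<open>M\<close>.\<close>

lemma algebraic_relation:
  fixes gs :: "('a \<Rightarrow> complex) list" and \<Psi> :: "'b \<Rightarrow> 'a"
  assumes Y: "finite Y" "card Y < length gs" and gs: "\<And>g. g \<in> set gs \<Longrightarrow> g \<circ> \<Psi> \<in> alg Y"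
  obtains D c as where "as \<in> exponents (length gs) D" "c as \<noteq> 0"
    "\<And>b. (\<Sum>as\<in>exponents (length gs) D. fun_scale (c as) (list_monomial gs as)) (\<Psi> b) = 0"
proof -
  have "\<exists>E. \<forall>g\<in>set gs. g \<circ> \<Psi> \<in> fun_space.span (monomials Y E)"
    using gs
  proof (induction gs)
    case (Cons g gs)
    have "\<exists>E. \<forall>g\<in>set gs. g \<circ> \<Psi> \<in> fun_space.span (monomials Y E)"
      by (rule Cons.IH) (rule Cons.prems, simp)
    then obtain E where E: "\<forall>g\<in>set gs. g \<circ> \<Psi> \<in> fun_space.span (monomials Y E)" by blast
    obtain N where N: "g \<circ> \<Psi> \<in> fun_space.span (monomials Y N)"
      using alg_in_span_monomials[OF Y(1) Cons.prems[of g]] by (meson list.set_intros(1))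
    show ?case
    proof (intro exI[of _ "max E N"] ballI)
      fix h assume "h \<in> set (g # gs)"
      then show "h \<circ> \<Psi> \<in> fun_space.span (monomials Y (max E N))"
        using E N span_monomials_mono[of E "max E N"] span_monomials_mono[of N "max E N"] by auto
    qed
  qed simp
  then obtain E where E: "\<And>g. g \<in> set gs \<Longrightarrow> g \<circ> \<Psi> \<in> fun_space.span (monomials Y E)" by blast
  obtain D where D: "(length gs * D * E + 1) ^ card Y < D ^ length gs"
    using power_count_bound[OF Y(2)] .
  have mon: "list_monomial gs as \<circ> \<Psi> \<in> fun_space.span (monomials Y (length gs * D * E))"
    if "as \<in> exponents (length gs) D" for as
    using that E
  proof (induction gs arbitrary: as)
    case Nil
    have "list_monomial [] as \<circ> \<Psi> = 1" by (auto simp: fun_eq_iff fun_apply)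
    moreover have "(1 :: 'b \<Rightarrow> complex) \<in> fun_space.span (monomials Y N)" for N
      by (rule fun_space.span_base[OF one_in_monomials])
    ultimately show ?case by metis
  next
    case (Cons g gs)
    obtain j bs where as: "as = j # bs" "j < D" "bs \<in> exponents (length gs) D"
      using Cons.prems(1) by (cases as) (auto simp: exponents_def)
    have "(g \<circ> \<Psi>) ^ j \<in> fun_space.span (monomials Y (D * E))"
      by (rule span_monomials_mono[OF _ span_monomials_power[OF Cons.prems(2)[of g]]])
        (use as(2) in simp_all)
    moreover have "list_monomial gs bs \<circ> \<Psi> \<in> fun_space.span (monomials Y (length gs * D * E))"
      by (rule Cons.IH[OF as(3)]) (use Cons.prems(2) in auto)
    ultimately have "(g \<circ> \<Psi>) ^ j * (list_monomial gs bs \<circ> \<Psi>)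
        \<in> fun_space.span (monomials Y (D * E + length gs * D * E))" by (rule span_monomials_mult)
    moreover have pw: "(g \<circ> \<Psi>) ^ j = (g ^ j) \<circ> \<Psi>"
      by (auto simp: fun_eq_iff power_fun_apply o_apply)
    have "(g \<circ> \<Psi>) ^ j * (list_monomial gs bs \<circ> \<Psi>) = list_monomial (g # gs) as \<circ> \<Psi>"
      unfolding pw as by (auto simp: fun_eq_iff fun_apply o_apply)
    moreover have "D * E + length gs * D * E = length (g # gs) * D * E" by (simp add: algebra_simps)
    ultimately show ?case by metis
  qed
  have "card (monomials Y (length gs * D * E)) < card (exponents (length gs) D)"
    using card_monomials[OF Y(1), of "length gs * D * E"] D by (simp add: card_exponents)
  then have "\<exists>c. (\<exists>as\<in>exponents (length gs) D. c as \<noteq> 0) \<and>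
      (\<Sum>as\<in>exponents (length gs) D. fun_scale (c as) (list_monomial gs as \<circ> \<Psi>)) = 0"
    by (rule fun_space.family_dependent[OF finite_monomials[OF Y(1)] finite_exponents _ mon])
  then obtain c where c: "\<exists>as\<in>exponents (length gs) D. c as \<noteq> 0"
    "(\<Sum>as\<in>exponents (length gs) D. fun_scale (c as) (list_monomial gs as \<circ> \<Psi>)) = 0" by (elim exE conjE)
  have "(\<Sum>as\<in>exponents (length gs) D. fun_scale (c as) (list_monomial gs as)) (\<Psi> b) = 0" for b
    using fun_cong[OF c(2), of b] by (simp add: sum_fun_apply fun_apply o_apply)
  then show ?thesis using that c(1) by blast
qed

section \<open>Homogeneous functions and Krull's intersection theorem\<close>

text \<open>Homogeneity is defined by generation and not by behaviour under scaling, so that it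
  makes sense on any domain and is accessible to induction. A function may have several degrees, as
  0 does.\<close>

inductive hom :: "('a \<Rightarrow> complex) set \<Rightarrow> nat \<Rightarrow> ('a \<Rightarrow> complex) \<Rightarrow> bool" for X where
  zero: "hom X d 0"
| const: "hom X 0 (\<lambda>_. c)"
| mult: "x \<in> X \<Longrightarrow> hom X d h \<Longrightarrow> hom X (Suc d) (x * h)"
| add: "hom X d f \<Longrightarrow> hom X d g \<Longrightarrow> hom X d (f + g)"

text \<open>This is the \<open>i\<close>-th power of the ideal generated by \<open>X\<close> in
  \<open>alg X\<close>.\<close>

inductive_set tail :: "('a \<Rightarrow> complex) set \<Rightarrow> nat \<Rightarrow> ('a \<Rightarrow> complex) set" for X i where
  hom: "hom X d h \<Longrightarrow> i \<le> d \<Longrightarrow> h \<in> tail X i"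
| add: "f \<in> tail X i \<Longrightarrow> g \<in> tail X i \<Longrightarrow> f + g \<in> tail X i"

lemma fun_scale_simps: "fun_scale c (f + g) = fun_scale c f + fun_scale c g" "fun_scale c 0 = 0"
  "fun_scale c (\<lambda>_. d) = (\<lambda>_. c * d)" "fun_scale 1 f = f" "fun_scale (- 1) f = - f"
  by (auto simp: fun_eq_iff fun_apply algebra_simps)

lemma hom_scale: "hom X d h \<Longrightarrow> hom X d (fun_scale c h)"
proof (induction rule: hom.induct)
  case (mult x d h)
  then show ?case using hom.mult[of x X d "fun_scale c h"] by (simp only: fun_scale_mult)
next
  case (add d f g)
  then show ?case using hom.add[of X d "fun_scale c f" "fun_scale c g"] by (simp only: fun_scale_simps)
next
  case (const d)
  show ?case unfolding fun_scale_simps by (rule hom.const)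
next
  case (zero d)
  show ?case unfolding fun_scale_simps by (rule hom.zero)
qed

lemma hom_uminus: "hom X d h \<Longrightarrow> hom X d (- h)"
  using hom_scale[of X d h "- 1"] by (simp only: fun_scale_simps)

lemma hom_diff: "hom X d f \<Longrightarrow> hom X d g \<Longrightarrow> hom X d (f - g)"
  using hom.add[of X d f "- g"] hom_uminus[of X d g] by (simp only: add_uminus_conv_diff)

lemma hom_sum: "(\<And>i. i \<in> S \<Longrightarrow> hom X d (f i)) \<Longrightarrow> hom X d (sum f S)"
proof (induction S rule: infinite_finite_induct)
  case (insert a F)
  have "hom X d (f a + sum f F)" by (rule hom.add) (use insert in auto)
  then show ?case unfolding sum.insert[OF insert(1,2)] .
next
  case (infinite A) show ?case unfolding sum.infinite[OF infinite(1)] by (rule hom.zero)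
next
  case empty show ?case unfolding sum.empty by (rule hom.zero)
qed

lemma hom_mult_const: "hom X d h \<Longrightarrow> hom X d ((\<lambda>_. c) * h)"
proof -
  have "(\<lambda>_. c) * h = fun_scale c h" by (auto simp: fun_eq_iff fun_apply)
  then show "hom X d h \<Longrightarrow> hom X d ((\<lambda>_. c) * h)" using hom_scale by metis
qed

lemma hom_mult: "hom X d f \<Longrightarrow> hom X e g \<Longrightarrow> hom X (d + e) (f * g)"
proof (induction rule: hom.induct)
  case (zero d) show ?case unfolding mult_zero_left by (rule hom.zero)
next
  case (const c) then show ?case unfolding add_0 by (rule hom_mult_const)
next
  case (mult x d h)
  have "hom X (Suc (d + e)) (x * (h * g))" by (rule hom.mult[OF mult(1) mult.IH[OF mult.prems]])
  then show ?case by (simp only: mult.assoc add_Suc)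
next
  case (add d f f')
  have "hom X (d + e) (f * g + f' * g)" by (rule hom.add[OF add.IH(1)[OF add.prems] add.IH(2)[OF add.prems]])
  then show ?case by (simp only: distrib_right)
qed

lemma hom_gen: "x \<in> X \<Longrightarrow> hom X 1 x"
proof -
  assume "x \<in> X"
  then have "hom X (Suc 0) (x * (\<lambda>_. 1))" by (intro hom.mult hom.const)
  moreover have "x * (\<lambda>_. 1) = x" by (auto simp: fun_eq_iff fun_apply)
  ultimately show ?thesis by (simp only: One_nat_def)
qed

lemma alg_zero: "0 \<in> alg X"
  using alg_closed(2) .

lemma hom_alg: "hom X d h \<Longrightarrow> h \<in> alg X"
proof (induction rule: hom.induct)
  case (mult x d h) show ?case by (rule alg.mult[OF alg.gen[OF mult(1)] mult.IH])
next
  case (add d f g) show ?case by (rule alg.add[OF add.IH])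
qed (rule alg_zero alg.const)+

lemma tail_zero: "0 \<in> tail X i"
  by (rule tail.hom[OF hom.zero order_refl])

lemma tail_mono: "f \<in> tail X i \<Longrightarrow> j \<le> i \<Longrightarrow> f \<in> tail X j"
  by (induction rule: tail.induct) (auto intro: tail.hom tail.add)

lemma tail_mult: 
  assumes "f \<in> tail X i" "g \<in> tail X j"
  shows "f * g \<in> tail X (i + j)"
  using assms(1)
proof (induction rule: tail.induct)
  case (hom d h)
  note h = hom
  show ?case using assms(2)
  proof (induction rule: tail.induct)
    case (hom e k)
    show ?case by (rule tail.hom[OF hom_mult[OF h(1) hom(1)]]) (use h hom in auto)
  next
    case (add f g)
    show ?case unfolding distrib_left by (rule tail.add[OF add.IH])
  qed
next
  case (add f f')
  show ?case unfolding distrib_right by (rule tail.add[OF add.IH])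
qed

lemma tail_alg: "f \<in> tail X i \<Longrightarrow> f \<in> alg X"
  by (induction rule: tail.induct) (auto intro: hom_alg alg.add)

lemma alg_tail_0: "f \<in> alg X \<Longrightarrow> f \<in> tail X 0"
proof (induction rule: alg.induct)
  case (const c) show ?case by (rule tail.hom[OF hom.const]) simp
next
  case (gen x) show ?case by (rule tail.hom[OF hom_gen[OF gen]]) simp
next
  case (add f g) show ?case by (rule tail.add[OF add.IH])
next
  case (mult f g) show ?case using tail_mult[OF mult.IH] by (simp only: add_0)
qed

lemma ideal_tail: "ideal_of (alg X) (tail X i)"
  unfolding ideal_of_def
proof (intro conjI ballI subsetI)
  fix a f assume "a \<in> alg X" "f \<in> tail X i"
  then show "a * f \<in> tail X i" using tail_mult[OF alg_tail_0] by (metis add_0)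
qed (auto intro: tail_alg tail_zero tail.add)


lemma tail_split: "f \<in> tail X i \<Longrightarrow> \<exists>e. hom X i e \<and> f - e \<in> tail X (Suc i)"
proof (induction rule: tail.induct)
  case (hom d h)
  show ?case
  proof (cases "d = i")
    case True
    then show ?thesis using hom tail_zero by (intro exI[of _ h]) (simp only: diff_self simp_thms)
  next
    case False
    then have "h \<in> tail X (Suc i)" using hom by (intro tail.hom[OF hom(1)]) simp
    then show ?thesis by (intro exI[of _ 0]) (simp only: diff_zero hom.zero simp_thms)
  qed
next
  case (add f g)
  then obtain e e' where e: "hom X i e" "f - e \<in> tail X (Suc i)" "hom X i e'" "g - e' \<in> tail X (Suc i)" by blast
  have "f + g - (e + e') \<in> tail X (Suc i)"
    using tail.add[OF e(2,4)] by (simp only: add_diff_add)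
  then show ?case using hom.add[OF e(1,3)] by blast
qed

lemma alg_decompose: 
  assumes "f \<in> alg X"
  obtains N h where "\<And>d. hom X d (h d)" "f = (\<Sum>d<N. h d)"
proof -
  have "\<exists>N h. (\<forall>d. hom X d (h d)) \<and> (\<forall>d\<ge>N. h d = 0) \<and> f = (\<Sum>d<N. h d)"
    using alg_tail_0[OF assms]
  proof (induction rule: tail.induct)
    case (hom d h)
    define h' where "h' e = (if e = d then h else 0)" for e
    have "(\<Sum>e<Suc d. h' e) = (\<Sum>e\<in>{d}. h' e)" by (rule sum.mono_neutral_right) (auto simp: h'_def)
    then have "h = (\<Sum>e<Suc d. h' e)" by (simp add: h'_def)
    moreover have "\<forall>e. hom X e (h' e)" using hom(1) hom.zero by (auto simp: h'_def)
    moreover have "\<forall>e\<ge>Suc d. h' e = 0" by (auto simp: h'_def)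
    ultimately show ?case by blast
  next
    case (add f g)
    then obtain N h M k where h: "\<forall>d. hom X d (h d)" "\<forall>d\<ge>N. h d = 0" "f = (\<Sum>d<N. h d)"
      and k: "\<forall>d. hom X d (k d)" "\<forall>d\<ge>M. k d = 0" "g = (\<Sum>d<M. k d)" by blast
    have "(\<Sum>d<N + M. h d) = (\<Sum>d<N. h d)" by (rule sum.mono_neutral_right) (use h in auto)
    moreover have "(\<Sum>d<N + M. k d) = (\<Sum>d<M. k d)" by (rule sum.mono_neutral_right) (use k in auto)
    ultimately have "f + g = (\<Sum>d<N + M. h d + k d)" unfolding h(3) k(3) by (simp only: sum.distrib)
    moreover have "\<forall>d. hom X d (h d + k d)" using h k hom.add by blast
    moreover have "\<forall>d\<ge>N + M. h d + k d = 0" using h(2) k(2) by simp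
    ultimately show ?case by (intro exI[of _ "N + M"] exI[of _ "\<lambda>d. h d + k d"]) blast
  qed
  then show ?thesis using that by blast
qed

definition degree_monomials :: "('a \<Rightarrow> complex) set \<Rightarrow> nat \<Rightarrow> ('a \<Rightarrow> complex) set" where
  "degree_monomials X d = {(\<Prod>x\<in>X. x ^ a x) | a. (\<Sum>x\<in>X. a x) = d}"

lemma hom_in_span:
  assumes "finite X" "hom X d h"
  shows "h \<in> fun_space.span (degree_monomials X d)"
  using assms(2)
proof (induction rule: hom.induct)
  case (zero d) show ?case by (rule fun_space.span_zero)
next
  case (const c)
  have "(1 :: 'a \<Rightarrow> complex) \<in> degree_monomials X 0"
    unfolding degree_monomials_def by (intro CollectI exI[of _ "\<lambda>_. 0"]) simp
  then have "fun_scale c (1 :: 'a \<Rightarrow> complex) \<in> fun_space.span (degree_monomials X 0)"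
    by (intro fun_space.span_scale fun_space.span_base)
  moreover have "fun_scale c (1 :: 'a \<Rightarrow> complex) = (\<lambda>_. c)" by (auto simp: fun_eq_iff fun_apply)
  ultimately show ?case by metis
next
  case (mult z d h)
  have step: "z * f \<in> degree_monomials X (Suc d)" if f: "f \<in> degree_monomials X d" for f
  proof -
    obtain a where a: "f = (\<Prod>x\<in>X. x ^ a x)" "(\<Sum>x\<in>X. a x) = d"
      using f unfolding degree_monomials_def by blast
    define b where "b = a(z := Suc (a z))"
    have "(\<Prod>x\<in>X. x ^ b x) = z ^ b z * (\<Prod>x\<in>X - {z}. x ^ b x)" by (rule prod.remove) (use assms mult in auto)
    also have "\<dots> = z * (z ^ a z * (\<Prod>x\<in>X - {z}. x ^ a x))" by (simp add: b_def mult.assoc)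
    also have "z ^ a z * (\<Prod>x\<in>X - {z}. x ^ a x) = f"
      unfolding a(1) by (rule prod.remove[symmetric]) (use assms mult in auto)
    finally have 1: "(\<Prod>x\<in>X. x ^ b x) = z * f" .
    have "(\<Sum>x\<in>X. b x) = b z + (\<Sum>x\<in>X - {z}. b x)" by (rule sum.remove) (use assms mult in auto)
    also have "\<dots> = Suc (a z + (\<Sum>x\<in>X - {z}. a x))" by (simp add: b_def)
    also have "a z + (\<Sum>x\<in>X - {z}. a x) = d"
      unfolding a(2)[symmetric] by (rule sum.remove[symmetric]) (use assms mult in auto)
    finally have "(\<Sum>x\<in>X. b x) = Suc d" .
    then show ?thesis unfolding 1[symmetric] degree_monomials_def by blast
  qed
  show ?case using mult.IH
  proof (induction rule: fun_space.span_induct_alt)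
    case base show ?case unfolding mult_zero_right by (rule fun_space.span_zero)
  next
    case (step c f g)
    show ?case unfolding distrib_left fun_scale_mult
      by (rule fun_space.span_add[OF fun_space.span_scale[OF fun_space.span_base] step(2)])
        (rule \<open>\<And>f. f \<in> degree_monomials X d \<Longrightarrow> z * f \<in> degree_monomials X (Suc d)\<close>[OF step(1)])
  qed
next
  case (add d f g) show ?case by (rule fun_space.span_add[OF add.IH])
qed

lemma ideal_scale: "ideal_of (alg X) I \<Longrightarrow> f \<in> I \<Longrightarrow> fun_scale c f \<in> I"
proof -
  assume I: "ideal_of (alg X) I" "f \<in> I"
  have "(\<lambda>_. c) * f \<in> I" by (rule ideal_of_closed(3)[OF I(1) alg.const I(2)])
  moreover have "(\<lambda>_. c) * f = fun_scale c f" by (auto simp: fun_eq_iff fun_apply)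
  ultimately show ?thesis by simp
qed

lemma ideal_span:
  assumes "ideal_of (alg X) I" "S \<subseteq> I" "f \<in> fun_space.span S"
  shows "f \<in> I"
  using assms(3)
proof (induction rule: fun_space.span_induct_alt)
  case base show ?case by (rule ideal_of_closed(1)[OF assms(1)])
next
  case (step c f g)
  show ?case by (rule ideal_of_closed(2)[OF assms(1) ideal_scale[OF assms(1)] step(2)]) (use step assms in auto)
qed

text \<open>Pigeonhole: in a monomial whose degree exceeds the sum of the exponents
  \<open>k x\<close>, some generator \<open>x\<close> occurs at least \<open>k x\<close>
  times.\<close>

lemma tail_subset_ideal:
  assumes X: "finite X" and Q: "ideal_of (alg X) Q" and pow: "\<And>x. x \<in> X \<Longrightarrow> \<exists>k. x ^ k \<in> Q"
  obtains J where "tail X J \<subseteq> Q"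
proof -
  from pow obtain k where k: "\<And>x. x \<in> X \<Longrightarrow> x ^ k x \<in> Q" by metis
  define J where "J = (\<Sum>x\<in>X. k x) + 1"
  have mon: "degree_monomials X d \<subseteq> Q" if "J \<le> d" for d
  proof
    fix f assume "f \<in> degree_monomials X d"
    then obtain a where a: "f = (\<Prod>x\<in>X. x ^ a x)" "(\<Sum>x\<in>X. a x) = d" unfolding degree_monomials_def by blast
    have "\<exists>x\<in>X. k x \<le> a x"
    proof (rule ccontr)
      assume "\<not> ?thesis"
      then have "(\<Sum>x\<in>X. a x) \<le> (\<Sum>x\<in>X. k x)" by (intro sum_mono) auto
      then show False using a(2) that by (simp add: J_def)
    qed
    then obtain x where x: "x \<in> X" "k x \<le> a x" by blast
    have "f = x ^ a x * (\<Prod>y\<in>X - {x}. y ^ a y)" unfolding a(1) by (rule prod.remove) (use X x in auto)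
    also have "x ^ a x = x ^ (a x - k x) * x ^ k x" using x(2) by (simp add: power_add[symmetric])
    finally have eq: "f = (x ^ (a x - k x) * (\<Prod>y\<in>X - {x}. y ^ a y)) * x ^ k x" by (simp add: mult_ac)
    have "(\<Prod>y\<in>F. y ^ a y) \<in> alg X" if "finite F" "F \<subseteq> X" for F
      using that
    proof (induction F)
      case empty show ?case unfolding prod.empty by (rule alg_closed(1))
    next
      case (insert y F)
      have "y ^ a y * (\<Prod>y\<in>F. y ^ a y) \<in> alg X"
        by (rule alg.mult[OF alg_closed(7)[OF alg.gen]]) (use insert in auto)
      then show ?case unfolding prod.insert[OF insert(1,2)] .
    qed
    from this[of "X - {x}"] have "x ^ (a x - k x) * (\<Prod>y\<in>X - {x}. y ^ a y) \<in> alg X"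
      using X alg.mult[OF alg_closed(7)[OF alg.gen[OF x(1)]]] by auto
    then show "f \<in> Q" unfolding eq by (rule ideal_of_closed(3)[OF Q _ k[OF x(1)]])
  qed
  have "f \<in> Q" if "f \<in> tail X J" for f
    using that
  proof (induction rule: tail.induct)
    case (hom d h)
    show ?case by (rule ideal_span[OF Q mon[OF hom(2)] hom_in_span[OF X hom(1)]])
  next
    case (add f g) show ?case by (rule ideal_of_closed(2)[OF Q add.IH])
  qed
  then show ?thesis using that by blast
qed

lemma ideal_sum_principal:
  assumes A: "subring_of A" and Q: "ideal_of A Q" and x: "x \<in> A"
  shows "ideal_of A {q + r * x | q r. q \<in> Q \<and> r \<in> A}" (is "ideal_of A ?S")
proof -
  have S: "q + r * x \<in> ?S" if "q \<in> Q" "r \<in> A" for q r using that by blast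
  show ?thesis
    unfolding ideal_of_def
  proof (intro conjI ballI subsetI)
    fix y assume "y \<in> ?S"
    then obtain q r where e: "y = q + r * x" "q \<in> Q" "r \<in> A" by blast
    show "y \<in> A" unfolding e(1)
      by (rule subring_of_closed(3)[OF A ideal_of_closed(4)[OF Q e(2)] subring_of_closed(5)[OF A e(3) x]])
  next
    show "0 \<in> ?S" using S[OF ideal_of_closed(1)[OF Q] subring_of_closed(2)[OF A]] by (simp only: mult_zero_left add_0)
  next
    fix y z assume "y \<in> ?S" "z \<in> ?S"
    then obtain q r q' r' where e: "y = q + r * x" "z = q' + r' * x" "q \<in> Q" "r \<in> A" "q' \<in> Q" "r' \<in> A" by blast
    have "y + z = (q + q') + (r + r') * x" unfolding e by (simp only: distrib_right add_ac)
    then show "y + z \<in> ?S"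
      using S[OF ideal_of_closed(2)[OF Q e(3,5)] subring_of_closed(3)[OF A e(4,6)]] by (simp only:)
  next
    fix a y assume a: "a \<in> A" and "y \<in> ?S"
    then obtain q r where e: "y = q + r * x" "q \<in> Q" "r \<in> A" by blast
    have "a * y = a * q + (a * r) * x" unfolding e by (simp only: distrib_left mult_ac)
    then show "a * y \<in> ?S"
      using S[OF ideal_of_closed(3)[OF Q a e(2)] subring_of_closed(5)[OF A a e(3)]] by (simp only:)
  qed
qed

text \<open>Krull's intersection theorem, by Herstein's argument: an ideal maximal among those meeting
  \<open>A g + I\<close> in \<open>\<mm> g + I\<close> contains a power of \<open>\<mm>\<close>.\<close>

lemma krull_intersection:
  assumes X: "finite X" and z: "\<And>x. x \<in> X \<Longrightarrow> x z = 0"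
    and I: "ideal_of (alg X) I" and g: "g \<in> alg X" and deep: "\<And>i. \<exists>h\<in>I. g - h \<in> tail X i"
  obtains a where "a \<in> alg X" "a z = 0" "(1 - a) * g \<in> I"
proof -
  define B where "B = {i + r * g | i r. i \<in> I \<and> r \<in> alg X}"
  define mB where "mB = {i + a * g | i a. i \<in> I \<and> a \<in> alg X \<and> a z = 0}"
  have BI: "i + r * g \<in> B" if "i \<in> I" "r \<in> alg X" for i r unfolding B_def using that by blast
  have mBI: "i + a * g \<in> mB" if "i \<in> I" "a \<in> alg X" "a z = 0" for i a unfolding mB_def using that by blast
  have mBE: "\<exists>i a. y = i + a * g \<and> i \<in> I \<and> a \<in> alg X \<and> a z = 0" if "y \<in> mB" for y
    using that unfolding mB_def by blast
  have mBB: "mB \<subseteq> B" using mBE BI by blast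
  have mB: "ideal_of (alg X) mB"
    unfolding ideal_of_def
  proof (intro conjI ballI subsetI)
    fix y assume "y \<in> mB"
    then obtain i a where e: "y = i + a * g" "i \<in> I" "a \<in> alg X" using mBE by blast
    show "y \<in> alg X" unfolding e(1) by (rule alg.add[OF ideal_of_closed(4)[OF I e(2)] alg.mult[OF e(3) g]])
  next
    show "0 \<in> mB" using mBI[OF ideal_of_closed(1)[OF I] alg_zero zero_fun_apply]
      by (simp only: mult_zero_left add_0)
  next
    fix y y' assume "y \<in> mB" "y' \<in> mB"
    then obtain i a i' a' where e: "y = i + a * g" "y' = i' + a' * g" "i \<in> I" "i' \<in> I"
      "a \<in> alg X" "a' \<in> alg X" "a z = 0" "a' z = 0" using mBE by metis
    have eq: "y + y' = (i + i') + (a + a') * g" unfolding e by (simp only: distrib_right add_ac)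
    have "(a + a') z = 0" using e by (simp add: fun_apply)
    from mBI[OF ideal_of_closed(2)[OF I e(3,4)] alg.add[OF e(5,6)] this]
    show "y + y' \<in> mB" unfolding eq .
  next
    fix b y assume b: "b \<in> alg X" and "y \<in> mB"
    then obtain i a where e: "y = i + a * g" "i \<in> I" "a \<in> alg X" "a z = 0" using mBE by metis
    have eq: "b * y = b * i + (b * a) * g" unfolding e by (simp only: distrib_left mult.assoc)
    have "(b * a) z = 0" using e by (simp add: fun_apply)
    from mBI[OF ideal_of_closed(3)[OF I b e(2)] alg.mult[OF b e(3)] this]
    show "b * y \<in> mB" unfolding eq .
  qed
  have xB: "x * b \<in> mB" if x: "x \<in> X" and b: "b \<in> B" for x b
  proof -
    obtain i r where e: "b = i + r * g" "i \<in> I" "r \<in> alg X" using b unfolding B_def by blast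
    have eq: "x * b = x * i + (x * r) * g" unfolding e by (simp only: distrib_left mult.assoc)
    have "(x * r) z = 0" using z[OF x] by (simp add: fun_apply)
    from mBI[OF ideal_of_closed(3)[OF I alg.gen[OF x] e(2)] alg.mult[OF alg.gen[OF x] e(3)] this]
    show ?thesis unfolding eq .
  qed
  define C where "C = {Q. ideal_of (alg X) Q \<and> Q \<inter> B = mB}"
  have "mB \<in> C" unfolding C_def using mB mBB by blast
  then obtain Q where Q: "Q \<in> C" "mB \<subseteq> Q" and max: "\<And>N. N \<in> C \<Longrightarrow> Q \<subseteq> N \<Longrightarrow> N = Q"
    using acc_maximal[OF acc_alg[OF X], of mB C] unfolding C_def by blast
  have Qi: "ideal_of (alg X) Q" and QB: "Q \<inter> B = mB" using Q(1) unfolding C_def by blast+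
  have "\<exists>k. x ^ k \<in> Q" if x: "x \<in> X" for x
  proof -
    have xk: "x ^ k \<in> alg X" for k by (rule alg_closed(7)[OF alg.gen[OF x]])
    \<comment> \<open>These colon ideals increase with \<open>k\<close>; once they are stationary at
      \<open>K\<close>, adding \<open>x ^ K\<close> to \<open>Q\<close> does not enlarge the
      intersection with \<open>B\<close>, so maximality forces \<open>x ^ K \<in> Q\<close>.\<close>
    define L where "L k = {r \<in> alg X. x ^ k * r \<in> Q}" for k
    have "ideal_of (alg X) (L k)" for k
      unfolding ideal_of_def
    proof (intro conjI ballI subsetI)
      show "0 \<in> L k" unfolding L_def using ideal_of_closed(1)[OF Qi] alg_zero
        by (simp only: mult_zero_right mem_Collect_eq simp_thms)
    next
      fix r r' assume "r \<in> L k" "r' \<in> L k"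
      then show "r + r' \<in> L k" unfolding L_def
        using ideal_of_closed(2)[OF Qi, of "x ^ k * r" "x ^ k * r'"] alg.add[of r X r']
        by (simp only: distrib_left mem_Collect_eq)
    next
      fix a r assume "a \<in> alg X" "r \<in> L k"
      then show "a * r \<in> L k" unfolding L_def
        using ideal_of_closed(3)[OF Qi, of a "x ^ k * r"] alg.mult[of a X r]
        by (simp only: mult.left_commute mem_Collect_eq)
    qed (auto simp: L_def)
    moreover have "L k \<subseteq> L (Suc k)" for k
    proof
      fix r assume "r \<in> L k"
      then have "r \<in> alg X" "x * (x ^ k * r) \<in> Q"
        using ideal_of_closed(3)[OF Qi alg.gen[OF x]] unfolding L_def by auto
      then show "r \<in> L (Suc k)" unfolding L_def by (simp only: mult.assoc power_Suc mem_Collect_eq simp_thms)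
    qed
    ultimately obtain K where K: "\<And>k. k \<ge> K \<Longrightarrow> L k = L K"
      using acc_alg[OF X, unfolded acc_def, rule_format, of L] by blast
    have Q'I: "q + r * x ^ K \<in> {q + r * x ^ K | q r. q \<in> Q \<and> r \<in> alg X}" if "q \<in> Q" "r \<in> alg X" for q r
      using that by blast
    define Q' where "Q' = {q + r * x ^ K | q r. q \<in> Q \<and> r \<in> alg X}"
    have Q'i: "ideal_of (alg X) Q'" unfolding Q'_def by (rule ideal_sum_principal[OF subring_alg Qi xk])
    have QQ': "Q \<subseteq> Q'"
    proof
      fix q assume "q \<in> Q"
      then show "q \<in> Q'" unfolding Q'_def using Q'I[OF _ alg_zero, of q] by (simp only: mult_zero_left add_0_right)
    qed
    \<comment> \<open>Multiplication by \<open>x\<close> maps \<open>B\<close> into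
      \<open>mB\<close>, hence into \<open>Q\<close>; so \<open>x ^ Suc K * r \<in> Q\<close>, and
      stationarity gives \<open>x ^ K * r \<in> Q\<close>.\<close>
    have "Q' \<inter> B \<subseteq> mB"
    proof
      fix b assume b: "b \<in> Q' \<inter> B"
      then obtain q r where e: "b = q + r * x ^ K" "q \<in> Q" "r \<in> alg X" unfolding Q'_def by blast
      have "x * b \<in> Q" using xB[OF x, of b] b Q(2) by blast
      moreover have "x * q \<in> Q" by (rule ideal_of_closed(3)[OF Qi alg.gen[OF x] e(2)])
      ultimately have "x * b - x * q \<in> Q" by (rule ideal_of_diff[OF subring_alg Qi])
      moreover have "x * b - x * q = x ^ Suc K * r" unfolding e(1)
        by (simp only: distrib_left add_diff_cancel_left' power_Suc mult_ac)
      ultimately have "r \<in> L (Suc K)" using e(3) unfolding L_def by (simp only: mem_Collect_eq simp_thms)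
      then have "r \<in> L K" using K[of "Suc K"] by auto
      then have "r * x ^ K \<in> Q" unfolding L_def by (simp only: mem_Collect_eq mult.commute)
      from ideal_of_closed(2)[OF Qi e(2) this]
      show "b \<in> mB" using QB b e(1) by auto
    qed
    then have "Q' \<inter> B = mB" using QB QQ' by blast
    then have "Q' = Q" using max[of Q'] Q'i QQ' unfolding C_def by blast
    moreover have "x ^ K \<in> Q'"
    proof -
      show ?thesis unfolding Q'_def using Q'I[OF ideal_of_closed(1)[OF Qi] alg_closed(1)]
        by (simp only: mult_1_left add_0)
    qed
    ultimately show ?thesis by blast
  qed
  then obtain J where J: "tail X J \<subseteq> Q" using tail_subset_ideal[OF X Qi] by blast
  \<comment> \<open>\<open>h\<close> lies in \<open>I \<subseteq> mB \<subseteq> Q\<close> and the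
    rest in a power of the ideal of the generators, so \<open>g \<in> Q\<close>, and therefore
    \<open>g \<in> mB\<close>.\<close>
  obtain h where h: "h \<in> I" "g - h \<in> tail X J" using deep by blast
  have "h \<in> mB" using mBI[OF h(1) alg_zero zero_fun_apply] by (simp only: mult_zero_left add_0_right)
  then have "h \<in> Q" using Q(2) by blast
  moreover have "g - h \<in> Q" using J h(2) by blast
  ultimately have "g - h + h \<in> Q" using ideal_of_closed(2)[OF Qi] by blast
  then have "g \<in> Q" by (simp only: diff_add_cancel)
  moreover have "g \<in> B"
    using BI[OF ideal_of_closed(1)[OF I] alg_closed(1)] by (simp only: mult_1_left add_0)
  ultimately have "g \<in> mB" using QB by blast
  then obtain i a where e: "g = i + a * g" "i \<in> I" "a \<in> alg X" "a z = 0" using mBE by metis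
  have "(1 - a) * g = g - a * g" by (simp add: left_diff_distrib)
  also have "\<dots> = i" using e(1) by (metis add_diff_cancel_right')
  finally show ?thesis using that[OF e(3,4)] e(2) by simp
qed

section \<open>The Nullstellensatz\<close>

lemma prime_ofD:
  assumes "prime_of A P"
  shows "ideal_of A P" "1 \<notin> P" "x \<in> A \<Longrightarrow> y \<in> A \<Longrightarrow> x * y \<in> P \<Longrightarrow> x \<in> P \<or> y \<in> P"
  using assms unfolding prime_of_def by blast+

lemma ideal_const_imp_one:
  assumes "ideal_of (alg X) M" "(\<lambda>_. c) \<in> M" "c \<noteq> 0"
  shows "1 \<in> M"
proof -
  have "(\<lambda>_. 1 / c) * (\<lambda>_. c) \<in> M" by (rule ideal_of_closed(3)[OF assms(1) alg.const assms(2)])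
  moreover have "(\<lambda>_::'a. 1 / c) * (\<lambda>_. c) = 1" using assms(3) by (auto simp: fun_eq_iff fun_apply)
  ultimately show ?thesis by simp
qed

lemma poly_eval_alg:
  assumes "x \<in> alg X"
  shows "(\<lambda>v. poly p (x v)) \<in> alg X"
proof (induction p)
  case 0
  show ?case using alg.const[of 0 X] by simp
next
  case (pCons a p)
  have "(\<lambda>_. a) + x * (\<lambda>v. poly p (x v)) \<in> alg X"
    by (intro alg.add alg.mult alg.const assms pCons(2))
  then show ?case by (simp add: plus_fun_def times_fun_def)
qed

text \<open>Over the complex numbers \<open>p\<close> splits into linear factors, one of which a
  prime ideal has to contain.\<close>

lemma prime_contains_root:
  assumes M: "prime_of (alg X) M" and x: "x \<in> alg X" and p: "p \<noteq> 0" "(\<lambda>v. poly p (x v)) \<in> M"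
  shows "\<exists>\<alpha>. x - (\<lambda>_. \<alpha>) \<in> M"
  using p
proof (induction "degree p" arbitrary: p rule: less_induct)
  case less
  show ?case
  proof (cases "degree p = 0")
    case True
    then obtain c where c: "p = [:c:]" by (auto elim: degree_eq_zeroE)
    then have "c \<noteq> 0" "(\<lambda>_. c) \<in> M" using less.prems by auto
    then show ?thesis using ideal_const_imp_one[OF prime_ofD(1)[OF M]] prime_ofD(2)[OF M] by blast
  next
    case False
    then obtain \<alpha> where "poly p \<alpha> = 0"
      using fundamental_theorem_of_algebra[of p] constant_degree[of p] by auto
    then obtain q where q: "p = [:- \<alpha>, 1:] * q" by (meson dvdE poly_eq_0_iff_dvd)
    have "q \<noteq> 0" using q less.prems(1) by auto
    have "degree p = Suc (degree q)" unfolding q using \<open>q \<noteq> 0\<close> by (subst degree_mult_eq) auto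
    have "(x - (\<lambda>_. \<alpha>)) * (\<lambda>v. poly q (x v)) = (\<lambda>v. poly p (x v))"
      by (auto simp: q fun_eq_iff fun_apply minus_apply algebra_simps)
    then have "(x - (\<lambda>_. \<alpha>)) * (\<lambda>v. poly q (x v)) \<in> M" using less.prems(2) by simp
    then have "x - (\<lambda>_. \<alpha>) \<in> M \<or> (\<lambda>v. poly q (x v)) \<in> M"
      by (rule prime_ofD(3)[OF M alg_closed(4)[OF x alg.const] poly_eval_alg[OF x]])
    then show ?thesis using less.hyps[of q] \<open>q \<noteq> 0\<close> \<open>degree p = Suc (degree q)\<close> by auto
  qed
qed

text \<open>The residue field of an ideal maximal among those avoiding the powers of \<open>g\<close> has countable
  dimension, whereas an element \<open>x\<close> transcendental over the complex numbers would produce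
  uncountably many linearly independent elements \<open>1 / (x - a)\<close>.\<close>

lemma nullstellensatz:
  fixes X :: "('a \<Rightarrow> complex) set"
  assumes X: "finite X" and pts: "\<And>\<alpha>. \<exists>v. \<forall>x\<in>X. x v = \<alpha> x"
    and P: "prime_of (alg X) P" and g: "g \<in> alg X" "g \<notin> P"
  shows "\<exists>v. (\<forall>f\<in>P. f v = 0) \<and> g v \<noteq> 0"
proof -
  \<comment> \<open>A maximal element of \<open>C\<close> plays the role of a maximal ideal in the
    localization at \<open>g\<close>.\<close>
  define C where "C = {Q. ideal_of (alg X) Q \<and> P \<subseteq> Q \<and> (\<forall>k. g ^ k \<notin> Q)}"
  have gk: "g ^ k \<in> alg X" for k by (rule alg_closed(7)[OF g(1)])
  have gkP: "g ^ k \<notin> P" for k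
  proof (induction k)
    case 0 show ?case using prime_ofD(2)[OF P] by (simp only: power_0 not_False_eq_True)
  next
    case (Suc k) show ?case using prime_ofD(3)[OF P g(1) gk[of k]] Suc g(2) by auto
  qed
  then have PC: "P \<in> C" unfolding C_def using prime_ofD(1)[OF P] by simp
  have Cid: "ideal_of (alg X) J" if "J \<in> C" for J using that unfolding C_def by simp
  obtain M where MC: "M \<in> C" and max: "\<And>N. N \<in> C \<Longrightarrow> M \<subseteq> N \<Longrightarrow> N = M"
    by (rule acc_maximal[OF acc_alg[OF X] PC Cid]) (assumption, rule that)
  have M: "ideal_of (alg X) M" and PM: "P \<subseteq> M" and gM: "\<And>k. g ^ k \<notin> M"
    using MC unfolding C_def by blast+
  \<comment> \<open>By maximality an element outside \<open>M\<close> becomes invertible modulo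
    \<open>M\<close> once \<open>g\<close> is inverted; the denominators are the powers of
    \<open>g\<close>.\<close>
  have inv: "\<exists>k u. u \<in> alg X \<and> g ^ k - u * x \<in> M" if x: "x \<in> alg X" "x \<notin> M" for x
  proof -
    define N where "N = {q + r * x | q r. q \<in> M \<and> r \<in> alg X}"
    have NI: "q + r * x \<in> N" if "q \<in> M" "r \<in> alg X" for q r unfolding N_def using that by blast
    have Nid: "ideal_of (alg X) N" unfolding N_def by (rule ideal_sum_principal[OF subring_alg M x(1)])
    have MN: "M \<subseteq> N"
    proof
      fix q assume "q \<in> M"
      then show "q \<in> N" using NI[OF _ alg_zero, of q] by (simp only: mult_zero_left add_0_right)
    qed
    have "x \<in> N" using NI[OF ideal_of_closed(1)[OF M] alg_closed(1)] by (simp only: mult_1_left add_0)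
    then have "N \<notin> C" using max[of N] MN x(2) by blast
    then obtain k where "g ^ k \<in> N" unfolding C_def using Nid MN PM by blast
    then obtain q r where e: "g ^ k = q + r * x" "q \<in> M" "r \<in> alg X" unfolding N_def by blast
    have "g ^ k - r * x = q" unfolding e(1) by (simp only: add_diff_cancel_right')
    then show ?thesis using e by metis
  qed
  have "x \<in> M \<or> y \<in> M" if xy: "x \<in> alg X" "y \<in> alg X" "x * y \<in> M" for x y
  proof (rule ccontr)
    assume "\<not> ?thesis"
    then obtain k u l w where u: "u \<in> alg X" "g ^ k - u * x \<in> M" and w: "w \<in> alg X" "g ^ l - w * y \<in> M"
      using inv xy(1,2) by metis
    have "g ^ l * (g ^ k - u * x) + (u * x) * (g ^ l - w * y) + (u * w) * (x * y) \<in> M"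
      by (rule ideal_of_closed(2)[OF M ideal_of_closed(2)[OF M ideal_of_closed(3)[OF M gk u(2)]
        ideal_of_closed(3)[OF M alg.mult[OF u(1) xy(1)] w(2)]] ideal_of_closed(3)[OF M alg.mult[OF u(1) w(1)] xy(3)]])
    moreover have "g ^ l * (g ^ k - u * x) + (u * x) * (g ^ l - w * y) + (u * w) * (x * y) = g ^ (l + k)"
      by (simp add: algebra_simps power_add)
    ultimately show False using gM by metis
  qed
  moreover have "1 \<notin> M" using gM[of 0] by (simp only: power_0 not_False_eq_True)
  ultimately have Mp: "prime_of (alg X) M" unfolding prime_of_def using M by blast
  have root: "\<exists>\<alpha>. x - (\<lambda>_. \<alpha>) \<in> M" if xX: "x \<in> X" for x
  proof (rule ccontr)
    assume no: "\<nexists>\<alpha>. x - (\<lambda>_. \<alpha>) \<in> M"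
    have x: "x \<in> alg X" by (rule alg.gen[OF xX])
    have "\<exists>k u D. u \<in> fun_space.span (monomials X D) \<and> g ^ k - u * (x - (\<lambda>_. a)) \<in> M" for a
    proof -
      obtain k u where "u \<in> alg X" "g ^ k - u * (x - (\<lambda>_. a)) \<in> M"
        using inv[OF alg_closed(4)[OF x alg.const[of a]]] no by blast
      then show ?thesis using alg_in_span_monomials[OF X] by blast
    qed
    then obtain k u D where u: "\<And>a. u a \<in> fun_space.span (monomials X (D a))"
      and ku: "\<And>a. g ^ k a - u a * (x - (\<lambda>_. a)) \<in> M" by metis
    \<comment> \<open>There are uncountably many \<open>a\<close> but only countably many pairs of a
      power of \<open>g\<close> and a degree bound, so infinitely many \<open>a\<close> share one
      pair.\<close>
    have "\<exists>p::nat \<times> nat. infinite {a. (k a, D a) = p}"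
    proof (rule ccontr)
      assume "\<not> ?thesis"
      then have "countable (\<Union>p::nat \<times> nat. {a. (k a, D a) = p})"
        by (intro countable_UN) (auto intro: countable_finite)
      moreover have "(\<Union>p::nat \<times> nat. {a. (k a, D a) = p}) = UNIV" by auto
      ultimately show False using uncountable_UNIV_complex by simp
    qed
    then obtain kk DD where inf: "infinite {a. k a = kk \<and> D a = DD}" by auto
    obtain S where S: "finite S" "card S = Suc (card (monomials X DD))" "S \<subseteq> {a. k a = kk \<and> D a = DD}"
      using infinite_arbitrarily_large[OF inf] by blast
    have "\<exists>c. (\<exists>a\<in>S. c a \<noteq> 0) \<and> (\<Sum>a\<in>S. fun_scale (c a) (u a)) = 0"
      by (rule fun_space.family_dependent[OF finite_monomials[OF X, of DD] S(1)]) (use S u in auto)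
    then obtain c a0 where c: "a0 \<in> S" "c a0 \<noteq> 0" "(\<Sum>a\<in>S. fun_scale (c a) (u a)) = 0" by blast
    \<comment> \<open>Clearing denominators in a relation between the \<open>1 / (x - a)\<close>:
      \<open>p\<close> is the resulting numerator, nonzero because its value at \<open>a0\<close> is
      \<open>c a0\<close> times a nonzero product.\<close>
    define q where "q a = (\<Prod>b\<in>S - {a}. [:- b, 1:])" for a
    define p where "p = (\<Sum>a\<in>S. smult (c a) (q a))"
    define ev where "ev p = (\<lambda>v. poly p (x v))" for p
    have ev: "ev p \<in> alg X" for p unfolding ev_def by (rule poly_eval_alg[OF x])
    have "poly p a0 = (\<Sum>a\<in>{a0}. c a * poly (q a) a0)"
      unfolding p_def poly_sum poly_smult
      by (rule sum.mono_neutral_right) (use c(1) S(1) in \<open>auto simp: q_def poly_prod\<close>)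
    also have "\<dots> \<noteq> 0" using c(2) S(1) by (auto simp: q_def poly_prod)
    finally have "p \<noteq> 0" by auto
    have qa: "ev (q a) * (x - (\<lambda>_. a)) = ev (\<Prod>b\<in>S. [:- b, 1:])" if a: "a \<in> S" for a
    proof -
      have "(\<Prod>b\<in>S. [:- b, 1:]) = [:- a, 1:] * q a" unfolding q_def by (rule prod.remove[OF S(1) a])
      then have "poly (\<Prod>b\<in>S. [:- b, 1:]) w = (w - a) * poly (q a) w" for w
        by (simp only: poly_mult) (simp add: algebra_simps)
      then show ?thesis by (simp add: ev_def fun_eq_iff fun_apply minus_apply)
    qed
    have summand: "g ^ kk * fun_scale (c a) (ev (q a)) - fun_scale (c a) (u a) * ev (\<Prod>b\<in>S. [:- b, 1:]) \<in> M"
      if a: "a \<in> S" for a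
    proof -
      have "k a = kk" using a S(3) by blast
      then have "fun_scale (c a) (ev (q a)) * (g ^ kk - u a * (x - (\<lambda>_. a))) \<in> M"
        using ideal_of_closed(3)[OF M alg_scale[OF ev] ku[of a]] by metis
      moreover have "fun_scale (c a) (ev (q a)) * (g ^ kk - u a * (x - (\<lambda>_. a)))
        = g ^ kk * fun_scale (c a) (ev (q a)) - fun_scale (c a) (u a) * (ev (q a) * (x - (\<lambda>_. a)))"
        by (auto simp: fun_eq_iff fun_apply minus_apply algebra_simps)
      ultimately show ?thesis using qa[OF a] by metis
    qed
    have "(\<Sum>a\<in>S. g ^ kk * fun_scale (c a) (ev (q a)) - fun_scale (c a) (u a) * ev (\<Prod>b\<in>S. [:- b, 1:])) \<in> M"
      by (rule ideal_of_sum[OF M summand])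
    moreover have "(\<Sum>a\<in>S. g ^ kk * fun_scale (c a) (ev (q a)) - fun_scale (c a) (u a) * ev (\<Prod>b\<in>S. [:- b, 1:]))
      = g ^ kk * (\<Sum>a\<in>S. fun_scale (c a) (ev (q a))) - (\<Sum>a\<in>S. fun_scale (c a) (u a)) * ev (\<Prod>b\<in>S. [:- b, 1:])"
      by (simp only: sum_subtractf sum_distrib_left sum_distrib_right)
    moreover have "(\<Sum>a\<in>S. fun_scale (c a) (ev (q a))) = ev p"
      by (auto simp: fun_eq_iff sum_fun_apply fun_apply ev_def p_def poly_sum)
    ultimately have "g ^ kk * ev p \<in> M" unfolding c(3) mult_zero_left diff_zero by (simp only:)
    then have "ev p \<in> M" using prime_ofD(3)[OF Mp gk ev] gM by blast
    then show False using prime_contains_root[OF Mp x \<open>p \<noteq> 0\<close>] no unfolding ev_def by blast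
  qed
  then obtain \<alpha> where \<alpha>: "\<And>x. x \<in> X \<Longrightarrow> x - (\<lambda>_. \<alpha> x) \<in> M" by metis
  obtain v where v: "\<And>x. x \<in> X \<Longrightarrow> x v = \<alpha> x" using pts by blast
  \<comment> \<open>Modulo \<open>M\<close> every generator is a constant \<open>\<alpha> x\<close>;
    hence evaluation at the point \<open>v\<close> with these coordinates agrees with reduction
    modulo \<open>M\<close> on all of \<open>alg X\<close>.\<close>
  have res: "f - (\<lambda>_. f v) \<in> M" if "f \<in> alg X" for f
    using that
  proof (induction rule: alg.induct)
    case (const c) show ?case unfolding diff_self by (rule ideal_of_closed(1)[OF M])
  next
    case (gen x) show ?case unfolding v[OF gen] by (rule \<alpha>[OF gen])
  next
    case (add f h)
    have "f + h - (\<lambda>_. (f + h) v) = (f - (\<lambda>_. f v)) + (h - (\<lambda>_. h v))"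
      by (auto simp: fun_eq_iff fun_apply minus_apply)
    then show ?case using ideal_of_closed(2)[OF M add.IH] by (simp only:)
  next
    case (mult f h)
    have "f * h - (\<lambda>_. (f * h) v) = f * (h - (\<lambda>_. h v)) + (\<lambda>_. h v) * (f - (\<lambda>_. f v))"
      by (auto simp: fun_eq_iff fun_apply minus_apply algebra_simps)
    moreover have "f * (h - (\<lambda>_. h v)) + (\<lambda>_. h v) * (f - (\<lambda>_. f v)) \<in> M"
      by (rule ideal_of_closed(2)[OF M ideal_of_closed(3)[OF M mult(1) mult.IH(2)]
        ideal_of_closed(3)[OF M alg.const mult.IH(1)]])
    ultimately show ?case by (simp only:)
  qed
  have "f v = 0" if "f \<in> P" for f
  proof (rule ccontr)
    assume nz: "f v \<noteq> 0"
    have f: "f \<in> M" "f \<in> alg X" using that PM ideal_of_closed(4)[OF M] by blast+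
    have "f - (f - (\<lambda>_. f v)) \<in> M" by (rule ideal_of_diff[OF subring_alg M f(1) res[OF f(2)]])
    then have "(\<lambda>_. f v) \<in> M" by (simp only: diff_diff_eq2 add_diff_cancel_left')
    then show False using ideal_const_imp_one[OF M _ nz] \<open>1 \<notin> M\<close> by blast
  qed
  moreover have "g v \<noteq> 0"
  proof
    assume "g v = 0"
    then have "g - (\<lambda>_. g v) = g ^ 1" by (auto simp: fun_eq_iff fun_apply minus_apply)
    then show False using res[OF g(1)] gM[of 1] by metis
  qed
  ultimately show ?thesis by blast
qed

section \<open>Germs with independent differentials\<close>

definition polyfun :: "(complex \<Rightarrow> complex) \<Rightarrow> bool" where
  "polyfun f \<longleftrightarrow> (\<exists>p. \<forall>t. f t = poly p t)"

definition vanishes_to_order :: "nat \<Rightarrow> (complex \<Rightarrow> complex) \<Rightarrow> bool" where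
  "vanishes_to_order i f \<longleftrightarrow> (\<exists>p. \<forall>t. f t = t ^ i * poly p t)"

lemma polyfun_intros:
  "polyfun (\<lambda>_. c)" "polyfun (\<lambda>t. t)" "polyfun f \<Longrightarrow> polyfun g \<Longrightarrow> polyfun (\<lambda>t. f t + g t)"
  "polyfun f \<Longrightarrow> polyfun g \<Longrightarrow> polyfun (\<lambda>t. f t * g t)" "polyfun f \<Longrightarrow> polyfun (\<lambda>t. f t ^ n)"
proof -
  show "polyfun (\<lambda>_. c)" unfolding polyfun_def by (rule exI[of _ "[:c:]"]) simp
  show "polyfun (\<lambda>t. t)" unfolding polyfun_def by (rule exI[of _ "[:0, 1:]"]) simp
  show "polyfun f \<Longrightarrow> polyfun g \<Longrightarrow> polyfun (\<lambda>t. f t + g t)" unfolding polyfun_def by (metis poly_add)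
  show "polyfun f \<Longrightarrow> polyfun g \<Longrightarrow> polyfun (\<lambda>t. f t * g t)" unfolding polyfun_def by (metis poly_mult)
  show "polyfun f \<Longrightarrow> polyfun (\<lambda>t. f t ^ n)" unfolding polyfun_def by (metis poly_power)
qed

lemma polyfun_sum: "(\<And>i. i \<in> S \<Longrightarrow> polyfun (f i)) \<Longrightarrow> polyfun (\<lambda>t. \<Sum>i\<in>S. f i t)"
  by (induction S rule: infinite_finite_induct) (auto intro: polyfun_intros)

lemma polyfun_uminus: "polyfun f \<Longrightarrow> polyfun (\<lambda>t. - f t)"
  using polyfun_intros(4)[OF polyfun_intros(1)[of "- 1"], of f] by simp

lemma polyfun_diff: "polyfun f \<Longrightarrow> polyfun g \<Longrightarrow> polyfun (\<lambda>t. f t - g t)"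
  using polyfun_intros(3)[of f "\<lambda>t. - g t"] polyfun_uminus[of g] by simp

text \<open>The algebraic substitute for letting \<open>t\<close> tend to 0: a polynomial identity
  off the origin extends to it.\<close>

lemma polyfun_eq_0:
  assumes "polyfun f" "\<And>t. t \<noteq> 0 \<Longrightarrow> f t = 0"
  shows "f t = 0"
proof -
  obtain p where p: "\<And>t. f t = poly p t" using assms(1) unfolding polyfun_def by blast
  have "p = 0"
  proof (rule ccontr)
    assume "p \<noteq> 0"
    then have "finite {t. poly p t = 0}" by (rule poly_roots_finite)
    moreover have "UNIV - {0} \<subseteq> {t. poly p t = 0}" using assms(2) p by auto
    ultimately have "finite (UNIV - {0 :: complex})" by (rule finite_subset[rotated])
    then show False by (simp add: infinite_UNIV_char_0)
  qed
  then show ?thesis using p by simp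
qed

lemma polyfun_prod_eq_0:
  assumes f: "polyfun f" and g: "polyfun g" and eq: "\<And>t. f t * g t = 0"
  shows "(\<forall>t. f t = 0) \<or> (\<forall>t. g t = 0)"
proof -
  obtain p q where p: "\<And>t. f t = poly p t" and q: "\<And>t. g t = poly q t"
    using f g unfolding polyfun_def by blast
  have "\<forall>t. poly (p * q) t = 0" using eq p q by simp
  then have "p * q = 0" using poly_all_0_iff_0 by blast
  then show ?thesis using p q by auto
qed

lemma vanishes_to_order_polyfun: "vanishes_to_order i f \<longleftrightarrow> (\<exists>g. polyfun g \<and> (\<forall>t. f t = t ^ i * g t))"
proof
  assume "vanishes_to_order i f"
  then obtain p where "\<forall>t. f t = t ^ i * poly p t" unfolding vanishes_to_order_def by blast
  then show "\<exists>g. polyfun g \<and> (\<forall>t. f t = t ^ i * g t)" unfolding polyfun_def by (intro exI[of _ "poly p"]) auto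
qed (auto simp: vanishes_to_order_def polyfun_def)

lemma vanishes_to_orderI: "polyfun g \<Longrightarrow> (\<And>t. f t = t ^ i * g t) \<Longrightarrow> vanishes_to_order i f"
  unfolding vanishes_to_order_polyfun by blast

lemma vanishes_to_orderE:
  assumes "vanishes_to_order i f"
  obtains g where "polyfun g" "\<And>t. f t = t ^ i * g t"
  using assms unfolding vanishes_to_order_polyfun by blast

lemma vanishes_to_order_0: "vanishes_to_order i (\<lambda>_. 0)"
  by (rule vanishes_to_orderI[OF polyfun_intros(1)[of 0]]) simp

lemma vanishes_to_order_zero_iff: "vanishes_to_order 0 f \<longleftrightarrow> polyfun f"
  unfolding vanishes_to_order_def polyfun_def by simp

lemma vanishes_to_order_add:
  assumes "vanishes_to_order i f" "vanishes_to_order i g"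
  shows "vanishes_to_order i (\<lambda>t. f t + g t)"
proof -
  obtain p where p: "polyfun p" "\<And>t. f t = t ^ i * p t" using assms(1) by (rule vanishes_to_orderE) blast
  obtain q where q: "polyfun q" "\<And>t. g t = t ^ i * q t" using assms(2) by (rule vanishes_to_orderE) blast
  show ?thesis by (rule vanishes_to_orderI[OF polyfun_intros(3)[OF p(1) q(1)]]) (simp add: p q algebra_simps)
qed

lemma vanishes_to_order_mult:
  assumes "vanishes_to_order i f" "vanishes_to_order j g"
  shows "vanishes_to_order (i + j) (\<lambda>t. f t * g t)"
proof -
  obtain p where p: "polyfun p" "\<And>t. f t = t ^ i * p t" using assms(1) by (rule vanishes_to_orderE) blast
  obtain q where q: "polyfun q" "\<And>t. g t = t ^ j * q t" using assms(2) by (rule vanishes_to_orderE) blast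
  show ?thesis
    by (rule vanishes_to_orderI[OF polyfun_intros(4)[OF p(1) q(1)]]) (simp add: p q power_add algebra_simps)
qed

lemma vanishes_to_order_sum:
  "(\<And>k. k \<in> S \<Longrightarrow> vanishes_to_order i (f k)) \<Longrightarrow> vanishes_to_order i (\<lambda>t. \<Sum>k\<in>S. f k t)"
  by (induction S rule: infinite_finite_induct) (auto intro: vanishes_to_order_add vanishes_to_order_0)

lemma vanishes_to_order_mono:
  assumes "vanishes_to_order i f" "j \<le> i"
  shows "vanishes_to_order j f"
proof -
  obtain p where p: "polyfun p" "\<And>t. f t = t ^ i * p t" using assms(1) by (rule vanishes_to_orderE) blast
  show ?thesis
    by (rule vanishes_to_orderI[OF polyfun_intros(4)[OF polyfun_intros(5)[OF polyfun_intros(2), of "i - j"] p(1)]])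
      (use assms(2) in \<open>simp add: p(2) power_add[symmetric] mult.assoc[symmetric]\<close>)
qed

text \<open>Cancelling \<open>t\<close> says nothing at the origin itself; there the polynomial
  nature of \<open>f\<close> decides.\<close>

lemma vanishes_to_order_cancel:
  assumes "vanishes_to_order (i + 1) (\<lambda>t. t * f t)" "polyfun f"
  shows "vanishes_to_order i f"
proof -
  obtain p where p: "polyfun p" "\<And>t. t * f t = t ^ (i + 1) * p t"
    using assms(1) by (rule vanishes_to_orderE) blast
  have "f t - t ^ i * p t = 0" for t
    by (rule polyfun_eq_0[of "\<lambda>t. f t - t ^ i * p t"])
      (use p in \<open>auto intro!: polyfun_diff assms(2) polyfun_intros\<close>)
  then show ?thesis using p(1) by (intro vanishes_to_orderI[of p]) auto
qed

lemma hom_0_const: "hom X d h \<Longrightarrow> d = 0 \<Longrightarrow> \<exists>c. h = (\<lambda>_. c)"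
  by (induction rule: hom.induct) (auto simp: fun_eq_iff fun_apply)

section \<open>Polynomial arcs in linear coordinates\<close>

locale linear_coords = vector_space s for s :: "complex \<Rightarrow> 'w::ab_group_add \<Rightarrow> 'w" +
  fixes X :: "('w \<Rightarrow> complex) set"
  assumes finX: "finite X"
    and lin_add: "x \<in> X \<Longrightarrow> x (u + v) = x u + x v"
    and lin_scale: "x \<in> X \<Longrightarrow> x (s c v) = c * x v"
begin

lemma lin_zero: "x \<in> X \<Longrightarrow> x 0 = 0"
  using lin_scale[of x 0 0] by simp

lemma hom_homogeneous: "hom X d h \<Longrightarrow> h (s c v) = c ^ d * h v"
  by (induction rule: hom.induct) (auto simp: fun_apply lin_scale algebra_simps)

lemma hom_1_linear:
  assumes "hom X 1 h"
  shows "h (u + v) = h u + h v" "h (s c v) = c * h v" "h 0 = 0"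
proof -
  have "hom X d h \<Longrightarrow> d = 1 \<Longrightarrow> h (u + v) = h u + h v" for d h
  proof (induction rule: hom.induct)
    case (mult x d h)
    then obtain c where "h = (\<lambda>_. c)" using hom_0_const[OF mult(2)] by auto
    then show ?case using mult(1) by (simp add: fun_apply lin_add algebra_simps)
  qed (auto simp: fun_apply)
  then show "h (u + v) = h u + h v" using assms by blast
  show *: "h (s c v) = c * h v" for c v using hom_homogeneous[OF assms, of c v] by simp
  show "h 0 = 0" using *[of 0 0] by simp
qed

lemma hom_1_sum: "hom X 1 h \<Longrightarrow> h (\<Sum>i\<in>S. f i) = (\<Sum>i\<in>S. h (f i))"
  by (induction S rule: infinite_finite_induct) (auto simp: hom_1_linear)

lemma tail_pos_0: "f \<in> tail X i \<Longrightarrow> i > 0 \<Longrightarrow> f 0 = 0"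
proof (induction rule: tail.induct)
  case (hom d h)
  then have zd: "(0::complex) ^ d = 0" by simp
  show ?case using hom_homogeneous[OF hom(1), of 0 0] unfolding zd by simp
qed (simp add: fun_apply)

definition path :: "(complex \<Rightarrow> 'w) \<Rightarrow> bool" where
  "path \<eta> \<longleftrightarrow> (\<forall>x\<in>X. polyfun (\<lambda>t. x (\<eta> t)))"

lemma path_intros:
  "path (\<lambda>_. v)" "path \<eta> \<Longrightarrow> path \<zeta> \<Longrightarrow> path (\<lambda>t. \<eta> t + \<zeta> t)" "polyfun f \<Longrightarrow> path \<eta> \<Longrightarrow> path (\<lambda>t. s (f t) (\<eta> t))"
  by (auto simp: path_def lin_add lin_scale intro: polyfun_intros)

lemma alg_path: "f \<in> alg X \<Longrightarrow> path \<eta> \<Longrightarrow> polyfun (\<lambda>t. f (\<eta> t))"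
  by (induction rule: alg.induct) (auto simp: fun_apply path_def intro: polyfun_intros)

lemma tail_path:
  assumes "f \<in> tail X i" "path \<eta>"
  shows "vanishes_to_order i (\<lambda>t. f (s t (\<eta> t)))"
  using assms(1)
proof (induction rule: tail.induct)
  case (hom d h)
  have "vanishes_to_order d (\<lambda>t. h (s t (\<eta> t)))"
    by (rule vanishes_to_orderI[OF alg_path[OF hom_alg[OF hom(1)] assms(2)]]) (rule hom_homogeneous[OF hom(1)])
  then show ?case using hom(2) by (rule vanishes_to_order_mono)
next
  case (add f g) then show ?case by (simp add: fun_apply vanishes_to_order_add)
qed

text \<open>Moving \<open>\<eta> t\<close> by a multiple of \<open>t ^ J\<close> changes the
  argument of \<open>h\<close> in order \<open>J + 1\<close> and leaves \<open>d - 1\<close> factors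
  of order 1, so \<open>h\<close> changes in order \<open>J + d\<close>. The factor \<open>t\<close>
  avoids the subtraction \<open>d - 1\<close>.\<close>

lemma hom_perturb:
  assumes "hom X d h" "path \<eta>"
  shows "vanishes_to_order (Suc J + d) (\<lambda>t. t * (h (s t (\<eta> t + s (t ^ J) u)) - h (s t (\<eta> t))))"
  using assms(1)
proof (induction rule: hom.induct)
  case (mult x d h)
  let ?p = "\<lambda>t. s t (\<eta> t + s (t ^ J) u)" and ?q = "\<lambda>t. s t (\<eta> t)"
  have pp: "path (\<lambda>t. \<eta> t + s (t ^ J) u)" by (intro path_intros polyfun_intros assms)
  have "vanishes_to_order (Suc (Suc J)) (\<lambda>t. t * (x (?p t) - x (?q t)))"
    by (rule vanishes_to_orderI[OF polyfun_intros(1)[of "x u"]])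
      (simp add: lin_add[OF mult(1)] lin_scale[OF mult(1)] algebra_simps)
  from vanishes_to_order_mult[OF this tail_path[OF tail.hom[OF mult(2) order_refl] pp]]
  have 1: "vanishes_to_order (Suc J + Suc d) (\<lambda>t. t * (x (?p t) - x (?q t)) * h (?p t))" by simp
  have "vanishes_to_order 1 (\<lambda>t. x (?q t))" by (rule tail_path[OF tail.hom[OF hom_gen[OF mult(1)] order_refl] assms(2)])
  from vanishes_to_order_mult[OF this mult.IH]
  have 2: "vanishes_to_order (Suc J + Suc d) (\<lambda>t. x (?q t) * (t * (h (?p t) - h (?q t))))" by simp
  show ?case using vanishes_to_order_add[OF 1 2] by (simp add: fun_apply algebra_simps)
next
  case (add d f g)
  show ?case using vanishes_to_order_add[OF add.IH] by (simp add: fun_apply algebra_simps)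
qed (auto simp: fun_apply intro: vanishes_to_order_0)

lemma tail_perturb:
  assumes "f \<in> tail X i" "path \<eta>"
  shows "vanishes_to_order (Suc J + i) (\<lambda>t. t * (f (s t (\<eta> t + s (t ^ J) u)) - f (s t (\<eta> t))))"
  using assms(1)
proof (induction rule: tail.induct)
  case (hom d h)
  show ?case by (rule vanishes_to_order_mono[OF hom_perturb[OF hom(1) assms(2)]]) (use hom(2) in simp)
next
  case (add f g)
  show ?case using vanishes_to_order_add[OF add.IH] by (simp add: fun_apply algebra_simps)
qed

end

text \<open>Independence of the differentials \<open>l i\<close> is witnessed by the dual vectors \<open>u i\<close>. The set
  \<open>germ_ideal j\<close> consists of the functions vanishing on the formal germ at the origin cut out by
  \<open>f 0, \<dots>, f (j - 1)\<close>.\<close>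

locale regular_sequence = linear_coords s X
  for s :: "complex \<Rightarrow> 'b::ab_group_add \<Rightarrow> 'b" and X +
  fixes c :: nat and f l :: "nat \<Rightarrow> 'b \<Rightarrow> complex" and u :: "nat \<Rightarrow> 'b"
  assumes l: "i < c \<Longrightarrow> hom X 1 (l i)" and fl: "i < c \<Longrightarrow> f i - l i \<in> tail X 2"
    and dual: "i < c \<Longrightarrow> k < c \<Longrightarrow> l i (u k) = (if i = k then 1 else 0)"
begin

definition gen_ideal :: "nat \<Rightarrow> ('b \<Rightarrow> complex) set" where
  "gen_ideal j = {(\<Sum>i<j. a i * f i) | a. \<forall>i. a i \<in> alg X}"

definition ideal_plus_tail :: "nat \<Rightarrow> nat \<Rightarrow> ('b \<Rightarrow> complex) set" where
  "ideal_plus_tail j p = {g \<in> alg X. \<exists>h\<in>gen_ideal j. g - h \<in> tail X p}"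

definition germ_ideal :: "nat \<Rightarrow> ('b \<Rightarrow> complex) set" where
  "germ_ideal j = {g \<in> alg X. \<forall>p. \<exists>h\<in>gen_ideal j. g - h \<in> tail X p}"

definition tangent :: "nat \<Rightarrow> 'b set" where
  "tangent j = {v. \<forall>i<j. l i v = 0}"

lemma f_tail: "i < c \<Longrightarrow> f i \<in> tail X 1"
proof -
  assume i: "i < c"
  have "f i - l i + l i \<in> tail X 1"
    by (rule tail.add[OF tail_mono[OF fl[OF i]] tail.hom[OF l[OF i] order_refl]]) simp
  then show ?thesis by simp
qed

lemma f_alg: "i < c \<Longrightarrow> f i \<in> alg X"
  using f_tail tail_alg by blast

lemma gen_idealI: "(\<And>i. a i \<in> alg X) \<Longrightarrow> (\<Sum>i<j. a i * f i) \<in> gen_ideal j"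
  unfolding gen_ideal_def by blast

lemma gen_idealE:
  assumes "h \<in> gen_ideal j"
  shows "\<exists>a. (\<forall>i. a i \<in> alg X) \<and> h = (\<Sum>i<j. a i * f i)"
  using assms unfolding gen_ideal_def by blast

lemma ideal_gen_ideal:
  assumes "j \<le> c"
  shows "ideal_of (alg X) (gen_ideal j)"
  unfolding ideal_of_def
proof (intro conjI ballI subsetI)
  fix h assume "h \<in> gen_ideal j"
  then obtain a where a: "\<And>i. a i \<in> alg X" "h = (\<Sum>i<j. a i * f i)" using gen_idealE by blast
  show "h \<in> alg X" unfolding a(2) by (rule subring_of_sum[OF subring_alg]) (use a(1) f_alg assms in \<open>auto intro: alg.mult\<close>)
next
  show "0 \<in> gen_ideal j" using gen_idealI[of "\<lambda>_. 0" j, OF alg_zero] by (simp only: mult_zero_left sum.neutral_const)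
next
  fix h k assume "h \<in> gen_ideal j" "k \<in> gen_ideal j"
  then obtain a b where a: "\<And>i. a i \<in> alg X" "h = (\<Sum>i<j. a i * f i)"
    and b: "\<And>i. b i \<in> alg X" "k = (\<Sum>i<j. b i * f i)" using gen_idealE by meson
  have "h + k = (\<Sum>i<j. (a i + b i) * f i)" unfolding a b by (simp only: distrib_right sum.distrib)
  then show "h + k \<in> gen_ideal j" using gen_idealI[of "\<lambda>i. a i + b i"] alg.add[OF a(1) b(1)] by simp
next
  fix b h assume b: "b \<in> alg X" and "h \<in> gen_ideal j"
  then obtain a where a: "\<And>i. a i \<in> alg X" "h = (\<Sum>i<j. a i * f i)" using gen_idealE by meson
  have "b * h = (\<Sum>i<j. (b * a i) * f i)" unfolding a by (simp only: sum_distrib_left mult.assoc)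
  then show "b * h \<in> gen_ideal j" using gen_idealI[of "\<lambda>i. b * a i"] alg.mult[OF b a(1)] by simp
qed

lemma f_gen_ideal:
  assumes "i < j"
  shows "f i \<in> gen_ideal j"
proof -
  have "(\<Sum>k<j. (if k = i then 1 else 0) * f k) = (\<Sum>k\<in>{i}. (if k = i then 1 else 0) * f k)"
    by (rule sum.mono_neutral_right) (use assms in auto)
  then have "(\<Sum>k<j. (if k = i then 1 else 0) * f k) = f i" by simp
  moreover have "(\<Sum>k<j. (if k = i then 1 else 0) * f k) \<in> gen_ideal j"
    by (rule gen_idealI) (auto intro: alg_closed)
  ultimately show ?thesis by simp
qed

lemma ideal_plus_tailI: "g \<in> alg X \<Longrightarrow> h \<in> gen_ideal j \<Longrightarrow> g - h \<in> tail X p \<Longrightarrow> g \<in> ideal_plus_tail j p"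
  unfolding ideal_plus_tail_def by blast

lemma ideal_plus_tailE:
  assumes "g \<in> ideal_plus_tail j p"
  obtains h where "g \<in> alg X" "h \<in> gen_ideal j" "g - h \<in> tail X p"
  using assms unfolding ideal_plus_tail_def by blast

lemma tail_ideal_plus_tail: "j \<le> c \<Longrightarrow> g \<in> tail X p \<Longrightarrow> g \<in> ideal_plus_tail j p"
  by (rule ideal_plus_tailI[OF tail_alg ideal_of_closed(1)[OF ideal_gen_ideal]]) simp_all

lemma ideal_plus_tail_add:
  assumes j: "j \<le> c" and "g \<in> ideal_plus_tail j p" "h \<in> ideal_plus_tail j p"
  shows "g + h \<in> ideal_plus_tail j p"
proof -
  obtain a where a: "g \<in> alg X" "a \<in> gen_ideal j" "g - a \<in> tail X p" using assms(2) by (rule ideal_plus_tailE)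
  obtain b where b: "h \<in> alg X" "b \<in> gen_ideal j" "h - b \<in> tail X p" using assms(3) by (rule ideal_plus_tailE)
  have "g + h - (a + b) = (g - a) + (h - b)" by simp
  then show ?thesis
    using ideal_plus_tailI[OF alg.add[OF a(1) b(1)] ideal_of_closed(2)[OF ideal_gen_ideal[OF j] a(2) b(2)]]
      tail.add[OF a(3) b(3)] by metis
qed

lemma ideal_plus_tail_mult:
  assumes j: "j \<le> c" and "g \<in> ideal_plus_tail j p" "h \<in> tail X q"
  shows "h * g \<in> ideal_plus_tail j (q + p)"
proof -
  obtain a where a: "g \<in> alg X" "a \<in> gen_ideal j" "g - a \<in> tail X p" using assms(2) by (rule ideal_plus_tailE)
  have h: "h \<in> alg X" by (rule tail_alg[OF assms(3)])
  have "h * g - h * a = h * (g - a)" by (simp only: right_diff_distrib)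
  then show ?thesis
    using ideal_plus_tailI[OF alg.mult[OF h a(1)] ideal_of_closed(3)[OF ideal_gen_ideal[OF j] h a(2)]]
      tail_mult[OF assms(3) a(3)] by metis
qed

lemma germ_ideal_iff: "g \<in> germ_ideal j \<longleftrightarrow> (\<forall>p. g \<in> ideal_plus_tail j p)"
  unfolding germ_ideal_def ideal_plus_tail_def by blast

lemma ideal_germ_ideal:
  assumes j: "j \<le> c"
  shows "ideal_of (alg X) (germ_ideal j)"
  unfolding ideal_of_def
proof (intro conjI ballI subsetI)
  show "0 \<in> germ_ideal j" unfolding germ_ideal_iff using tail_ideal_plus_tail[OF j tail_zero] by blast
next
  fix a h assume a: "a \<in> alg X" and h: "h \<in> germ_ideal j"
  have "a * h \<in> ideal_plus_tail j (0 + p)" for p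
    by (rule ideal_plus_tail_mult[OF j _ alg_tail_0[OF a]]) (use h germ_ideal_iff in blast)
  then show "a * h \<in> germ_ideal j" unfolding germ_ideal_iff by simp
qed (auto simp: germ_ideal_iff intro: ideal_plus_tail_add[OF j] elim: ideal_plus_tailE)

lemma f_germ_ideal: "i < j \<Longrightarrow> i < c \<Longrightarrow> f i \<in> germ_ideal j"
  unfolding germ_ideal_def using f_alg f_gen_ideal tail_zero
  by (intro CollectI conjI allI) (auto intro!: bexI[of _ "f i"])

lemma germ_ideal_at_0:
  assumes j: "j \<le> c" and g: "g \<in> germ_ideal j"
  shows "g 0 = 0"
proof -
  obtain h where h: "h \<in> gen_ideal j" "g - h \<in> tail X 1" using g unfolding germ_ideal_def by blast
  obtain a where a: "\<And>i. a i \<in> alg X" "h = (\<Sum>i<j. a i * f i)" using gen_idealE[OF h(1)] by blast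
  have "f i 0 = 0" if "i < j" for i using tail_pos_0[OF f_tail] that j by auto
  then have "h 0 = 0" unfolding a(2) by (simp add: sum_fun_apply fun_apply)
  then show ?thesis using tail_pos_0[OF h(2)] by (simp add: minus_apply)
qed

lemma germ_ideal_mono:
  assumes "j \<le> k" "k \<le> c"
  shows "germ_ideal j \<subseteq> germ_ideal k"
proof -
  have "gen_ideal j \<subseteq> gen_ideal k"
  proof
    fix h assume "h \<in> gen_ideal j"
    then obtain a where a: "\<And>i. a i \<in> alg X" "h = (\<Sum>i<j. a i * f i)" using gen_idealE by blast
    have "f i \<in> gen_ideal k" if "i < j" for i using f_gen_ideal that assms by simp
    then show "h \<in> gen_ideal k" unfolding a(2)
      by (intro ideal_of_sum[OF ideal_gen_ideal[OF assms(2)]] ideal_of_closed(3)[OF ideal_gen_ideal[OF assms(2)]])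
        (use a(1) in auto)
  qed
  then show ?thesis unfolding germ_ideal_def by blast
qed

text \<open>Newton iteration: every tangent direction is realised, to any finite order, by a polynomial arc
  on the germ.\<close>

lemma arc_exists:
  assumes j: "j \<le> c" and \<xi>: "\<xi> \<in> tangent j"
  shows "\<exists>\<eta>. path \<eta> \<and> \<eta> 0 = \<xi> \<and> (\<forall>i<j. vanishes_to_order (J + 2) (\<lambda>t. f i (s t (\<eta> t))))"
proof (induction J)
  case 0
  have "vanishes_to_order 2 (\<lambda>t. f i (s t \<xi>))" if "i < j" for i
  proof -
    have i: "i < c" using that j by simp
    have "vanishes_to_order 2 (\<lambda>t. (f i - l i) (s t \<xi>))" by (rule tail_path[OF fl[OF i] path_intros(1)])
    moreover have "l i (s t \<xi>) = 0" for t
      using hom_1_linear(2)[OF l[OF i]] \<xi> that unfolding tangent_def by simp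
    ultimately show ?thesis by (simp add: minus_apply)
  qed
  then show ?case by (intro exI[of _ "\<lambda>_. \<xi>"]) (use \<open>\<And>i. i < j \<Longrightarrow> vanishes_to_order 2 (\<lambda>t. f i (s t \<xi>))\<close> in \<open>simp add: path_intros numeral_2_eq_2\<close>)
next
  case (Suc J)
  then obtain \<eta> where \<eta>: "path \<eta>" "\<eta> 0 = \<xi>" "\<And>i. i < j \<Longrightarrow> vanishes_to_order (J + 2) (\<lambda>t. f i (s t (\<eta> t)))"
    by blast
  then have "\<exists>p. \<forall>i<j. polyfun (p i) \<and> (\<forall>t. f i (s t (\<eta> t)) = t ^ (J + 2) * p i t)"
    unfolding vanishes_to_order_polyfun by metis
  then obtain p where p: "\<And>i. i < j \<Longrightarrow> polyfun (p i)"
    "\<And>i t. i < j \<Longrightarrow> f i (s t (\<eta> t)) = t ^ (J + 2) * p i t" by blast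
  \<comment> \<open>The correction is chosen through the dual vectors so that the linear part of
    each \<open>f i\<close> cancels the coefficient of \<open>t ^ (J + 2)\<close>.\<close>
  define w where "w = (\<Sum>k<j. s (- p k 0) (u k))"
  have lw: "l i w = - p i 0" if "i < j" for i
  proof -
    have i: "i < c" using that j by simp
    have "l i w = (\<Sum>k<j. - p k 0 * l i (u k))"
      unfolding w_def hom_1_sum[OF l[OF i]] hom_1_linear(2)[OF l[OF i]] ..
    also have "\<dots> = (\<Sum>k\<in>{i}. - p k 0 * l i (u k))"
      by (rule sum.mono_neutral_right) (use that j dual[OF i] in auto)
    finally show ?thesis using dual[OF i i] by simp
  qed
  define \<zeta> where "\<zeta> t = \<eta> t + s (t ^ Suc J) w" for t
  have path: "path \<zeta>" unfolding \<zeta>_def by (intro path_intros polyfun_intros \<eta>(1))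
  have "vanishes_to_order (Suc J + 2) (\<lambda>t. f i (s t (\<zeta> t)))" if ij: "i < j" for i
  proof -
    have i: "i < c" using ij j by simp
    let ?g = "f i - l i"
    \<comment> \<open>Terms of degree at least 2 feel the correction one order later than linear
      ones.\<close>
    have "vanishes_to_order (Suc (Suc J) + 2) (\<lambda>t. t * (?g (s t (\<zeta> t)) - ?g (s t (\<eta> t))))"
      unfolding \<zeta>_def by (rule tail_perturb[OF fl[OF i] \<eta>(1)])
    then have "vanishes_to_order (Suc J + 2 + 1) (\<lambda>t. t * (?g (s t (\<zeta> t)) - ?g (s t (\<eta> t))))" by simp
    moreover have "?g \<in> alg X" by (rule tail_alg[OF fl[OF i]])
    then have "polyfun (\<lambda>t. ?g (s t (\<zeta> t)) - ?g (s t (\<eta> t)))"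
      by (intro polyfun_diff alg_path path_intros polyfun_intros path \<eta>(1))
    ultimately have 1: "vanishes_to_order (Suc J + 2) (\<lambda>t. ?g (s t (\<zeta> t)) - ?g (s t (\<eta> t)))"
      by (rule vanishes_to_order_cancel)
    have "polyfun (\<lambda>t. p i t - p i 0)" by (intro polyfun_diff polyfun_intros p(1) ij)
    then have "vanishes_to_order 1 (\<lambda>t. p i t - p i 0)"
    proof -
      obtain q where q: "\<And>t. p i t = poly q t" using p(1)[OF ij] unfolding polyfun_def by blast
      have "poly (q - [:poly q 0:]) 0 = 0" by simp
      then have "[:- 0, 1:] dvd q - [:poly q 0:]" using poly_eq_0_iff_dvd by blast
      then obtain r where r: "q - [:poly q 0:] = [:- 0, 1:] * r" by (rule dvdE)
      have "poly q t - poly q 0 = t * poly r t" for t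
        using arg_cong[OF r, of "\<lambda>q. poly q t"] by simp
      then show ?thesis unfolding vanishes_to_order_def q by auto
    qed
    moreover have "vanishes_to_order (J + 2) (\<lambda>t. t ^ (J + 2))"
      by (rule vanishes_to_orderI[OF polyfun_intros(1)[of 1]]) simp
    ultimately have 2: "vanishes_to_order (Suc J + 2) (\<lambda>t. t ^ (J + 2) * (p i t - p i 0))"
      using vanishes_to_order_mult[of "J + 2" _ 1] by simp
    have "f i (s t (\<zeta> t)) = (?g (s t (\<zeta> t)) - ?g (s t (\<eta> t))) + t ^ (J + 2) * (p i t - p i 0)" for t
      using p(2)[OF ij, of t]
      by (simp add: minus_apply \<zeta>_def hom_1_linear[OF l[OF i]] scale_right_distrib lw[OF ij] algebra_simps)
    then show ?thesis using vanishes_to_order_add[OF 1 2] by simp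
  qed
  moreover have "\<zeta> 0 = \<xi>" using \<eta>(2) by (simp add: \<zeta>_def)
  ultimately show ?case using path by blast
qed

text \<open>Along an arc in direction \<open>\<xi>\<close> on which the equations vanish to order
  \<open>p + 2\<close>, \<open>e\<close> vanishes to order \<open>p + 1\<close>, while homogeneity
  makes \<open>e \<xi>\<close> the coefficient of \<open>t ^ p\<close>.\<close>

lemma initial_form_vanishes:
  assumes j: "j \<le> c" and e: "hom X p e" "e \<in> ideal_plus_tail j (Suc p)" and \<xi>: "\<xi> \<in> tangent j"
  shows "e \<xi> = 0"
proof -
  obtain h where h: "h \<in> gen_ideal j" "e - h \<in> tail X (Suc p)" using e(2) by (rule ideal_plus_tailE)
  obtain a where a: "\<And>i. a i \<in> alg X" "h = (\<Sum>i<j. a i * f i)" using gen_idealE[OF h(1)] by blast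
  obtain \<eta> where \<eta>: "path \<eta>" "\<eta> 0 = \<xi>" "\<And>i. i < j \<Longrightarrow> vanishes_to_order (p + 2) (\<lambda>t. f i (s t (\<eta> t)))"
    using arc_exists[OF j \<xi>] by blast
  have "vanishes_to_order (Suc p) (\<lambda>t. \<Sum>i<j. a i (s t (\<eta> t)) * f i (s t (\<eta> t)))"
  proof (rule vanishes_to_order_sum)
    fix i assume "i \<in> {..<j}"
    then have f: "vanishes_to_order (p + 2) (\<lambda>t. f i (s t (\<eta> t)))" using \<eta>(3) by simp
    have "vanishes_to_order 0 (\<lambda>t. a i (s t (\<eta> t)))"
      unfolding vanishes_to_order_zero_iff by (intro alg_path a(1) path_intros polyfun_intros \<eta>(1))
    from vanishes_to_order_mult[OF this f]
    show "vanishes_to_order (Suc p) (\<lambda>t. a i (s t (\<eta> t)) * f i (s t (\<eta> t)))"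
      by (rule vanishes_to_order_mono) simp
  qed
  then have "vanishes_to_order (Suc p) (\<lambda>t. h (s t (\<eta> t)))" unfolding a(2) by (simp add: sum_fun_apply fun_apply)
  from vanishes_to_order_add[OF this tail_path[OF h(2) \<eta>(1)]]
  have "vanishes_to_order (Suc p) (\<lambda>t. e (s t (\<eta> t)))" by (simp add: minus_apply)
  then obtain q where q: "polyfun q" "\<And>t. e (s t (\<eta> t)) = t ^ Suc p * q t"
    by (rule vanishes_to_orderE) blast
  have "e (\<eta> t) - t * q t = 0" for t
  proof (rule polyfun_eq_0[of "\<lambda>t. e (\<eta> t) - t * q t"])
    show "polyfun (\<lambda>t. e (\<eta> t) - t * q t)"
      by (intro polyfun_diff polyfun_intros q(1) alg_path[OF hom_alg[OF e(1)] \<eta>(1)])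
    fix t :: complex assume "t \<noteq> 0"
    then show "e (\<eta> t) - t * q t = 0" using q(2)[of t] hom_homogeneous[OF e(1), of t "\<eta> t"] by simp
  qed
  from this[of 0] show ?thesis using \<eta>(2) by simp
qed

text \<open>The projection onto \<open>tangent j\<close> along the dual vectors.\<close>

definition proj :: "nat \<Rightarrow> 'b \<Rightarrow> 'b" where
  "proj j v = v - (\<Sum>i<j. s (l i v) (u i))"

lemma proj_tangent:
  assumes j: "j \<le> c"
  shows "proj j v \<in> tangent j"
  unfolding tangent_def
proof (intro CollectI allI impI)
  fix i assume ij: "i < j"
  then have i: "i < c" using j by simp
  have "l i (proj j v + (\<Sum>k<j. s (l k v) (u k))) = l i v" by (simp add: proj_def)
  moreover have "l i (\<Sum>k<j. s (l k v) (u k)) = (\<Sum>k<j. l k v * l i (u k))"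
    unfolding hom_1_sum[OF l[OF i]] by (simp add: hom_1_linear(2)[OF l[OF i]])
  moreover have "(\<Sum>k<j. l k v * l i (u k)) = (\<Sum>k\<in>{i}. l k v * l i (u k))"
    by (rule sum.mono_neutral_right) (use ij j dual[OF i] in auto)
  ultimately show "l i (proj j v) = 0" using dual[OF i i] by (simp add: hom_1_linear(1)[OF l[OF i]])
qed

text \<open>Projecting changes a coordinate by a combination of the \<open>l i\<close>, and
  \<open>l i\<close> equals \<open>f i\<close> up to order 2; so modulo the equations, each change
  of a factor raises the order by one.\<close>

lemma tangent_vanishing_form:
  assumes j: "j \<le> c" and e: "hom X p e"
  shows "hom X p (\<lambda>v. e (proj j v)) \<and> e - (\<lambda>v. e (proj j v)) \<in> ideal_plus_tail j (Suc p)"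
  using e
proof (induction rule: hom.induct)
  case (zero d)
  have "(\<lambda>v. (0 :: 'b \<Rightarrow> complex) (proj j v)) = 0" by (auto simp: fun_eq_iff fun_apply)
  then show ?case using hom.zero tail_ideal_plus_tail[OF j tail_zero] by simp
next
  case (const d)
  show ?case using hom.const tail_ideal_plus_tail[OF j tail_zero] by simp
next
  case (mult x d h)
  let ?x = "\<lambda>v. x (proj j v)" and ?h = "\<lambda>v. h (proj j v)"
  have x: "hom X 1 x" by (rule hom_gen[OF mult(1)])
  have lj: "hom X 1 (fun_scale (x (u i)) (l i))" if "i \<in> {..<j}" for i
    by (rule hom_scale[OF l]) (use that j in auto)
  have x': "?x = x - (\<Sum>i<j. fun_scale (x (u i)) (l i))"
  proof
    fix v
    have "x (proj j v + (\<Sum>i<j. s (l i v) (u i))) = x v" by (simp add: proj_def)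
    then have "x (proj j v) = x v - x (\<Sum>i<j. s (l i v) (u i))"
      unfolding hom_1_linear(1)[OF x] by (simp add: eq_diff_eq)
    then show "?x v = (x - (\<Sum>i<j. fun_scale (x (u i)) (l i))) v"
      by (simp add: hom_1_sum[OF x] hom_1_linear(2)[OF x] minus_apply sum_fun_apply fun_apply mult.commute)
  qed
  have hx: "hom X 1 ?x" unfolding x' by (intro hom_diff x hom_sum lj)
  have hom: "hom X (Suc d) (?x * ?h)" using hom_mult[OF hx conjunct1[OF mult.IH]] by simp
  have li: "fun_scale (x (u i)) (l i) \<in> ideal_plus_tail j 2" if "i \<in> {..<j}" for i
  proof -
    have i: "i < c" "i < j" using that j by auto
    have "fun_scale (x (u i)) (l i) - fun_scale (x (u i)) (f i) = fun_scale (- x (u i)) (f i - l i)"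
      by (auto simp: fun_eq_iff fun_apply minus_apply algebra_simps)
    moreover have "fun_scale (- x (u i)) (f i - l i) \<in> tail X 2" by (rule ideal_scale[OF ideal_tail fl[OF i(1)]])
    ultimately show ?thesis
      using ideal_plus_tailI[OF hom_alg[OF lj[OF that]] ideal_scale[OF ideal_gen_ideal[OF j] f_gen_ideal[OF i(2)]]]
      by metis
  qed
  have "(\<Sum>i\<in>T. fun_scale (x (u i)) (l i)) \<in> ideal_plus_tail j 2" if "finite T" "T \<subseteq> {..<j}" for T
    using that
  proof (induction T)
    case empty show ?case unfolding sum.empty by (rule tail_ideal_plus_tail[OF j tail_zero])
  next
    case (insert i T)
    show ?case unfolding sum.insert[OF insert(1,2)]
      by (rule ideal_plus_tail_add[OF j li]) (use insert in auto)
  qed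
  then have xx: "x - ?x \<in> ideal_plus_tail j 2" unfolding x' by simp
  have 1: "h * (x - ?x) \<in> ideal_plus_tail j (Suc (Suc d))"
    using ideal_plus_tail_mult[OF j xx tail.hom[OF mult(2) order_refl]] by simp
  have 2: "?x * (h - ?h) \<in> ideal_plus_tail j (Suc (Suc d))"
    using ideal_plus_tail_mult[OF j conjunct2[OF mult.IH] tail.hom[OF hx order_refl]] by simp
  have "x * h - (\<lambda>v. (x * h) (proj j v)) = h * (x - ?x) + ?x * (h - ?h)"
    by (auto simp: fun_eq_iff fun_apply minus_apply algebra_simps)
  moreover have "(\<lambda>v. (x * h) (proj j v)) = ?x * ?h" by (auto simp: fun_eq_iff fun_apply)
  ultimately show ?case using hom ideal_plus_tail_add[OF j 1 2] by (simp only: simp_thms)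
next
  case (add d g h)
  have "(\<lambda>v. (g + h) (proj j v)) = (\<lambda>v. g (proj j v)) + (\<lambda>v. h (proj j v))"
    by (auto simp: fun_eq_iff fun_apply)
  moreover have "g + h - ((\<lambda>v. g (proj j v)) + (\<lambda>v. h (proj j v)))
    = (g - (\<lambda>v. g (proj j v))) + (h - (\<lambda>v. h (proj j v)))" by simp
  ultimately show ?case using add.IH hom.add ideal_plus_tail_add[OF j] by (simp only: simp_thms) blast
qed

lemma tangent_segment:
  assumes "j \<le> c" "v \<in> tangent j" "w \<in> tangent j"
  shows "v + s t (w - v) \<in> tangent j"
  unfolding tangent_def
proof (intro CollectI allI impI)
  fix i assume ij: "i < j"
  then have i: "i < c" using assms by simp
  have v: "l i v = 0" "l i w = 0" using assms ij unfolding tangent_def by auto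
  have "l i (w - v) + l i v = l i w" using hom_1_linear(1)[OF l[OF i], of "w - v" v] by simp
  then show "l i (v + s t (w - v)) = 0" using v by (simp add: hom_1_linear[OF l[OF i]])
qed

text \<open>Take the largest \<open>p\<close> with \<open>g \<in> ideal_plus_tail j p\<close>. If
  the leading form vanished on the tangent space, it could be absorbed into the equations and
  \<open>p\<close> increased.\<close>

lemma leading_form:
  assumes j: "j \<le> c" and g: "g \<in> alg X" "g \<notin> germ_ideal j"
  obtains p e \<xi> where "hom X p e" "g - e \<in> ideal_plus_tail j (Suc p)" "\<xi> \<in> tangent j" "e \<xi> \<noteq> 0"
proof -
  define N where "N = (LEAST p. g \<notin> ideal_plus_tail j p)"
  have ex: "\<exists>p. g \<notin> ideal_plus_tail j p" using g(2) germ_ideal_iff by blast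
  have N: "g \<notin> ideal_plus_tail j N" unfolding N_def by (rule LeastI_ex[OF ex])
  have less: "g \<in> ideal_plus_tail j p" if "p < N" for p using not_less_Least that unfolding N_def by blast
  have "g \<in> ideal_plus_tail j 0" by (rule tail_ideal_plus_tail[OF j alg_tail_0[OF g(1)]])
  then have "N \<noteq> 0" using N by metis
  then obtain p where Np: "N = Suc p" using not0_implies_Suc by blast
  obtain h where h: "h \<in> gen_ideal j" "g - h \<in> tail X p" using less[of p] Np by (auto elim: ideal_plus_tailE)
  obtain e where e: "hom X p e" "g - h - e \<in> tail X (Suc p)" using tail_split[OF h(2)] by blast
  have "g - e - h = g - h - e" by simp
  then have "g - e - h \<in> tail X (Suc p)" using e(2) by (simp only:)
  then have ge: "g - e \<in> ideal_plus_tail j (Suc p)"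
    by (rule ideal_plus_tailI[OF alg_closed(4)[OF g(1) hom_alg[OF e(1)]] h(1)])
  have "\<exists>\<xi>\<in>tangent j. e \<xi> \<noteq> 0"
  proof (rule ccontr)
    assume "\<not> ?thesis"
    then have "(\<lambda>v. e (proj j v)) = 0" using proj_tangent[OF j] by (auto simp: fun_eq_iff fun_apply)
    then have "e \<in> ideal_plus_tail j (Suc p)"
      using conjunct2[OF tangent_vanishing_form[OF j e(1)]] by (simp only: diff_zero)
    from ideal_plus_tail_add[OF j ge this] have "g \<in> ideal_plus_tail j (Suc p)" by (simp only: diff_add_cancel)
    then show False using N Np by simp
  qed
  then show ?thesis using that e(1) ge by blast
qed

text \<open>The germ is smooth, so leading forms on its tangent space multiply without cancelling:
  on a segment joining points where the two forms do not vanish, they restrict to nonzero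
  polynomials in one variable.\<close>

lemma prime_germ_ideal:
  assumes j: "j \<le> c"
  shows "prime_of (alg X) (germ_ideal j)"
  unfolding prime_of_def
proof (intro conjI ballI impI)
  show "ideal_of (alg X) (germ_ideal j)" by (rule ideal_germ_ideal[OF j])
  show "1 \<notin> germ_ideal j" using germ_ideal_at_0[OF j, of 1] by (auto simp: fun_apply)
  fix a b assume a: "a \<in> alg X" and b: "b \<in> alg X" and ab: "a * b \<in> germ_ideal j"
  show "a \<in> germ_ideal j \<or> b \<in> germ_ideal j"
  proof (rule ccontr)
    assume no: "\<not> ?thesis"
    obtain p d \<xi> where d: "hom X p d" "a - d \<in> ideal_plus_tail j (Suc p)" "\<xi> \<in> tangent j" "d \<xi> \<noteq> 0"
      using leading_form[OF j a] no by blast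
    obtain q e \<zeta> where e: "hom X q e" "b - e \<in> ideal_plus_tail j (Suc q)" "\<zeta> \<in> tangent j" "e \<zeta> \<noteq> 0"
      using leading_form[OF j b] no by blast
    have de: "hom X (p + q) (d * e)" by (rule hom_mult[OF d(1) e(1)])
    obtain h where h: "h \<in> gen_ideal j" "a - d - h \<in> tail X (Suc p)" using d(2) by (rule ideal_plus_tailE)
    obtain k where k: "k \<in> gen_ideal j" "b - e - k \<in> tail X (Suc q)" using e(2) by (rule ideal_plus_tailE)
    note I = ideal_gen_ideal[OF j]
    define dh where "dh = a - d - h"
    define ek where "ek = b - e - k"
    have ekq: "ek \<in> tail X q" using tail_mono[OF k(2)] unfolding ek_def by simp
    have rest: "d * ek + dh * e + dh * ek \<in> tail X (Suc (p + q))"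
    proof (intro tail.add)
      show "d * ek \<in> tail X (Suc (p + q))"
        using tail_mult[OF tail.hom[OF d(1) order_refl] k(2)] unfolding ek_def by simp
      show "dh * e \<in> tail X (Suc (p + q))"
        using tail_mult[OF h(2) tail.hom[OF e(1) order_refl]] unfolding dh_def by simp
      show "dh * ek \<in> tail X (Suc (p + q))"
        using tail_mult[OF h(2) ekq] unfolding dh_def by simp
    qed
    \<comment> \<open>The part of \<open>a * b\<close> that lies in the ideal of the equations;
      subtracting it and \<open>d * e\<close> leaves only products of order above
      \<open>p + q\<close>.\<close>
    have hk: "h * b + (a - h) * k \<in> gen_ideal j"
      by (rule ideal_of_closed(2)[OF I])
        (use ideal_of_closed(3)[OF I b h(1)] ideal_of_closed(3)[OF I alg_closed(4)[OF a ideal_of_closed(4)[OF I h(1)]] k(1)]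
          in \<open>simp_all only: mult.commute[of h b]\<close>)
    have "a * b - d * e - (h * b + (a - h) * k) = d * ek + dh * e + dh * ek"
      unfolding dh_def ek_def by (simp add: algebra_simps)
    then have "a * b - d * e \<in> ideal_plus_tail j (Suc (p + q))"
      using ideal_plus_tailI[OF alg_closed(4)[OF alg.mult[OF a b] hom_alg[OF de]] hk] rest by metis
    then have "fun_scale (- 1) (a * b - d * e) \<in> ideal_plus_tail j (0 + Suc (p + q))"
      using ideal_plus_tail_mult[OF j _ tail.hom[OF hom.const order_refl], of _ _ "- 1"]
      by (simp add: fun_scale_def times_fun_def)
    moreover have "a * b \<in> ideal_plus_tail j (Suc (p + q))" using ab germ_ideal_iff by blast
    ultimately have "fun_scale (- 1) (a * b - d * e) + a * b \<in> ideal_plus_tail j (Suc (p + q))"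
      by (intro ideal_plus_tail_add[OF j]) (simp_all only: add_0)
    moreover have "fun_scale (- 1) (a * b - d * e) + a * b = d * e"
      by (auto simp: fun_eq_iff fun_apply minus_apply algebra_simps)
    ultimately have mem: "d * e \<in> ideal_plus_tail j (Suc (p + q))" by (simp only:)
    have zero: "d v * e v = 0" if "v \<in> tangent j" for v
      using initial_form_vanishes[OF j de mem that] by (simp add: fun_apply)
    define \<gamma> where "\<gamma> t = \<xi> + s t (\<zeta> - \<xi>)" for t
    have \<gamma>: "path \<gamma>" unfolding \<gamma>_def by (intro path_intros polyfun_intros)
    have "d (\<gamma> t) * e (\<gamma> t) = 0" for t
      by (rule zero) (use tangent_segment[OF j d(3) e(3)] in \<open>simp add: \<gamma>_def\<close>)
    then have "(\<forall>t. d (\<gamma> t) = 0) \<or> (\<forall>t. e (\<gamma> t) = 0)"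
      by (rule polyfun_prod_eq_0[OF alg_path[OF hom_alg[OF d(1)] \<gamma>] alg_path[OF hom_alg[OF e(1)] \<gamma>]])
    moreover have "\<gamma> 0 = \<xi>" "\<gamma> 1 = \<zeta>" by (simp_all add: \<gamma>_def)
    ultimately show False using d(4) e(4) by metis
  qed
qed

text \<open>Otherwise the leading form \<open>l j\<close> would vanish on \<open>tangent j\<close>,
  which contains \<open>u j\<close>.\<close>

lemma f_notin_germ_ideal:
  assumes "j < c"
  shows "f j \<notin> germ_ideal j"
proof
  assume "f j \<in> germ_ideal j"
  then have fj: "f j \<in> ideal_plus_tail j 2" using germ_ideal_iff by blast
  have "fun_scale (- 1) (f j - l j) \<in> ideal_plus_tail j 2"
    using assms by (intro tail_ideal_plus_tail ideal_scale[OF ideal_tail] fl) auto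
  from ideal_plus_tail_add[OF _ fj this]
  have "f j + fun_scale (- 1) (f j - l j) \<in> ideal_plus_tail j 2" using assms by simp
  moreover have "f j + fun_scale (- 1) (f j - l j) = l j" by (auto simp: fun_eq_iff fun_apply minus_apply)
  ultimately have "l j \<in> ideal_plus_tail j (Suc 1)" by (simp add: numeral_2_eq_2)
  moreover have "u j \<in> tangent j" using dual assms unfolding tangent_def by auto
  ultimately have "l j (u j) = 0" using initial_form_vanishes[of j 1 "l j" "u j"] l assms by simp
  then show False using dual[OF assms assms] by simp
qed

text \<open>Trades the infinitely many approximations that define the germ ideal for one identity,
  at the price of a factor that is invertible near the origin.\<close>

lemma germ_ideal_unit:
  assumes j: "j \<le> c" and g: "g \<in> germ_ideal j"
  obtains a where "a \<in> alg X" "a 0 = 0" "(1 - a) * g \<in> gen_ideal j"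
proof -
  have deep: "\<exists>h\<in>gen_ideal j. g - h \<in> tail X p" for p using g unfolding germ_ideal_def by blast
  show ?thesis
  proof (rule krull_intersection[of X 0 "gen_ideal j" g])
    show "a \<in> alg X \<Longrightarrow> a 0 = 0 \<Longrightarrow> (1 - a) * g \<in> gen_ideal j \<Longrightarrow> thesis" for a by (rule that)
  qed (rule finX lin_zero ideal_gen_ideal[OF j] ideal_of_closed(4)[OF ideal_germ_ideal[OF j] g] deep | assumption)+
qed

end

section \<open>Forms in coordinates and affine cones\<close>

lemma sym_forms_support: "\<phi> \<in> sym_forms s V k \<Longrightarrow> \<not> (length vs = k \<and> set vs \<subseteq> V) \<Longrightarrow> \<phi> vs = 0"
  unfolding sym_forms_def by blast

lemma sym_forms_perm: "\<phi> \<in> sym_forms s V k \<Longrightarrow> mset us = mset vs \<Longrightarrow> \<phi> us = \<phi> vs"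
  unfolding sym_forms_def by blast

lemma sym_forms_linear:
  assumes "\<phi> \<in> sym_forms s V (Suc k)" "x \<in> V" "y \<in> V" "set vs \<subseteq> V" "length vs = k"
  shows "\<phi> ((s a x + s b y) # vs) = a * \<phi> (x # vs) + b * \<phi> (y # vs)"
proof -
  have "\<forall>us vs. \<forall>x\<in>V. \<forall>y\<in>V. \<forall>a b. set us \<subseteq> V \<and> set vs \<subseteq> V \<and> length us + 1 + length vs = Suc k \<longrightarrow>
        \<phi> (us @ (s a x + s b y) # vs) = a * \<phi> (us @ x # vs) + b * \<phi> (us @ y # vs)"
    using assms(1) unfolding sym_forms_def by blast
  from this[rule_format, of x y "[]" vs a b] show ?thesis using assms(2-) by simp
qed

text \<open>By symmetry, linearity in the first argument suffices.\<close>

lemma sym_formsI: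
  assumes "\<And>vs. \<not> (length vs = k \<and> set vs \<subseteq> V) \<Longrightarrow> \<phi> vs = 0"
    and perm: "\<And>us vs. mset us = mset vs \<Longrightarrow> \<phi> us = \<phi> vs"
    and lin: "\<And>vs x y a b. x \<in> V \<Longrightarrow> y \<in> V \<Longrightarrow> set vs \<subseteq> V \<Longrightarrow> Suc (length vs) = k \<Longrightarrow>
        \<phi> ((s a x + s b y) # vs) = a * \<phi> (x # vs) + b * \<phi> (y # vs)"
  shows "\<phi> \<in> sym_forms s V k"
proof -
  have "\<phi> (us @ (s a x + s b y) # vs) = a * \<phi> (us @ x # vs) + b * \<phi> (us @ y # vs)"
    if "x \<in> V" "y \<in> V" "set us \<subseteq> V" "set vs \<subseteq> V" "length us + 1 + length vs = k" for us vs x y a b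
  proof -
    have "\<phi> (us @ z # vs) = \<phi> (z # us @ vs)" for z by (rule perm) simp
    then show ?thesis using lin[of x y "us @ vs" a b] that by simp
  qed
  then show ?thesis using assms(1) perm unfolding sym_forms_def by blast
qed

lemma sym_forms_contract:
  assumes "\<phi> \<in> sym_forms s V (Suc k)" "w \<in> V"
  shows "contract w \<phi> \<in> sym_forms s V k"
proof (rule sym_formsI)
  fix vs assume "\<not> (length vs = k \<and> set vs \<subseteq> V)"
  then show "contract w \<phi> vs = 0" unfolding contract_def by (intro sym_forms_support[OF assms(1)]) auto
next
  fix us vs :: "'a list" assume "mset us = mset vs"
  then show "contract w \<phi> us = contract w \<phi> vs" unfolding contract_def by (intro sym_forms_perm[OF assms(1)]) auto
next
  fix vs x y a b assume h: "x \<in> V" "y \<in> V" "set vs \<subseteq> V" "Suc (length vs) = k"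
  have sw: "\<phi> (w # z # vs) = \<phi> (z # w # vs)" for z by (rule sym_forms_perm[OF assms(1)]) simp
  show "contract w \<phi> ((s a x + s b y) # vs) = a * contract w \<phi> (x # vs) + b * contract w \<phi> (y # vs)"
    unfolding contract_def sw by (rule sym_forms_linear[OF assms(1)]) (use h assms(2) in auto)
qed

lemma sym_forms_add:
  assumes "\<phi> \<in> sym_forms s V k" "\<psi> \<in> sym_forms s V k"
  shows "\<phi> + \<psi> \<in> sym_forms s V k"
proof (rule sym_formsI)
  fix vs x y a b assume h: "x \<in> V" "y \<in> V" "set vs \<subseteq> V" "Suc (length vs) = k"
  then show "(\<phi> + \<psi>) ((s a x + s b y) # vs) = a * (\<phi> + \<psi>) (x # vs) + b * (\<phi> + \<psi>) (y # vs)"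
    using sym_forms_linear[of \<phi> s V "length vs"] sym_forms_linear[of \<psi> s V "length vs"] assms
    by (simp add: fun_apply algebra_simps)
next
  fix vs assume "\<not> (length vs = k \<and> set vs \<subseteq> V)"
  then show "(\<phi> + \<psi>) vs = 0" 
    using sym_forms_support[OF assms(1), of vs] sym_forms_support[OF assms(2), of vs] by (simp add: plus_fun_apply)
next
  fix us vs :: "'a list" assume "mset us = mset vs"
  then show "(\<phi> + \<psi>) us = (\<phi> + \<psi>) vs" 
    using sym_forms_perm[OF assms(1)] sym_forms_perm[OF assms(2)] by (metis plus_fun_apply)
qed

lemma sym_forms_zero: "0 \<in> sym_forms s V k"
  by (rule sym_formsI) (auto simp: fun_apply)

text \<open>The symmetrized product: \<open>ell\<close> takes each argument in turn while
  \<open>\<phi>\<close> receives the others, and the average is taken; on the diagonal all terms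
  agree.\<close>

lemma sym_forms_mult_linear:
  fixes ell :: "'v::ab_group_add \<Rightarrow> complex"
  assumes \<phi>: "\<phi> \<in> sym_forms s V d" and V: "\<And>x y a b. x \<in> V \<Longrightarrow> y \<in> V \<Longrightarrow> s a x + s b y \<in> V"
    and ell: "\<And>x y a b. x \<in> V \<Longrightarrow> y \<in> V \<Longrightarrow> ell (s a x + s b y) = a * ell x + b * ell y"
  shows "\<exists>\<psi>\<in>sym_forms s V (Suc d). \<forall>v\<in>V. \<psi> (replicate (Suc d) v) = ell v * \<phi> (replicate d v)"
proof -
  define G where "G vs = (\<Sum>p<length vs. ell (vs ! p) * \<phi> (take p vs @ drop (Suc p) vs))" for vs
  define \<psi> where "\<psi> vs = (if length vs = Suc d \<and> set vs \<subseteq> V then G vs / of_nat (Suc d) else 0)" for vs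
  have Gperm: "G us = G vs" if m: "mset us = mset vs" for us vs
  proof -
    \<comment> \<open>\<open>\<phi>\<close> depends only on the multiset of its arguments, so
      \<open>G\<close> becomes a sum over that multiset and its symmetry is visible.\<close>
    define \<Phi> where "\<Phi> M = \<phi> (SOME l. mset l = M)" for M
    have \<Phi>: "\<phi> l = \<Phi> (mset l)" for l
      unfolding \<Phi>_def by (rule sym_forms_perm[OF \<phi>]) (rule sym, rule someI, rule refl)
    have "G us = sum_mset (image_mset (\<lambda>x. ell x * \<Phi> (mset us - {#x#})) (mset us))" for us
    proof -
      have "G us = (\<Sum>p<length us. ell (us ! p) * \<Phi> (mset us - {#us ! p#}))"
        unfolding G_def
      proof (rule sum.cong[OF refl])
        fix p assume "p \<in> {..<length us}"
        then have "us = take p us @ us ! p # drop (Suc p) us" by (simp add: id_take_nth_drop[symmetric])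
        then have "mset us = mset (take p us @ us ! p # drop (Suc p) us)" by simp
        then have "mset us - {#us ! p#} = mset (take p us @ drop (Suc p) us)" by simp
        then show "ell (us ! p) * \<phi> (take p us @ drop (Suc p) us) = ell (us ! p) * \<Phi> (mset us - {#us ! p#})"
          using \<Phi> by simp
      qed
      also have "\<dots> = sum_list (map (\<lambda>x. ell x * \<Phi> (mset us - {#x#})) us)"
        by (simp add: sum_list_sum_nth atLeast0LessThan)
      also have "\<dots> = sum_mset (image_mset (\<lambda>x. ell x * \<Phi> (mset us - {#x#})) (mset us))"
        by (simp only: mset_map[symmetric] sum_mset_sum_list)
      finally show ?thesis .
    qed
    then show ?thesis using m by simp
  qed
  have Gcons: "G (x # vs) = ell x * \<phi> vs + (\<Sum>q<length vs. ell (vs ! q) * \<phi> (x # take q vs @ drop (Suc q) vs))" for x vs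
    unfolding G_def by (simp add: sum.lessThan_Suc_shift del: sum.lessThan_Suc)
  have "\<psi> \<in> sym_forms s V (Suc d)"
  proof (rule sym_formsI)
    fix us vs :: "'v list" assume m: "mset us = mset vs"
    have "length us = length vs" "set us = set vs" using m mset_eq_length mset_eq_setD by blast+
    then show "\<psi> us = \<psi> vs" unfolding \<psi>_def using Gperm[OF m] by simp
  next
    fix vs x y a b assume h: "x \<in> V" "y \<in> V" "set vs \<subseteq> V" "Suc (length vs) = Suc d"
    have "\<phi> ((s a x + s b y) # take q vs @ drop (Suc q) vs)
      = a * \<phi> (x # take q vs @ drop (Suc q) vs) + b * \<phi> (y # take q vs @ drop (Suc q) vs)"
      if "q < length vs" for q
    proof (rule sym_forms_linear[of \<phi> s V "d - 1"])
      show "\<phi> \<in> sym_forms s V (Suc (d - 1))" using \<phi> h that by simp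
      show "set (take q vs @ drop (Suc q) vs) \<subseteq> V" using h(3) set_take_subset[of q vs] set_drop_subset[of "Suc q" vs] by auto
    qed (use h that in auto)
    then have "G ((s a x + s b y) # vs) = a * G (x # vs) + b * G (y # vs)"
      unfolding Gcons by (simp add: ell[OF h(1,2)] algebra_simps sum.distrib sum_distrib_left)
    then show "\<psi> ((s a x + s b y) # vs) = a * \<psi> (x # vs) + b * \<psi> (y # vs)"
      unfolding \<psi>_def using h V by (simp add: add_divide_distrib)
  qed (auto simp: \<psi>_def)
  moreover have "\<psi> (replicate (Suc d) v) = ell v * \<phi> (replicate d v)" if v: "v \<in> V" for v
  proof -
    have "take p (replicate (Suc d) v) @ drop (Suc p) (replicate (Suc d) v) = replicate d v" if "p < Suc d" for p
      using that by (simp add: replicate_add[symmetric] del: replicate_Suc)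
    then have "G (replicate (Suc d) v) = of_nat (Suc d) * (ell v * \<phi> (replicate d v))"
      unfolding G_def by (simp del: replicate_Suc of_nat_Suc)
    then show ?thesis using v unfolding \<psi>_def by (auto simp del: of_nat_Suc)
  qed
  ultimately show ?thesis by blast
qed

text \<open>A basis of a subspace together with coordinate functions that are linear on the whole
  type, so that polynomials in them are total functions.\<close>

locale coord_space = vector_space s for s :: "complex \<Rightarrow> 'v::ab_group_add \<Rightarrow> 'v" +
  fixes V :: "'v set" and I :: "'i set" and bb :: "'i \<Rightarrow> 'v" and cc :: "'i \<Rightarrow> 'v \<Rightarrow> complex"
  assumes finI: "finite I" and subV: "subspace V" and bbV: "i \<in> I \<Longrightarrow> bb i \<in> V"
    and cc_add: "i \<in> I \<Longrightarrow> cc i (a + b) = cc i a + cc i b"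
    and cc_scale: "i \<in> I \<Longrightarrow> cc i (s c a) = c * cc i a"
    and expand: "v \<in> V \<Longrightarrow> v = (\<Sum>i\<in>I. s (cc i v) (bb i))"
    and cc_bb: "i \<in> I \<Longrightarrow> k \<in> I \<Longrightarrow> cc i (bb k) = (if i = k then 1 else 0)"
begin

sublocale linear_coords s "cc ` I"
  by unfold_locales (auto simp: finI cc_add cc_scale)

abbreviation "X \<equiv> cc ` I"

lemma card_X: "card X = card I"
proof (rule card_image)
  show "inj_on cc I" by (rule inj_onI) (metis cc_bb zero_neq_one)
qed

lemma V_closed: "v \<in> V \<Longrightarrow> w \<in> V \<Longrightarrow> v + w \<in> V" "v \<in> V \<Longrightarrow> s a v \<in> V" "0 \<in> V"
  "(\<And>i. i \<in> T \<Longrightarrow> f i \<in> V) \<Longrightarrow> (\<Sum>i\<in>T. f i) \<in> V" "v \<in> V \<Longrightarrow> w \<in> V \<Longrightarrow> v - w \<in> V"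
  using subspace_add[OF subV] subspace_scale[OF subV] subspace_0[OF subV] subspace_sum[OF subV, of T f]
    subspace_diff[OF subV] by auto

lemma cc_sum: "i \<in> I \<Longrightarrow> cc i (\<Sum>k\<in>T. f k) = (\<Sum>k\<in>T. cc i (f k))"
  by (rule hom_1_sum[OF hom_gen]) auto

lemma cc_comb:
  assumes "i \<in> I"
  shows "cc i (\<Sum>k\<in>I. s (a k) (bb k)) = a i"
proof -
  have "cc i (\<Sum>k\<in>I. s (a k) (bb k)) = (\<Sum>k\<in>I. a k * cc i (bb k))" by (simp add: cc_sum cc_scale assms)
  also have "\<dots> = (\<Sum>k\<in>{i}. a k * cc i (bb k))"
    by (rule sum.mono_neutral_right) (use finI assms cc_bb in auto)
  finally show ?thesis using cc_bb assms by simp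
qed

lemma coords_exist: "\<exists>v\<in>V. \<forall>x\<in>X. x v = \<alpha> x"
  by (rule bexI[of _ "\<Sum>k\<in>I. s (\<alpha> (cc k)) (bb k)"]) (auto simp: cc_comb intro: V_closed bbV)

lemma V_span: "v \<in> V \<Longrightarrow> v \<in> span (bb ` I)"
  by (subst expand) (auto intro: span_sum span_scale span_base)

lemma form_sum:
  assumes "\<phi> \<in> sym_forms s V (Suc k)" "\<And>i. i \<in> T \<Longrightarrow> b i \<in> V" "set vs \<subseteq> V" "length vs = k"
  shows "\<phi> ((\<Sum>i\<in>T. s (c i) (b i)) # vs) = (\<Sum>i\<in>T. c i * \<phi> (b i # vs))"
  using assms(2)
proof (induction T rule: infinite_finite_induct)
  case (insert i T)
  have "\<phi> ((s (c i) (b i) + s 1 (\<Sum>i\<in>T. s (c i) (b i))) # vs)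
    = c i * \<phi> (b i # vs) + 1 * \<phi> ((\<Sum>i\<in>T. s (c i) (b i)) # vs)"
    by (rule sym_forms_linear[OF assms(1)]) (use insert assms in \<open>auto intro!: V_closed\<close>)
  then show ?case using insert by simp
next
  case empty
  have "\<phi> ((s 0 0 + s 0 0) # vs) = 0 * \<phi> (0 # vs) + 0 * \<phi> (0 # vs)"
    by (rule sym_forms_linear[OF assms(1)]) (use assms V_closed in auto)
  then show ?case by simp
next
  case (infinite A)
  have "\<phi> ((s 0 0 + s 0 0) # vs) = 0 * \<phi> (0 # vs) + 0 * \<phi> (0 # vs)"
    by (rule sym_forms_linear[OF assms(1)]) (use assms V_closed in auto)
  then show ?case using infinite by simp
qed

lemma form_expand:
  assumes "\<phi> \<in> sym_forms s V (Suc k)" "v \<in> V" "set vs \<subseteq> V" "length vs = k"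
  shows "\<phi> (v # vs) = (\<Sum>i\<in>I. cc i v * \<phi> (bb i # vs))"
proof -
  have "\<phi> ((\<Sum>i\<in>I. s (cc i v) (bb i)) # vs) = (\<Sum>i\<in>I. cc i v * \<phi> (bb i # vs))"
    by (rule form_sum[OF assms(1) _ assms(3,4)]) (rule bbV)
  then show ?thesis unfolding expand[OF assms(2), symmetric] .
qed

text \<open>Together with \<open>hom_to_form\<close>, the dictionary between symmetric forms and
  homogeneous polynomials in the coordinates. The agreement is asserted on \<open>V\<close>
  only.\<close>

lemma form_to_hom:
  assumes "\<phi> \<in> sym_forms s V d"
  shows "\<exists>h. hom X d h \<and> (\<forall>v\<in>V. h v = \<phi> (replicate d v))"
  using assms
proof (induction d arbitrary: \<phi>)
  case 0
  show ?case by (rule exI[of _ "\<lambda>_. \<phi> []"]) (simp add: hom.const)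
next
  case (Suc d)
  have "\<forall>i\<in>I. \<exists>h. hom X d h \<and> (\<forall>v\<in>V. h v = contract (bb i) \<phi> (replicate d v))"
    using Suc.IH[OF sym_forms_contract[OF Suc.prems bbV]] by blast
  then obtain h where h: "\<And>i. i \<in> I \<Longrightarrow> hom X d (h i)"
    "\<And>i v. i \<in> I \<Longrightarrow> v \<in> V \<Longrightarrow> h i v = contract (bb i) \<phi> (replicate d v)" by metis
  have "hom X (Suc d) (\<Sum>i\<in>I. cc i * h i)" by (intro hom_sum hom.mult h) auto
  moreover have "(\<Sum>i\<in>I. cc i * h i) v = \<phi> (replicate (Suc d) v)" if v: "v \<in> V" for v
  proof -
    have "set (replicate d v) \<subseteq> V" using v by auto
    from form_expand[OF Suc.prems v this length_replicate] show ?thesis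
      using v by (simp add: sum_fun_apply fun_apply h(2) contract_def)
  qed
  ultimately show ?case by blast
qed

lemma hom_to_form:
  assumes "hom X d h"
  shows "\<exists>\<phi>\<in>sym_forms s V d. \<forall>v\<in>V. h v = \<phi> (replicate d v)"
  using assms
proof (induction rule: hom.induct)
  case (zero d)
  show ?case by (rule bexI[OF _ sym_forms_zero]) (simp add: fun_apply)
next
  case (const c)
  show ?case
    by (rule bexI[of _ "\<lambda>vs. if vs = [] then c else 0"]) (auto intro!: sym_formsI split: if_splits)
next
  case (mult x d h)
  then obtain \<phi> where \<phi>: "\<phi> \<in> sym_forms s V d" "\<forall>v\<in>V. h v = \<phi> (replicate d v)" by blast
  have "x (s a u + s b v) = a * x u + b * x v" for a b u v using mult(1) by (simp add: lin_add lin_scale)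
  then obtain \<psi> where "\<psi> \<in> sym_forms s V (Suc d)" "\<forall>v\<in>V. \<psi> (replicate (Suc d) v) = x v * \<phi> (replicate d v)"
    using sym_forms_mult_linear[OF \<phi>(1), of x] V_closed by metis
  then show ?case using \<phi>(2) by (intro bexI[of _ \<psi>]) (auto simp: fun_apply)
next
  case (add d f g)
  then obtain \<phi> \<psi> where "\<phi> \<in> sym_forms s V d" "\<forall>v\<in>V. f v = \<phi> (replicate d v)"
    "\<psi> \<in> sym_forms s V d" "\<forall>v\<in>V. g v = \<psi> (replicate d v)" by blast
  then show ?case using sym_forms_add[of \<phi> s V d \<psi>] by (intro bexI[of _ "\<phi> + \<psi>"]) (auto simp: fun_apply)
qed

lemma form_homogeneous:
  assumes "\<phi> \<in> sym_forms s V d" "v \<in> V"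
  shows "\<phi> (replicate d (s c v)) = c ^ d * \<phi> (replicate d v)"
proof -
  obtain h where h: "hom X d h" "\<And>v. v \<in> V \<Longrightarrow> h v = \<phi> (replicate d v)" using form_to_hom[OF assms(1)] by blast
  show ?thesis using hom_homogeneous[OF h(1), of c v] h(2) assms(2) V_closed(2) by metis
qed

text \<open>The arguments \<open>a\<close> are replaced by \<open>a + s e b\<close> one at a time.
  This stands in for the binomial expansion: what matters is that the increment is divisible by
  \<open>e\<close> and which value the quotient takes at \<open>e = 0\<close>.\<close>

lemma form_telescope:
  assumes "\<phi> \<in> sym_forms s V (Suc d)" and a: "a \<in> V" and b: "b \<in> V"
  shows "\<phi> (replicate (Suc d) (a + s e b)) = \<phi> (replicate (Suc d) a)
    + e * (\<Sum>j<Suc d. \<phi> (b # replicate j (a + s e b) @ replicate (d - j) a))"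
proof -
  let ?c = "a + s e b"
  define A where "A j = \<phi> (replicate j ?c @ replicate (Suc d - j) a)" for j
  have c: "?c \<in> V" using a b V_closed by simp
  have step: "A (Suc j) - A j = e * \<phi> (b # replicate j ?c @ replicate (d - j) a)" if "j < Suc d" for j
  proof -
    let ?r = "replicate j ?c @ replicate (d - j) a"
    have "A (Suc j) = \<phi> (?c # ?r)" unfolding A_def by simp
    moreover have "A j = \<phi> (a # ?r)"
      unfolding A_def by (rule sym_forms_perm[OF assms(1)]) (use that in \<open>simp add: Suc_diff_le\<close>)
    moreover have "\<phi> ((s 1 a + s e b) # ?r) = 1 * \<phi> (a # ?r) + e * \<phi> (b # ?r)"
      by (rule sym_forms_linear[OF assms(1)]) (use a b c that in auto)
    ultimately show ?thesis by simp
  qed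
  have "(\<Sum>j<Suc d. A (Suc j) - A j) = A (Suc d) - A 0" by (rule sum_lessThan_telescope)
  moreover have "(\<Sum>j<Suc d. A (Suc j) - A j) = (\<Sum>j<Suc d. e * \<phi> (b # replicate j ?c @ replicate (d - j) a))"
    by (rule sum.cong) (use step in auto)
  ultimately have "A (Suc d) = A 0 + (\<Sum>j<Suc d. e * \<phi> (b # replicate j ?c @ replicate (d - j) a))"
    by (metis add.commute diff_add_cancel)
  moreover have "A 0 = \<phi> (replicate (Suc d) a)" "A (Suc d) = \<phi> (replicate (Suc d) ?c)"
    by (simp_all add: A_def)
  ultimately show ?thesis by (simp only: sum_distrib_left)
qed

lemma form_path:
  assumes "\<phi> \<in> sym_forms s V (length \<gamma>s)" "\<And>\<gamma> t. \<gamma> \<in> set \<gamma>s \<Longrightarrow> \<gamma> t \<in> V" "\<And>\<gamma>. \<gamma> \<in> set \<gamma>s \<Longrightarrow> path \<gamma>"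
  shows "polyfun (\<lambda>t. \<phi> (map (\<lambda>\<gamma>. \<gamma> t) \<gamma>s))"
  using assms
proof (induction \<gamma>s arbitrary: \<phi>)
  case Nil then show ?case by (simp add: polyfun_intros)
next
  case (Cons \<gamma> \<gamma>s)
  have \<phi>: "\<phi> \<in> sym_forms s V (Suc (length \<gamma>s))" using Cons.prems(1) by simp
  have "\<phi> (map (\<lambda>\<gamma>. \<gamma> t) (\<gamma> # \<gamma>s)) = (\<Sum>i\<in>I. cc i (\<gamma> t) * contract (bb i) \<phi> (map (\<lambda>\<gamma>. \<gamma> t) \<gamma>s))" for t
    using form_expand[OF \<phi>, of "\<gamma> t" "map (\<lambda>\<gamma>. \<gamma> t) \<gamma>s"] Cons.prems(2) by (auto simp: contract_def)
  moreover have "polyfun (\<lambda>t. \<Sum>i\<in>I. cc i (\<gamma> t) * contract (bb i) \<phi> (map (\<lambda>\<gamma>. \<gamma> t) \<gamma>s))"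
  proof (intro polyfun_sum polyfun_intros)
    fix i assume i: "i \<in> I"
    show "polyfun (\<lambda>t. cc i (\<gamma> t))" using Cons.prems(3)[of \<gamma>] i unfolding path_def by auto
    show "polyfun (\<lambda>t. contract (bb i) \<phi> (map (\<lambda>\<gamma>. \<gamma> t) \<gamma>s))"
      by (rule Cons.IH[OF sym_forms_contract[OF \<phi> bbV[OF i]]]) (use Cons.prems in auto)
  qed
  ultimately show ?case by simp
qed

text \<open>The difference quotient of \<open>form_telescope\<close> along a moving direction is
  polynomial, and at 0 it is the differential.\<close>

lemma telescope_polyfun:
  assumes \<phi>: "\<phi> \<in> sym_forms s V (Suc d)" and a: "a \<in> V" and b: "path \<beta>" "\<And>t. \<beta> t \<in> V"
  shows "polyfun (\<lambda>t. \<Sum>j<Suc d. \<phi> (\<beta> t # replicate j (a + s t (\<beta> t)) @ replicate (d - j) a))"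
    and "(\<Sum>j<Suc d. \<phi> (\<beta> 0 # replicate j (a + s 0 (\<beta> 0)) @ replicate (d - j) a))
      = of_nat (Suc d) * \<phi> (\<beta> 0 # replicate d a)"
proof -
  show "polyfun (\<lambda>t. \<Sum>j<Suc d. \<phi> (\<beta> t # replicate j (a + s t (\<beta> t)) @ replicate (d - j) a))"
  proof (intro polyfun_sum)
    fix j assume j: "j \<in> {..<Suc d}"
    let ?\<gamma>s = "\<beta> # replicate j (\<lambda>t. a + s t (\<beta> t)) @ replicate (d - j) (\<lambda>_. a)"
    have "polyfun (\<lambda>t. \<phi> (map (\<lambda>\<gamma>. \<gamma> t) ?\<gamma>s))"
    proof (rule form_path)
      show "\<phi> \<in> sym_forms s V (length ?\<gamma>s)" using \<phi> j by simp
      show "\<gamma> t \<in> V" if "\<gamma> \<in> set ?\<gamma>s" for \<gamma> t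
        using that a b(2) V_closed(1)[OF a V_closed(2)[OF b(2)]] by (auto split: if_splits)
      show "path \<gamma>" if "\<gamma> \<in> set ?\<gamma>s" for \<gamma>
        using that b(1) by (auto split: if_splits intro!: path_intros polyfun_intros)
    qed
    then show "polyfun (\<lambda>t. \<phi> (\<beta> t # replicate j (a + s t (\<beta> t)) @ replicate (d - j) a))"
      by (simp add: map_replicate_const)
  qed
  have "replicate j a @ replicate (d - j) a = replicate d a" if "j < Suc d" for j
    using that by (simp add: replicate_add[symmetric])
  then show "(\<Sum>j<Suc d. \<phi> (\<beta> 0 # replicate j (a + s 0 (\<beta> 0)) @ replicate (d - j) a))
      = of_nat (Suc d) * \<phi> (\<beta> 0 # replicate d a)"
    by (simp del: sum.lessThan_Suc)
qed

section \<open>Closed sets of projective space and their affine cones\<close>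

lemma proj_spaceE:
  assumes "x \<in> proj_space s V"
  obtains v where "v \<in> V" "v \<noteq> 0" "x = span {v}"
  using assms unfolding proj_space_def by blast

lemma in_span_single: "u \<in> span {v} \<longleftrightarrow> (\<exists>c. u = s c v)"
  by (auto simp: span_singleton)

lemma form_zero_on_line:
  assumes "\<phi> \<in> sym_forms s V d" "v \<in> V"
  shows "(\<forall>u\<in>span {v}. \<phi> (replicate d u) = 0) \<longleftrightarrow> \<phi> (replicate d v) = 0"
  using form_homogeneous[OF assms] span_base[of v "{v}"] by (auto simp: in_span_single)

lemma zariski_closed_subset: "zariski_closed s V Z \<Longrightarrow> Z \<subseteq> proj_space s V"
  unfolding zariski_closed_def proj_zeros_def by blast

lemma zariski_closed_inter_zeros:
  assumes "zariski_closed s V Z" "\<phi> \<in> sym_forms s V d"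
  shows "zariski_closed s V {x \<in> Z. \<forall>v\<in>x. \<phi> (replicate d v) = 0}"
proof -
  obtain S where S: "S \<subseteq> (SIGMA d:UNIV. sym_forms s V d)" "Z = proj_zeros s V S"
    using assms(1) unfolding zariski_closed_def by blast
  have "{x \<in> Z. \<forall>v\<in>x. \<phi> (replicate d v) = 0} = proj_zeros s V (insert (d, \<phi>) S)"
    unfolding S(2) proj_zeros_def by auto
  moreover have "insert (d, \<phi>) S \<subseteq> (SIGMA d:UNIV. sym_forms s V d)" using S(1) assms(2) by auto
  ultimately show ?thesis unfolding zariski_closed_def by blast
qed

lemma cone_subset: "Z \<subseteq> proj_space s V \<Longrightarrow> v \<in> \<Union>Z \<Longrightarrow> v \<in> V"
  using V_closed(2) by (auto simp: in_span_single elim!: proj_spaceE dest!: subsetD)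

lemma cone_scale: "Z \<subseteq> proj_space s V \<Longrightarrow> v \<in> \<Union>Z \<Longrightarrow> s c v \<in> \<Union>Z"
  using span_scale by (auto elim!: proj_spaceE dest!: subsetD)

text \<open>The ideal of the affine cone over \<open>Z\<close>, inhomogeneous polynomials
  included.\<close>

definition vanishing :: "'v set set \<Rightarrow> ('v \<Rightarrow> complex) set" where
  "vanishing Z = {g \<in> alg X. \<forall>v\<in>\<Union>Z. g v = 0}"

lemma ideal_vanishing: "ideal_of (alg X) (vanishing Z)"
  unfolding ideal_of_def vanishing_def by (auto simp: fun_apply intro: alg_zero alg.add alg.mult)

text \<open>Irreducibility is tested on forms, so inhomogeneous \<open>g\<close> and
  \<open>h\<close> are replaced by their lowest homogeneous parts that do not vanish on the cone.
  Along the lines of the cone these are leading coefficients, and hence their product vanishes there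
  when \<open>g * h\<close> does.\<close>

lemma prime_vanishing:
  assumes "irreducible_closed s V Z"
  shows "prime_of (alg X) (vanishing Z)"
  unfolding prime_of_def
proof (intro conjI ballI impI)
  have Z: "zariski_closed s V Z" "Z \<noteq> {}"
    and irr: "\<And>A B. zariski_closed s V A \<Longrightarrow> zariski_closed s V B \<Longrightarrow> Z = A \<union> B \<Longrightarrow> Z = A \<or> Z = B"
    using assms unfolding irreducible_closed_def by blast+
  note sub = zariski_closed_subset[OF Z(1)]
  show "ideal_of (alg X) (vanishing Z)" by (rule ideal_vanishing)
  show "1 \<notin> vanishing Z"
  proof -
    obtain x where x: "x \<in> Z" using Z(2) by blast
    obtain v where "x = span {v}" using x sub by (blast elim: proj_spaceE)
    then have "v \<in> \<Union>Z" using x span_base by blast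
    then show ?thesis unfolding vanishing_def by (auto simp: fun_apply)
  qed
  fix g h assume gh: "g \<in> alg X" "h \<in> alg X" "g * h \<in> vanishing Z"
  show "g \<in> vanishing Z \<or> h \<in> vanishing Z"
  proof (rule ccontr)
    assume no: "\<not> ?thesis"
    have lead: "\<exists>d e v. hom X d e \<and> v \<in> \<Union>Z \<and> e v \<noteq> 0 \<and>
        (\<forall>v\<in>\<Union>Z. \<exists>q. polyfun q \<and> q 0 = e v \<and> (\<forall>t. g (s t v) = t ^ d * q t))"
      if g: "g \<in> alg X" "g \<notin> vanishing Z" for g
    proof -
      obtain N k where k: "\<And>d. hom X d (k d)" "g = (\<Sum>d<N. k d)" using alg_decompose[OF g(1)] by blast
      have "\<exists>d. d < N \<and> (\<exists>v\<in>\<Union>Z. k d v \<noteq> 0)"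
      proof (rule ccontr)
        assume "\<not> ?thesis"
        then have "\<forall>v\<in>\<Union>Z. g v = 0" unfolding k(2) sum_fun_apply by (intro ballI sum.neutral) auto
        then show False using g unfolding vanishing_def by blast
      qed
      then obtain d where d: "d < N" "\<exists>v\<in>\<Union>Z. k d v \<noteq> 0" "\<And>e. e < d \<Longrightarrow> \<not> (e < N \<and> (\<exists>v\<in>\<Union>Z. k e v \<noteq> 0))"
        using exists_least_iff[of "\<lambda>d. d < N \<and> (\<exists>v\<in>\<Union>Z. k d v \<noteq> 0)"] by blast
      have "\<exists>q. polyfun q \<and> q 0 = k d v \<and> (\<forall>t. g (s t v) = t ^ d * q t)" if v: "v \<in> \<Union>Z" for v
      proof (intro exI[of _ "\<lambda>t. \<Sum>e=d..<N. t ^ (e - d) * k e v"] conjI allI)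
        show "polyfun (\<lambda>t. \<Sum>e=d..<N. t ^ (e - d) * k e v)" by (intro polyfun_sum polyfun_intros)
        have "(\<Sum>e=d..<N. 0 ^ (e - d) * k e v) = (\<Sum>e\<in>{d}. 0 ^ (e - d) * k e v)"
          by (rule sum.mono_neutral_right) (use d(1) in auto)
        then show "(\<Sum>e=d..<N. 0 ^ (e - d) * k e v) = k d v" by simp
        fix t
        have "g (s t v) = (\<Sum>e<N. t ^ e * k e v)"
          unfolding k(2) sum_fun_apply by (simp add: hom_homogeneous[OF k(1)])
        also have "\<dots> = (\<Sum>e=d..<N. t ^ e * k e v)"
          by (rule sum.mono_neutral_right) (use d(3) v in \<open>auto simp: not_le\<close>)
        also have "\<dots> = t ^ d * (\<Sum>e=d..<N. t ^ (e - d) * k e v)"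
          unfolding sum_distrib_left
          by (rule sum.cong) (auto simp: mult.assoc[symmetric] power_add[symmetric])
        finally show "g (s t v) = t ^ d * (\<Sum>e=d..<N. t ^ (e - d) * k e v)" .
      qed
      then show ?thesis using k(1) d(2) by blast
    qed
    obtain d e v where e: "hom X d e" "v \<in> \<Union>Z" "e v \<noteq> 0"
      "\<And>v. v \<in> \<Union>Z \<Longrightarrow> \<exists>q. polyfun q \<and> q 0 = e v \<and> (\<forall>t. g (s t v) = t ^ d * q t)"
      using lead[OF gh(1)] no by blast
    obtain d' e' v' where e': "hom X d' e'" "v' \<in> \<Union>Z" "e' v' \<noteq> 0"
      "\<And>v. v \<in> \<Union>Z \<Longrightarrow> \<exists>q. polyfun q \<and> q 0 = e' v \<and> (\<forall>t. h (s t v) = t ^ d' * q t)"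
      using lead[OF gh(2)] no by blast
    have prod: "e v * e' v = 0" if v: "v \<in> \<Union>Z" for v
    proof -
      obtain q where q: "polyfun q" "q 0 = e v" "\<And>t. g (s t v) = t ^ d * q t" using e(4)[OF v] by blast
      obtain q' where q': "polyfun q'" "q' 0 = e' v" "\<And>t. h (s t v) = t ^ d' * q' t" using e'(4)[OF v] by blast
      have "q t * q' t = 0" if "t \<noteq> 0" for t
      proof -
        have "(g * h) (s t v) = 0" using gh(3) cone_scale[OF sub v] unfolding vanishing_def by blast
        then show ?thesis using that q(3) q'(3) by (simp add: fun_apply)
      qed
      then have "q 0 * q' 0 = 0" by (rule polyfun_eq_0[OF polyfun_intros(4)[OF q(1) q'(1)]])
      then show ?thesis using q(2) q'(2) by simp
    qed
    obtain \<phi> where \<phi>: "\<phi> \<in> sym_forms s V d" "\<And>v. v \<in> V \<Longrightarrow> e v = \<phi> (replicate d v)" using hom_to_form[OF e(1)] by blast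
    obtain \<psi> where \<psi>: "\<psi> \<in> sym_forms s V d'" "\<And>v. v \<in> V \<Longrightarrow> e' v = \<psi> (replicate d' v)" using hom_to_form[OF e'(1)] by blast
    define A where "A = {x \<in> Z. \<forall>v\<in>x. \<phi> (replicate d v) = 0}"
    define B where "B = {x \<in> Z. \<forall>v\<in>x. \<psi> (replicate d' v) = 0}"
    have "x \<in> A \<union> B" if x: "x \<in> Z" for x
    proof -
      obtain w where w: "w \<in> V" "x = span {w}" using x sub by (blast elim: proj_spaceE)
      then have "w \<in> \<Union>Z" using x span_base by blast
      then have "e w = 0 \<or> e' w = 0" using prod by simp
      then show ?thesis using x w form_zero_on_line[OF \<phi>(1) w(1)] form_zero_on_line[OF \<psi>(1) w(1)] \<phi>(2) \<psi>(2)
        unfolding A_def B_def by auto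
    qed
    then have "Z = A \<union> B" unfolding A_def B_def by blast
    moreover have "zariski_closed s V A" "zariski_closed s V B"
      unfolding A_def B_def by (rule zariski_closed_inter_zeros[OF Z(1)], fact \<phi>(1) \<psi>(1))+
    ultimately have "Z = A \<or> Z = B" using irr by blast
    moreover have "v \<in> V" "v' \<in> V" using cone_subset[OF sub] e(2) e'(2) by blast+
    ultimately show False using e(2,3) e'(2,3) \<phi>(2) \<psi>(2) unfolding A_def B_def by auto
  qed
qed

lemma vanishing_strict:
  assumes "zariski_closed s V Z" "Z \<subset> Z'" "Z' \<subseteq> proj_space s V"
  shows "\<exists>g\<in>vanishing Z. g \<notin> vanishing Z'"
proof -
  obtain S where S: "S \<subseteq> (SIGMA d:UNIV. sym_forms s V d)" "Z = proj_zeros s V S"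
    using assms(1) unfolding zariski_closed_def by blast
  obtain x where x: "x \<in> Z'" "x \<notin> Z" using assms(2) by blast
  then obtain d \<phi> v where \<phi>: "(d, \<phi>) \<in> S" "v \<in> x" "\<phi> (replicate d v) \<noteq> 0"
    using assms(3) unfolding S(2) proj_zeros_def by blast
  have "\<phi> \<in> sym_forms s V d" using S(1) \<phi>(1) by blast
  then obtain h where h: "hom X d h" "\<And>v. v \<in> V \<Longrightarrow> h v = \<phi> (replicate d v)" using form_to_hom by blast
  have sub: "Z \<subseteq> proj_space s V" using zariski_closed_subset[OF assms(1)] .
  have "\<phi> (replicate d v) = 0" if "v \<in> \<Union>Z" for v using that \<phi>(1) unfolding S(2) proj_zeros_def by blast
  then have "h v = 0" if "v \<in> \<Union>Z" for v using h(2) cone_subset[OF sub that] that by simp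
  then have "h \<in> vanishing Z" unfolding vanishing_def using hom_alg[OF h(1)] by blast
  moreover have "v \<in> V" using cone_subset[OF assms(3)] x(1) \<phi>(2) by blast
  then have "h v \<noteq> 0" using h(2) \<phi>(3) by simp
  then have "h \<notin> vanishing Z'" unfolding vanishing_def using x(1) \<phi>(2) by blast
  ultimately show ?thesis by blast
qed

lemma vanishing_antimono: "Z \<subseteq> Z' \<Longrightarrow> vanishing Z' \<subseteq> vanishing Z"
  unfolding vanishing_def by blast

end

section \<open>Tangent spaces and local dimensions\<close>

text \<open>Functions separating consecutive primes are algebraically independent modulo
  \<open>Q 0\<close>, whereas more than \<open>card X\<close> elements of \<open>alg X\<close>
  satisfy a relation.\<close>

lemma prime_chain_bound:
  fixes Q :: "nat \<Rightarrow> ('a \<Rightarrow> complex) set"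
  assumes X: "finite X" and Q: "\<And>i. i \<le> L \<Longrightarrow> prime_of (alg X) (Q i)"
    and sub: "\<And>i. i < L \<Longrightarrow> Q i \<subseteq> Q (Suc i) \<and> (\<exists>g\<in>Q (Suc i). g \<notin> Q i)"
  shows "L \<le> card X"
proof (rule ccontr)
  assume L: "\<not> L \<le> card X"
  have "\<forall>i. \<exists>g. i < L \<longrightarrow> g \<in> Q (Suc i) \<and> g \<notin> Q i" using sub by blast
  then obtain g where g: "\<And>i. i < L \<Longrightarrow> g i \<in> Q (Suc i)" "\<And>i. i < L \<Longrightarrow> g i \<notin> Q i" by metis
  define gs where "gs = map g [0..<L]"
  have len: "length gs = L" by (simp add: gs_def)
  have gX: "h \<circ> id \<in> alg X" if "h \<in> set gs" for h
  proof -
    obtain i where i: "i < L" "h = g i" using \<open>h \<in> set gs\<close> unfolding gs_def by auto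
    have "prime_of (alg X) (Q (Suc i))" by (rule Q) (use i in simp)
    from ideal_of_closed(4)[OF prime_ofD(1)[OF this] g(1)[OF i(1)]] show ?thesis by (simp add: i)
  qed
  show False
  proof (rule algebraic_relation[of X gs id])
    show "finite X" "card X < length gs" using X L len by simp_all
    show "h \<circ> id \<in> alg X" if "h \<in> set gs" for h using gX[OF that] .
    fix D c as
    assume as: "as \<in> exponents (length gs) D" and nz: "c as \<noteq> 0"
      and rel: "\<And>b. (\<Sum>as\<in>exponents (length gs) D. fun_scale (c as) (list_monomial gs as)) (id b) = 0"
    have "(\<Sum>as\<in>exponents (length gs) D. fun_scale (c as) (list_monomial gs as)) = 0"
      using rel by (simp add: fun_eq_iff fun_apply)
    also have "0 \<in> Q 0" by (rule ideal_of_closed(1)[OF prime_ofD(1)[OF Q]]) simp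
    finally have mem: "(\<Sum>as\<in>exponents (length gs) D. fun_scale (c as) (list_monomial gs as)) \<in> Q 0" .
    have "c as = 0"
    proof (rule prime_chain_independent[of gs X Q, OF _ _ mem as])
      show "prime_of (alg X) (Q i)" if "i \<le> length gs" for i using Q that len by simp
      show "Q i \<subseteq> Q (Suc i) \<and> gs ! i \<in> Q (Suc i) \<and> gs ! i \<notin> Q i" if "i < length gs" for i
        using sub[of i] g[of i] that len by (simp add: gs_def)
    qed
    then show False using nz by simp
  qed
qed

context coord_space
begin

text \<open>Dual vectors certify that the linear forms \<open>l\<close> are independent on
  \<open>V\<close>.\<close>

definition dual_system :: "nat \<Rightarrow> (nat \<Rightarrow> 'v \<Rightarrow> complex) \<Rightarrow> (nat \<Rightarrow> 'v) \<Rightarrow> bool" where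
  "dual_system c l u \<longleftrightarrow> (\<forall>i<c. hom X 1 (l i) \<and> u i \<in> V) \<and>
     (\<forall>i<c. \<forall>k<c. l i (u k) = (if i = k then 1 else 0))"

lemma dual_systemD:
  assumes "dual_system c l u" "i < c"
  shows "hom X 1 (l i)" "u i \<in> V" "k < c \<Longrightarrow> l i (u k) = (if i = k then 1 else 0)"
  using assms unfolding dual_system_def by blast+

lemma hom_1_comb: "hom X 1 h \<Longrightarrow> h (\<Sum>k\<in>T. s (a k) (w k)) = (\<Sum>k\<in>T. a k * h (w k))"
  by (simp only: hom_1_sum hom_1_linear(2))

lemma dual_system_comb:
  assumes "dual_system c l u" "i < c"
  shows "l i (\<Sum>k<c. s (a k) (u k)) = a i"
proof -
  have "l i (\<Sum>k<c. s (a k) (u k)) = (\<Sum>k<c. a k * l i (u k))"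
    by (rule hom_1_comb[OF dual_systemD(1)[OF assms]])
  also have "\<dots> = (\<Sum>k\<in>{i}. a k * l i (u k))"
    by (rule sum.mono_neutral_right) (use assms dual_systemD(3)[OF assms] in auto)
  finally show ?thesis using dual_systemD(3)[OF assms assms(2)] by simp
qed

lemma dual_system_le:
  assumes "dual_system c l u"
  shows "c \<le> card I"
proof (rule ccontr)
  assume "\<not> c \<le> card I"
  moreover have "card (bb ` I) \<le> card I" by (rule card_image_le[OF finI])
  ultimately have "card (bb ` I) < card {..<c}" by simp
  then obtain a where a: "\<exists>i\<in>{..<c}. a i \<noteq> 0" "(\<Sum>i<c. s (a i) (u i)) = 0"
    using family_dependent[of "bb ` I" "{..<c}" u] finI V_span dual_systemD(2)[OF assms] by auto
  then obtain i where i: "i < c" "a i \<noteq> 0" by blast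
  have "a i = l i 0" using dual_system_comb[OF assms i(1), of a] a(2) by simp
  then show False using i hom_1_linear(3)[OF dual_systemD(1)[OF assms i(1)]] by simp
qed

text \<open>A dual system inside \<open>\<Theta>\<close> of maximal size; the bound
  \<open>card I\<close> makes the maximum exist. If some \<open>\<theta> \<in> \<Theta>\<close> did
  not vanish on the common kernel, the system could be enlarged.\<close>

lemma dual_system_extend:
  assumes \<Theta>: "fun_space.subspace \<Theta>" "\<And>\<theta>. \<theta> \<in> \<Theta> \<Longrightarrow> hom X 1 \<theta>"
    and init: "dual_system c0 l0 u0" "\<And>i. i < c0 \<Longrightarrow> l0 i \<in> \<Theta>"
  obtains c l u where "c0 \<le> c" "dual_system c l u" "\<And>i. i < c0 \<Longrightarrow> l i = l0 i \<and> u i = u0 i"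
    "\<And>i. i < c \<Longrightarrow> l i \<in> \<Theta>"
    "\<And>v \<theta>. v \<in> V \<Longrightarrow> (\<And>i. i < c \<Longrightarrow> l i v = 0) \<Longrightarrow> \<theta> \<in> \<Theta> \<Longrightarrow> \<theta> v = 0"
proof -
  define E where "E c \<longleftrightarrow> c0 \<le> c \<and> (\<exists>l u. dual_system c l u \<and> (\<forall>i<c0. l i = l0 i \<and> u i = u0 i) \<and>
      (\<forall>i<c. l i \<in> \<Theta>))" for c
  define c where "c = (GREATEST c. E c)"
  have E0: "E c0" unfolding E_def using init by blast
  have bound: "d \<le> card I" if "E d" for d using that dual_system_le unfolding E_def by blast
  have "E c" unfolding c_def by (rule GreatestI_nat[of E c0 "card I"]) (use E0 bound in auto)
  then obtain l u where lu: "c0 \<le> c" "dual_system c l u" "\<forall>i<c0. l i = l0 i \<and> u i = u0 i" "\<forall>i<c. l i \<in> \<Theta>"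
    unfolding E_def by blast
  have "\<theta> v = 0" if v: "v \<in> V" "\<And>i. i < c \<Longrightarrow> l i v = 0" and \<theta>: "\<theta> \<in> \<Theta>" for v \<theta>
  proof (rule ccontr)
    assume nz: "\<theta> v \<noteq> 0"
    \<comment> \<open>Corrected to vanish on all old dual vectors and normalized to 1 at
      \<open>v\<close>, which becomes the new dual vector.\<close>
    define \<mu> where "\<mu> = fun_scale (1 / \<theta> v) (\<theta> - (\<Sum>i<c. fun_scale (\<theta> (u i)) (l i)))"
    have \<mu>\<Theta>: "\<mu> \<in> \<Theta>" unfolding \<mu>_def
      by (intro fun_space.subspace_scale[OF \<Theta>(1)] fun_space.subspace_diff[OF \<Theta>(1)] fun_space.subspace_sum[OF \<Theta>(1)] \<theta>)
        (use lu(4) in auto)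
    have \<mu>: "\<mu> z = (\<theta> z - (\<Sum>i<c. \<theta> (u i) * l i z)) / \<theta> v" for z
      unfolding \<mu>_def by (simp add: fun_apply minus_apply sum_fun_apply)
    have \<mu>u: "\<mu> (u k) = 0" if k: "k < c" for k
    proof -
      have "(\<Sum>i<c. \<theta> (u i) * l i (u k)) = (\<Sum>i\<in>{k}. \<theta> (u i) * l i (u k))"
        by (rule sum.mono_neutral_right) (use k dual_systemD(3)[OF lu(2)] in auto)
      then show ?thesis unfolding \<mu> using dual_systemD(3)[OF lu(2) k k] by simp
    qed
    have \<mu>v: "\<mu> v = 1" unfolding \<mu> using v(2) nz by simp
    have "dual_system (Suc c) (l(c := \<mu>)) (u(c := v))"
      unfolding dual_system_def
    proof (intro conjI allI impI)
      fix i assume "i < Suc c"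
      then show "hom X 1 ((l(c := \<mu>)) i)" "(u(c := v)) i \<in> V"
        using \<Theta>(2)[OF \<mu>\<Theta>] dual_systemD[OF lu(2)] v(1) by (auto simp: less_Suc_eq)
      fix k assume "k < Suc c"
      then show "(l(c := \<mu>)) i ((u(c := v)) k) = (if i = k then 1 else 0)"
        using \<open>i < Suc c\<close> \<mu>u \<mu>v v(2) dual_systemD(3)[OF lu(2)] by (auto simp: less_Suc_eq)
    qed
    then have "E (Suc c)" unfolding E_def using lu \<mu>\<Theta>
      by (intro conjI exI[of _ "l(c := \<mu>)"] exI[of _ "u(c := v)"]) (auto simp: less_Suc_eq)
    then have "Suc c \<le> c" unfolding c_def by (rule Greatest_le_nat[of E _ "card I"]) (use bound in auto)
    then show False by simp
  qed
  then show ?thesis using that lu by blast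
qed

lemma hom_1_zero_span:
  assumes "hom X 1 l" "\<And>b. b \<in> S \<Longrightarrow> l b = 0" "v \<in> span S"
  shows "l v = 0"
  using assms(3)
  by (induction rule: span_induct_alt) (simp_all add: hom_1_linear[OF assms(1)] assms(2))

lemma independent_bb: "independent (bb ` I)" "card (bb ` I) = card I"
proof -
  have inj: "inj_on bb I" by (rule inj_onI) (metis cc_bb zero_neq_one)
  then show "card (bb ` I) = card I" by (rule card_image)
  show "independent (bb ` I)"
    unfolding dependent_def
  proof (rule notI, elim bexE)
    fix a assume "a \<in> bb ` I" and a: "a \<in> span (bb ` I - {a})"
    then obtain i where i: "i \<in> I" "a = bb i" by blast
    have "cc i a = 0"
      by (rule hom_1_zero_span[OF hom_gen _ a]) (use i cc_bb in auto)
    then show False using cc_bb[OF i(1) i(1)] i(2) by simp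
  qed
qed

lemma dim_V: "dim V = card I"
proof -
  have "bb ` I \<subseteq> V" "V \<subseteq> span (bb ` I)" using bbV V_span by blast+
  from basis_card_eq_dim[OF this independent_bb(1)] show ?thesis using independent_bb(2) by simp
qed

lemma independent_in_V:
  assumes "independent S" "S \<subseteq> V"
  shows "finite S" "card S \<le> card I"
proof -
  have "S \<subseteq> span (bb ` I)" using assms(2) V_span by blast
  from independent_span_bound[OF finite_imageI[OF finI] assms(1) this]
  show "finite S" "card S \<le> card I" using independent_bb(2) by simp_all
qed

lemma independent_card_le:
  assumes "independent S" "S \<subseteq> T" "T \<subseteq> V"
  shows "card S \<le> dim T"
proof -
  obtain B where B: "B \<subseteq> T" "independent B" "T \<subseteq> span B" "card B = dim T" using basis_exists[of T] by metis
  have "finite B" by (rule independent_in_V(1)[OF B(2) order_trans[OF B(1) assms(3)]])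
  have "S \<subseteq> span B" by (rule order_trans[OF assms(2) B(3)])
  from independent_span_bound[OF \<open>finite B\<close> assms(1) this] show ?thesis by (simp add: B(4)[symmetric])
qed

lemma dim_mono_V: "S \<subseteq> T \<Longrightarrow> T \<subseteq> V \<Longrightarrow> dim S \<le> dim T"
proof -
  assume h: "S \<subseteq> T" "T \<subseteq> V"
  obtain B where B: "B \<subseteq> S" "independent B" "card B = dim S" using basis_exists[of S] by metis
  have "card B \<le> dim T" by (rule independent_card_le[OF B(2) order_trans[OF B(1) h(1)] h(2)])
  then show ?thesis using B(3) by simp
qed

text \<open>A basis of the kernel together with the dual vectors is a basis of
  \<open>V\<close>.\<close>

lemma dim_kernel:
  assumes d: "dual_system c l u"
  shows "dim {v \<in> V. \<forall>i<c. l i v = 0} + c = card I"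
proof -
  let ?K = "{v \<in> V. \<forall>i<c. l i v = 0}"
  obtain B where B: "B \<subseteq> ?K" "independent B" "?K \<subseteq> span B" "card B = dim ?K" 
    by (rule basis_exists[of ?K])
  have "B \<subseteq> V" using B(1) by (rule order_trans) (rule Collect_subset)
  then have finB: "finite B" by (rule independent_in_V(1)[OF B(2)])
  have ind: "independent (B \<union> u ` {..<k}) \<and> card (B \<union> u ` {..<k}) = card B + k" if "k \<le> c" for k
    using that
  proof (induction k)
    case 0 then show ?case using B(2) by simp
  next
    case (Suc k)
    have k: "k < c" using Suc.prems by simp
    have "u k \<notin> span (B \<union> u ` {..<k})"
    proof
      assume a: "u k \<in> span (B \<union> u ` {..<k})"
      have "l k (u k) = 0"
      proof (rule hom_1_zero_span[OF dual_systemD(1)[OF d k] _ a])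
        fix b assume b: "b \<in> B \<union> u ` {..<k}"
        then show "l k b = 0"
        proof
          assume "b \<in> u ` {..<k}"
          then obtain i where "i < k" "b = u i" by blast
          then show ?thesis using dual_systemD(3)[OF d k, of i] k by simp
        qed (use B(1) k in blast)
      qed
      then show False using dual_systemD(3)[OF d k k] by simp
    qed
    then have 1: "independent (insert (u k) (B \<union> u ` {..<k}))"
      by (rule independent_insertI) (use Suc in simp)
    have "u k \<notin> B \<union> u ` {..<k}"
      by (rule notI, rule notE[OF \<open>u k \<notin> span (B \<union> u ` {..<k})\<close>], rule span_base)
    then have 2: "card (insert (u k) (B \<union> u ` {..<k})) = Suc (card B + k)"
      using Suc finB by simp
    have "B \<union> u ` {..<Suc k} = insert (u k) (B \<union> u ` {..<k})" by (auto simp: less_Suc_eq)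
    then show ?case using 1 2 by simp
  qed
  have "V \<subseteq> span (B \<union> u ` {..<c})"
  proof
    fix v assume v: "v \<in> V"
    define w where "w = (\<Sum>i<c. s (l i v) (u i))"
    have w: "w \<in> V" unfolding w_def by (intro V_closed dual_systemD(2)[OF d]) auto
    have "l i (v - w) = 0" if i: "i < c" for i
    proof -
      have "l i (v - w) + l i w = l i v" by (simp add: hom_1_linear(1)[OF dual_systemD(1)[OF d i], symmetric])
      moreover have "l i w = l i v" unfolding w_def by (rule dual_system_comb[OF d i])
      ultimately show ?thesis by simp
    qed
    then have "v - w \<in> span B" using B(3) v w V_closed(5) by blast
    then have "v - w \<in> span (B \<union> u ` {..<c})" using span_mono[of B "B \<union> u ` {..<c}"] by blast
    moreover have "w \<in> span (B \<union> u ` {..<c})"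
      unfolding w_def by (intro span_sum span_scale span_base) auto
    ultimately have "v - w + w \<in> span (B \<union> u ` {..<c})" by (rule span_add)
    then show "v \<in> span (B \<union> u ` {..<c})" by simp
  qed
  then have "card (B \<union> u ` {..<c}) = dim V"
    using basis_card_eq_dim[of "B \<union> u ` {..<c}" V] ind[of c] \<open>B \<subseteq> V\<close> dual_systemD(2)[OF d] by auto
  then show ?thesis using ind[of c] B(4) dim_V by simp
qed

lemma translate_alg: "f \<in> alg X \<Longrightarrow> (\<lambda>v. f (v + w)) \<in> alg X"
proof (induction rule: alg.induct)
  case (const c) show ?case by (rule alg.const)
next
  case (gen x)
  have "(\<lambda>v. x (v + w)) = x + (\<lambda>_. x w)" using lin_add[OF gen] by (auto simp: fun_eq_iff fun_apply)
  then show ?case using alg.add[OF alg.gen[OF gen] alg.const] by simp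
next
  case (add f g)
  have "(\<lambda>v. (f + g) (v + w)) = (\<lambda>v. f (v + w)) + (\<lambda>v. g (v + w))" by (auto simp: fun_eq_iff fun_apply)
  then show ?case using alg.add[OF add.IH] by simp
next
  case (mult f g)
  have "(\<lambda>v. (f * g) (v + w)) = (\<lambda>v. f (v + w)) * (\<lambda>v. g (v + w))" by (auto simp: fun_eq_iff fun_apply)
  then show ?case using alg.mult[OF mult.IH] by simp
qed

lemma linear_part:
  assumes "g \<in> alg X"
  shows "\<exists>l. hom X 1 l \<and> g - (\<lambda>_. g 0) - l \<in> tail X 2"
proof -
  obtain e where e: "hom X 0 e" "g - e \<in> tail X (Suc 0)" using tail_split[OF alg_tail_0[OF assms]] by blast
  obtain c where c: "e = (\<lambda>_. c)" using hom_0_const[OF e(1)] by blast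
  have "(g - e) 0 = 0" by (rule tail_pos_0[OF e(2)]) simp
  then have "e = (\<lambda>_. g 0)" by (simp add: c minus_apply)
  then obtain l where "hom X (Suc 0) l" "g - (\<lambda>_. g 0) - l \<in> tail X (Suc (Suc 0))"
    using tail_split[of "g - (\<lambda>_. g 0)"] e(2) by blast
  then show ?thesis by (auto simp: numeral_2_eq_2)
qed

text \<open>Moves the point \<open>w\<close> to the origin, where orders are measured by
  \<open>tail\<close>, and identifies the linear part with the polarization that defines the affine
  tangent space.\<close>

lemma differential:
  assumes \<phi>: "\<phi> \<in> sym_forms s V (Suc d)" and w: "w \<in> V"
  obtains g l where "g \<in> alg X" "\<And>v. v \<in> V \<Longrightarrow> g v = \<phi> (replicate (Suc d) (v + w))" "hom X 1 l"
    "g - (\<lambda>_. \<phi> (replicate (Suc d) w)) - l \<in> tail X 2"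
    "\<And>v. v \<in> V \<Longrightarrow> l v = of_nat (Suc d) * \<phi> (v # replicate d w)"
proof -
  obtain h where h: "hom X (Suc d) h" "\<And>v. v \<in> V \<Longrightarrow> h v = \<phi> (replicate (Suc d) v)"
    using form_to_hom[OF \<phi>] by blast
  define g where "g = (\<lambda>v. h (v + w))"
  have g: "g \<in> alg X" unfolding g_def by (rule translate_alg[OF hom_alg[OF h(1)]])
  have gv: "g v = \<phi> (replicate (Suc d) (v + w))" if "v \<in> V" for v
    unfolding g_def using h(2) V_closed(1)[OF that w] by simp
  have g0: "g 0 = \<phi> (replicate (Suc d) w)" using gv[OF V_closed(3)] by simp
  obtain l where l: "hom X 1 l" "g - (\<lambda>_. g 0) - l \<in> tail X 2" using linear_part[OF g] by blast
  have "l v = of_nat (Suc d) * \<phi> (v # replicate d w)" if v: "v \<in> V" for v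
  proof -
    \<comment> \<open>On the line through \<open>v\<close>, \<open>t * (R t - l v)\<close> is the
      remainder of order 2, so \<open>R 0 = l v\<close>.\<close>
    define R where "R t = (\<Sum>j<Suc d. \<phi> (v # replicate j (w + s t v) @ replicate (d - j) w))" for t
    have polyR: "polyfun R"
      unfolding R_def by (rule telescope_polyfun(1)[OF \<phi> w path_intros(1) v])
    have "vanishes_to_order 2 (\<lambda>t. (g - (\<lambda>_. g 0) - l) (s t v))" by (rule tail_path[OF l(2) path_intros(1)])
    moreover have "(g - (\<lambda>_. g 0) - l) (s t v) = t * (R t - l v)" for t
    proof -
      have "g (s t v) = \<phi> (replicate (Suc d) (w + s t v))"
        using gv[OF V_closed(2)[OF v]] by (simp add: add.commute)
      also have "\<dots> = g 0 + t * R t" unfolding g0 R_def by (rule form_telescope[OF \<phi> w v])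
      finally show ?thesis by (simp add: minus_apply fun_apply hom_1_linear(2)[OF l(1)] algebra_simps)
    qed
    ultimately have "vanishes_to_order (1 + 1) (\<lambda>t. t * (R t - l v))" by (simp add: numeral_2_eq_2)
    then have "vanishes_to_order 1 (\<lambda>t. R t - l v)"
      by (rule vanishes_to_order_cancel) (intro polyfun_diff polyR polyfun_intros)
    then obtain q where "\<And>t. R t - l v = t ^ 1 * q t" by (rule vanishes_to_orderE) blast
    from this[of 0] have "R 0 - l v = 0" by simp
    moreover have "R 0 = of_nat (Suc d) * \<phi> (v # replicate d w)"
      unfolding R_def by (rule telescope_polyfun(2)[OF \<phi> w path_intros(1) v])
    ultimately show ?thesis by simp
  qed
  then show ?thesis using that[OF g gv l(1)] l(2) g0 by simp
qed

lemma prime_translated_vanishing: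
  assumes "irreducible_closed s V Z"
  shows "prime_of (alg X) {g \<in> alg X. \<forall>v\<in>\<Union>Z. g (v - w) = 0}"
proof -
  let ?J = "{g \<in> alg X. \<forall>v\<in>\<Union>Z. g (v - w) = 0}"
  have J: "g \<in> ?J \<longleftrightarrow> (\<lambda>v. g (v - w)) \<in> vanishing Z" if "g \<in> alg X" for g
    using that translate_alg[OF that, of "- w"] unfolding vanishing_def by simp
  note P = prime_vanishing[OF assms]
  have one: "(\<lambda>v. (1 :: 'v \<Rightarrow> complex) (v - w)) = 1" by (auto simp: fun_eq_iff fun_apply)
  have mult: "(\<lambda>v. (g * h) (v - w)) = (\<lambda>v. g (v - w)) * (\<lambda>v. h (v - w))" for g h :: "'v \<Rightarrow> complex"
    by (auto simp: fun_eq_iff fun_apply)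
  have al: "(\<lambda>v. g (v - w)) \<in> alg X" if "g \<in> alg X" for g using translate_alg[OF that, of "- w"] by simp
  have ideal: "ideal_of (alg X) ?J"
    unfolding ideal_of_def by (auto simp: fun_apply intro: alg_zero alg.add alg.mult)
  show ?thesis
    unfolding prime_of_def
  proof (intro conjI ballI impI ideal)
    show "1 \<notin> ?J" using J[OF alg_closed(1)] one prime_ofD(2)[OF P] by simp
    fix g h assume gh: "g \<in> alg X" "h \<in> alg X" "g * h \<in> ?J"
    then have "(\<lambda>v. g (v - w)) * (\<lambda>v. h (v - w)) \<in> vanishing Z" using J[OF alg.mult[OF gh(1,2)]] mult by simp
    then show "g \<in> ?J \<or> h \<in> ?J" using prime_ofD(3)[OF P al[OF gh(1)] al[OF gh(2)]] J gh by blast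
  qed
qed

lemma prime_point: "prime_of (alg X) {g \<in> alg X. g p = 0}"
  unfolding prime_of_def ideal_of_def by (auto simp: fun_apply intro: alg_zero alg.add alg.mult)

text \<open>The chain of irreducible sets through the point continues upwards, through the primes of the
  germs cut out by fewer and fewer of the equations, and downwards to the vertex of the cone.\<close>

lemma chain_bound:
  assumes reg: "regular_sequence s X c f l u"
    and chain: "\<And>i. i \<le> n \<Longrightarrow> irreducible_closed s V (Z i) \<and> x \<in> Z i" "\<And>i. i < n \<Longrightarrow> Z i \<subset> Z (Suc i)"
    and x: "x = span {w}" "w \<noteq> 0" "w \<in> V"
    and f: "\<And>i v. i < c \<Longrightarrow> v \<in> \<Union>(Z n) \<Longrightarrow> f i (v - w) = 0"
  shows "n + 1 + c \<le> card I"
proof -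
  interpret reg: regular_sequence s X c f l u by (rule reg)
  define J where "J k = {g \<in> alg X. \<forall>v\<in>\<Union>(Z k). g (v - w) = 0}" for k
  have J: "prime_of (alg X) (J k)" if "k \<le> n" for k
    unfolding J_def by (rule prime_translated_vanishing) (use chain(1) that in blast)
  have closed: "zariski_closed s V (Z i)" if "i \<le> n" for i
    using chain(1)[OF that] unfolding irreducible_closed_def by blast
  have w: "w \<in> \<Union>(Z i)" if "i \<le> n" for i using chain(1)[OF that] x(1) span_base by blast
  have gen_J: "reg.gen_ideal c \<subseteq> J n"
  proof
    fix h assume "h \<in> reg.gen_ideal c"
    then obtain a where a: "\<forall>i. a i \<in> alg X" "h = (\<Sum>i<c. a i * f i)" using reg.gen_idealE by blast
    have "h \<in> alg X" unfolding a(2) by (rule subring_of_sum[OF subring_alg]) (use a(1) reg.f_alg in \<open>auto intro: alg.mult\<close>)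
    moreover have "h (v - w) = 0" if "v \<in> \<Union>(Z n)" for v
      unfolding a(2) sum_fun_apply using f that by (intro sum.neutral) (simp add: fun_apply)
    ultimately show "h \<in> J n" unfolding J_def by blast
  qed
  \<comment> \<open>The prime \<open>J n\<close> contains \<open>gen_ideal c\<close> but not the
    factor \<open>1 - a\<close>, which is 1 at the point; so it contains the whole germ
    ideal.\<close>
  have germ_J: "reg.germ_ideal c \<subseteq> J n"
  proof
    fix g assume g: "g \<in> reg.germ_ideal c"
    obtain a where a: "a \<in> alg X" "a 0 = 0" "(1 - a) * g \<in> reg.gen_ideal c"
      using reg.germ_ideal_unit[OF order_refl g] by blast
    have "(1 - a) * g \<in> J n" using a(3) gen_J by blast
    moreover have "1 - a \<in> alg X" by (rule alg_closed(4)[OF alg_closed(1) a(1)])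
    moreover have "g \<in> alg X" by (rule ideal_of_closed(4)[OF reg.ideal_germ_ideal[OF order_refl] g])
    moreover have "(1 - a) (w - w) \<noteq> 0" using a(2) by (simp add: minus_apply fun_apply)
    then have "1 - a \<notin> J n" unfolding J_def using w[of n] by blast
    ultimately show "g \<in> J n" using prime_ofD(3)[OF J[OF order_refl]] by blast
  qed
  \<comment> \<open>In total \<open>c + n + 2\<close> primes: the germs, the cones translated so
    that \<open>w\<close> is the origin, and the vertex, which has moved to
    \<open>- w\<close>.\<close>
  define Q where "Q i = (if i < c then reg.germ_ideal i else if i \<le> c + n then J (c + n - i)
      else {g \<in> alg X. g (- w) = 0})" for i
  have "c + n + 1 \<le> card X"
  proof (rule prime_chain_bound[OF finX, of _ Q])
    fix i assume "i \<le> c + n + 1"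
    then show "prime_of (alg X) (Q i)"
      unfolding Q_def using reg.prime_germ_ideal[of i] J[of "c + n - i"] prime_point by auto
  next
    fix i assume i: "i < c + n + 1"
    consider "Suc i < c" | "Suc i = c" | "c \<le> i" "i < c + n" | "i = c + n" using i by linarith
    then show "Q i \<subseteq> Q (Suc i) \<and> (\<exists>g\<in>Q (Suc i). g \<notin> Q i)"
    proof cases
      case 1
      then show ?thesis
        using reg.germ_ideal_mono[of i "Suc i"] reg.f_germ_ideal[of i "Suc i"] reg.f_notin_germ_ideal[of i]
        unfolding Q_def by auto
    next
      case 2
      then show ?thesis
        using reg.germ_ideal_mono[of i c] reg.f_germ_ideal[of i c] reg.f_notin_germ_ideal[of i] germ_J
        unfolding Q_def by auto
    next
      case 3
      define k where "k = c + n - Suc i"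
      have k: "k < n" "c + n - i = Suc k" using 3 unfolding k_def by auto
      have Qk: "Q i = J (Suc k)" "Q (Suc i) = J k" using 3 k(2) unfolding k_def Q_def by auto
      have sub: "J (Suc k) \<subseteq> J k" using chain(2)[OF k(1)] unfolding J_def by blast
      obtain h where h: "h \<in> vanishing (Z k)" "h \<notin> vanishing (Z (Suc k))"
        using vanishing_strict[OF closed chain(2)[OF k(1)] zariski_closed_subset[OF closed]] k(1) by auto
      define g where "g = (\<lambda>v. h (v + w))"
      have "g \<in> alg X" unfolding g_def by (rule translate_alg) (use h(1) in \<open>auto simp: vanishing_def\<close>)
      then have "g \<in> J k" "g \<notin> J (Suc k)" using h unfolding J_def g_def vanishing_def by auto
      then show ?thesis using sub Qk by blast
    next
      case 4
      have Qi: "Q i = J 0" "Q (Suc i) = {g \<in> alg X. g (- w) = 0}" unfolding Q_def 4 by auto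
      have "0 \<in> \<Union>(Z 0)" using cone_scale[OF zariski_closed_subset[OF closed[of 0]] w[of 0], of 0] by simp
      then have sub: "Q i \<subseteq> Q (Suc i)" unfolding Qi J_def by force
      have "\<exists>i\<in>I. cc i w \<noteq> 0"
      proof (rule ccontr)
        assume "\<not> ?thesis"
        then have "w = 0" using expand[OF x(3)] by simp
        then show False using x(2) by simp
      qed
      then obtain k where k: "k \<in> I" "cc k w \<noteq> 0" by blast
      define g where "g = (\<lambda>v. cc k (v + w))"
      have "g \<in> alg X" unfolding g_def by (rule translate_alg[OF alg.gen]) (use k in auto)
      moreover have "g (- w) = 0" unfolding g_def using lin_zero k(1) by simp
      moreover have "g (w - w) \<noteq> 0" unfolding g_def using k(2) by simp
      ultimately show ?thesis using sub w[of 0] unfolding Qi J_def by blast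
    qed
  qed
  then show ?thesis using card_X by simp
qed

end

context coord_space
begin

lemma form_homogeneous_tail:
  assumes "\<phi> \<in> sym_forms s V (Suc d)" "z \<in> V" "v \<in> V"
  shows "\<phi> (z # replicate d (s c v)) = c ^ d * \<phi> (z # replicate d v)"
  using form_homogeneous[OF sym_forms_contract[OF assms(1,2)] assms(3), of c] by (simp add: contract_def)

lemma affine_tangent_space_at:
  assumes "w \<in> V"
  shows "affine_tangent_space s V Y (span {w}) = {z \<in> V. \<forall>d. \<forall>\<phi>\<in>sym_forms s V (Suc d).
     (\<forall>y\<in>Y. \<forall>v\<in>y. \<phi> (replicate (Suc d) v) = 0) \<longrightarrow> \<phi> (z # replicate d w) = 0}"
proof -
  have "(\<forall>v\<in>span {w}. \<phi> (z # replicate d v) = 0) \<longleftrightarrow> \<phi> (z # replicate d w) = 0"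
    if "\<phi> \<in> sym_forms s V (Suc d)" "z \<in> V" for \<phi> d z
    using form_homogeneous_tail[OF that assms] span_base[of w "{w}"] by (auto simp: in_span_single)
  then show ?thesis unfolding affine_tangent_space_def by (simp del: replicate_Suc cong: conj_cong ball_cong)
qed

lemma tangent_subset: "affine_tangent_space s V Y x \<subseteq> V"
  unfolding affine_tangent_space_def by blast

text \<open>Among the functions vanishing on \<open>Y\<close>, some \<open>c\<close> have
  independent differentials at \<open>w\<close> whose common kernel lies in the tangent space
  \<open>T\<close>. For these \<open>chain_bound\<close> gives
  \<open>n + 1 + c \<le> card I\<close>, and \<open>card I \<le> dim T + c\<close>.\<close>

lemma local_dim_le:
  assumes Y: "Y \<subseteq> proj_space s V" "x \<in> Y"
  shows "local_dim s V Y x + 1 \<le> enat (dim (affine_tangent_space s V Y x))"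
proof -
  obtain w where w: "w \<in> V" "w \<noteq> 0" "x = span {w}" using Y by (blast elim: proj_spaceE)
  define T where "T = affine_tangent_space s V Y x"
  note T = affine_tangent_space_at[OF w(1), of Y, folded w(3), folded T_def]
  have TV: "T \<subseteq> V" unfolding T by blast
  have wx: "w \<in> x" unfolding w(3) by (rule span_base) simp
  have wT: "w \<in> T"
    unfolding T using w(1) wx Y(2) by auto
  \<comment> \<open>Differentials at \<open>w\<close> of all polynomials, not only forms, that
    vanish on the cone over \<open>Y\<close>.\<close>
  define \<Theta> where "\<Theta> = {l. hom X 1 l \<and> (\<exists>f\<in>alg X. (\<forall>v\<in>\<Union>Y. f (v - w) = 0) \<and> f - l \<in> tail X 2)}"
  have sub: "fun_space.subspace \<Theta>"
  proof (rule fun_space.subspaceI)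
    show "0 \<in> \<Theta>" unfolding \<Theta>_def
      using hom.zero[of X 1] alg_zero[of X] tail_zero[of X 2]
      by (intro CollectI conjI bexI[of _ 0]) (simp_all add: fun_apply)
  next
    fix l k assume "l \<in> \<Theta>" "k \<in> \<Theta>"
    then obtain f g where l: "hom X 1 l" "f \<in> alg X" "\<forall>v\<in>\<Union>Y. f (v - w) = 0" "f - l \<in> tail X 2"
      and k: "hom X 1 k" "g \<in> alg X" "\<forall>v\<in>\<Union>Y. g (v - w) = 0" "g - k \<in> tail X 2" unfolding \<Theta>_def by blast
    have "f + g - (l + k) = (f - l) + (g - k)" by simp
    then have "f + g - (l + k) \<in> tail X 2" using tail.add[OF l(4) k(4)] by (simp only:)
    moreover have "\<forall>v\<in>\<Union>Y. (f + g) (v - w) = 0" using l(3) k(3) by (simp add: fun_apply)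
    ultimately show "l + k \<in> \<Theta>" unfolding \<Theta>_def using hom.add[OF l(1) k(1)] alg.add[OF l(2) k(2)] by blast
  next
    fix a l assume "l \<in> \<Theta>"
    then obtain f where l: "hom X 1 l" "f \<in> alg X" "\<forall>v\<in>\<Union>Y. f (v - w) = 0" "f - l \<in> tail X 2" unfolding \<Theta>_def by blast
    have "fun_scale a f - fun_scale a l = fun_scale a (f - l)" by (auto simp: fun_eq_iff fun_apply minus_apply algebra_simps)
    then have "fun_scale a f - fun_scale a l \<in> tail X 2" using ideal_scale[OF ideal_tail l(4)] by simp
    moreover have "\<forall>v\<in>\<Union>Y. (fun_scale a f) (v - w) = 0" using l(3) by (simp add: fun_apply)
    ultimately show "fun_scale a l \<in> \<Theta>" unfolding \<Theta>_def using hom_scale[OF l(1)] alg_scale[OF l(2)] by blast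
  qed
  have homs: "hom X 1 \<theta>" if "\<theta> \<in> \<Theta>" for \<theta> using that unfolding \<Theta>_def by blast
  have d0: "dual_system 0 (\<lambda>_ _. 0) (\<lambda>_. 0)" unfolding dual_system_def by simp
  have "\<exists>c l u. dual_system c l u \<and> (\<forall>i<c. l i \<in> \<Theta>) \<and> (\<forall>v\<in>V. (\<forall>i<c. l i v = 0) \<longrightarrow> (\<forall>\<theta>\<in>\<Theta>. \<theta> v = 0))"
  proof (rule dual_system_extend[OF sub homs d0])
    fix c l u
    assume 1: "dual_system c l u" and 2: "\<And>i. i < c \<Longrightarrow> l i \<in> \<Theta>"
      and 3: "\<And>v \<theta>. v \<in> V \<Longrightarrow> (\<And>i. i < c \<Longrightarrow> l i v = 0) \<Longrightarrow> \<theta> \<in> \<Theta> \<Longrightarrow> \<theta> v = 0"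
    have "\<theta> v = 0" if "v \<in> V" "\<forall>i<c. l i v = 0" "\<theta> \<in> \<Theta>" for v \<theta>
      by (rule 3[OF that(1) _ that(3)]) (use that(2) in blast)
    then show ?thesis using 1 2 by (intro exI[of _ c] exI[of _ l] exI[of _ u]) blast
  qed (assumption, simp)
  then obtain c l u where d: "dual_system c l u" and l\<Theta>: "\<And>i. i < c \<Longrightarrow> l i \<in> \<Theta>"
    and ker: "\<And>v \<theta>. v \<in> V \<Longrightarrow> (\<And>i. i < c \<Longrightarrow> l i v = 0) \<Longrightarrow> \<theta> \<in> \<Theta> \<Longrightarrow> \<theta> v = 0" by blast
  have "\<forall>i. \<exists>f. i < c \<longrightarrow> f \<in> alg X \<and> (\<forall>v\<in>\<Union>Y. f (v - w) = 0) \<and> f - l i \<in> tail X 2"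
    using l\<Theta> unfolding \<Theta>_def by blast
  then obtain f where f: "\<And>i. i < c \<Longrightarrow> f i \<in> alg X \<and> (\<forall>v\<in>\<Union>Y. f i (v - w) = 0) \<and> f i - l i \<in> tail X 2" by metis
  have reg: "regular_sequence s X c f l u"
    by unfold_locales (use f dual_systemD[OF d] in auto)
  have "{v \<in> V. \<forall>i<c. l i v = 0} \<subseteq> T"
  proof
    fix z assume z: "z \<in> {v \<in> V. \<forall>i<c. l i v = 0}"
    have "\<phi> (z # replicate d w) = 0"
      if \<phi>: "\<phi> \<in> sym_forms s V (Suc d)" "\<forall>y\<in>Y. \<forall>v\<in>y. \<phi> (replicate (Suc d) v) = 0" for d \<phi>
    proof -
      obtain g k where g: "g \<in> alg X" "\<And>v. v \<in> V \<Longrightarrow> g v = \<phi> (replicate (Suc d) (v + w))" "hom X 1 k"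
        "g - (\<lambda>_. \<phi> (replicate (Suc d) w)) - k \<in> tail X 2"
        "\<And>v. v \<in> V \<Longrightarrow> k v = of_nat (Suc d) * \<phi> (v # replicate d w)"
        by (rule differential[OF \<phi>(1) w(1)]) blast
      have "\<phi> (replicate (Suc d) w) = 0" using \<phi>(2) Y(2) wx by blast
      then have "g - (\<lambda>_. \<phi> (replicate (Suc d) w)) = g" by (auto simp: fun_eq_iff minus_apply)
      then have "g - k \<in> tail X 2" using g(4) by simp
      moreover have "g (v - w) = 0" if v: "v \<in> \<Union>Y" for v
      proof -
        have "v \<in> V" by (rule cone_subset[OF Y(1) v])
        then show ?thesis using g(2)[of "v - w"] V_closed(5) w(1) \<phi>(2) v by (simp del: replicate_Suc) blast
      qed
      ultimately have "k \<in> \<Theta>" unfolding \<Theta>_def using g(1,3) by blast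
      then have "k z = 0" using ker[of z k] z by blast
      then show ?thesis using g(5)[of z] z by (simp del: of_nat_Suc)
    qed
    then show "z \<in> T" unfolding T using z by blast
  qed
  from dim_mono_V[OF this TV] have dimT: "card I \<le> dim T + c" using dim_kernel[OF d] by simp
  have "independent {w}" using w(2) by simp
  then have "card {w} \<le> dim T" by (rule independent_card_le) (use wT TV in auto)
  then obtain k where k: "dim T = Suc k" by (cases "dim T") auto
  have "local_dim s V Y x \<le> enat k"
    unfolding local_dim_def
  proof (rule Sup_least, clarify)
    fix n Z assume Z: "\<forall>i\<le>n. irreducible_closed s V (Z i) \<and> x \<in> Z i \<and> Z i \<subseteq> Y" "\<forall>i<n. Z i \<subset> Z (Suc i)"
    have "n + 1 + c \<le> card I"
    proof (rule chain_bound[OF reg _ _ w(3,2,1)])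
      show "f i (v - w) = 0" if "i < c" "v \<in> \<Union>(Z n)" for i v using f[OF that(1)] that(2) Z(1) by blast
    qed (use Z in blast)+
    then show "enat n \<le> enat k" using dimT k by simp
  qed
  then have "local_dim s V Y x + 1 \<le> enat k + 1" by (rule add_right_mono)
  then show ?thesis using k unfolding T_def by (simp add: one_enat_def)
qed

text \<open>The germs cut out by more and more equations extend to irreducible closed sets.\<close>

lemma local_dim_ge:
  assumes reg: "regular_sequence s X N f l u" and c: "c \<le> N" and UNIV: "V = UNIV"
    and x: "x = span {w}" "w \<noteq> 0"
    and forms: "\<And>i. i < N \<Longrightarrow> \<exists>d. \<exists>\<psi>\<in>sym_forms s V d. \<forall>v. f i v = \<psi> (replicate d (v + w))"
    and Y: "\<And>y. y \<in> proj_space s V \<Longrightarrow>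
      (\<And>d \<phi>. \<phi> \<in> sym_forms s V d \<Longrightarrow> (\<lambda>v. \<phi> (replicate d (v + w))) \<in> regular_sequence.germ_ideal X f c \<Longrightarrow>
        \<forall>v\<in>y. \<phi> (replicate d v) = 0) \<Longrightarrow> y \<in> Y"
  shows "enat (N - c) \<le> local_dim s V Y x"
proof -
  interpret reg: regular_sequence s X N f l u by (rule reg)
  \<comment> \<open>Translation moves \<open>w\<close> to the origin, where the germs live.\<close>
  define tr where "tr d \<phi> = (\<lambda>v. \<phi> (replicate d (v + w)) :: complex)" for d \<phi>
  define S where "S j = {(d, \<phi>). \<phi> \<in> sym_forms s V d \<and> tr d \<phi> \<in> reg.germ_ideal j}" for j
  define Z where "Z j = proj_zeros s V (S j)" for j
  have trX: "tr d \<phi> \<in> alg X" if \<phi>: "\<phi> \<in> sym_forms s V d" for d \<phi>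
  proof -
    obtain h where h: "hom X d h" "\<forall>v\<in>V. h v = \<phi> (replicate d v)" using form_to_hom[OF \<phi>] by blast
    then have "tr d \<phi> = (\<lambda>v. h (v + w))" unfolding tr_def UNIV by auto
    then show ?thesis using translate_alg[OF hom_alg[OF h(1)]] by simp
  qed
  have closed: "zariski_closed s V (Z j)" for j
    unfolding zariski_closed_def Z_def by (rule exI[of _ "S j"]) (auto simp: S_def)
  have xP: "x \<in> proj_space s V" unfolding proj_space_def x(1) UNIV using x(2) by blast
  have line: "(\<forall>v\<in>span {p}. \<phi> (replicate d v) = 0) \<longleftrightarrow> \<phi> (replicate d p) = 0"
    if "\<phi> \<in> sym_forms s V d" for \<phi> d p
    by (rule form_zero_on_line[OF that]) (simp add: UNIV)
  have point: "span {p} \<in> Z j" if "p \<noteq> 0" "\<And>g. g \<in> reg.germ_ideal j \<Longrightarrow> g (p - w) = 0" for p j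
  proof -
    have "span {p} \<in> proj_space s V" unfolding proj_space_def UNIV using that(1) by blast
    moreover have "\<forall>v\<in>span {p}. \<phi> (replicate d v) = 0" if "(d, \<phi>) \<in> S j" for d \<phi>
    proof -
      have \<phi>: "\<phi> \<in> sym_forms s V d" "tr d \<phi> \<in> reg.germ_ideal j" using that unfolding S_def by auto
      have "tr d \<phi> (p - w) = 0" using \<open>\<And>g. g \<in> reg.germ_ideal j \<Longrightarrow> g (p - w) = 0\<close> \<phi>(2) by blast
      then show ?thesis using line[OF \<phi>(1)] unfolding tr_def by simp
    qed
    ultimately show ?thesis unfolding Z_def proj_zeros_def by blast
  qed
  have xZ: "x \<in> Z j" if "j \<le> N" for j
    unfolding x(1) by (rule point[OF x(2)]) (use reg.germ_ideal_at_0[OF that] in simp)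
  \<comment> \<open>Irreducibility asks for a point of \<open>Z j\<close> at which two given forms
    are both nonzero; primality of the germ ideal and the Nullstellensatz for the product provide
    it.\<close>
  have nss: "\<exists>y\<in>Z j. \<not> (\<forall>v\<in>y. \<phi> (replicate d v) = 0) \<and> \<not> (\<forall>v\<in>y. \<psi> (replicate e v) = 0)"
    if j: "j \<le> N" and \<phi>: "\<phi> \<in> sym_forms s V d" "tr d \<phi> \<notin> reg.germ_ideal j"
      and \<psi>: "\<psi> \<in> sym_forms s V e" "tr e \<psi> \<notin> reg.germ_ideal j" for j d \<phi> e \<psi>
  proof -
    note prime = reg.prime_germ_ideal[OF j]
    have "tr d \<phi> * tr e \<psi> \<notin> reg.germ_ideal j" using prime_ofD(3)[OF prime trX[OF \<phi>(1)] trX[OF \<psi>(1)]] \<phi>(2) \<psi>(2) by blast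
    moreover have "\<exists>v. \<forall>x\<in>X. x v = \<alpha> x" for \<alpha> using coords_exist by blast
    ultimately obtain v where v: "\<forall>g\<in>reg.germ_ideal j. g v = 0" "(tr d \<phi> * tr e \<psi>) v \<noteq> 0"
      using nullstellensatz[OF finX _ prime alg.mult[OF trX[OF \<phi>(1)] trX[OF \<psi>(1)]]] by blast
    \<comment> \<open>The zero vector is no projective point. A form that does not vanish there has
      degree 0, so \<open>w\<close> serves equally well.\<close>
    define p where "p = (if v + w = 0 then w else v + w)"
    have p0: "p \<noteq> 0" using x(2) unfolding p_def by simp
    have pv: "g (p - w) = 0" if "g \<in> reg.germ_ideal j" for g
      using v(1) reg.germ_ideal_at_0[OF j] that unfolding p_def by auto
    have nz: "\<chi> (replicate k p) \<noteq> 0" if \<chi>: "\<chi> \<in> sym_forms s V k" "tr k \<chi> v \<noteq> 0" for \<chi> k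
    proof (cases "v + w = 0")
      case False then show ?thesis using \<chi>(2) unfolding p_def tr_def by simp
    next
      case True
      then have "\<chi> (replicate k 0) \<noteq> 0" using \<chi>(2) unfolding tr_def by simp
      moreover have "\<chi> (replicate k (s 0 w)) = 0 ^ k * \<chi> (replicate k w)"
        by (rule form_homogeneous[OF \<chi>(1)]) (simp add: UNIV)
      ultimately have "k = 0" by (cases k) auto
      then show ?thesis using \<chi>(2) unfolding tr_def by simp
    qed
    have "span {p} \<in> Z j" by (rule point[of p j]) (use p0 pv in auto)
    moreover have "\<phi> (replicate d p) \<noteq> 0" "\<psi> (replicate e p) \<noteq> 0"
      using nz[OF \<phi>(1)] nz[OF \<psi>(1)] v(2) by (auto simp: fun_apply)
    ultimately show ?thesis using line[OF \<phi>(1)] line[OF \<psi>(1)] by blast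
  qed
  have irr: "irreducible_closed s V (Z j)" if j: "j \<le> N" for j
    unfolding irreducible_closed_def
  proof (intro conjI allI impI closed)
    show "Z j \<noteq> {}" using xZ[OF j] by blast
    fix A B assume AB: "zariski_closed s V A \<and> zariski_closed s V B \<and> Z j = A \<union> B"
    obtain SA SB where SA: "SA \<subseteq> (SIGMA d:UNIV. sym_forms s V d)" "A = proj_zeros s V SA"
      and SB: "SB \<subseteq> (SIGMA d:UNIV. sym_forms s V d)" "B = proj_zeros s V SB"
      using AB unfolding zariski_closed_def by blast
    have ex: "\<exists>d \<phi>. (d, \<phi>) \<in> R \<and> \<phi> \<in> sym_forms s V d \<and> tr d \<phi> \<notin> reg.germ_ideal j"
      if R: "R \<subseteq> (SIGMA d:UNIV. sym_forms s V d)" "proj_zeros s V R \<subset> Z j" for R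
    proof -
      obtain y where y: "y \<in> Z j" "y \<notin> proj_zeros s V R" using R(2) by blast
      have "y \<in> proj_space s V" using y(1) zariski_closed_subset[OF closed] by blast
      then obtain d \<phi> v where \<phi>: "(d, \<phi>) \<in> R" "v \<in> y" "\<phi> (replicate d v) \<noteq> 0"
        using y(2) unfolding proj_zeros_def by blast
      have \<phi>f: "\<phi> \<in> sym_forms s V d" using R(1) \<phi>(1) by blast
      have "tr d \<phi> \<notin> reg.germ_ideal j"
      proof
        assume "tr d \<phi> \<in> reg.germ_ideal j"
        then have "(d, \<phi>) \<in> S j" unfolding S_def using \<phi>f by blast
        then show False using y(1) \<phi>(2,3) unfolding Z_def proj_zeros_def by blast
      qed
      then show ?thesis using \<phi>(1) \<phi>f by blast
    qed
    show "Z j = A \<or> Z j = B"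
    proof (rule ccontr)
      assume "\<not> (Z j = A \<or> Z j = B)"
      then have "A \<subset> Z j" "B \<subset> Z j" using AB by blast+
      then obtain d \<phi> e \<psi> where \<phi>: "(d, \<phi>) \<in> SA" "\<phi> \<in> sym_forms s V d" "tr d \<phi> \<notin> reg.germ_ideal j"
        and \<psi>: "(e, \<psi>) \<in> SB" "\<psi> \<in> sym_forms s V e" "tr e \<psi> \<notin> reg.germ_ideal j"
        using ex[OF SA(1)] ex[OF SB(1)] SA(2) SB(2) by blast
      obtain y where y: "y \<in> Z j" "\<not> (\<forall>v\<in>y. \<phi> (replicate d v) = 0)" "\<not> (\<forall>v\<in>y. \<psi> (replicate e v) = 0)"
        using nss[OF j \<phi>(2,3) \<psi>(2,3)] by blast
      then have "y \<in> A \<or> y \<in> B" using AB by blast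
      then show False using y(2,3) \<phi>(1) \<psi>(1) unfolding SA(2) SB(2) proj_zeros_def by blast
    qed
  qed
  have sub: "Z k \<subseteq> Z j" if "j \<le> k" "k \<le> N" for j k
    using reg.germ_ideal_mono[OF that] unfolding Z_def S_def proj_zeros_def by blast
  have strict: "Z (Suc j) \<subset> Z j" if j: "j < N" for j
  proof -
    obtain d \<psi> where \<psi>: "\<psi> \<in> sym_forms s V d" "\<forall>v. f j v = \<psi> (replicate d (v + w))" using forms[OF j] by blast
    have fj: "tr d \<psi> = f j" unfolding tr_def using \<psi>(2) by auto
    have "tr d \<psi> \<notin> reg.germ_ideal j" unfolding fj by (rule reg.f_notin_germ_ideal[OF j])
    then obtain y where y: "y \<in> Z j" "\<not> (\<forall>v\<in>y. \<psi> (replicate d v) = 0)"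
      using nss[of j \<psi> d \<psi> d] j \<psi>(1) by auto
    have "(d, \<psi>) \<in> S (Suc j)" unfolding S_def using fj \<psi>(1) reg.f_germ_ideal[of j "Suc j"] j by simp
    then have "y \<notin> Z (Suc j)" using y(2) unfolding Z_def proj_zeros_def by blast
    then show ?thesis using sub[of j "Suc j"] y(1) j by auto
  qed
  have ZY: "Z j \<subseteq> Y" if "c \<le> j" "j \<le> N" for j
  proof
    fix y assume "y \<in> Z j"
    then have y: "y \<in> Z c" using sub[OF that] by blast
    show "y \<in> Y"
    proof (rule Y)
      show "y \<in> proj_space s V" using y zariski_closed_subset[OF closed] by blast
      show "\<forall>v\<in>y. \<phi> (replicate d v) = 0"
        if "\<phi> \<in> sym_forms s V d" "(\<lambda>v. \<phi> (replicate d (v + w))) \<in> regular_sequence.germ_ideal X f c" for d \<phi>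
      proof -
        have "(d, \<phi>) \<in> S c" using that unfolding S_def tr_def by blast
        then show ?thesis using y unfolding Z_def proj_zeros_def by blast
      qed
    qed
  qed
  show ?thesis
    unfolding local_dim_def
  \<comment> \<open>The sets \<open>Z j\<close> shrink as \<open>j\<close> grows, so the chain is
    indexed backwards from \<open>N\<close> down to \<open>c\<close>.\<close>
  proof (rule Sup_upper, intro CollectI exI[of _ "N - c"] conjI refl exI[of _ "\<lambda>i. Z (N - i)"] allI impI)
    fix i assume "i \<le> N - c"
    then show "irreducible_closed s V (Z (N - i))" "x \<in> Z (N - i)" "Z (N - i) \<subseteq> Y"
      using irr xZ ZY c by simp_all
  next
    fix i assume "i < N - c"
    then have "N - i = Suc (N - Suc i)" "N - Suc i < N" by simp_all
    then show "Z (N - i) \<subset> Z (N - Suc i)" using strict by metis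
  qed
qed

end

section \<open>Coordinates on the ambient space\<close>

lemma coord_spaceI:
  fixes s :: "complex \<Rightarrow> 'v::ab_group_add \<Rightarrow> 'v" and cc :: "'i \<Rightarrow> 'v \<Rightarrow> complex"
  assumes vs: "vector_space s" and I: "finite I" and V: "module.subspace s V"
    and bb: "\<And>i. i \<in> I \<Longrightarrow> bb i \<in> V"
    and add: "\<And>i a b. i \<in> I \<Longrightarrow> cc i (a + b) = cc i a + cc i b"
    and scale: "\<And>i c a. i \<in> I \<Longrightarrow> cc i (s c a) = c * cc i a"
    and sep: "\<And>v. v \<in> V \<Longrightarrow> (\<And>i. i \<in> I \<Longrightarrow> cc i v = 0) \<Longrightarrow> v = 0"
    and dual: "\<And>i k. i \<in> I \<Longrightarrow> k \<in> I \<Longrightarrow> cc i (bb k) = (if i = k then 1 else 0)"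
  shows "coord_space s V I bb cc"
proof -
  interpret vector_space s by (rule vs)
  have zero: "cc i 0 = 0" if "i \<in> I" for i using scale[OF that, of 0 0] by simp
  have sum: "cc i (\<Sum>k\<in>T. g k) = (\<Sum>k\<in>T. cc i (g k))" if "i \<in> I" for i T and g :: "'i \<Rightarrow> 'v"
    by (induction T rule: infinite_finite_induct) (simp_all add: zero add that)
  have "v = (\<Sum>i\<in>I. s (cc i v) (bb i))" if v: "v \<in> V" for v
  proof -
    have "v - (\<Sum>i\<in>I. s (cc i v) (bb i)) = 0"
    proof (rule sep)
      show "v - (\<Sum>i\<in>I. s (cc i v) (bb i)) \<in> V"
        by (intro subspace_diff[OF V] subspace_sum[OF V] subspace_scale[OF V] v bb)
      fix i assume i: "i \<in> I"
      have "cc i (\<Sum>k\<in>I. s (cc k v) (bb k)) = (\<Sum>k\<in>I. cc k v * cc i (bb k))" by (simp add: sum scale i)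
      also have "\<dots> = (\<Sum>k\<in>{i}. cc k v * cc i (bb k))"
        by (rule sum.mono_neutral_right) (use I i dual in auto)
      finally have "cc i (\<Sum>k\<in>I. s (cc k v) (bb k)) = cc i v" using dual[OF i i] by simp
      moreover have "cc i (v - (\<Sum>k\<in>I. s (cc k v) (bb k))) + cc i (\<Sum>k\<in>I. s (cc k v) (bb k)) = cc i v"
        by (simp add: add[OF i, symmetric])
      ultimately show "cc i (v - (\<Sum>k\<in>I. s (cc k v) (bb k))) = 0" by simp
    qed
    then show ?thesis by simp
  qed
  then show ?thesis by unfold_locales (use assms in auto)
qed

locale symbol_setup = finite_dimensional_vector_space s B
  for s :: "complex \<Rightarrow> 'w::ab_group_add \<Rightarrow> 'w" and B :: "'w set" +
  fixes F :: "nat \<Rightarrow> ('w list \<Rightarrow> complex) set" and r :: nat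
  assumes sys: "symbol_system s F r"
begin

lemma coord_space_W: "coord_space s UNIV B (\<lambda>b. b) (\<lambda>b v. representation B v b)"
proof (rule coord_spaceI)
  show "vector_space s" by (rule vector_space_axioms)
  show "finite B" by (rule finite_Basis)
  show "representation B (a + b) i = representation B a i + representation B b i" for i a b
    using representation_add[OF independent_Basis] span_Basis by auto
  show "representation B (s c a) i = c * representation B a i" for i a c
    using representation_scale[OF independent_Basis] span_Basis by auto
  show "representation B k i = (if i = k then 1 else 0)" if "k \<in> B" for i k
    using representation_basis[OF independent_Basis that] by auto
  fix v assume v: "\<And>i. i \<in> B \<Longrightarrow> representation B v i = 0"
  have "(\<Sum>b\<in>B. s (representation B v b) b) = v"
    by (rule sum_representation_eq[OF independent_Basis]) (use span_Basis finite_Basis in auto)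
  then show "v = 0" using v by simp
qed auto

sublocale W: coord_space s UNIV B "\<lambda>b. b" "\<lambda>b v. representation B v b"
  by (rule coord_space_W)

lemma r_pos: "1 \<le> r"
  and F_form: "\<phi> \<in> F k \<Longrightarrow> \<phi> \<in> sym_forms s UNIV k"
  and F_subspace: "fun_space.subspace (F k)"
  and F_0: "F 0 = sym_forms s UNIV 0" and F_1: "F 1 = sym_forms s UNIV 1"
  and F_gt: "r < k \<Longrightarrow> F k = {0}"
  and F_contract: "\<phi> \<in> F (Suc k) \<Longrightarrow> contract w \<phi> \<in> F k"
proof -
  show "r < k \<Longrightarrow> F k = {0}" for k
  proof -
    assume "r < k"
    moreover have "\<forall>i\<ge>1. F (r + i) = {0}" using sys unfolding symbol_system_def by blast
    moreover have "1 \<le> k - r" using \<open>r < k\<close> by simp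
    ultimately have "F (r + (k - r)) = {0}" by blast
    then show "F k = {0}" using \<open>r < k\<close> by simp
  qed
  show "\<phi> \<in> F (Suc k) \<Longrightarrow> contract w \<phi> \<in> F k" for \<phi> k w
    using sys unfolding symbol_system_def by blast
qed (use sys in \<open>unfold symbol_system_def, blast+\<close>)

lemma form_determined:
  assumes "\<phi> \<in> sym_forms s UNIV k" "\<And>ls. set ls \<subseteq> B \<Longrightarrow> length ls = k \<Longrightarrow> \<phi> ls = 0"
  shows "\<phi> = 0"
  using assms
proof (induction k arbitrary: \<phi>)
  case 0
  have "\<phi> vs = 0" for vs
    using sym_forms_support[OF 0(1), of vs] 0(2)[of "[]"] by (cases vs) auto
  then show ?case by (auto simp: fun_eq_iff fun_apply)
next
  case (Suc k)
  have c: "contract b \<phi> = 0" if b: "b \<in> B" for b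
    by (rule Suc.IH[OF sym_forms_contract[OF Suc.prems(1)]]) (use b Suc.prems(2) in \<open>auto simp: contract_def\<close>)
  have "\<phi> vs = 0" for vs
  proof (cases "length vs = Suc k")
    case True
    then obtain v us where vs: "vs = v # us" "length us = k" by (cases vs) auto
    have "\<phi> (b # us) = 0" if "b \<in> B" for b
      using fun_cong[OF c[OF that], of us] by (simp add: contract_def fun_apply)
    then show ?thesis using W.form_expand[OF Suc.prems(1), of v us] vs by simp
  qed (use sym_forms_support[OF Suc.prems(1)] in blast)
  then show ?case by (auto simp: fun_eq_iff fun_apply)
qed

text \<open>A form is determined by its values on the finitely many lists of \<open>k\<close> basis
  vectors, which bounds the size of an independent set of forms.\<close>

lemma F_finite_basis:
  "\<exists>S. finite S \<and> S \<subseteq> F k \<and> fun_space.independent S \<and> F k \<subseteq> fun_space.span S"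
proof -
  define L where "L = {ls. set ls \<subseteq> B \<and> length ls = k}"
  have L: "finite L" unfolding L_def by (rule finite_lists_length_eq[OF finite_Basis])
  define \<rho> where "\<rho> \<phi> = (\<lambda>ls. if ls \<in> L then \<phi> ls else 0 :: complex)" for \<phi>
  define D where "D = (\<lambda>l ls. if ls = l then 1 else 0 :: complex) ` L"
  have \<rho>span: "\<rho> \<phi> \<in> fun_space.span D" for \<phi>
  proof -
    have "(\<Sum>l\<in>L. fun_scale (\<phi> l) (\<lambda>ls. if ls = l then 1 else 0)) \<in> fun_space.span D"
      unfolding D_def by (intro fun_space.span_sum fun_space.span_scale fun_space.span_base) auto
    moreover have "(\<Sum>l\<in>L. fun_scale (\<phi> l) (\<lambda>ls. if ls = l then 1 else 0)) = \<rho> \<phi>"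
    proof
      fix ls
      have "(\<Sum>l\<in>L. \<phi> l * (if ls = l then 1 else 0)) = (\<Sum>l\<in>L. if ls = l then \<phi> l else 0)"
        by (rule sum.cong) auto
      then show "(\<Sum>l\<in>L. fun_scale (\<phi> l) (\<lambda>ls. if ls = l then 1 else 0)) ls = \<rho> \<phi> ls"
        using L by (simp add: sum_fun_apply fun_apply \<rho>_def)
    qed
    ultimately show ?thesis by simp
  qed
  obtain S where S: "S \<subseteq> F k" "fun_space.independent S" "F k \<subseteq> fun_space.span S"
    by (rule fun_space.basis_exists[of "F k"]) blast
  have "finite S"
  proof (rule ccontr)
    assume "infinite S"
    then obtain T where T: "finite T" "card T = Suc (card D)" "T \<subseteq> S" using infinite_arbitrarily_large by blast
    have "finite D" unfolding D_def using L by simp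
    then have "\<exists>c. (\<exists>\<phi>\<in>T. c \<phi> \<noteq> 0) \<and> (\<Sum>\<phi>\<in>T. fun_scale (c \<phi>) (\<rho> \<phi>)) = 0"
      by (rule fun_space.family_dependent) (use T \<rho>span in auto)
    then obtain c where c: "\<exists>\<phi>\<in>T. c \<phi> \<noteq> 0" "(\<Sum>\<phi>\<in>T. fun_scale (c \<phi>) (\<rho> \<phi>)) = 0" by blast
    have "(\<Sum>\<phi>\<in>T. fun_scale (c \<phi>) \<phi>) \<in> F k"
      by (intro fun_space.subspace_sum[OF F_subspace] fun_space.subspace_scale[OF F_subspace]) (use T S in auto)
    then have "(\<Sum>\<phi>\<in>T. fun_scale (c \<phi>) \<phi>) = 0"
    proof (rule form_determined[OF F_form])
      fix ls assume "set ls \<subseteq> B" "length ls = k"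
      then have "ls \<in> L" unfolding L_def by blast
      then show "(\<Sum>\<phi>\<in>T. fun_scale (c \<phi>) \<phi>) ls = 0"
        using fun_cong[OF c(2), of ls] by (simp add: sum_fun_apply fun_apply \<rho>_def)
    qed
    then have "fun_space.dependent S" unfolding fun_space.dependent_explicit using T c(1) by blast
    then show False using S(2) by blast
  qed
  then show ?thesis using S by blast
qed

section \<open>A basis of the ambient space dual to bases of the spaces of forms\<close>

definition one_form :: "'w \<Rightarrow> 'w list \<Rightarrow> complex" where
  "one_form b = (\<lambda>vs. if length vs = 1 then representation B (hd vs) b else 0)"

text \<open>In degrees 0 and 1 the bases are prescribed, so that \<open>t\<close> and the
  coordinates of \<open>w\<close> have the same shape as the coordinates on the duals of
  \<open>F k\<close>, \<open>k \<ge> 2\<close>.\<close>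

definition Fbasis :: "nat \<Rightarrow> ('w list \<Rightarrow> complex) set" where
  "Fbasis k = (if k = 0 then {\<lambda>vs. if vs = [] then 1 else 0} else if k = 1 then one_form ` B
     else SOME S. finite S \<and> S \<subseteq> F k \<and> fun_space.independent S \<and> F k \<subseteq> fun_space.span S)"

text \<open>The coordinates of the ambient space are indexed by basis forms; the degree
  \<open>fst\<close> of an index is its weight under the flow.\<close>

definition coords :: "(nat \<times> ('w list \<Rightarrow> complex)) set" where
  "coords = Sigma {..r} Fbasis"

definition coord :: "nat \<times> ('w list \<Rightarrow> complex) \<Rightarrow> 'w symbol_vec \<Rightarrow> complex" where
  "coord = (\<lambda>(k, \<phi>) (t, w, \<xi>). if k = 0 then t else if k = 1 then \<phi> [w] else \<xi> k \<phi>)"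

definition basis_vec :: "nat \<times> ('w list \<Rightarrow> complex) \<Rightarrow> 'w symbol_vec" where
  "basis_vec = (\<lambda>(k, \<phi>). if k = 0 then (1, 0, 0) else if k = 1 then (0, inv_into B one_form \<phi>, 0)
     else (0, 0, \<lambda>i. if i = k then (\<lambda>\<psi>. if \<psi> \<in> F k then fun_space.representation (Fbasis k) \<psi> \<phi> else 0) else 0))"

lemma one_form_basis: "b \<in> B \<Longrightarrow> one_form c [b] = (if c = b then 1 else 0)"
  using representation_basis[OF independent_Basis, of b] by (auto simp: one_form_def)

lemma inj_one_form: "inj_on one_form B"
  by (rule inj_onI) (metis one_form_basis zero_neq_one)

lemma one_form_linear: "one_form b [x + y] = one_form b [x] + one_form b [y]" "one_form b [s c x] = c * one_form b [x]"
  using representation_add[OF independent_Basis] representation_scale[OF independent_Basis] span_Basis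
  by (auto simp: one_form_def)

lemma one_form_F: "one_form b \<in> F 1"
  unfolding F_1
proof (rule sym_formsI)
  fix us vs :: "'w list" assume m: "mset us = mset vs"
  then have len: "length us = length vs" by (rule mset_eq_length)
  then show "one_form b us = one_form b vs"
  proof (cases "length us = 1")
    case True
    then show ?thesis using m len by (auto simp: length_Suc_conv)
  qed (simp add: one_form_def)
next
  fix vs :: "'w list" and x y a c assume "Suc (length vs) = 1"
  then show "one_form b ((s a x + s c y) # vs) = a * one_form b (x # vs) + c * one_form b (y # vs)"
    using one_form_linear by simp
qed (auto simp: one_form_def)

lemma Fbasis_ge_2:
  assumes "2 \<le> k"
  shows "finite (Fbasis k)" "Fbasis k \<subseteq> F k" "fun_space.independent (Fbasis k)" "F k \<subseteq> fun_space.span (Fbasis k)"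
proof -
  have "Fbasis k = (SOME S. finite S \<and> S \<subseteq> F k \<and> fun_space.independent S \<and> F k \<subseteq> fun_space.span S)"
    unfolding Fbasis_def using assms by simp
  then have "finite (Fbasis k) \<and> Fbasis k \<subseteq> F k \<and> fun_space.independent (Fbasis k) \<and> F k \<subseteq> fun_space.span (Fbasis k)"
    using someI_ex[OF F_finite_basis[of k]] by simp
  then show "finite (Fbasis k)" "Fbasis k \<subseteq> F k" "fun_space.independent (Fbasis k)" "F k \<subseteq> fun_space.span (Fbasis k)"
    by blast+
qed

lemma Fbasis_finite: "finite (Fbasis k)"
proof -
  consider "k = 0" | "k = 1" | "2 \<le> k" by linarith
  then show ?thesis by cases (auto simp: Fbasis_ge_2(1), auto simp: Fbasis_def finite_Basis)
qed

lemma Fbasis_F: "\<phi> \<in> Fbasis k \<Longrightarrow> \<phi> \<in> F k"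
proof -
  assume \<phi>: "\<phi> \<in> Fbasis k"
  consider "k = 0" | "k = 1" | "2 \<le> k" by linarith
  then show ?thesis
  proof cases
    case 1
    then have "\<phi> = (\<lambda>vs. if vs = [] then 1 else 0)" using \<phi> by (simp add: Fbasis_def)
    then show ?thesis unfolding 1 F_0 by (auto intro!: sym_formsI split: if_splits)
  next
    case 2
    then show ?thesis using \<phi> one_form_F by (auto simp: Fbasis_def)
  next
    case 3
    then show ?thesis using \<phi> Fbasis_ge_2(2) by blast
  qed
qed

lemma F_expand:
  assumes \<phi>: "\<phi> \<in> F k"
  shows "\<exists>a. \<forall>vs. \<phi> vs = (\<Sum>\<psi>\<in>Fbasis k. a \<psi> * \<psi> vs)"
proof -
  consider "k = 0" | "k = 1" | "2 \<le> k" by linarith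
  then show ?thesis
  proof cases
    case 1
    have "\<phi> vs = \<phi> [] * (if vs = [] then 1 else 0)" for vs
      using sym_forms_support[OF F_form[OF \<phi>], of vs] 1 by (cases vs) simp_all
    moreover have "(\<Sum>\<psi>\<in>Fbasis k. \<phi> [] * \<psi> vs) = \<phi> [] * (if vs = [] then 1 else 0)" for vs
      using 1 by (simp add: Fbasis_def)
    ultimately have "\<forall>vs. \<phi> vs = (\<Sum>\<psi>\<in>Fbasis k. \<phi> [] * \<psi> vs)" by metis
    then show ?thesis by (rule exI[of _ "\<lambda>_. \<phi> []"])
  next
    case 2
    have "\<phi> vs = (\<Sum>b\<in>B. \<phi> [b] * one_form b vs)" for vs
    proof (cases "length vs = 1")
      case True
      then obtain v where v: "vs = [v]" by (auto simp: length_Suc_conv)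
      have "\<phi> \<in> sym_forms s UNIV (Suc 0)" using F_form[OF \<phi>] 2 by simp
      from W.form_expand[OF this, of v "[]"] show ?thesis
        unfolding v by (simp add: one_form_def mult.commute)
    next
      case False
      then show ?thesis using sym_forms_support[OF F_form[OF \<phi>], of vs] 2 by (simp add: one_form_def)
    qed
    moreover have "(\<Sum>\<psi>\<in>Fbasis k. \<phi> [inv_into B one_form \<psi>] * \<psi> vs) = (\<Sum>b\<in>B. \<phi> [b] * one_form b vs)" for vs
      using 2 by (simp add: Fbasis_def sum.reindex[OF inj_one_form] inj_one_form)
    ultimately have "\<forall>vs. \<phi> vs = (\<Sum>\<psi>\<in>Fbasis k. \<phi> [inv_into B one_form \<psi>] * \<psi> vs)" by metis
    then show ?thesis by (rule exI[of _ "\<lambda>\<psi>. \<phi> [inv_into B one_form \<psi>]"])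
  next
    case 3
    have "(\<Sum>\<psi>\<in>Fbasis k. fun_scale (fun_space.representation (Fbasis k) \<phi> \<psi>) \<psi>) = \<phi>"
      by (rule fun_space.sum_representation_eq) (use Fbasis_ge_2[OF 3] \<phi> in auto)
    then have "\<phi> vs = (\<Sum>\<psi>\<in>Fbasis k. fun_space.representation (Fbasis k) \<phi> \<psi> * \<psi> vs)" for vs
      by (metis (no_types, lifting) fun_scale_apply sum.cong sum_fun_apply)
    then show ?thesis by blast
  qed
qed

lemma symbol_scale_simps: "symbol_scale s c (t, w, \<xi>) = (c * t, s c w, \<lambda>k. fun_scale c (\<xi> k))"
  by (simp add: symbol_scale_def)

lemma vector_space_symbol: "vector_space (symbol_scale s)"
  by unfold_locales
    (auto simp: symbol_scale_def scale_right_distrib scale_left_distrib fun_eq_iff fun_apply algebra_simps)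

lemma symbol_space_iff: "(t, w, \<xi>) \<in> symbol_space F r \<longleftrightarrow>
    (\<forall>k. if k \<in> {2..r} then \<xi> k \<in> dual_space (F k) else \<xi> k = 0)"
  by (simp add: symbol_space_def)

lemma dual_space_closed:
  "0 \<in> dual_space U" "\<xi> \<in> dual_space U \<Longrightarrow> \<zeta> \<in> dual_space U \<Longrightarrow> \<xi> + \<zeta> \<in> dual_space U"
  "\<xi> \<in> dual_space U \<Longrightarrow> fun_scale c \<xi> \<in> dual_space U"
  by (auto simp: dual_space_def fun_apply algebra_simps)

lemma subspace_symbol_space: "module.subspace (symbol_scale s) (symbol_space F r)"
proof -
  interpret VS: vector_space "symbol_scale s" by (rule vector_space_symbol)
  show ?thesis
  proof (rule VS.subspaceI)
    show "0 \<in> symbol_space F r" by (auto simp: zero_prod_def symbol_space_iff dual_space_closed fun_apply)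
    fix x y :: "'w symbol_vec" and c
    obtain t w \<xi> where x: "x = (t, w, \<xi>)" by (cases x)
    obtain t' w' \<xi>' where y: "y = (t', w', \<xi>')" by (cases y)
    assume xV: "x \<in> symbol_space F r"
    have "fun_scale c (0 :: ('w list \<Rightarrow> complex) \<Rightarrow> complex) = 0" for c by (auto simp: fun_eq_iff fun_apply)
    then show "symbol_scale s c x \<in> symbol_space F r" for c
      using xV unfolding x symbol_scale_simps symbol_space_iff by (auto intro: dual_space_closed(3))
    assume yV: "y \<in> symbol_space F r"
    show "x + y \<in> symbol_space F r"
      unfolding x y add_Pair symbol_space_iff
    proof
      fix k
      show "if k \<in> {2..r} then (\<xi> + \<xi>') k \<in> dual_space (F k) else (\<xi> + \<xi>') k = 0"
        using xV[unfolded x symbol_space_iff, rule_format, of k] yV[unfolded y symbol_space_iff, rule_format, of k]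
        unfolding plus_fun_apply[of \<xi> \<xi>' k]
        by (auto intro: dual_space_closed(2) split: if_splits)
    qed
  qed
qed

lemma basis_vec_in: "i \<in> coords \<Longrightarrow> basis_vec i \<in> symbol_space F r"
proof -
  assume "i \<in> coords"
  then obtain k \<phi> where i: "i = (k, \<phi>)" "k \<le> r" "\<phi> \<in> Fbasis k" unfolding coords_def by blast
  consider "k = 0" | "k = 1" | "2 \<le> k" by linarith
  then show ?thesis
  proof cases
    case 3
    let ?R = "fun_space.representation (Fbasis k)"
    note b = Fbasis_ge_2[OF 3]
    have sp: "\<psi> \<in> fun_space.span (Fbasis k)" if "\<psi> \<in> F k" for \<psi> using that b(4) by blast
    have "(\<lambda>\<psi>. if \<psi> \<in> F k then ?R \<psi> \<phi> else 0) \<in> dual_space (F k)"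
      unfolding dual_space_def
      using fun_space.subspace_add[OF F_subspace] fun_space.subspace_scale[OF F_subspace]
        fun_space.representation_add[OF b(3) sp sp] fun_space.representation_scale[OF b(3) sp]
      by auto
    then show ?thesis using 3 i(2) by (auto simp: i basis_vec_def symbol_space_iff dual_space_closed)
  qed (auto simp: i basis_vec_def symbol_space_iff dual_space_closed fun_apply)
qed

sublocale VF: coord_space "symbol_scale s" "symbol_space F r" coords basis_vec coord
proof (rule coord_spaceI)
  show "vector_space (symbol_scale s)" by (rule vector_space_symbol)
  show "finite coords" unfolding coords_def by (intro finite_SigmaI Fbasis_finite) simp
  show "module.subspace (symbol_scale s) (symbol_space F r)" by (rule subspace_symbol_space)
  show "basis_vec i \<in> symbol_space F r" if "i \<in> coords" for i by (rule basis_vec_in[OF that])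
next
  fix i and a b :: "'w symbol_vec" and c assume "i \<in> coords"
  then obtain k \<phi> where i: "i = (k, \<phi>)" "k \<le> r" "\<phi> \<in> Fbasis k" unfolding coords_def by blast
  obtain t w \<xi> where a: "a = (t, w, \<xi>)" by (cases a)
  obtain t' w' \<xi>' where b: "b = (t', w', \<xi>')" by (cases b)
  have one: "\<exists>b. \<phi> = one_form b" if "k = 1" using i that by (auto simp: Fbasis_def)
  show "coord i (a + b) = coord i a + coord i b"
    using one by (auto simp: coord_def i a b one_form_linear fun_apply)
  show "coord i (symbol_scale s c a) = c * coord i a"
    using one by (auto simp: coord_def i a symbol_scale_simps one_form_linear fun_apply)
next
  fix v assume v: "v \<in> symbol_space F r" and z: "\<And>i. i \<in> coords \<Longrightarrow> coord i v = 0"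
  obtain t w \<xi> where tw: "v = (t, w, \<xi>)" by (cases v)
  have cI: "coord (k, \<phi>) v = 0" if "k \<le> r" "\<phi> \<in> Fbasis k" for k \<phi>
    by (rule z) (use that in \<open>simp add: coords_def\<close>)
  have "t = 0" using cI[of 0 "\<lambda>vs. if vs = [] then 1 else 0"] by (simp add: coord_def Fbasis_def tw)
  moreover have "representation B w b = 0" if "b \<in> B" for b
    using cI[of 1 "one_form b"] r_pos that by (simp add: coord_def Fbasis_def tw one_form_def)
  then have "w = 0" using W.expand[of w] by simp
  moreover have "\<xi> k = 0" for k
  proof (cases "k \<in> {2..r}")
    case True
    then have \<xi>: "\<xi> k \<in> dual_space (F k)" using v unfolding tw symbol_space_iff by (metis (full_types))
    have k: "2 \<le> k" using True by simp
    have "\<xi> k \<phi> = 0" for \<phi>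
    proof (cases "\<phi> \<in> F k")
      case in_F: True
      then have "\<phi> \<in> fun_space.span (Fbasis k)" using Fbasis_ge_2(4)[OF k] by blast
      then have "\<phi> \<in> F k \<and> \<xi> k \<phi> = 0"
      proof (induction rule: fun_space.span_induct_alt)
        case base
        have "\<xi> k (fun_scale 0 \<phi>) = 0 * \<xi> k \<phi>" using \<xi> in_F unfolding dual_space_def by blast
        moreover have "fun_scale 0 \<phi> = 0" by (auto simp: fun_eq_iff fun_apply)
        ultimately show ?case using fun_space.subspace_0[OF F_subspace] by simp
      next
        case (step c x y)
        have x: "x \<in> F k" using step(1) Fbasis_F by blast
        have cx: "fun_scale c x \<in> F k" by (rule fun_space.subspace_scale[OF F_subspace x])
        have "\<xi> k x = 0" using cI[of k x] True step(1) k by (simp add: coord_def tw)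
        moreover have "\<xi> k (fun_scale c x + y) = \<xi> k (fun_scale c x) + \<xi> k y"
          using \<xi> cx step(2) unfolding dual_space_def by blast
        moreover have "\<xi> k (fun_scale c x) = c * \<xi> k x" using \<xi> x unfolding dual_space_def by blast
        ultimately show ?case using fun_space.subspace_add[OF F_subspace cx] step(2) by simp
      qed
      then show ?thesis by blast
    next
      case False
      then show ?thesis using \<xi> unfolding dual_space_def by blast
    qed
    then show ?thesis by (auto simp: fun_eq_iff fun_apply)
  next
    case False
    then show ?thesis using v unfolding tw symbol_space_iff by (metis (full_types))
  qed
  ultimately show "v = 0" by (auto simp: tw zero_prod_def fun_eq_iff fun_apply)
next
  fix i i' assume "i \<in> coords" "i' \<in> coords"
  then obtain k \<phi> k' \<phi>' where i: "i = (k, \<phi>)" "k \<le> r" "\<phi> \<in> Fbasis k"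
    and i': "i' = (k', \<phi>')" "k' \<le> r" "\<phi>' \<in> Fbasis k'" unfolding coords_def by blast
  consider "k' = 0" | "k' = 1" | "2 \<le> k'" by linarith
  then show "coord i (basis_vec i') = (if i = i' then 1 else 0)"
  proof cases
    case 1
    then show ?thesis using i i' one_form_linear(2)[of _ 0 0]
      by (auto simp: coord_def basis_vec_def Fbasis_def fun_apply)
  next
    case 2
    then obtain b where b: "b \<in> B" "\<phi>' = one_form b" using i' by (auto simp: Fbasis_def)
    have inv: "inv_into B one_form \<phi>' = b" unfolding b(2) by (rule inv_into_f_f[OF inj_one_form b(1)])
    show ?thesis
    proof (cases "k = 1")
      case True
      then obtain c where c: "c \<in> B" "\<phi> = one_form c" using i by (auto simp: Fbasis_def)
      have "one_form c = one_form b \<longleftrightarrow> c = b" using inj_one_form b(1) c(1) by (auto simp: inj_on_def)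
      then show ?thesis using True 2 inv b c by (simp add: coord_def basis_vec_def i i' one_form_basis)
    qed (use 2 in \<open>auto simp: coord_def basis_vec_def i i' fun_apply\<close>)
  next
    case 3
    have z: "one_form b [0] = 0" for b using one_form_linear(2)[of b 0 0] by simp
    show ?thesis
    proof (cases "k = k'")
      case True
      have "fun_space.representation (Fbasis k) \<phi> \<phi>' = (if \<phi> = \<phi>' then 1 else 0)"
        using fun_space.representation_basis[OF Fbasis_ge_2(3)[OF 3]] i(3) True by auto
      then show ?thesis using True 3 Fbasis_F[OF i(3)] by (auto simp: coord_def basis_vec_def i i')
    next
      case False
      then show ?thesis using 3 i z by (auto simp: coord_def basis_vec_def i' fun_apply Fbasis_def)
    qed
  qed
qed

lemma coord_symbol_map:
  assumes "(k, \<phi>) \<in> coords"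
  shows "coord (k, \<phi>) (symbol_map s F r t v) = t ^ (r - k) * \<phi> (replicate k v)"
proof -
  have k: "k \<le> r" "\<phi> \<in> Fbasis k" using assms by (auto simp: coords_def)
  consider "k = 0" | "k = 1" | "2 \<le> k" by linarith
  then show ?thesis
  proof cases
    case 1
    then show ?thesis using k by (simp add: coord_def symbol_map_def Fbasis_def)
  next
    case 2
    then show ?thesis using k by (auto simp: coord_def symbol_map_def Fbasis_def one_form_linear)
  next
    case 3
    then show ?thesis using k Fbasis_F[OF k(2)] by (simp add: coord_def symbol_map_def power_functional_def fun_apply)
  qed
qed

lemma symbol_map_in: "symbol_map s F r t v \<in> symbol_space F r"
proof -
  have "power_functional F k v \<in> dual_space (F k)" for k
    unfolding dual_space_def power_functional_def
    using fun_space.subspace_add[OF F_subspace] fun_space.subspace_scale[OF F_subspace] by (auto simp: fun_apply)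
  then show ?thesis unfolding symbol_map_def symbol_space_iff by (auto intro: dual_space_closed(3))
qed

end

section \<open>Weights\<close>

lemma sum_powers_coeff:
  fixes A :: "'x \<Rightarrow> complex"
  assumes "finite Z" "\<And>t. (\<Sum>x\<in>Z. t ^ N x * A x) = 0"
  shows "(\<Sum>x\<in>{x \<in> Z. N x = k}. A x) = 0"
proof -
  define p where "p = (\<Sum>x\<in>Z. monom (A x) (N x))"
  have "poly p t = 0" for t
    using assms(2)[of t] by (simp add: p_def poly_sum poly_monom mult.commute)
  then have "p = 0" using poly_all_0_iff_0 by blast
  then have "coeff p k = 0" by simp
  then have "(\<Sum>x\<in>Z. if N x = k then A x else 0) = 0" by (simp add: p_def coeff_sum)
  then show ?thesis using sum.inter_filter[OF assms(1), of A "\<lambda>x. N x = k"] by simp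
qed

lemma prod_list_map_zero: "x \<in> set xs \<Longrightarrow> f x = 0 \<Longrightarrow> prod_list (map f xs) = (0 :: complex)"
  by (metis (no_types, lifting) image_eqI list.set_map prod_list_zero_iff)

lemma sum_list_eq_max:
  fixes f :: "'x \<Rightarrow> nat"
  assumes "\<And>x. x \<in> set xs \<Longrightarrow> m \<le> f x" "sum_list (map f xs) \<le> length xs * m" "x \<in> set xs"
  shows "f x = m"
  using assms
proof (induction xs)
  case (Cons y ys)
  have "length ys * m \<le> sum_list (map f ys)"
  proof -
    have "sum_list (map (\<lambda>_. m) ys) \<le> sum_list (map f ys)" by (rule sum_list_mono) (use Cons.prems(1) in auto)
    then show ?thesis by (simp add: sum_list_replicate map_replicate_const)
  qed
  moreover have "m \<le> f y" using Cons.prems(1) by simp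
  ultimately have "f y = m" "sum_list (map f ys) \<le> length ys * m" using Cons.prems(2) by simp_all
  then show ?case using Cons by auto
qed simp

context coord_space
begin

definition index_lists :: "nat \<Rightarrow> 'i list set" where
  "index_lists k = {is. set is \<subseteq> I \<and> length is = k}"

lemma finite_index_lists: "finite (index_lists k)"
  unfolding index_lists_def by (rule finite_lists_length_eq[OF finI])

lemma sum_index_lists_Suc:
  "(\<Sum>is\<in>index_lists (Suc k). f is) = (\<Sum>i\<in>I. \<Sum>js\<in>index_lists k. f (i # js))"
proof -
  have "index_lists (Suc k) = (\<lambda>(i, js). i # js) ` (I \<times> index_lists k)"
    by (auto simp: index_lists_def length_Suc_conv image_iff)
  then have "(\<Sum>is\<in>index_lists (Suc k). f is) = (\<Sum>x\<in>I \<times> index_lists k. f ((\<lambda>(i, js). i # js) x))"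
    by (simp add: sum.reindex inj_on_def o_def case_prod_unfold)
  also have "\<dots> = (\<Sum>(i, js)\<in>I \<times> index_lists k. f (i # js))" by (simp add: case_prod_unfold)
  also have "\<dots> = (\<Sum>i\<in>I. \<Sum>js\<in>index_lists k. f (i # js))" by (rule sum.cartesian_product[symmetric])
  finally show ?thesis .
qed

lemma form_expand_lists:
  assumes "\<theta> \<in> sym_forms s V k" "set xs \<subseteq> V" "length xs = k"
  shows "\<theta> xs = (\<Sum>is\<in>index_lists k. prod_list (map2 cc is xs) * \<theta> (map bb is))"
  using assms
proof (induction k arbitrary: \<theta> xs)
  case 0
  have "index_lists 0 = {[]}" by (auto simp: index_lists_def)
  then show ?case using 0 by simp
next
  case (Suc k)
  obtain x ys where xs: "xs = x # ys" using Suc.prems(3) by (cases xs) auto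
  have ys: "set ys \<subseteq> V" "length ys = k" "x \<in> V" using Suc.prems xs by auto
  have "\<theta> xs = (\<Sum>i\<in>I. cc i x * contract (bb i) \<theta> ys)"
    unfolding xs contract_def by (rule form_expand[OF Suc.prems(1) ys(3,1,2)])
  also have "\<dots> = (\<Sum>i\<in>I. \<Sum>js\<in>index_lists k. cc i x * (prod_list (map2 cc js ys) * contract (bb i) \<theta> (map bb js)))"
    unfolding sum_distrib_left[symmetric]
    by (rule sum.cong[OF refl], rule arg_cong[where f = "\<lambda>z. _ * z"])
      (rule Suc.IH[OF sym_forms_contract[OF Suc.prems(1) bbV] ys(1,2)])
  finally show ?case unfolding sum_index_lists_Suc by (simp add: xs contract_def mult.assoc)
qed

context
  fixes wt :: "'i \<Rightarrow> nat"
begin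

text \<open>For \<open>v = 0\<close> this is the maximum of the empty set, so the value is
  meaningful only for nonzero vectors.\<close>

definition weight :: "'v \<Rightarrow> nat" where
  "weight v = Max (wt ` {i \<in> I. cc i v \<noteq> 0})"

definition component :: "nat \<Rightarrow> 'v \<Rightarrow> 'v" where
  "component k v = (\<Sum>i\<in>I. s (if wt i = k then cc i v else 0) (bb i))"

text \<open>When the components of weight \<open>k\<close> are scaled by \<open>t ^ (r - k)\<close>
  and \<open>t\<close> tends to 0, this part dominates; its line is the limit of the moved
  line.\<close>

definition top_part :: "'v \<Rightarrow> 'v" where
  "top_part v = component (weight v) v"

lemma cc_component: "i \<in> I \<Longrightarrow> cc i (component k v) = (if wt i = k then cc i v else 0)"
  unfolding component_def by (rule cc_comb)

lemma component_V: "component k v \<in> V"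
  unfolding component_def by (intro V_closed bbV) auto

lemma eq_0I: "v \<in> V \<Longrightarrow> (\<And>i. i \<in> I \<Longrightarrow> cc i v = 0) \<Longrightarrow> v = 0"
  using expand[of v] by simp

lemma weight_upper: "i \<in> I \<Longrightarrow> cc i v \<noteq> 0 \<Longrightarrow> wt i \<le> weight v"
  unfolding weight_def by (rule Max_ge) (use finI in auto)

lemma weight_attained:
  assumes "v \<in> V" "v \<noteq> 0"
  shows "\<exists>i\<in>I. cc i v \<noteq> 0 \<and> wt i = weight v"
proof -
  have "{i \<in> I. cc i v \<noteq> 0} \<noteq> {}" using eq_0I[OF assms(1)] assms(2) by blast
  then have "weight v \<in> wt ` {i \<in> I. cc i v \<noteq> 0}" unfolding weight_def by (intro Max_in) (use finI in auto)
  then obtain i where "weight v = wt i" "i \<in> {i \<in> I. cc i v \<noteq> 0}" by (rule imageE)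
  then show ?thesis by (intro bexI[of _ i]) simp_all
qed

text \<open>A maximal \<open>S\<close> with these properties spans \<open>L\<close>: otherwise a vector of least weight outside its
  span could be reduced by the leading parts.\<close>

lemma graded_basis:
  assumes L: "subspace L" "L \<subseteq> V"
  shows "\<exists>S. finite S \<and> S \<subseteq> L \<and> inj_on top_part S \<and> independent (top_part ` S) \<and> L \<subseteq> span S"
proof -
  define good where "good k \<longleftrightarrow> (\<exists>S. card S = k \<and> finite S \<and> S \<subseteq> L \<and> inj_on top_part S \<and> independent (top_part ` S))" for k
  have topV: "top_part ` S \<subseteq> V" for S unfolding top_part_def using component_V by blast
  have bound: "k \<le> card I" if k: "good k" for k
  proof -
    obtain S where S: "card S = k" "inj_on top_part S" "independent (top_part ` S)" using k unfolding good_def by blast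
    show ?thesis using independent_in_V(2)[OF S(3) topV] card_image[OF S(2)] S(1) by simp
  qed
  have "good 0" unfolding good_def by (rule exI[of _ "{}"]) (simp add: independent_empty)
  define k where "k = (GREATEST k. good k)"
  have "good k" unfolding k_def by (rule GreatestI_nat[of good 0 "card I"]) (use \<open>good 0\<close> bound in auto)
  then obtain S where S: "card S = k" "finite S" "S \<subseteq> L" "inj_on top_part S" "independent (top_part ` S)"
    unfolding good_def by blast
  have "L \<subseteq> span S"
  proof (rule ccontr)
    assume "\<not> L \<subseteq> span S"
    then obtain v0 where v0: "v0 \<in> L - span S" by blast
    obtain v where vm: "v \<in> L - span S" and min: "\<And>v'. v' \<in> L - span S \<Longrightarrow> weight v \<le> weight v'"
      using ex_has_least_nat[of "\<lambda>v. v \<in> L - span S" v0 weight] v0 by blast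
    have v: "v \<in> L" "v \<notin> span S" using vm by auto
    have "top_part v \<notin> span (top_part ` S)"
    proof
      assume "top_part v \<in> span (top_part ` S)"
      then obtain a where a: "top_part v = (\<Sum>x\<in>top_part ` S. s (a x) x)"
        using span_finite[OF finite_imageI[OF S(2)]] by auto
      then have a: "top_part v = (\<Sum>x\<in>S. s (a (top_part x)) (top_part x))"
        by (simp add: sum.reindex[OF S(4)])
      \<comment> \<open>Only elements of the same weight can contribute to the top part of
        \<open>v\<close>; subtracting their combination leaves \<open>v'\<close>, of smaller
        weight.\<close>
      define S' where "S' = {x \<in> S. weight x = weight v}"
      define v' where "v' = v - (\<Sum>x\<in>S'. s (a (top_part x)) x)"
      have sumS: "(\<Sum>x\<in>S'. s (a (top_part x)) x) \<in> span S"
        by (intro span_sum span_scale span_base) (simp add: S'_def)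
      have "(\<Sum>x\<in>S'. s (a (top_part x)) x) \<in> L"
        by (intro subspace_sum[OF L(1)] subspace_scale[OF L(1)]) (use S(3) in \<open>auto simp: S'_def\<close>)
      then have v'L: "v' \<in> L" unfolding v'_def by (rule subspace_diff[OF L(1) v(1)])
      have v'S: "v' \<notin> span S"
      proof
        assume "v' \<in> span S"
        then have "v' + (\<Sum>x\<in>S'. s (a (top_part x)) x) \<in> span S" using sumS by (rule span_add)
        then show False using v(2) by (simp add: v'_def)
      qed
      have "v' \<noteq> 0" using v'S span_zero by blast
      then obtain i where i: "i \<in> I" "cc i v' \<noteq> 0" "wt i = weight v'" 
        using weight_attained[of v'] v'L L(2) by (meson subsetD)
      have ge: "weight v \<le> wt i" using min[of v'] v'L v'S i(3) by simp
      have "cc i (\<Sum>x\<in>S'. s (a (top_part x)) x) = (\<Sum>x\<in>S'. a (top_part x) * cc i x)"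
        by (simp add: cc_sum[OF i(1)] cc_scale[OF i(1)])
      moreover have "cc i v' + cc i (\<Sum>x\<in>S'. s (a (top_part x)) x) = cc i v"
        unfolding v'_def by (simp add: cc_add[OF i(1), symmetric])
      ultimately have cv: "cc i v' + (\<Sum>x\<in>S'. a (top_part x) * cc i x) = cc i v" by simp
      show False
      proof (cases "wt i = weight v")
        case False
        then have gt: "weight v < wt i" using ge by simp
        have "cc i v = 0" using weight_upper[OF i(1), of v] gt by force
        moreover have "cc i x = 0" if "x \<in> S'" for x
          using weight_upper[OF i(1), of x] gt that by (force simp: S'_def)
        then have "(\<Sum>x\<in>S'. a (top_part x) * cc i x) = 0" by (intro sum.neutral) simp
        ultimately show False using cv i(2) by simp
      next
        case True
        have "cc i v = cc i (top_part v)" using True by (simp add: top_part_def cc_component i(1))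
        also have "\<dots> = (\<Sum>x\<in>S. a (top_part x) * cc i (top_part x))"
          by (subst a) (simp add: cc_sum[OF i(1)] cc_scale[OF i(1)])
        also have "\<dots> = (\<Sum>x\<in>S'. a (top_part x) * cc i x)"
          by (rule sum.mono_neutral_cong_right)
            (use S(2) True in \<open>auto simp: S'_def top_part_def cc_component i(1)\<close>)
        finally show False using cv i(2) by simp
      qed
    qed
    then have ind: "independent (insert (top_part v) (top_part ` S))" and "top_part v \<notin> top_part ` S"
      using independent_insertI[OF _ S(5)] span_base[of "top_part v" "top_part ` S"] by auto
    then have "inj_on top_part (insert v S)" using S(4) by auto
    moreover have "v \<notin> S" using v(2) span_base[of v S] by auto
    ultimately have "good (Suc k)"
      unfolding good_def using S(1,2,3) v(1) ind by (intro exI[of _ "insert v S"]) auto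
    then have "Suc k \<le> k" unfolding k_def by (intro Greatest_le_nat[of good _ "card I"]) (use bound in auto)
    then show False by simp
  qed
  then show ?thesis using S by blast
qed

end

end

section \<open>The Euler-symmetric variety\<close>

lemma complex_root_exists:
  assumes "1 \<le> (n :: nat)"
  shows "\<exists>z :: complex. z ^ n = c"
proof -
  have "degree (monom 1 n + [:- c:]) = degree (monom (1 :: complex) n)"
    by (rule degree_add_eq_left) (use assms in \<open>simp add: degree_monom_eq\<close>)
  then have "\<not> constant (poly (monom 1 n + [:- c:]))" using assms by (simp add: constant_degree degree_monom_eq)
  then obtain z where "poly (monom 1 n + [:- c:]) z = 0" using fundamental_theorem_of_algebra by blast
  then show ?thesis by (auto simp: poly_monom)
qed

context symbol_setup
begin

definition coord_fun :: "nat \<times> ('w list \<Rightarrow> complex) \<Rightarrow> 'w \<Rightarrow> complex" where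
  "coord_fun i v = snd i (replicate (fst i) v)"

abbreviation "M \<equiv> euler_symmetric_variety s F r"

lemma coordsD:
  assumes "i \<in> coords"
  shows "fst i \<le> r" "snd i \<in> Fbasis (fst i)" "snd i \<in> F (fst i)" "snd i \<in> sym_forms s UNIV (fst i)"
  using assms Fbasis_F F_form unfolding coords_def by auto

lemma coord_map: "i \<in> coords \<Longrightarrow> coord i (symbol_map s F r t v) = t ^ (r - fst i) * coord_fun i v"
  using coord_symbol_map[of "fst i" "snd i"] by (simp add: coord_fun_def)

lemma coord_fun_hom: "i \<in> coords \<Longrightarrow> hom W.X (fst i) (coord_fun i)"
proof -
  assume "i \<in> coords"
  then obtain h where h: "hom W.X (fst i) h" "\<forall>v\<in>UNIV. h v = snd i (replicate (fst i) v)"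
    using W.form_to_hom[OF coordsD(4)] by blast
  then have "h = coord_fun i" by (auto simp: coord_fun_def)
  then show ?thesis using h(1) by simp
qed

lemmas coord_fun_alg = hom_alg[OF coord_fun_hom]

lemma VF_eqI:
  assumes "x \<in> symbol_space F r" "y \<in> symbol_space F r" "\<And>i. i \<in> coords \<Longrightarrow> coord i x = coord i y"
  shows "x = y"
proof -
  have "(\<Sum>i\<in>coords. symbol_scale s (coord i x) (basis_vec i)) = (\<Sum>i\<in>coords. symbol_scale s (coord i y) (basis_vec i))"
    by (rule sum.cong) (use assms in auto)
  then show ?thesis using VF.expand[OF assms(1)] VF.expand[OF assms(2)] by simp
qed

lemma symbol_map_scale: "symbol_map s F r (\<mu> * t) (s \<mu> v) = symbol_scale s (\<mu> ^ r) (symbol_map s F r t v)"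
proof (rule VF_eqI)
  fix i assume i: "i \<in> coords"
  have "coord_fun i (s \<mu> v) = \<mu> ^ fst i * coord_fun i v" by (rule W.hom_homogeneous[OF coord_fun_hom[OF i]])
  moreover have "\<mu> ^ (r - fst i) * \<mu> ^ fst i = \<mu> ^ r" using coordsD(1)[OF i] by (simp add: power_add[symmetric])
  ultimately show "coord i (symbol_map s F r (\<mu> * t) (s \<mu> v)) = coord i (symbol_scale s (\<mu> ^ r) (symbol_map s F r t v))"
    by (simp add: coord_map i VF.cc_scale power_mult_distrib)
qed (auto intro: symbol_map_in VF.V_closed)

lemma symbol_map_0: "symbol_map s F r 0 0 = 0"
  using symbol_map_scale[of 0 0 0] r_pos by (simp add: power_0_left VF.scale_zero_left)

lemma form_at_0: "\<theta> \<in> sym_forms (symbol_scale s) (symbol_space F r) (Suc d) \<Longrightarrow> \<theta> (replicate (Suc d) 0) = 0"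
  using VF.form_homogeneous[of \<theta> "Suc d" 0 0] VF.V_closed(3) by simp

lemma symbol_map_point:
  assumes "symbol_map s F r t v \<noteq> 0"
  shows "module.span (symbol_scale s) {symbol_map s F r t v} \<in> {module.span (symbol_scale s) {symbol_map s F r t w} | t w.
        (t, w) \<noteq> 0 \<and> symbol_map s F r t w \<noteq> 0}"
proof -
  have "(t, v) \<noteq> 0" using assms symbol_map_0 by (auto simp: zero_prod_def)
  then show ?thesis using assms by blast
qed

lemma M_least:
  assumes "zariski_closed (symbol_scale s) (symbol_space F r) Z"
    and "\<And>t v. symbol_map s F r t v \<noteq> 0 \<Longrightarrow> module.span (symbol_scale s) {symbol_map s F r t v} \<in> Z"
  shows "M \<subseteq> Z"
  unfolding euler_symmetric_variety_def zariski_closure_def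
  by (rule Inter_lower) (use assms in auto)

lemma symbol_map_in_M:
  assumes "symbol_map s F r t v \<noteq> 0"
  shows "module.span (symbol_scale s) {symbol_map s F r t v} \<in> M"
  unfolding euler_symmetric_variety_def zariski_closure_def
proof (rule InterI)
  fix Z
  assume "Z \<in> {X. zariski_closed (symbol_scale s) (symbol_space F r) X \<and>
    {module.span (symbol_scale s) {symbol_map s F r t w} | t w. (t, w) \<noteq> 0 \<and> symbol_map s F r t w \<noteq> 0} \<subseteq> X}"
  then have "{module.span (symbol_scale s) {symbol_map s F r t w} | t w. (t, w) \<noteq> 0 \<and> symbol_map s F r t w \<noteq> 0} \<subseteq> Z"
    by simp
  then show "module.span (symbol_scale s) {symbol_map s F r t v} \<in> Z" using symbol_map_point[OF assms] by (rule subsetD)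
qed

lemma proj_spaceI: "p \<in> symbol_space F r \<Longrightarrow> p \<noteq> 0 \<Longrightarrow>
    module.span (symbol_scale s) {p} \<in> proj_space (symbol_scale s) (symbol_space F r)"
  unfolding proj_space_def by (intro CollectI exI[of _ p]) simp

lemma M_subset: "M \<subseteq> proj_space (symbol_scale s) (symbol_space F r)"
proof -
  have "proj_space (symbol_scale s) (symbol_space F r) = proj_zeros (symbol_scale s) (symbol_space F r) {}"
    by (simp add: proj_zeros_def)
  then have "zariski_closed (symbol_scale s) (symbol_space F r) (proj_space (symbol_scale s) (symbol_space F r))"
    unfolding zariski_closed_def by (intro exI[of _ "{}"]) simp
  then show ?thesis by (rule M_least) (intro proj_spaceI symbol_map_in)
qed

lemma vanish_on_M:
  assumes \<theta>: "\<theta> \<in> sym_forms (symbol_scale s) (symbol_space F r) d"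
    and z: "\<And>t v. \<theta> (replicate d (symbol_map s F r t v)) = 0" and y: "y \<in> M" "u \<in> y"
  shows "\<theta> (replicate d u) = 0"
proof -
  let ?Z = "proj_zeros (symbol_scale s) (symbol_space F r) {(d, \<theta>)}"
  have "zariski_closed (symbol_scale s) (symbol_space F r) ?Z"
    unfolding zariski_closed_def by (rule exI[of _ "{(d, \<theta>)}"]) (simp add: \<theta>)
  moreover have "VF.span {symbol_map s F r t w} \<in> ?Z" if "symbol_map s F r t w \<noteq> 0" for t w
  proof -
    have "\<forall>v\<in>VF.span {symbol_map s F r t w}. \<theta> (replicate d v) = 0"
      using VF.form_zero_on_line[OF \<theta> symbol_map_in] z by simp
    then show ?thesis using proj_spaceI[OF symbol_map_in that] unfolding proj_zeros_def by simp
  qed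
  ultimately have "M \<subseteq> ?Z" by (rule M_least)
  then have "y \<in> ?Z" using y(1) by (rule subsetD)
  then show ?thesis using y(2) unfolding proj_zeros_def by simp
qed

lemma vanish_on_map:
  assumes \<theta>: "\<theta> \<in> sym_forms (symbol_scale s) (symbol_space F r) (Suc d)"
    and z: "\<forall>y\<in>M. \<forall>u\<in>y. \<theta> (replicate (Suc d) u) = 0"
  shows "\<theta> (replicate (Suc d) (symbol_map s F r t v)) = 0"
proof (cases "symbol_map s F r t v = 0")
  case True
  then show ?thesis using form_at_0[OF \<theta>] by (simp only:)
next
  case False
  show ?thesis
    by (rule z[rule_format, OF symbol_map_in_M[OF False] VF.span_base]) simp
qed

text \<open>\<open>M\<close> is parametrized by \<open>card B + 1\<close> variables,
  \<open>t\<close> and the coordinates of \<open>v\<close>; this is the source of the bound on its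
  dimension.\<close>

lemma compose_symbol_map_alg:
  assumes "g \<in> alg VF.X"
  shows "g \<circ> (\<lambda>(t, v). symbol_map s F r t v) \<in> alg (insert fst ((\<lambda>b p. representation B (snd p) b) ` B))"
    (is "_ \<in> alg ?Y")
proof -
  have snd: "(\<lambda>p. h (snd p)) \<in> alg ?Y" if "h \<in> alg W.X" for h
    using that
  proof (induction rule: alg.induct)
    case (const c) show ?case by (rule alg.const)
  next
    case (gen x) then show ?case by (intro alg.gen) auto
  next
    case (add f g)
    have "(\<lambda>p. (f + g) (snd p)) = (\<lambda>p. f (snd p)) + (\<lambda>p::complex \<times> 'w. g (snd p))" by (auto simp: fun_eq_iff fun_apply)
    then show ?case using alg.add[OF add.IH] by simp
  next
    case (mult f g)
    have "(\<lambda>p. (f * g) (snd p)) = (\<lambda>p. f (snd p)) * (\<lambda>p::complex \<times> 'w. g (snd p))" by (auto simp: fun_eq_iff fun_apply)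
    then show ?case using alg.mult[OF mult.IH] by simp
  qed
  show ?thesis using assms
  proof (induction rule: alg.induct)
    case (const c)
    have "(\<lambda>_. c) \<circ> (\<lambda>(t, v). symbol_map s F r t v) = (\<lambda>_. c)" by auto
    then show ?case using alg.const[of c ?Y] by simp
  next
    case (gen x)
    then obtain i where i: "i \<in> coords" "x = coord i" by blast
    have "x \<circ> (\<lambda>(t, v). symbol_map s F r t v) = fst ^ (r - fst i) * (\<lambda>p. coord_fun i (snd p))"
      by (auto simp: fun_eq_iff fun_apply power_fun_apply coord_map i)
    moreover have "fst ^ (r - fst i) * (\<lambda>p. coord_fun i (snd p)) \<in> alg ?Y"
      by (rule alg.mult[OF alg_closed(7)[OF alg.gen] snd[OF coord_fun_alg[OF i(1)]]]) simp
    ultimately show ?case by simp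
  next
    case (add f g)
    have eq: "(f + g) \<circ> (\<lambda>(t, v). symbol_map s F r t v) = (f \<circ> (\<lambda>(t, v). symbol_map s F r t v)) + (g \<circ> (\<lambda>(t, v). symbol_map s F r t v))"
      by (auto simp: fun_eq_iff fun_apply)
    show ?case unfolding eq by (rule alg.add[OF add.IH])
  next
    case (mult f g)
    have eq: "(f * g) \<circ> (\<lambda>(t, v). symbol_map s F r t v) = (f \<circ> (\<lambda>(t, v). symbol_map s F r t v)) * (g \<circ> (\<lambda>(t, v). symbol_map s F r t v))"
      by (auto simp: fun_eq_iff fun_apply)
    show ?case unfolding eq by (rule alg.mult[OF mult.IH])
  qed
qed

text \<open>The set of values of \<open>symbol_map\<close> is stable under scalars, every scalar
  being an \<open>r\<close>-th power; hence each homogeneous part of \<open>R\<close> vanishes on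
  it, and then on the closure.\<close>

lemma polynomial_vanishing_on_M:
  assumes R: "R \<in> alg VF.X" and z: "\<And>t v. R (symbol_map s F r t v) = 0" and y: "y \<in> M" "u \<in> y"
  shows "R u = 0"
proof -
  obtain N h where h: "\<And>d. hom VF.X d (h d)" "R = (\<Sum>d<N. h d)" by (rule alg_decompose[OF R]) blast
  have hz: "h d (symbol_map s F r t v) = 0" if d: "d < N" for d t v
  proof -
    have "(\<Sum>e<N. c ^ e * h e (symbol_map s F r t v)) = 0" for c
    proof -
      obtain \<mu> where \<mu>: "\<mu> ^ r = c" using complex_root_exists[OF r_pos] by blast
      have "R (symbol_scale s c (symbol_map s F r t v)) = 0"
        unfolding \<mu>[symmetric] symbol_map_scale[symmetric] by (rule z)
      then show ?thesis unfolding h(2) sum_fun_apply by (simp add: VF.hom_homogeneous[OF h(1)])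
    qed
    then have "(\<Sum>e\<in>{e \<in> {..<N}. e = d}. h e (symbol_map s F r t v)) = 0"
      by (rule sum_powers_coeff[where N = "\<lambda>e. e", OF finite_lessThan])
    moreover have "{e \<in> {..<N}. e = d} = {d}" using d by auto
    ultimately show ?thesis by simp
  qed
  have "u \<in> symbol_space F r" by (rule VF.cone_subset[OF M_subset]) (use y in blast)
  have "h d u = 0" if d: "d < N" for d
  proof -
    obtain \<theta> where \<theta>: "\<theta> \<in> sym_forms (symbol_scale s) (symbol_space F r) d"
      "\<forall>v\<in>symbol_space F r. h d v = \<theta> (replicate d v)" using VF.hom_to_form[OF h(1)] by blast
    have "\<theta> (replicate d u) = 0"
    proof (rule vanish_on_M[OF \<theta>(1) _ y])
      show "\<theta> (replicate d (symbol_map s F r t v)) = 0" for t v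
        using \<theta>(2) symbol_map_in hz[OF d, of t v] by metis
    qed
    then show ?thesis using \<theta>(2) \<open>u \<in> symbol_space F r\<close> by metis
  qed
  then show ?thesis unfolding h(2) sum_fun_apply by (intro sum.neutral) simp
qed

text \<open>A chain of \<open>k + 1\<close> irreducible sets, with the vertex of the cone added,
  yields \<open>k + 1\<close> separating functions. If they outnumber the \<open>card B + 1\<close>
  parameters, they satisfy a relation on the image of \<open>symbol_map\<close>, thus on
  \<open>M\<close>, against their independence modulo \<open>Q 0\<close>.\<close>

lemma local_dim_M_le: "local_dim (symbol_scale s) (symbol_space F r) M y \<le> enat (card B)"
  unfolding local_dim_def
proof (rule Sup_least, clarify)
  fix k Z assume Z: "\<forall>i\<le>k. irreducible_closed (symbol_scale s) (symbol_space F r) (Z i) \<and> y \<in> Z i \<and> Z i \<subseteq> M"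
    "\<forall>i<k. Z i \<subset> Z (Suc i)"
  have closed: "zariski_closed (symbol_scale s) (symbol_space F r) (Z i)" if "i \<le> k" for i
    using Z(1) that unfolding irreducible_closed_def by blast
  define Q where "Q i = (if i \<le> k then VF.vanishing (Z (k - i)) else {g \<in> alg VF.X. g 0 = 0})" for i
  have Qp: "prime_of (alg VF.X) (Q i)" for i
    unfolding Q_def using VF.prime_vanishing[of "Z (k - i)"] Z(1) VF.prime_point[of 0] by simp
  have step: "Q i \<subseteq> Q (Suc i) \<and> (\<exists>g\<in>Q (Suc i). g \<notin> Q i)" if i: "i < Suc k" for i
  proof (cases "i < k")
    case True
    define j where "j = k - Suc i"
    have j: "j < k" "k - i = Suc j" using True by (auto simp: j_def)
    have Qi: "Q i = VF.vanishing (Z (Suc j))" "Q (Suc i) = VF.vanishing (Z j)"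
      unfolding Q_def using True j(2) by (auto simp: j_def)
    have "Z j \<subset> Z (Suc j)" using Z(2) j(1) by blast
    moreover have "Z (Suc j) \<subseteq> proj_space (symbol_scale s) (symbol_space F r)" using Z(1) j(1) M_subset by (meson Suc_leI order_trans)
    ultimately show ?thesis unfolding Qi
      using VF.vanishing_strict[OF closed[of j]] VF.vanishing_antimono[of "Z j" "Z (Suc j)"] j(1) by simp
  next
    case False
    then have Qi: "Q i = VF.vanishing (Z 0)" "Q (Suc i) = {g \<in> alg VF.X. g 0 = 0}"
      using i unfolding Q_def by (auto simp: less_Suc_eq)
    have sub: "Z 0 \<subseteq> proj_space (symbol_scale s) (symbol_space F r)" and y: "y \<in> Z 0" using Z(1) M_subset by blast+
    obtain p where p: "p \<in> symbol_space F r" "p \<noteq> 0" "y = VF.span {p}" using sub y by (blast elim: VF.proj_spaceE)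
    have pZ: "p \<in> \<Union>(Z 0)" using y p(3) VF.span_base by blast
    have "0 \<in> \<Union>(Z 0)" using VF.cone_scale[OF sub pZ, of 0] by (simp add: VF.scale_zero_left)
    then have "Q i \<subseteq> Q (Suc i)" unfolding Qi VF.vanishing_def by blast
    moreover obtain i0 where i0: "i0 \<in> coords" "coord i0 p \<noteq> 0" using VF.eq_0I[OF p(1)] p(2) by blast
    then have "coord i0 \<in> Q (Suc i)" "coord i0 \<notin> Q i"
      unfolding Qi VF.vanishing_def using VF.lin_zero[of "coord i0"] pZ by (auto intro: alg.gen)
    ultimately show ?thesis by blast
  qed
  have "\<forall>i. \<exists>g. i < Suc k \<longrightarrow> g \<in> Q (Suc i) \<and> g \<notin> Q i" using step by blast
  then obtain g where g: "\<And>i. i < Suc k \<Longrightarrow> g i \<in> Q (Suc i)" "\<And>i. i < Suc k \<Longrightarrow> g i \<notin> Q i" by metis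
  define gs where "gs = map g [0..<Suc k]"
  have len: "length gs = Suc k" by (simp add: gs_def)
  have gsX: "set gs \<subseteq> alg VF.X"
  proof
    fix h assume "h \<in> set gs"
    then obtain i where "i < Suc k" "h = g i" unfolding gs_def by (auto simp del: upt_Suc)
    then show "h \<in> alg VF.X" using ideal_of_closed(4)[OF prime_ofD(1)[OF Qp] g(1)] by blast
  qed
  let ?Y = "insert fst ((\<lambda>b (p :: complex \<times> 'w). representation B (snd p) b) ` B)"
  have "card ?Y \<le> Suc (card ((\<lambda>b (p :: complex \<times> 'w). representation B (snd p) b) ` B))" by (rule card_insert_le_m1) simp_all
  also have "\<dots> \<le> Suc (card B)" using card_image_le[OF finite_Basis] by simp
  finally have cardY: "card ?Y \<le> Suc (card B)" .
  show "enat k \<le> enat (card B)"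
  proof (rule ccontr)
    assume "\<not> enat k \<le> enat (card B)"
    then have lt: "card ?Y < length gs" using cardY len by simp
    show False
    proof (rule algebraic_relation[of ?Y gs "\<lambda>(t, v). symbol_map s F r t v"])
      show "finite ?Y" using finite_Basis by simp
      show "card ?Y < length gs" by (rule lt)
      show "h \<circ> (\<lambda>(t, v). symbol_map s F r t v) \<in> alg ?Y" if "h \<in> set gs" for h
        by (rule compose_symbol_map_alg) (use gsX that in blast)
      fix D c as
      assume as: "as \<in> exponents (length gs) D" and nz: "c as \<noteq> 0"
        and rel: "\<And>b. (\<Sum>as\<in>exponents (length gs) D. fun_scale (c as) (list_monomial gs as))
          ((\<lambda>(t, v). symbol_map s F r t v) b) = 0"
      define R where "R = (\<Sum>as\<in>exponents (length gs) D. fun_scale (c as) (list_monomial gs as))"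
      have RX: "R \<in> alg VF.X"
        unfolding R_def by (rule subring_of_sum[OF subring_alg alg_scale[OF list_monomial_alg[OF gsX]]])
      have Rz: "R (symbol_map s F r t v) = 0" for t v using rel[of "(t, v)"] by (simp add: R_def)
      have "R u = 0" if "u \<in> \<Union>(Z k)" for u
      proof -
        obtain y where "y \<in> Z k" "u \<in> y" using \<open>u \<in> \<Union>(Z k)\<close> by blast
        moreover have "Z k \<subseteq> M" using Z(1) by blast
        ultimately show ?thesis using polynomial_vanishing_on_M[OF RX Rz, of y u] by blast
      qed
      then have "\<forall>u\<in>\<Union>(Z k). R u = 0" by (rule ballI)
      then have mem: "R \<in> Q 0" unfolding Q_def VF.vanishing_def using RX by (simp del: Union_iff)
      have "c as = 0"
      proof (rule prime_chain_independent[of gs VF.X Q, OF _ _ mem[unfolded R_def] as])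
        show "prime_of (alg VF.X) (Q i)" for i by (rule Qp)
        show "Q i \<subseteq> Q (Suc i) \<and> gs ! i \<in> Q (Suc i) \<and> gs ! i \<notin> Q i" if "i < length gs" for i
          using step[of i] g[of i] that len by (simp add: gs_def del: upt_Suc)
      qed
      then show False using nz by simp
    qed
  qed
qed

end

section \<open>Tangency along the flow to the limit point\<close>

lemma map2_replicate: "length xs = n \<Longrightarrow> map2 f xs (replicate n y) = map (\<lambda>x. f x y) xs"
  by (simp add: zip_replicate2)

lemma prod_list_power_mult:
  "prod_list (map (\<lambda>x. t ^ a x * b x) xs) = t ^ sum_list (map a xs) * prod_list (map b xs)"
  for t :: complex
  by (induction xs) (simp_all add: power_add algebra_simps)

context symbol_setup
begin

text \<open>The derivative of \<open>coord_fun i\<close> at \<open>v\<close> in direction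
  \<open>u\<close>. In weight 0 the factor 0 covers the truncated \<open>fst i - 1\<close>.\<close>

definition coord_deriv :: "nat \<times> ('w list \<Rightarrow> complex) \<Rightarrow> 'w \<Rightarrow> 'w \<Rightarrow> complex" where
  "coord_deriv i v u = of_nat (fst i) * snd i (u # replicate (fst i - 1) v)"

definition vec :: "(nat \<times> ('w list \<Rightarrow> complex) \<Rightarrow> complex) \<Rightarrow> 'w symbol_vec" where
  "vec e = (\<Sum>i\<in>coords. symbol_scale s (e i) (basis_vec i))"

lemma coord_vec: "i \<in> coords \<Longrightarrow> coord i (vec e) = e i"
  unfolding vec_def by (rule VF.cc_comb)

lemma vec_in: "vec e \<in> symbol_space F r"
  unfolding vec_def by (intro VF.V_closed VF.bbV) auto

lemma vec_path: "(\<And>i. i \<in> coords \<Longrightarrow> polyfun (\<lambda>t. e t i)) \<Longrightarrow> VF.path (\<lambda>t. vec (e t))"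
  unfolding VF.path_def by (auto simp: coord_vec)

lemma coord_fun_taylor:
  assumes i: "i \<in> coords"
  shows "\<exists>q. polyfun q \<and> q 0 = coord_deriv i v u \<and> (\<forall>t. coord_fun i (v + s t u) = coord_fun i v + t * q t)"
proof (cases "fst i")
  case 0
  then show ?thesis
    by (intro exI[of _ "\<lambda>_. 0"]) (simp add: polyfun_intros coord_deriv_def coord_fun_def)
next
  case (Suc k)
  have \<phi>: "snd i \<in> sym_forms s UNIV (Suc k)" using coordsD(4)[OF i] Suc by simp
  let ?q = "\<lambda>t. \<Sum>j<Suc k. snd i (u # replicate j (v + s t u) @ replicate (k - j) v)"
  have "polyfun ?q" by (rule W.telescope_polyfun(1)[OF \<phi> _ W.path_intros(1)]) auto
  moreover have "?q 0 = coord_deriv i v u"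
    using W.telescope_polyfun(2)[OF \<phi> UNIV_I W.path_intros(1)[of u]] unfolding coord_deriv_def Suc by simp
  moreover have "coord_fun i (v + s t u) = coord_fun i v + t * ?q t" for t
    unfolding coord_fun_def Suc by (rule W.form_telescope[OF \<phi>]) auto
  ultimately show ?thesis by blast
qed

text \<open>Differentiates \<open>\<theta>\<close> along the points
  \<open>symbol_map s F r t (v + s e u)\<close> at \<open>e = 0\<close>: for
  \<open>e \<noteq> 0\<close> the telescoped difference quotient vanishes, and being polynomial it
  vanishes at 0.\<close>

lemma tangent_identity:
  assumes \<theta>: "\<theta> \<in> sym_forms (symbol_scale s) (symbol_space F r) (Suc d)"
    and z: "\<forall>y\<in>M. \<forall>u\<in>y. \<theta> (replicate (Suc d) u) = 0"
  shows "\<theta> (vec (\<lambda>i. t ^ (r - fst i) * coord_deriv i v u) # replicate d (symbol_map s F r t v)) = 0"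
proof -
  have "\<forall>i\<in>coords. \<exists>q. polyfun q \<and> q 0 = coord_deriv i v u \<and> (\<forall>t. coord_fun i (v + s t u) = coord_fun i v + t * q t)"
    using coord_fun_taylor by blast
  then obtain q where q: "\<And>i. i \<in> coords \<Longrightarrow> polyfun (q i)" "\<And>i. i \<in> coords \<Longrightarrow> q i 0 = coord_deriv i v u"
    "\<And>i e. i \<in> coords \<Longrightarrow> coord_fun i (v + s e u) = coord_fun i v + e * q i e" by metis
  let ?P = "symbol_map s F r t v"
  define \<beta> where "\<beta> e = vec (\<lambda>i. t ^ (r - fst i) * q i e)" for e
  have \<beta>: "VF.path \<beta>" unfolding \<beta>_def by (rule vec_path) (intro polyfun_intros q(1))
  have \<beta>V: "\<beta> e \<in> symbol_space F r" for e unfolding \<beta>_def by (rule vec_in)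
  let ?S = "\<lambda>e. \<Sum>j<Suc d. \<theta> (\<beta> e # replicate j (?P + symbol_scale s e (\<beta> e)) @ replicate (d - j) ?P)"
  have "?S e = 0" if "e \<noteq> 0" for e
  proof -
    have "symbol_map s F r t (v + s e u) = ?P + symbol_scale s e (\<beta> e)"
      by (rule VF_eqI)
        (auto simp: coord_map VF.cc_add VF.cc_scale \<beta>_def coord_vec q(3) algebra_simps
          intro!: symbol_map_in VF.V_closed vec_in)
    then have "\<theta> (replicate (Suc d) (?P + symbol_scale s e (\<beta> e))) = 0"
      using vanish_on_map[OF \<theta> z, of t "v + s e u"] by (simp only:)
    moreover have "\<theta> (replicate (Suc d) ?P) = 0" by (rule vanish_on_map[OF \<theta> z])
    moreover have "\<theta> (replicate (Suc d) (?P + symbol_scale s e (\<beta> e))) = \<theta> (replicate (Suc d) ?P) + e * ?S e"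
      by (rule VF.form_telescope[OF \<theta> symbol_map_in \<beta>V])
    ultimately have "0 = 0 + e * ?S e" by (simp only:)
    then show ?thesis using that by (simp del: sum.lessThan_Suc)
  qed
  then have "?S 0 = 0"
    by (rule polyfun_eq_0[OF VF.telescope_polyfun(1)[OF \<theta> symbol_map_in \<beta> \<beta>V]])
  then have "of_nat (Suc d) * \<theta> (\<beta> 0 # replicate d ?P) = 0"
    unfolding VF.telescope_polyfun(2)[OF \<theta> symbol_map_in \<beta> \<beta>V] .
  then have "\<theta> (\<beta> 0 # replicate d ?P) = 0" by (simp del: of_nat_Suc)
  moreover have "\<beta> 0 = vec (\<lambda>i. t ^ (r - fst i) * coord_deriv i v u)"
    unfolding \<beta>_def vec_def by (rule sum.cong) (simp_all add: q(2))
  ultimately show ?thesis by simp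
qed

text \<open>The exponent of \<open>t\<close> in the product of the coordinates of
  \<open>symbol_map\<close> with these indices.\<close>

definition coweight :: "(nat \<times> ('w list \<Rightarrow> complex)) list \<Rightarrow> nat" where
  "coweight is = sum_list (map (\<lambda>i. r - fst i) is)"

text \<open>The coefficients in \<open>t\<close> of the tangency of \<open>M\<close> to itself along the image of \<open>symbol_map\<close>.\<close>

lemma weight_relation:
  assumes \<theta>: "\<theta> \<in> sym_forms (symbol_scale s) (symbol_space F r) (Suc d)"
    and z: "\<forall>y\<in>M. \<forall>u\<in>y. \<theta> (replicate (Suc d) u) = 0"
  shows "(\<Sum>is\<in>{is \<in> VF.index_lists (Suc d). coweight is = k}.
    (a * coord_fun (hd is) v + coord_deriv (hd is) v u) * prod_list (map (\<lambda>i. coord_fun i v) (tl is)) * \<theta> (map basis_vec is)) = 0"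
proof (rule sum_powers_coeff[OF VF.finite_index_lists])
  fix t
  let ?P = "symbol_map s F r t v"
  let ?e = "\<lambda>i. a * coord_fun i v + coord_deriv i v u"
  let ?E = "vec (\<lambda>i. t ^ (r - fst i) * ?e i)" and ?D = "vec (\<lambda>i. t ^ (r - fst i) * coord_deriv i v u)"
  \<comment> \<open>The multiple of \<open>?P\<close> is the radial direction, tangent to the cone
    because \<open>\<theta>\<close> vanishes at \<open>?P\<close>.\<close>
  have "?E = symbol_scale s a ?P + symbol_scale s 1 ?D"
    by (rule VF_eqI) (auto simp: coord_map VF.cc_add VF.cc_scale coord_vec algebra_simps
          intro!: symbol_map_in VF.V_closed vec_in)
  moreover have "\<theta> ((symbol_scale s a ?P + symbol_scale s 1 ?D) # replicate d ?P)
    = a * \<theta> (?P # replicate d ?P) + 1 * \<theta> (?D # replicate d ?P)"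
    by (rule sym_forms_linear[OF \<theta>]) (auto simp: symbol_map_in vec_in)
  moreover have "\<theta> (?P # replicate d ?P) = 0" using vanish_on_map[OF \<theta> z, of t v] by simp
  moreover have "\<theta> (?D # replicate d ?P) = 0" by (rule tangent_identity[OF \<theta> z])
  ultimately have zero: "\<theta> (?E # replicate d ?P) = 0" by simp
  have "\<theta> (?E # replicate d ?P)
    = (\<Sum>is\<in>VF.index_lists (Suc d). prod_list (map2 coord is (?E # replicate d ?P)) * \<theta> (map basis_vec is))"
    by (rule VF.form_expand_lists[OF \<theta>]) (auto simp: symbol_map_in vec_in)
  also have "\<dots> = (\<Sum>is\<in>VF.index_lists (Suc d). t ^ coweight is *
      (?e (hd is) * prod_list (map (\<lambda>i. coord_fun i v) (tl is)) * \<theta> (map basis_vec is)))"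
  proof (rule sum.cong[OF refl])
    fix is' assume "is' \<in> VF.index_lists (Suc d)"
    then obtain i js where is': "is' = i # js" "i \<in> coords" "set js \<subseteq> coords" "length js = d"
      unfolding VF.index_lists_def by (cases is') auto
    have "map2 coord js (replicate d ?P) = map (\<lambda>j. t ^ (r - fst j) * coord_fun j v) js"
      unfolding map2_replicate[OF is'(4)] using is'(3) by (auto simp: coord_map)
    then have "prod_list (map2 coord is' (?E # replicate d ?P))
        = t ^ (r - fst i) * ?e i * (t ^ coweight js * prod_list (map (\<lambda>i. coord_fun i v) js))"
      unfolding is'(1) by (simp add: coord_vec is'(2) prod_list_power_mult coweight_def)
    then show "prod_list (map2 coord is' (?E # replicate d ?P)) * \<theta> (map basis_vec is') = t ^ coweight is' *
      (?e (hd is') * prod_list (map (\<lambda>i. coord_fun i v) (tl is')) * \<theta> (map basis_vec is'))"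
      unfolding is'(1) by (simp add: coweight_def power_add algebra_simps)
  qed
  finally show "(\<Sum>is\<in>VF.index_lists (Suc d). t ^ coweight is *
      (?e (hd is) * prod_list (map (\<lambda>i. coord_fun i v) (tl is)) * \<theta> (map basis_vec is))) = 0"
    using zero by simp
qed

end

text \<open>\<open>lead\<close> expresses that \<open>w\<close> is no base point in degree
  \<open>m\<close>; for \<open>m\<close> the order, this holds at every \<open>w \<noteq> 0\<close>,
  as the base locus of degree \<open>m\<close> is empty.\<close>

locale base_point = symbol_setup s B F r
  for s :: "complex \<Rightarrow> 'w::ab_group_add \<Rightarrow> 'w" and B :: "'w set"
    and F :: "nat \<Rightarrow> ('w list \<Rightarrow> complex) set" and r :: nat +
  fixes m :: nat and w :: 'w
  assumes w0: "w \<noteq> 0" and base: "\<phi> \<in> F (Suc m) \<Longrightarrow> \<phi> (replicate (Suc m) w) = 0"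
    and lead: "\<exists>\<psi>\<in>F m. \<psi> (replicate m w) \<noteq> 0"
begin

text \<open>Contraction with \<open>w\<close> lowers the degree by one inside the system, so
  vanishing at \<open>w\<close> climbs from \<open>m + 1\<close> to all higher degrees.\<close>

lemma F_above: "m < k \<Longrightarrow> \<phi> \<in> F k \<Longrightarrow> \<phi> (replicate k w) = 0"
proof (induction k arbitrary: \<phi>)
  case (Suc k)
  show ?case
  proof (cases "m = k")
    case True then show ?thesis using base Suc.prems by simp
  next
    case False
    then have "contract w \<phi> (replicate k w) = 0" using Suc F_contract by simp
    then show ?thesis by (simp add: contract_def)
  qed
qed simp

lemma coord_fun_above: "i \<in> coords \<Longrightarrow> m < fst i \<Longrightarrow> coord_fun i w = 0"
  unfolding coord_fun_def using F_above coordsD(3) by blast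

lemma m_le_r: "m \<le> r"
proof (rule ccontr)
  assume "\<not> m \<le> r"
  then have "F m = {0}" using F_gt by simp
  then show False using lead by (simp add: fun_apply)
qed

lemma lead_coord: "\<exists>i\<in>coords. fst i = m \<and> coord_fun i w \<noteq> 0"
proof -
  obtain \<psi> where \<psi>: "\<psi> \<in> F m" "\<psi> (replicate m w) \<noteq> 0" using lead by blast
  obtain a where a: "\<And>vs. \<psi> vs = (\<Sum>\<chi>\<in>Fbasis m. a \<chi> * \<chi> vs)" using F_expand[OF \<psi>(1)] by blast
  have "\<exists>\<chi>\<in>Fbasis m. \<chi> (replicate m w) \<noteq> 0"
  proof (rule ccontr)
    assume "\<not> ?thesis"
    then have "(\<Sum>\<chi>\<in>Fbasis m. a \<chi> * \<chi> (replicate m w)) = 0" by (intro sum.neutral) auto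
    then show False using \<psi>(2) a[of "replicate m w"] by metis
  qed
  then obtain \<chi> where "\<chi> \<in> Fbasis m" "\<chi> (replicate m w) \<noteq> 0" by blast
  then show ?thesis using m_le_r by (intro bexI[of _ "(m, \<chi>)"]) (auto simp: coord_fun_def coords_def)
qed

definition limit_vec :: "'w symbol_vec" where
  "limit_vec = vec (\<lambda>i. if fst i = m then coord_fun i w else 0)"

lemma limit_vec_in: "limit_vec \<in> symbol_space F r"
  unfolding limit_vec_def by (rule vec_in)

lemma limit_vec_nonzero: "limit_vec \<noteq> 0"
proof
  assume z: "limit_vec = 0"
  obtain i where "i \<in> coords" "fst i = m" "coord_fun i w \<noteq> 0" using lead_coord by blast
  then have "coord i limit_vec \<noteq> 0" by (simp add: limit_vec_def coord_vec)
  then show False using VF.lin_zero[of "coord i"] \<open>i \<in> coords\<close> z by simp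
qed

lemma coord_limit_vec: "i \<in> coords \<Longrightarrow> coord i limit_vec = (if fst i = m then coord_fun i w else 0)"
  unfolding limit_vec_def by (rule coord_vec)

lemma symbol_map_nonzero:
  assumes "t \<noteq> 0"
  shows "symbol_map s F r t v \<noteq> 0"
proof
  assume z: "symbol_map s F r t v = 0"
  let ?i = "(0, \<lambda>vs. if vs = [] then 1 else 0) :: nat \<times> ('w list \<Rightarrow> complex)"
  have i: "?i \<in> coords" unfolding coords_def by (simp add: Fbasis_def)
  have "coord ?i (symbol_map s F r t v) = t ^ r" unfolding coord_map[OF i] by (simp add: coord_fun_def)
  then show False using assms VF.lin_zero[of "coord ?i"] i z by simp
qed

lemma limit_point_in_M: "VF.span {limit_vec} \<in> M"
  unfolding euler_symmetric_variety_def zariski_closure_def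
proof (rule InterI)
  fix Z
  assume "Z \<in> {X. zariski_closed (symbol_scale s) (symbol_space F r) X \<and>
    {module.span (symbol_scale s) {symbol_map s F r t w} | t w. (t, w) \<noteq> 0 \<and> symbol_map s F r t w \<noteq> 0} \<subseteq> X}"
  then have Z: "zariski_closed (symbol_scale s) (symbol_space F r) Z"
    "{module.span (symbol_scale s) {symbol_map s F r t w} | t w. (t, w) \<noteq> 0 \<and> symbol_map s F r t w \<noteq> 0} \<subseteq> Z"
    by simp_all
  obtain S where S: "S \<subseteq> (SIGMA d:UNIV. sym_forms (symbol_scale s) (symbol_space F r) d)"
    "Z = proj_zeros (symbol_scale s) (symbol_space F r) S"
    using Z(1) unfolding zariski_closed_def by (elim exE conjE)
  have "\<theta> (replicate d limit_vec) = 0" if d\<theta>: "(d, \<theta>) \<in> S" for d \<theta>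
  proof -
    have \<theta>: "\<theta> \<in> sym_forms (symbol_scale s) (symbol_space F r) d" using S(1) d\<theta> by auto
    \<comment> \<open>For \<open>t \<noteq> 0\<close> this is \<open>symbol_map s F r t w\<close>
      divided by \<open>t ^ (r - m)\<close>; it is polynomial in \<open>t\<close> and equals
      \<open>limit_vec\<close> at \<open>t = 0\<close>.\<close>
    define c where "c t = vec (\<lambda>i. if fst i \<le> m then t ^ (m - fst i) * coord_fun i w else 0)" for t
    have c: "VF.path c" unfolding c_def
    proof (rule vec_path)
      show "polyfun (\<lambda>t. if fst i \<le> m then t ^ (m - fst i) * coord_fun i w else 0)" for i
        by (cases "fst i \<le> m") (simp_all add: polyfun_intros)
    qed
    have cV: "c t \<in> symbol_space F r" for t unfolding c_def by (rule vec_in)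
    have "\<theta> (replicate d (c t)) = 0" if t: "t \<noteq> 0" for t
    proof -
      have "VF.span {symbol_map s F r t w} \<in> Z"
        by (rule subsetD[OF Z(2) symbol_map_point[OF symbol_map_nonzero[OF t]]])
      moreover have "symbol_map s F r t w \<in> VF.span {symbol_map s F r t w}" by (rule VF.span_base) simp
      ultimately have "\<theta> (replicate d (symbol_map s F r t w)) = 0"
        using d\<theta> unfolding S(2) proj_zeros_def by fast
      moreover have "symbol_map s F r t w = symbol_scale s (t ^ (r - m)) (c t)"
      proof (rule VF_eqI)
        fix i assume i: "i \<in> coords"
        have "t ^ (r - fst i) = t ^ (r - m) * t ^ (m - fst i)" if "fst i \<le> m"
          using that m_le_r by (simp add: power_add[symmetric])
        then show "coord i (symbol_map s F r t w) = coord i (symbol_scale s (t ^ (r - m)) (c t))"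
          using coord_fun_above[OF i] by (auto simp: coord_map i VF.cc_scale c_def coord_vec not_le)
      qed (auto simp: c_def intro!: symbol_map_in VF.V_closed vec_in)
      ultimately have "(t ^ (r - m)) ^ d * \<theta> (replicate d (c t)) = 0"
        using VF.form_homogeneous[OF \<theta>, of "c t" "t ^ (r - m)"] vec_in by (simp add: c_def)
      then show ?thesis using t by simp
    qed
    moreover have "polyfun (\<lambda>t. \<theta> (map (\<lambda>\<gamma>. \<gamma> t) (replicate d c)))"
      by (rule VF.form_path) (use \<theta> c cV in \<open>auto split: if_splits\<close>)
    then have "polyfun (\<lambda>t. \<theta> (replicate d (c t)))" by (simp add: map_replicate_const)
    ultimately have "\<theta> (replicate d (c 0)) = 0" by (rule polyfun_eq_0[rotated])
    moreover have "c 0 = limit_vec"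
      unfolding c_def limit_vec_def vec_def by (rule sum.cong) (auto simp: power_0_left)
    ultimately show ?thesis by simp
  qed
  then have "\<forall>v\<in>VF.span {limit_vec}. \<theta> (replicate d v) = 0" if "(d, \<theta>) \<in> S" for d \<theta>
    using VF.form_zero_on_line[of \<theta> d, OF _ limit_vec_in] S(1) that by auto
  then show "VF.span {limit_vec} \<in> Z"
    unfolding S(2) proj_zeros_def using proj_spaceI[OF limit_vec_in limit_vec_nonzero] by auto
qed

end

lemma prod_list_remove1:
  fixes f :: "'x \<Rightarrow> 'r::comm_monoid_mult"
  shows "x \<in> set xs \<Longrightarrow> prod_list (map f xs) = f x * prod_list (map f (remove1 x xs))"
  by (induction xs) (auto simp: mult.left_commute)

lemma sum_list_lower:
  fixes f :: "'x \<Rightarrow> nat"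
  assumes "\<And>x. x \<in> set xs \<Longrightarrow> m \<le> f x"
  shows "length xs * m \<le> sum_list (map f xs)"
proof -
  have "sum_list (map (\<lambda>_. m) xs) \<le> sum_list (map f xs)" by (rule sum_list_mono) (use assms in auto)
  then show ?thesis by (simp add: map_replicate_const sum_list_replicate)
qed

context base_point
begin

abbreviation "T \<equiv> affine_tangent_space (symbol_scale s) (symbol_space F r) M (VF.span {limit_vec})"

text \<open>The contraction by \<open>u\<close> has degree at least \<open>m + 1\<close>, so it
  still vanishes at \<open>w\<close>.\<close>

lemma coord_deriv_above: "i \<in> coords \<Longrightarrow> Suc m < fst i \<Longrightarrow> coord_deriv i w u = 0"
proof -
  assume i: "i \<in> coords" "Suc m < fst i"
  then obtain k where k: "fst i = Suc k" "m < k" by (cases "fst i") auto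
  have "contract u (snd i) \<in> F k" using F_contract coordsD(3)[OF i(1)] k(1) by simp
  then have "contract u (snd i) (replicate k w) = 0" by (rule F_above[OF k(2)])
  then show ?thesis by (simp add: coord_deriv_def k(1) contract_def)
qed

lemma coord_deriv_linear:
  assumes "i \<in> coords"
  shows "coord_deriv i v (s a x + s b y) = a * coord_deriv i v x + b * coord_deriv i v y"
proof (cases "fst i")
  case (Suc k)
  have "snd i ((s a x + s b y) # replicate k v) = a * snd i (x # replicate k v) + b * snd i (y # replicate k v)"
    by (rule sym_forms_linear[of _ s UNIV k]) (use coordsD(4)[OF assms] Suc in auto)
  then show ?thesis by (simp add: coord_deriv_def Suc algebra_simps)
qed (simp add: coord_deriv_def)

lemma form_at_limit:
  assumes \<theta>: "\<theta> \<in> sym_forms (symbol_scale s) (symbol_space F r) (Suc d)" and x: "x \<in> symbol_space F r"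
  shows "\<theta> (x # replicate d limit_vec) = (\<Sum>is\<in>VF.index_lists (Suc d). coord (hd is) x *
    prod_list (map (\<lambda>i. if fst i = m then coord_fun i w else 0) (tl is)) * \<theta> (map basis_vec is))"
proof -
  have "\<theta> (x # replicate d limit_vec) = (\<Sum>is\<in>VF.index_lists (Suc d).
      prod_list (map2 coord is (x # replicate d limit_vec)) * \<theta> (map basis_vec is))"
    by (rule VF.form_expand_lists[OF \<theta>]) (auto simp: x limit_vec_in)
  also have "\<dots> = (\<Sum>is\<in>VF.index_lists (Suc d). coord (hd is) x *
    prod_list (map (\<lambda>i. if fst i = m then coord_fun i w else 0) (tl is)) * \<theta> (map basis_vec is))"
  proof (rule sum.cong[OF refl])
    fix is' assume "is' \<in> VF.index_lists (Suc d)"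
    then obtain i js where is': "is' = i # js" "set js \<subseteq> coords" "length js = d"
      unfolding VF.index_lists_def by (cases is') auto
    have "map2 coord js (replicate d limit_vec) = map (\<lambda>j. if fst j = m then coord_fun j w else 0) js"
      unfolding map2_replicate[OF is'(3)] by (intro map_cong refl coord_limit_vec) (use is'(2) in blast)
    then show "prod_list (map2 coord is' (x # replicate d limit_vec)) * \<theta> (map basis_vec is') = coord (hd is') x *
      prod_list (map (\<lambda>i. if fst i = m then coord_fun i w else 0) (tl is')) * \<theta> (map basis_vec is')"
      unfolding is'(1) by simp
  qed
  finally show ?thesis .
qed

lemma index_listsE:
  assumes "is \<in> VF.index_lists (Suc d)"
  obtains i js where "is = i # js" "i \<in> coords" "set js \<subseteq> coords" "length js = d"
  using assms unfolding VF.index_lists_def by (cases "is") auto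

definition coord_prod :: "(nat \<times> ('w list \<Rightarrow> complex)) list \<Rightarrow> 'w \<Rightarrow> complex" where
  "coord_prod js v = prod_list (map (\<lambda>i. coord_fun i v) js)"

lemma coord_prod_alg: "set js \<subseteq> coords \<Longrightarrow> coord_prod js \<in> alg W.X"
proof (induction js)
  case Nil
  have "coord_prod [] = (\<lambda>_. 1)" by (auto simp: coord_prod_def)
  then show ?case using alg.const[of 1 W.X] by simp
next
  case (Cons j js)
  have "coord_prod (j # js) = coord_fun j * coord_prod js" by (auto simp: coord_prod_def fun_eq_iff fun_apply)
  then show ?case using Cons alg.mult[OF coord_fun_alg] by simp
qed

lemma coord_prod_limit:
  assumes "set js \<subseteq> coords"
  shows "prod_list (map (\<lambda>i. if fst i = m then coord_fun i w else 0) js)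
    = (if \<forall>j\<in>set js. fst j = m then coord_prod js w else 0)"
proof (cases "\<forall>j\<in>set js. fst j = m")
  case True
  then have eq: "map (\<lambda>i. if fst i = m then coord_fun i w else 0) js = map (\<lambda>i. coord_fun i w) js" by auto
  show ?thesis unfolding eq coord_prod_def using True by simp
next
  case False
  then obtain j where "j \<in> set js" "fst j \<noteq> m" by blast
  then have "prod_list (map (\<lambda>i. if fst i = m then coord_fun i w else 0) js) = 0"
    by (intro prod_list_map_zero[of j]) auto
  then show ?thesis unfolding if_not_P[OF False] .
qed

text \<open>At \<open>limit_vec\<close> only products with one factor of weight \<open>k\<close> and
  \<open>d\<close> factors of weight \<open>m\<close> survive. They share one coweight; summing over
  all lists of that coweight gives the shape of \<open>weight_relation\<close>.\<close>

lemma form_at_limit_weight: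
  assumes \<theta>: "\<theta> \<in> sym_forms (symbol_scale s) (symbol_space F r) (Suc d)" and x: "x \<in> symbol_space F r"
    and wt: "\<And>i. i \<in> coords \<Longrightarrow> coord i x = (if fst i = k then e i else 0)"
  shows "\<theta> (x # replicate d limit_vec)
    = (\<Sum>is\<in>{is \<in> VF.index_lists (Suc d). coweight is = (r - k) + d * (r - m)}.
        (if fst (hd is) = k \<and> (\<forall>j\<in>set (tl is). fst j = m) then e (hd is) * coord_prod (tl is) w else 0) *
        \<theta> (map basis_vec is))"
  unfolding form_at_limit[OF \<theta> x]
proof (rule sum.mono_neutral_cong_right[OF VF.finite_index_lists])
  let ?L = "{is \<in> VF.index_lists (Suc d). coweight is = (r - k) + d * (r - m)}"
  have summand: "coord (hd is) x * prod_list (map (\<lambda>i. if fst i = m then coord_fun i w else 0) (tl is))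
    = (if fst (hd is) = k \<and> (\<forall>j\<in>set (tl is). fst j = m) then e (hd is) * coord_prod (tl is) w else 0)"
    if is0: "is \<in> VF.index_lists (Suc d)" for "is"
  proof -
    obtain i js where is': "is = i # js" "i \<in> coords" "set js \<subseteq> coords" "length js = d"
      by (rule index_listsE[OF is0])
    show ?thesis unfolding is'(1) by (simp add: wt[OF is'(2)] coord_prod_limit[OF is'(3)])
  qed
  show "\<forall>is\<in>VF.index_lists (Suc d) - ?L. coord (hd is) x *
    prod_list (map (\<lambda>i. if fst i = m then coord_fun i w else 0) (tl is)) * \<theta> (map basis_vec is) = 0"
  proof
    fix is' assume h: "is' \<in> VF.index_lists (Suc d) - ?L"
    then have is0: "is' \<in> VF.index_lists (Suc d)" by simp
    obtain i js where is': "is' = i # js" "i \<in> coords" "set js \<subseteq> coords" "length js = d"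
      by (rule index_listsE[OF is0])
    have neg: "\<not> (fst i = k \<and> (\<forall>j\<in>set js. fst j = m))"
    proof
      assume *: "fst i = k \<and> (\<forall>j\<in>set js. fst j = m)"
      then have "map (\<lambda>j. r - fst j) js = map (\<lambda>_. r - m) js" by auto
      then have "sum_list (map (\<lambda>j. r - fst j) js) = length js * (r - m)"
        by (simp add: map_replicate_const sum_list_replicate)
      then have "coweight is' = (r - k) + d * (r - m)" unfolding coweight_def is'(1) using * is'(4) by simp
      then show False using h by simp
    qed
    show "coord (hd is') x * prod_list (map (\<lambda>i. if fst i = m then coord_fun i w else 0) (tl is')) *
      \<theta> (map basis_vec is') = 0"
      unfolding summand[OF is0] unfolding is'(1) list.sel if_not_P[OF neg] by simp
  qed
  fix is' assume "is' \<in> ?L"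
  then have "is' \<in> VF.index_lists (Suc d)" by simp
  then show "coord (hd is') x * prod_list (map (\<lambda>i. if fst i = m then coord_fun i w else 0) (tl is')) *
      \<theta> (map basis_vec is')
    = (if fst (hd is') = k \<and> (\<forall>j\<in>set (tl is'). fst j = m) then e (hd is') * coord_prod (tl is') w else 0) *
      \<theta> (map basis_vec is')"
    by (simp only: summand)
qed auto

text \<open>Tangent vectors to the cone over \<open>M\<close> at
  \<open>symbol_map s F r 1 w\<close>: \<open>a\<close> is the radial part, \<open>u\<close> the
  direction in the space of \<open>w\<close>.\<close>

definition tangent_vec :: "complex \<Rightarrow> 'w \<Rightarrow> 'w symbol_vec" where
  "tangent_vec a u = vec (\<lambda>i. a * coord_fun i w + coord_deriv i w u)"

text \<open>Tangent spaces along the flow to the limit point degenerate to the span of the leading parts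
  of their elements.\<close>

lemma top_part_tangent:
  assumes nz: "tangent_vec a u \<noteq> 0"
  shows "VF.top_part fst (tangent_vec a u) \<in> T"
  unfolding VF.affine_tangent_space_at[OF limit_vec_in]
proof (intro CollectI conjI allI ballI impI)
  let ?E = "tangent_vec a u"
  define K where "K = VF.weight fst ?E"
  define e where "e i = a * coord_fun i w + coord_deriv i w u" for i
  have eE: "coord i ?E = e i" if "i \<in> coords" for i using that by (simp add: tangent_vec_def coord_vec e_def)
  have EV: "?E \<in> symbol_space F r" unfolding tangent_vec_def by (rule vec_in)
  have top: "VF.top_part fst ?E \<in> symbol_space F r" unfolding VF.top_part_def by (rule VF.component_V)
  then show "VF.top_part fst ?E \<in> symbol_space F r" .
  have ctop: "coord i (VF.top_part fst ?E) = (if fst i = K then e i else 0)" if "i \<in> coords" for i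
    using that by (simp add: VF.top_part_def VF.cc_component K_def eE)
  have upper: "fst i \<le> K" if "i \<in> coords" "e i \<noteq> 0" for i
    unfolding K_def by (rule VF.weight_upper) (use that eE in auto)
  have Kr: "K \<le> r"
    using VF.weight_attained[OF EV nz, of fst] coordsD(1) unfolding K_def by auto
  fix d \<theta>
  assume \<theta>: "\<theta> \<in> sym_forms (symbol_scale s) (symbol_space F r) (Suc d)"
    and z: "\<forall>y\<in>M. \<forall>v\<in>y. \<theta> (replicate (Suc d) v) = 0"
  \<comment> \<open>The coweight of one factor of weight \<open>K\<close> and \<open>d\<close>
    factors of weight \<open>m\<close>.\<close>
  define N where "N = (r - K) + d * (r - m)"
  define A where "A is = e (hd is) * coord_prod (tl is) w * \<theta> (map basis_vec is)" for "is"
  have "(\<Sum>is\<in>{is \<in> VF.index_lists (Suc d). coweight is = N}. A is) = 0"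
    using weight_relation[OF \<theta> z, where k = N and a = a and v = w and u = u] unfolding A_def e_def coord_prod_def .
  moreover have "\<theta> (VF.top_part fst ?E # replicate d limit_vec) = (\<Sum>is\<in>{is \<in> VF.index_lists (Suc d). coweight is = N}. A is)"
  proof (rule trans[OF form_at_limit_weight[OF \<theta> top, of K e, unfolded N_def[symmetric]] sum.cong[OF refl]])
    show "coord i (VF.top_part fst ?E) = (if fst i = K then e i else 0)" if "i \<in> coords" for i by (rule ctop[OF that])
    fix is' assume h: "is' \<in> {is \<in> VF.index_lists (Suc d). coweight is = N}"
    then have is0: "is' \<in> VF.index_lists (Suc d)" by simp
    obtain i js where is': "is' = i # js" "i \<in> coords" "set js \<subseteq> coords" "length js = d"
      by (rule index_listsE[OF is0])
    have cw: "(r - fst i) + sum_list (map (\<lambda>j. r - fst j) js) = N"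
      using h unfolding is'(1) coweight_def by simp
    \<comment> \<open>A nonzero term has a head of weight at most \<open>K\<close> and a tail of
      weights at most \<open>m\<close>; the coweight \<open>N\<close> is the least possible under
      these bounds, so equality holds throughout.\<close>
    have "fst i = K \<and> (\<forall>j\<in>set js. fst j = m)" if ne: "e i * coord_prod js w \<noteq> 0"
    proof -
      have i: "fst i \<le> K" using upper[OF is'(2)] ne by auto
      have js: "fst j \<le> m" if "j \<in> set js" for j
      proof (rule ccontr)
        assume "\<not> fst j \<le> m"
        moreover have "j \<in> coords" using is'(3) that by blast
        ultimately have "coord_fun j w = 0" using coord_fun_above[of j] by simp
        then have "coord_prod js w = 0" unfolding coord_prod_def using that by (intro prod_list_map_zero[of j])
        then show False using ne by simp
      qed
      have low: "length js * (r - m) \<le> sum_list (map (\<lambda>j. r - fst j) js)"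
        by (rule sum_list_lower) (use js in \<open>simp add: diff_le_mono2\<close>)
      have 1: "r - fst i = r - K" "sum_list (map (\<lambda>j. r - fst j) js) \<le> length js * (r - m)"
        using cw low i unfolding N_def is'(4) by linarith+
      then have "fst i = K" using i Kr by simp
      moreover have "fst j = m" if j: "j \<in> set js" for j
      proof -
        have "r - fst j = r - m"
          by (rule sum_list_eq_max[of js "r - m" "\<lambda>j. r - fst j", OF _ 1(2) j]) (use js in \<open>simp add: diff_le_mono2\<close>)
        then show ?thesis using js[OF j] m_le_r by simp
      qed
      ultimately show ?thesis by blast
    qed
    then show "(if fst (hd is') = K \<and> (\<forall>j\<in>set (tl is'). fst j = m) then e (hd is') * coord_prod (tl is') w else 0) *
        \<theta> (map basis_vec is') = A is'"
      unfolding A_def is'(1) by auto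
  qed
  ultimately show "\<theta> (VF.top_part fst ?E # replicate d limit_vec) = 0" by simp
qed

lemma tangent_vec_linear:
  "tangent_vec a u + tangent_vec b v = tangent_vec (a + b) (u + v)"
  "symbol_scale s c (tangent_vec a u) = tangent_vec (c * a) (s c u)"
proof -
  have add: "coord_deriv i w (u + v) = coord_deriv i w u + coord_deriv i w v" if "i \<in> coords" for i u v
    using coord_deriv_linear[OF that, of w 1 u 1 v] by simp
  have scale: "coord_deriv i w (s c u) = c * coord_deriv i w u" if "i \<in> coords" for i u c
    using coord_deriv_linear[OF that, of w c u 0 0] by simp
  show "tangent_vec a u + tangent_vec b v = tangent_vec (a + b) (u + v)"
    by (rule VF_eqI)
      (auto simp: tangent_vec_def VF.cc_add coord_vec add algebra_simps intro!: VF.V_closed vec_in)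
  show "symbol_scale s c (tangent_vec a u) = tangent_vec (c * a) (s c u)"
    by (rule VF_eqI)
      (auto simp: tangent_vec_def VF.cc_scale coord_vec scale algebra_simps intro!: VF.V_closed vec_in)
qed

text \<open>The tangent vectors at one point of the curve form a space of dimension at least
  \<open>card B + 1\<close>; the top parts of a graded basis are as many independent vectors in
  \<open>T\<close>, and by \<open>dimT\<close> they span it. The functional kills each of them: the
  top weight is at most \<open>m + 1\<close>, and \<open>low\<close> and \<open>mid\<close> cover
  the cases.\<close>

lemma functional_kills_tangent:
  assumes dimT: "VF.dim T \<le> card B + 1" and \<alpha>: "hom VF.X 1 \<alpha>"
    and low: "\<And>i. i \<in> coords \<Longrightarrow> fst i \<le> m \<Longrightarrow> \<alpha> (basis_vec i) = 0"
    and mid: "\<And>u. (\<Sum>i\<in>coords. (if fst i = Suc m then coord_deriv i w u else 0) * \<alpha> (basis_vec i)) = 0"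
    and z: "z \<in> T"
  shows "\<alpha> z = 0"
proof (rule ccontr)
  assume nz: "\<alpha> z \<noteq> 0"
  define L where "L = {tangent_vec a u | a u. True}"
  have LI: "tangent_vec a u \<in> L" for a u unfolding L_def by blast
  have L: "VF.subspace L"
  proof (rule VF.subspaceI)
    have "symbol_scale s 0 (tangent_vec 0 0) = tangent_vec (0 * 0) (s 0 0)" by (rule tangent_vec_linear(2))
    then show "0 \<in> L" using LI[of "0 * 0" "s 0 0"] VF.scale_zero_left[of "tangent_vec 0 0"] by metis
    show "x + y \<in> L" if "x \<in> L" "y \<in> L" for x y using that LI unfolding L_def by (auto simp: tangent_vec_linear)
    show "symbol_scale s c x \<in> L" if "x \<in> L" for c x using that LI unfolding L_def by (auto simp: tangent_vec_linear)
  qed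
  have LV: "L \<subseteq> symbol_space F r" unfolding L_def tangent_vec_def using vec_in by blast
  obtain S where S: "finite S" "S \<subseteq> L" "inj_on (VF.top_part fst) S" "VF.independent (VF.top_part fst ` S)" "L \<subseteq> VF.span S"
    using VF.graded_basis[OF L LV, of fst] by blast
  have top0: "x \<noteq> 0" if "x \<in> S" for x
  proof
    assume "x = 0"
    have "coord i (VF.top_part fst 0) = coord i 0" if i: "i \<in> coords" for i
      using i VF.lin_zero[of "coord i"] by (simp add: VF.top_part_def VF.cc_component)
    then have "VF.top_part fst 0 = 0"
      by (intro VF_eqI) (auto simp: VF.top_part_def VF.component_V VF.V_closed)
    then have "0 \<in> VF.top_part fst ` S" using \<open>x \<in> S\<close> \<open>x = 0\<close> by (metis image_eqI)
    then show False using S(4) VF.dependent_zero by blast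
  qed
  have topT: "VF.top_part fst x \<in> T" if "x \<in> S" for x
  proof -
    have "x \<in> L" using S(2) that by blast
    then obtain a u where x: "x = tangent_vec a u" unfolding L_def by blast
    show ?thesis using top_part_tangent[of a u] top0[OF that] unfolding x by blast
  qed
  have \<alpha>top: "\<alpha> (VF.top_part fst x) = 0" if xS: "x \<in> S" for x
  proof -
    obtain a u where x: "x = tangent_vec a u" using S(2) xS unfolding L_def by blast
    define e where "e i = a * coord_fun i w + coord_deriv i w u" for i
    have eE: "coord i x = e i" if "i \<in> coords" for i using that by (simp add: x tangent_vec_def coord_vec e_def)
    define K where "K = VF.weight fst x"
    obtain i0 where i0: "i0 \<in> coords" "e i0 \<noteq> 0" "fst i0 = K"
      using VF.weight_attained[of x fst] top0[OF xS] LV S(2) xS eE unfolding K_def by (metis subsetD)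
    \<comment> \<open>Above weight \<open>m\<close> the coordinates vanish at \<open>w\<close>,
      above \<open>m + 1\<close> their differentials vanish too.\<close>
    have K: "K \<le> Suc m"
    proof (rule ccontr)
      assume "\<not> K \<le> Suc m"
      then have "e i0 = 0" unfolding e_def using coord_fun_above[OF i0(1)] coord_deriv_above[OF i0(1)] i0(3) by simp
      then show False using i0(2) by simp
    qed
    have "\<alpha> (VF.top_part fst x) = (\<Sum>i\<in>coords. (if fst i = K then coord i x else 0) * \<alpha> (basis_vec i))"
      unfolding VF.top_part_def VF.component_def K_def[symmetric] by (rule VF.hom_1_comb[OF \<alpha>])
    also have "\<dots> = 0"
    proof (cases "K \<le> m")
      case True
      then show ?thesis by (intro sum.neutral) (use low in auto)
    next
      case False
      then have Km: "K = Suc m" using K by simp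
      have "(\<Sum>i\<in>coords. (if fst i = K then coord i x else 0) * \<alpha> (basis_vec i))
        = (\<Sum>i\<in>coords. (if fst i = Suc m then coord_deriv i w u else 0) * \<alpha> (basis_vec i))"
        by (rule sum.cong) (auto simp: Km eE e_def coord_fun_above)
      then show ?thesis using mid[of u] by simp
    qed
    finally show ?thesis .
  qed
  \<comment> \<open>The coordinate of weight 0 detects \<open>a\<close> and those of weight 1 detect
    \<open>u\<close>, so the radial vector, indexed by \<open>None\<close>, and the basis directions
    are independent.\<close>
  have "card B + 1 \<le> card S"
  proof (rule ccontr)
    assume "\<not> card B + 1 \<le> card S"
    then have lt: "card S < card (insert None (Some ` B))"
      using finite_Basis by (simp add: card_image)
    define g where "g x = (case x of None \<Rightarrow> tangent_vec 1 0 | Some b \<Rightarrow> tangent_vec 0 b)" for x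
    have "\<exists>c. (\<exists>x\<in>insert None (Some ` B). c x \<noteq> 0) \<and> (\<Sum>x\<in>insert None (Some ` B). symbol_scale s (c x) (g x)) = 0"
      by (rule VF.family_dependent[OF S(1) _ lt]) (use LI S(5) finite_Basis in \<open>auto simp: g_def\<close>)
    then obtain c x0 where x0: "x0 \<in> insert None (Some ` B)" "c x0 \<noteq> 0"
      and c: "(\<Sum>x\<in>insert None (Some ` B). symbol_scale s (c x) (g x)) = 0" by blast
    have co: "(\<Sum>x\<in>insert None (Some ` B). c x * coord i (g x)) = 0" if i: "i \<in> coords" for i
    proof -
      have "coord i (\<Sum>x\<in>insert None (Some ` B). symbol_scale s (c x) (g x)) = 0"
        unfolding c using VF.lin_zero[of "coord i"] i by simp
      then show ?thesis by (simp only: VF.cc_sum[OF i] VF.cc_scale[OF i])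
    qed
    have split: "(\<Sum>x\<in>insert None (Some ` B). c x * coord i (g x))
        = c None * coord_fun i w + (\<Sum>b\<in>B. c (Some b) * coord_deriv i w b)" if i: "i \<in> coords" for i
    proof -
      have d0: "coord_deriv i w 0 = 0" using coord_deriv_linear[OF i, of w 0 0 0 0] by simp
      have "(\<Sum>x\<in>insert None (Some ` B). c x * coord i (g x)) = c None * coord i (g None) + (\<Sum>x\<in>Some ` B. c x * coord i (g x))"
        by (rule sum.insert) (use finite_Basis in auto)
      also have "(\<Sum>x\<in>Some ` B. c x * coord i (g x)) = (\<Sum>b\<in>B. c (Some b) * coord i (g (Some b)))"
        by (simp add: sum.reindex)
      finally show ?thesis using i d0 by (simp add: g_def tangent_vec_def coord_vec)
    qed
    let ?i0 = "(0, \<lambda>vs. if vs = [] then 1 else 0) :: nat \<times> ('w list \<Rightarrow> complex)"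
    have i0: "?i0 \<in> coords" unfolding coords_def by (simp add: Fbasis_def)
    have cN: "c None = 0" using co[OF i0] unfolding split[OF i0] by (simp add: coord_fun_def coord_deriv_def)
    have "c (Some b) = 0" if b: "b \<in> B" for b
    proof -
      have i1: "(1, one_form b) \<in> coords" unfolding coords_def using b r_pos by (simp add: Fbasis_def)
      have "(\<Sum>b'\<in>B. c (Some b') * coord_deriv (1, one_form b) w b') = (\<Sum>b'\<in>{b}. c (Some b') * coord_deriv (1, one_form b) w b')"
        by (rule sum.mono_neutral_right) (use b finite_Basis in \<open>auto simp: coord_deriv_def one_form_basis\<close>)
      then have "(\<Sum>b'\<in>B. c (Some b') * coord_deriv (1, one_form b) w b') = c (Some b)"
        using b by (simp add: coord_deriv_def one_form_basis)
      then show ?thesis using co[OF i1] unfolding split[OF i1] cN by simp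
    qed
    then show False using x0 cN by auto
  qed
  moreover have "z \<notin> VF.span (VF.top_part fst ` S)"
    using VF.hom_1_zero_span[OF \<alpha>, of "VF.top_part fst ` S" z] \<alpha>top nz by blast
  then have ind: "VF.independent (insert z (VF.top_part fst ` S))" by (rule VF.independent_insertI) (rule S(4))
  have "z \<notin> VF.top_part fst ` S" using \<alpha>top nz by auto
  then have "card (insert z (VF.top_part fst ` S)) = Suc (card S)"
    using S(1) card_image[OF S(3)] by simp
  moreover have "card (insert z (VF.top_part fst ` S)) \<le> VF.dim T"
    by (rule VF.independent_card_le[OF ind _ VF.tangent_subset]) (use z topT in auto)
  ultimately show False using dimT by simp
qed

end

section \<open>Relations at the limit point\<close>

context coord_space
begin

lemma dual_system_expand:
  assumes d: "dual_system c l u" and \<theta>: "hom X 1 \<theta>" and v: "v \<in> V"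
    and ker: "\<And>v. v \<in> V \<Longrightarrow> (\<And>i. i < c \<Longrightarrow> l i v = 0) \<Longrightarrow> \<theta> v = 0"
  shows "\<theta> v = (\<Sum>i<c. \<theta> (u i) * l i v)"
proof -
  let ?p = "\<Sum>i<c. s (l i v) (u i)"
  have p: "?p \<in> V" by (intro V_closed dual_systemD(2)[OF d]) simp
  have "\<theta> (v - ?p) = 0"
  proof (rule ker[OF V_closed(5)[OF v p]])
    fix i assume i: "i < c"
    have "l i (v - ?p) + l i ?p = l i v"
      using hom_1_linear(1)[OF dual_systemD(1)[OF d i], of "v - ?p" ?p] by simp
    then show "l i (v - ?p) = 0" using dual_system_comb[OF d i, of "\<lambda>i. l i v"] by simp
  qed
  moreover have "\<theta> (v - ?p) + \<theta> ?p = \<theta> v" using hom_1_linear(1)[OF \<theta>, of "v - ?p" ?p] by simp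
  ultimately have "\<theta> v = \<theta> ?p" by simp
  also have "\<dots> = (\<Sum>i<c. l i v * \<theta> (u i))" by (rule hom_1_comb[OF \<theta>])
  finally show ?thesis by (simp add: mult.commute)
qed

lemma tail_1I:
  assumes "g \<in> alg X" "g 0 = 0"
  shows "g \<in> tail X 1"
proof -
  obtain l where l: "hom X 1 l" "g - (\<lambda>_. g 0) - l \<in> tail X 2" using linear_part[OF assms(1)] by blast
  have "g = (g - (\<lambda>_. g 0) - l) + l" using assms(2) by (auto simp: fun_eq_iff fun_apply minus_apply)
  moreover have "(g - (\<lambda>_. g 0) - l) + l \<in> tail X 1"
    by (rule tail.add[OF tail_mono[OF l(2)] tail.hom[OF l(1) order_refl]]) simp
  ultimately show ?thesis by simp
qed

text \<open>Applied to the 2 by 2 minors, linear forms vanishing at \<open>w\<close>, the hypothesis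
  makes the coordinates of \<open>v\<close> proportional to those of \<open>w\<close>.\<close>

lemma vanishing_at_line:
  assumes w: "w \<in> V" "w \<noteq> 0" and v: "v \<in> V" and ker: "\<And>l. hom X 1 l \<Longrightarrow> l w = 0 \<Longrightarrow> l v = 0"
  shows "v \<in> span {w}"
proof -
  obtain k where k: "k \<in> I" "cc k w \<noteq> 0"
  proof (rule ccontr)
    assume "\<not> thesis"
    then have "(\<Sum>i\<in>I. s (cc i w) (bb i)) = 0" using that by (intro sum.neutral) auto
    then show False using expand[OF w(1)] w(2) by simp
  qed
  have comp: "cc i v = (cc k v / cc k w) * cc i w" if i: "i \<in> I" for i
  proof -
    let ?l = "fun_scale (cc k w) (cc i) - fun_scale (cc i w) (cc k)"
    have "hom X 1 ?l" by (intro hom_diff hom_scale hom_gen) (use i k(1) in auto)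
    moreover have "?l w = 0" by (simp add: minus_apply fun_apply)
    ultimately have "?l v = 0" by (rule ker)
    then show ?thesis using k(2) by (simp add: minus_apply fun_apply field_simps)
  qed
  have "v = (\<Sum>i\<in>I. s (cc i v) (bb i))" by (rule expand[OF v])
  also have "\<dots> = (\<Sum>i\<in>I. s (cc k v / cc k w) (s (cc i w) (bb i)))"
    by (rule sum.cong[OF refl]) (simp add: comp)
  also have "\<dots> = s (cc k v / cc k w) w"
    unfolding scale_sum_right[symmetric] expand[OF w(1), symmetric] ..
  finally show ?thesis unfolding in_span_single by blast
qed

end

context regular_sequence
begin

lemma ideal_plus_tail_sum:
  assumes "j \<le> c" "\<And>i. i \<in> S \<Longrightarrow> g i \<in> ideal_plus_tail j p"
  shows "sum g S \<in> ideal_plus_tail j p"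
  using assms(2)
proof (induction S rule: infinite_finite_induct)
  case (insert a S)
  have "g a + sum g S \<in> ideal_plus_tail j p"
    by (rule ideal_plus_tail_add[OF assms(1)]) (use insert in auto)
  then show ?case unfolding sum.insert[OF insert(1,2)] .
next
  case (infinite S) show ?case unfolding sum.infinite[OF infinite(1)] by (rule tail_ideal_plus_tail[OF assms(1) tail_zero])
next
  case empty show ?case unfolding sum.empty by (rule tail_ideal_plus_tail[OF assms(1) tail_zero])
qed

end

context base_point
begin

definition high :: "(nat \<times> ('w list \<Rightarrow> complex)) set" where
  "high = {i \<in> coords. m < fst i}"

text \<open>An element of \<open>relations k\<close> arises from the equations of weight above \<open>m\<close>, where those of
  weight at most \<open>k\<close> enter with coefficients vanishing at \<open>w\<close>. This makes equations of
  weight \<open>k\<close> that lie in it redundant at \<open>w\<close>.\<close>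

definition relations :: "nat \<Rightarrow> ('w \<Rightarrow> complex) set" where
  "relations k = {(\<Sum>i\<in>high. a i * coord_fun i) | a. \<forall>i. a i \<in> alg W.X \<and> (fst i \<le> k \<longrightarrow> a i w = 0)}"

lemma finite_high: "finite high"
  unfolding high_def using VF.finI by simp

lemma relationsI: "(\<And>i. a i \<in> alg W.X) \<Longrightarrow> (\<And>i. fst i \<le> k \<Longrightarrow> a i w = 0) \<Longrightarrow> (\<Sum>i\<in>high. a i * coord_fun i) \<in> relations k"
  unfolding relations_def by blast

lemma relationsE:
  assumes "g \<in> relations k"
  obtains a where "\<And>i. a i \<in> alg W.X" "\<And>i. fst i \<le> k \<Longrightarrow> a i w = 0" "g = (\<Sum>i\<in>high. a i * coord_fun i)"
  using assms unfolding relations_def by blast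

lemma subspace_relations: "fun_space.subspace (relations k)"
proof (rule fun_space.subspaceI)
  have "(\<Sum>i\<in>high. (\<lambda>_. 0) i * coord_fun i) \<in> relations k"
    by (rule relationsI) (simp_all add: alg_zero fun_apply)
  then show "0 \<in> relations k" by (simp only: mult_zero_left sum.neutral_const)
next
  fix g h assume "g \<in> relations k" "h \<in> relations k"
  obtain a where a: "\<And>i. a i \<in> alg W.X" "\<And>i. fst i \<le> k \<Longrightarrow> a i w = 0" "g = (\<Sum>i\<in>high. a i * coord_fun i)"
    using \<open>g \<in> relations k\<close> by (rule relationsE) blast
  obtain b where b: "\<And>i. b i \<in> alg W.X" "\<And>i. fst i \<le> k \<Longrightarrow> b i w = 0" "h = (\<Sum>i\<in>high. b i * coord_fun i)"
    using \<open>h \<in> relations k\<close> by (rule relationsE) blast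
  have "g + h = (\<Sum>i\<in>high. (a i + b i) * coord_fun i)" unfolding a b by (simp only: distrib_right sum.distrib)
  moreover have "(\<Sum>i\<in>high. (a i + b i) * coord_fun i) \<in> relations k"
    by (rule relationsI) (simp_all add: alg.add a(1,2) b(1,2) fun_apply)
  ultimately show "g + h \<in> relations k" by simp
next
  fix c g assume "g \<in> relations k"
  obtain a where a: "\<And>i. a i \<in> alg W.X" "\<And>i. fst i \<le> k \<Longrightarrow> a i w = 0" "g = (\<Sum>i\<in>high. a i * coord_fun i)"
    using \<open>g \<in> relations k\<close> by (rule relationsE) blast
  have "fun_scale c g = (\<Sum>i\<in>high. fun_scale c (a i) * coord_fun i)"
    by (rule ext) (simp add: a(3) sum_fun_apply fun_apply sum_distrib_left mult.assoc)
  moreover have "(\<Sum>i\<in>high. fun_scale c (a i) * coord_fun i) \<in> relations k"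
    by (rule relationsI) (simp_all add: alg_scale a(1,2) fun_apply)
  ultimately show "fun_scale c g \<in> relations k" by simp
qed

lemma relations_gen:
  assumes a: "a \<in> alg W.X" and i: "i \<in> coords" "m < fst i" and z: "fst i \<le> k \<Longrightarrow> a w = 0"
  shows "a * coord_fun i \<in> relations k"
proof -
  have "(\<Sum>j\<in>high. (if j = i then a else 0) * coord_fun j) = (\<Sum>j\<in>{i}. (if j = i then a else 0) * coord_fun j)"
    by (rule sum.mono_neutral_right) (use i finite_high in \<open>auto simp: high_def\<close>)
  moreover have "(\<Sum>j\<in>high. (if j = i then a else 0) * coord_fun j) \<in> relations k"
    by (rule relationsI) (auto simp: a z fun_apply intro: alg_zero)
  ultimately show ?thesis by simp
qed

definition weight_vec :: "nat \<Rightarrow> 'w \<Rightarrow> 'w symbol_vec" where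
  "weight_vec k v = vec (\<lambda>i. if fst i = k then coord_fun i v else 0)"

text \<open>If all weights were at most \<open>m\<close>, the coweight would be too large. Fix a
  factor of weight above \<open>m\<close>. Unless it exceeds \<open>k\<close> or has a companion
  above \<open>m\<close>, its coweight and those of the others attain their lower bounds.\<close>

lemma coweight_cases:
  assumes "set is \<subseteq> coords" "length is = Suc d" "coweight is = (r - k) + d * (r - m)" "m < k" "k \<le> r"
  obtains (high) j where "j \<in> set is" "k < fst j"
  | (two) j j' where "j \<in> set is" "m < fst j" "j' \<in> set (remove1 j is)" "m < fst j'"
  | (one) j where "j \<in> set is" "fst j = k" "\<And>j'. j' \<in> set (remove1 j is) \<Longrightarrow> fst j' = m"
proof -
  have le: "fst j \<le> r" if "j \<in> set is" for j using coordsD(1) assms(1) that by blast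
  have "\<exists>j\<in>set is. m < fst j"
  proof (rule ccontr)
    assume "\<not> ?thesis"
    then have "length is * (r - m) \<le> coweight is"
      unfolding coweight_def by (intro sum_list_lower) (simp add: not_less diff_le_mono2)
    then show False using assms(2-5) by simp
  qed
  then obtain j where j: "j \<in> set is" "m < fst j" by blast
  consider "k < fst j" | "\<exists>j'\<in>set (remove1 j is). m < fst j'"
    | "fst j \<le> k" "\<forall>j'\<in>set (remove1 j is). fst j' \<le> m" by force
  then show thesis
  proof cases
    case 1 then show thesis using high j(1) by blast
  next
    case 2 then show thesis using two j by blast
  next
    case 3
    let ?rest = "remove1 j is"
    have len: "length ?rest = d" using j(1) assms(2) by (simp add: length_remove1)
    have sum: "(r - fst j) + sum_list (map (\<lambda>j. r - fst j) ?rest) = (r - k) + d * (r - m)"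
      using sum_list_map_remove1[OF j(1), of "\<lambda>j. r - fst j"] assms(3) unfolding coweight_def by simp
    have low: "r - m \<le> r - fst j'" if "j' \<in> set ?rest" for j' using 3(2) that by (simp add: diff_le_mono2)
    have "length ?rest * (r - m) \<le> sum_list (map (\<lambda>j. r - fst j) ?rest)" by (rule sum_list_lower) (rule low)
    moreover have "r - k \<le> r - fst j" using 3(1) by simp
    ultimately have eq: "r - fst j = r - k" "sum_list (map (\<lambda>j. r - fst j) ?rest) \<le> length ?rest * (r - m)"
      using sum unfolding len by linarith+
    have "fst j' = m" if j': "j' \<in> set ?rest" for j'
    proof -
      have "r - fst j' = r - m" by (rule sum_list_eq_max[of ?rest "r - m" "\<lambda>j. r - fst j", OF low eq(2) j'])
      then show ?thesis using 3(2) j' m_le_r by force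
    qed
    moreover have "fst j = k" using eq(1) 3(1) assms(5) by simp
    ultimately show thesis using one j(1) by blast
  qed
qed

lemma coord_prod_remove1: "j \<in> set js \<Longrightarrow> coord_prod js = coord_prod (remove1 j js) * coord_fun j"
  by (rule ext) (simp add: coord_prod_def prod_list_remove1[of j js] fun_apply)

text \<open>For a main product the two terms combine to a coefficient that vanishes at
  \<open>w\<close>. Any other product contains a factor heavier than \<open>k\<close>, or two
  factors above \<open>m\<close>, one of which makes the coefficient of the other vanish at
  \<open>w\<close>, or a single factor of weight \<open>k\<close> in its tail; in the last case the
  head has weight \<open>m\<close> and is cancelled by
  \<open>of_nat (fst i) - of_nat m\<close>.\<close>

lemma relation_term:
  assumes is': "i \<in> coords" "set js \<subseteq> coords" "length js = d" and k: "m < k" "k \<le> r"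
    and cw: "coweight (i # js) = (r - k) + d * (r - m)"
  shows "(\<lambda>v. (of_nat k - of_nat m) * (if fst i = k \<and> (\<forall>j\<in>set js. fst j = m) then coord_fun i v * coord_prod js w else 0)
      - (of_nat (fst i) - of_nat m) * (coord_fun i v * coord_prod js v)) \<in> relations k"
proof (cases "fst i = k \<and> (\<forall>j\<in>set js. fst j = m)")
  case True
  let ?a = "fun_scale (of_nat k - of_nat m) ((\<lambda>_. coord_prod js w) - coord_prod js)"
  have "?a * coord_fun i \<in> relations k"
  proof (rule relations_gen[OF _ is'(1)])
    show "?a \<in> alg W.X"
      by (rule alg_scale[OF subring_of_closed(4)[OF subring_alg alg.const coord_prod_alg[OF is'(2)]]])
  qed (use True k in \<open>simp_all add: fun_apply minus_apply\<close>)
  moreover have "?a * coord_fun i = (\<lambda>v. (of_nat k - of_nat m) * (if fst i = k \<and> (\<forall>j\<in>set js. fst j = m) then coord_fun i v * coord_prod js w else 0)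
      - (of_nat (fst i) - of_nat m) * (coord_fun i v * coord_prod js v))"
    using True by (auto simp: fun_eq_iff fun_apply minus_apply algebra_simps)
  ultimately show ?thesis by simp
next
  case False
  let ?g = "fun_scale (- (of_nat (fst i) - of_nat m)) (coord_prod (i # js))"
  have eq: "(\<lambda>v. (of_nat k - of_nat m) * (if fst i = k \<and> (\<forall>j\<in>set js. fst j = m) then coord_fun i v * coord_prod js w else 0)
      - (of_nat (fst i) - of_nat m) * (coord_fun i v * coord_prod js v)) = ?g"
    unfolding if_not_P[OF False] by (simp add: fun_eq_iff fun_apply coord_prod_def left_diff_distrib)
  have cs: "set (i # js) \<subseteq> coords" using is' by simp
  have rest: "set (remove1 j (i # js)) \<subseteq> coords" for j using cs set_remove1_subset by fast
  note sub = fun_space.subspace_scale[OF subspace_relations]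
  have len: "length (i # js) = Suc d" using is'(3) by simp
  have "?g \<in> relations k"
  proof (cases rule: coweight_cases[OF cs len cw k])
    case (1 j)
    note high = 1
    show ?thesis unfolding coord_prod_remove1[OF high(1)]
      by (rule sub, rule relations_gen[OF coord_prod_alg[OF rest]]) (use high cs k in auto)
  next
    case (2 j j')
    note two = 2
    have "coord_fun j' w = 0" using two(3,4) rest coord_fun_above by blast
    then have "coord_prod (remove1 j (i # js)) w = 0" unfolding coord_prod_def using two(3) by (intro prod_list_map_zero[of j'])
    then show ?thesis unfolding coord_prod_remove1[OF two(1)]
      by (intro sub relations_gen[OF coord_prod_alg[OF rest]]) (use two cs in auto)
  next
    case (3 j)
    note one = 3
    have "fst i = m"
    proof (rule ccontr)
      assume ne: "fst i \<noteq> m"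
      then have "i = j" using one(3)[of i] by (cases "j = i") auto
      then show False using one False by simp
    qed
    then have "?g = 0" by (simp add: fun_eq_iff fun_apply)
    then show ?thesis using fun_space.subspace_0[OF subspace_relations] by (simp only:)
  qed
  then show ?thesis unfolding eq .
qed

text \<open>A form vanishing on \<open>M\<close>, polarized at the limit point, is compared with the part of
  \<open>weight_relation\<close> of the same weight, where \<open>a = - m\<close> cancels the terms with leading weight \<open>m\<close>.\<close>

lemma form_relation:
  assumes \<theta>: "\<theta> \<in> sym_forms (symbol_scale s) (symbol_space F r) (Suc d)"
    and z: "\<forall>y\<in>M. \<forall>u\<in>y. \<theta> (replicate (Suc d) u) = 0" and k: "m < k" "k \<le> r"
  shows "(\<lambda>v. \<theta> (weight_vec k v # replicate d limit_vec)) \<in> relations k"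
proof -
  define N where "N = (r - k) + d * (r - m)"
  define C where "C is = \<theta> (map basis_vec is)" for "is"
  define L where "L = {is \<in> VF.index_lists (Suc d). coweight is = N}"
  define main where "main is v = (if fst (hd is) = k \<and> (\<forall>j\<in>set (tl is). fst j = m)
    then coord_fun (hd is) v * coord_prod (tl is) w else 0)" for "is" v
  \<comment> \<open>The factor \<open>k - m\<close> matches the coefficient that a head of weight
    \<open>k\<close> has in \<open>rel\<close>, so that on main products the two terms differ only
    in evaluating the tail at \<open>w\<close> or at \<open>v\<close>.\<close>
  define D where "D is v = (of_nat k - of_nat m) * main is v
    - (of_nat (fst (hd is)) - of_nat m) * (coord_fun (hd is) v * coord_prod (tl is) v)" for "is" v
  have D: "D is \<in> relations k" if "is \<in> L" for "is"
  proof -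
    have is0: "is \<in> VF.index_lists (Suc d)" and cw: "coweight is = N" using that unfolding L_def by auto
    obtain i js where is': "is = i # js" "i \<in> coords" "set js \<subseteq> coords" "length js = d"
      by (rule index_listsE[OF is0])
    have "(\<lambda>v. (of_nat k - of_nat m) * (if fst i = k \<and> (\<forall>j\<in>set js. fst j = m) then coord_fun i v * coord_prod js w else 0)
      - (of_nat (fst i) - of_nat m) * (coord_fun i v * coord_prod js v)) \<in> relations k"
      by (rule relation_term[OF is'(2-4) k]) (use cw is'(1) in \<open>simp add: N_def\<close>)
    moreover have "(\<lambda>v. (of_nat k - of_nat m) * (if fst i = k \<and> (\<forall>j\<in>set js. fst j = m) then coord_fun i v * coord_prod js w else 0)
      - (of_nat (fst i) - of_nat m) * (coord_fun i v * coord_prod js v)) = D is"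
      by (rule ext) (simp add: D_def main_def is'(1))
    ultimately show ?thesis by simp
  qed
  have g: "\<theta> (weight_vec k v # replicate d limit_vec) = (\<Sum>is\<in>L. main is v * C is)" for v
  proof -
    have V: "weight_vec k v \<in> symbol_space F r" unfolding weight_vec_def by (rule vec_in)
    have cV: "coord i (weight_vec k v) = (if fst i = k then coord_fun i v else 0)" if "i \<in> coords" for i
      using that by (simp add: weight_vec_def coord_vec)
    show ?thesis unfolding L_def N_def main_def C_def by (rule form_at_limit_weight[OF \<theta> V cV])
  qed
  have rel: "(\<Sum>is\<in>L. (of_nat (fst (hd is)) - of_nat m) * (coord_fun (hd is) v * coord_prod (tl is) v) * C is) = 0" for v
  proof -
    \<comment> \<open>Euler's identity, which turns the differential in direction
      \<open>u = v\<close> into multiplication by the weight.\<close>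
    have "coord_deriv i v v = of_nat (fst i) * coord_fun i v" for i
      unfolding coord_deriv_def coord_fun_def by (cases "fst i") auto
    then show ?thesis
      using weight_relation[OF \<theta> z, where k = N and a = "- of_nat m" and v = v and u = v]
      unfolding L_def C_def coord_prod_def by (simp add: algebra_simps)
  qed
  have km: "of_nat k - of_nat m \<noteq> (0::complex)" using k by simp
  have "(\<lambda>v. \<theta> (weight_vec k v # replicate d limit_vec))
    = fun_scale (1 / (of_nat k - of_nat m)) (\<Sum>is\<in>L. fun_scale (C is) (D is))"
  proof (rule ext)
    fix v
    have "(\<Sum>is\<in>L. C is * D is v) = (of_nat k - of_nat m) * (\<Sum>is\<in>L. main is v * C is)
      - (\<Sum>is\<in>L. (of_nat (fst (hd is)) - of_nat m) * (coord_fun (hd is) v * coord_prod (tl is) v) * C is)"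
      unfolding sum_distrib_left sum_subtractf[symmetric]
      by (rule sum.cong[OF refl]) (simp add: D_def algebra_simps)
    then show "\<theta> (weight_vec k v # replicate d limit_vec)
      = fun_scale (1 / (of_nat k - of_nat m)) (\<Sum>is\<in>L. fun_scale (C is) (D is)) v"
      unfolding rel g using km by (simp add: fun_apply sum_fun_apply)
  qed
  moreover have "fun_scale (1 / (of_nat k - of_nat m)) (\<Sum>is\<in>L. fun_scale (C is) (D is)) \<in> relations k"
    by (intro fun_space.subspace_scale fun_space.subspace_sum subspace_relations D)
  ultimately show ?thesis by simp
qed

text \<open>The linear forms that yield relations form a space \<open>\<Theta>\<close>, which by
  \<open>form_relation\<close> contains the differentials that define \<open>T\<close>. As
  \<open>\<alpha>\<close> vanishes on their common kernel, it is a combination of elements of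
  \<open>\<Theta>\<close>.\<close>

lemma functional_relation:
  assumes \<alpha>: "hom VF.X 1 \<alpha>" "\<And>z. z \<in> T \<Longrightarrow> \<alpha> z = 0" and k: "m < k" "k \<le> r"
  shows "(\<lambda>v. \<alpha> (weight_vec k v)) \<in> relations k"
proof -
  define \<Theta> where "\<Theta> = {l. hom VF.X 1 l \<and> (\<lambda>v. l (weight_vec k v)) \<in> relations k}"
  have V: "weight_vec k v \<in> symbol_space F r" for v unfolding weight_vec_def by (rule vec_in)
  have sub: "fun_space.subspace \<Theta>"
  proof (rule fun_space.subspaceI)
    have "(\<lambda>v. (0 :: 'w symbol_vec \<Rightarrow> complex) (weight_vec k v)) = 0" by (simp add: fun_eq_iff fun_apply)
    then show "0 \<in> \<Theta>" unfolding \<Theta>_def using hom.zero fun_space.subspace_0[OF subspace_relations] by simp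
  next
    fix g h assume "g \<in> \<Theta>" "h \<in> \<Theta>"
    then have gh: "hom VF.X 1 g" "(\<lambda>v. g (weight_vec k v)) \<in> relations k"
      "hom VF.X 1 h" "(\<lambda>v. h (weight_vec k v)) \<in> relations k" unfolding \<Theta>_def by auto
    have "(\<lambda>v. (g + h) (weight_vec k v)) = (\<lambda>v. g (weight_vec k v)) + (\<lambda>v. h (weight_vec k v))"
      by (simp add: fun_eq_iff fun_apply)
    then show "g + h \<in> \<Theta>" unfolding \<Theta>_def
      using hom.add[OF gh(1,3)] fun_space.subspace_add[OF subspace_relations gh(2,4)] by simp
  next
    fix c g assume "g \<in> \<Theta>"
    then have g: "hom VF.X 1 g" "(\<lambda>v. g (weight_vec k v)) \<in> relations k" unfolding \<Theta>_def by auto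
    have "(\<lambda>v. fun_scale c g (weight_vec k v)) = fun_scale c (\<lambda>v. g (weight_vec k v))"
      by (simp add: fun_eq_iff fun_apply)
    then show "fun_scale c g \<in> \<Theta>" unfolding \<Theta>_def
      using hom_scale[OF g(1)] fun_space.subspace_scale[OF subspace_relations g(2)] by simp
  qed
  have homs: "hom VF.X 1 \<theta>" if "\<theta> \<in> \<Theta>" for \<theta> using that unfolding \<Theta>_def by blast
  have d0: "VF.dual_system 0 (\<lambda>_ _. 0) (\<lambda>_. 0)" unfolding VF.dual_system_def by simp
  show ?thesis
  proof (rule VF.dual_system_extend[OF sub homs d0])
    fix c l u
    assume d: "VF.dual_system c l u" and l: "\<And>i. i < c \<Longrightarrow> l i \<in> \<Theta>"
      and ker: "\<And>v \<theta>. v \<in> symbol_space F r \<Longrightarrow> (\<And>i. i < c \<Longrightarrow> l i v = 0) \<Longrightarrow> \<theta> \<in> \<Theta> \<Longrightarrow> \<theta> v = 0"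
    have "\<alpha> x = 0" if x: "x \<in> symbol_space F r" "\<And>i. i < c \<Longrightarrow> l i x = 0" for x
    proof (rule \<alpha>(2))
      show "x \<in> T" unfolding VF.affine_tangent_space_at[OF limit_vec_in]
      proof (intro CollectI conjI allI ballI impI x(1))
        fix d \<theta> assume \<theta>: "\<theta> \<in> sym_forms (symbol_scale s) (symbol_space F r) (Suc d)"
          and z: "\<forall>y\<in>M. \<forall>v\<in>y. \<theta> (replicate (Suc d) v) = 0"
        define g where "g = (\<Sum>i\<in>coords. fun_scale (\<theta> (basis_vec i # replicate d limit_vec)) (coord i))"
        have gV: "g y = \<theta> (y # replicate d limit_vec)" if "y \<in> symbol_space F r" for y
          unfolding g_def by (subst VF.form_expand[OF \<theta> that])
            (auto simp: limit_vec_in sum_fun_apply fun_apply mult.commute)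
        have "hom VF.X 1 g" unfolding g_def by (intro hom_sum hom_scale hom_gen) auto
        moreover have "(\<lambda>v. g (weight_vec k v)) = (\<lambda>v. \<theta> (weight_vec k v # replicate d limit_vec))"
          using gV[OF V] by simp
        ultimately have g: "g \<in> \<Theta>" unfolding \<Theta>_def using form_relation[OF \<theta> z k] by simp
        have "g x = 0" by (rule ker[OF x(1) x(2) g])
        then show "\<theta> (x # replicate d limit_vec) = 0" using gV[OF x(1)] by simp
      qed
    qed
    then have "\<alpha> x = (\<Sum>i<c. \<alpha> (u i) * l i x)" if "x \<in> symbol_space F r" for x
      by (rule VF.dual_system_expand[OF d \<alpha>(1) that])
    then have "(\<lambda>v. \<alpha> (weight_vec k v)) = (\<Sum>i<c. fun_scale (\<alpha> (u i)) (\<lambda>v. l i (weight_vec k v)))"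
      using V by (simp add: fun_eq_iff sum_fun_apply fun_apply)
    moreover have "(\<Sum>i<c. fun_scale (\<alpha> (u i)) (\<lambda>v. l i (weight_vec k v))) \<in> relations k"
      by (intro fun_space.subspace_sum fun_space.subspace_scale subspace_relations) (use l in \<open>auto simp: \<Theta>_def\<close>)
    ultimately show ?thesis by simp
  qed (assumption, simp)
qed

text \<open>\<open>\<chi>\<close> is a linear function \<open>\<alpha>\<close> of weight
  \<open>k\<close> on the ambient space. It kills the tangent space: for \<open>k > m + 1\<close> no
  leading part reaches weight \<open>k\<close>, and for \<open>k = m + 1\<close> the differential
  vanishes by hypothesis. Above \<open>r\<close> the form is 0.\<close>

lemma form_redundant:
  assumes dimT: "VF.dim T \<le> card B + 1" and \<chi>: "\<chi> \<in> F k" and k: "m < k"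
    and lin: "k = Suc m \<Longrightarrow> (\<And>u. \<chi> (u # replicate m w) = 0)"
  shows "(\<lambda>v. \<chi> (replicate k v)) \<in> relations k"
proof (cases "k \<le> r")
  case False
  then have "\<chi> = 0" using \<chi> F_gt by auto
  then have "(\<lambda>v. \<chi> (replicate k v)) = 0" by (simp add: fun_eq_iff fun_apply)
  then show ?thesis using fun_space.subspace_0[OF subspace_relations] by simp
next
  case True
  obtain a where a: "\<And>vs. \<chi> vs = (\<Sum>\<psi>\<in>Fbasis k. a \<psi> * \<psi> vs)" using F_expand[OF \<chi>] by blast
  have c: "(k, \<psi>) \<in> coords" if "\<psi> \<in> Fbasis k" for \<psi> using that True by (simp add: coords_def)
  define \<alpha> where "\<alpha> = (\<Sum>\<psi>\<in>Fbasis k. fun_scale (a \<psi>) (coord (k, \<psi>)))"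
  have \<alpha>: "hom VF.X 1 \<alpha>" unfolding \<alpha>_def by (intro hom_sum hom_scale hom_gen) (use c in auto)
  have \<alpha>v: "\<alpha> (vec e) = (\<Sum>\<psi>\<in>Fbasis k. a \<psi> * e (k, \<psi>))" for e
    unfolding \<alpha>_def sum_fun_apply by (rule sum.cong) (use c in \<open>auto simp: fun_apply coord_vec\<close>)
  have "\<alpha> z = 0" if zT: "z \<in> T" for z
  proof (rule functional_kills_tangent[OF dimT \<alpha> _ _ zT])
    fix i assume i: "i \<in> coords" "fst i \<le> m"
    show "\<alpha> (basis_vec i) = 0" unfolding \<alpha>_def sum_fun_apply
      by (rule sum.neutral) (use c i k in \<open>auto simp: fun_apply VF.cc_bb\<close>)
  next
    fix u
    let ?e = "\<lambda>i. if fst i = Suc m then coord_deriv i w u else 0"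
    have "(\<Sum>i\<in>coords. ?e i * \<alpha> (basis_vec i)) = \<alpha> (vec ?e)"
      unfolding vec_def by (rule VF.hom_1_comb[OF \<alpha>, symmetric])
    also have "\<dots> = 0"
    proof (cases "k = Suc m")
      case True
      have "\<alpha> (vec ?e) = of_nat (Suc m) * \<chi> (u # replicate m w)"
        unfolding \<alpha>v a sum_distrib_left
        by (rule sum.cong[OF refl]) (simp add: True coord_deriv_def)
      then show ?thesis using lin[OF True] by simp
    qed (simp add: \<alpha>v)
    finally show "(\<Sum>i\<in>coords. ?e i * \<alpha> (basis_vec i)) = 0" .
  qed
  then have "(\<lambda>v. \<alpha> (weight_vec k v)) \<in> relations k" by (rule functional_relation[OF \<alpha> _ k True])
  moreover have "\<alpha> (weight_vec k v) = \<chi> (replicate k v)" for v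
    unfolding weight_vec_def \<alpha>v a by (simp add: coord_fun_def)
  ultimately show ?thesis by simp
qed

end

section \<open>Regularity of the base loci\<close>

context base_point
begin

text \<open>Each equation of weight above \<open>m\<close> is redundant modulo \<open>f\<close>: by induction on the order of
  vanishing at \<open>w\<close> and, for a fixed order, downwards on the weight.\<close>

lemma translate_in_ideal:
  assumes dimT: "VF.dim T \<le> card B + 1" and reg: "regular_sequence s W.X N f l u" and c: "c \<le> N"
    and f: "\<And>j. j < c \<Longrightarrow> \<phi> j \<in> F (Suc m) \<and> (\<forall>v. f j v = \<phi> j (replicate (Suc m) (v + w)) / of_nat (Suc m))
      \<and> (\<forall>v. l j v = \<phi> j (v # replicate m w))"
    and lin: "\<And>\<chi>. \<chi> \<in> F (Suc m) \<Longrightarrow> \<exists>\<beta>. \<forall>v. \<chi> (v # replicate m w) = (\<Sum>j<c. \<beta> j * l j v)"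
    and k: "m < k" and \<chi>: "\<chi> \<in> F k"
  shows "(\<lambda>v. \<chi> (replicate k (v + w))) \<in> regular_sequence.germ_ideal W.X f c"
proof -
  interpret reg: regular_sequence s W.X N f l u by (rule reg)
  have trX: "(\<lambda>v. g (v + w)) \<in> alg W.X" if "g \<in> alg W.X" for g by (rule W.translate_alg[OF that])
  have form_alg: "(\<lambda>v. \<chi> (replicate k (v + w))) \<in> alg W.X" if \<chi>: "\<chi> \<in> F k" for \<chi> k
  proof -
    obtain h where h: "hom W.X k h" "\<forall>v\<in>UNIV. h v = \<chi> (replicate k v)"
      using W.form_to_hom[OF F_form[OF \<chi>]] by blast
    then show ?thesis using trX[OF hom_alg[OF h(1)]] by simp
  qed
  have "(\<lambda>v. \<chi> (replicate k (v + w))) \<in> reg.ideal_plus_tail c p" if "m < k" "\<chi> \<in> F k" for p k \<chi>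
    using that
  proof (induction p arbitrary: k \<chi>)
    case 0
    show ?case by (rule reg.tail_ideal_plus_tail[OF c alg_tail_0[OF form_alg[OF 0(2)]]])
  next
    case (Suc p)
    note outer = Suc.IH
    show ?case using Suc.prems
    proof (induction "Suc r - k" arbitrary: k \<chi> rule: less_induct)
      case less
      \<comment> \<open>Equations with vanishing differential in weight \<open>m + 1\<close>, and
        all equations of higher weight, are redundant by \<open>form_redundant\<close>.\<close>
      have rel: "(\<lambda>v. \<psi> (replicate k (v + w))) \<in> reg.ideal_plus_tail c (Suc p)"
        if \<psi>: "\<psi> \<in> F k" "k = Suc m \<Longrightarrow> (\<And>u. \<psi> (u # replicate m w) = 0)" for \<psi>
      proof -
        have "(\<lambda>v. \<psi> (replicate k v)) \<in> relations k" by (rule form_redundant[OF dimT \<psi>(1) less.prems(1) \<psi>(2)])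
        then obtain a where a: "\<And>i. a i \<in> alg W.X" "\<And>i. fst i \<le> k \<Longrightarrow> a i w = 0"
          "(\<lambda>v. \<psi> (replicate k v)) = (\<Sum>i\<in>high. a i * coord_fun i)" by (rule relationsE) blast
        have eq: "(\<lambda>v. \<psi> (replicate k (v + w))) = (\<Sum>i\<in>high. (\<lambda>v. a i (v + w)) * (\<lambda>v. coord_fun i (v + w)))"
        proof (rule ext)
          fix v
          show "\<psi> (replicate k (v + w)) = (\<Sum>i\<in>high. (\<lambda>v. a i (v + w)) * (\<lambda>v. coord_fun i (v + w))) v"
            using fun_cong[OF a(3), of "v + w"] by (simp add: sum_fun_apply fun_apply)
        qed
        have summand: "(\<lambda>v. a i (v + w)) * (\<lambda>v. coord_fun i (v + w)) \<in> reg.ideal_plus_tail c (Suc p)" if i: "i \<in> high" for i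
        proof -
          have i: "i \<in> coords" "m < fst i" "snd i \<in> F (fst i)" using i coordsD(3) unfolding high_def by auto
          show ?thesis
          \<comment> \<open>Up to weight \<open>k\<close> the coefficient contributes the missing
            order; above \<open>k\<close> the full order is known from the inner induction.\<close>
          proof (cases "fst i \<le> k")
            case True
            have "(\<lambda>v. coord_fun i (v + w)) \<in> reg.ideal_plus_tail c p"
              unfolding coord_fun_def by (rule outer[OF i(2,3)])
            moreover have "(\<lambda>v. a i (v + w)) \<in> tail W.X 1"
              by (rule W.tail_1I[OF trX[OF a(1)]]) (simp add: a(2)[OF True])
            ultimately have "(\<lambda>v. a i (v + w)) * (\<lambda>v. coord_fun i (v + w)) \<in> reg.ideal_plus_tail c (1 + p)"
              by (rule reg.ideal_plus_tail_mult[OF c])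
            then show ?thesis by simp
          next
            case False
            have "(\<lambda>v. coord_fun i (v + w)) \<in> reg.ideal_plus_tail c (Suc p)"
              unfolding coord_fun_def
              by (rule less.hyps[OF _ i(2,3)]) (use False coordsD(1)[OF i(1)] in linarith)
            then have "(\<lambda>v. a i (v + w)) * (\<lambda>v. coord_fun i (v + w)) \<in> reg.ideal_plus_tail c (0 + Suc p)"
              by (rule reg.ideal_plus_tail_mult[OF c _ alg_tail_0[OF trX[OF a(1)]]])
            then show ?thesis by simp
          qed
        qed
        show ?thesis unfolding eq by (rule reg.ideal_plus_tail_sum[OF c summand])
      qed
      show ?case
      proof (cases "k = Suc m")
        case False
        then show ?thesis using rel[OF less.prems(2)] by blast
      next
        case True
        obtain \<beta> where \<beta>: "\<And>v. \<chi> (v # replicate m w) = (\<Sum>j<c. \<beta> j * l j v)" using lin less.prems(2) True by blast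
        \<comment> \<open>In weight \<open>m + 1\<close>, subtracting a combination of the chosen
          equations removes the differential.\<close>
        define \<psi> where "\<psi> = \<chi> - (\<Sum>j<c. fun_scale (\<beta> j) (\<phi> j))"
        have \<psi>v: "\<psi> vs = \<chi> vs - (\<Sum>j<c. \<beta> j * \<phi> j vs)" for vs
          by (simp add: \<psi>_def minus_apply sum_fun_apply fun_apply)
        have \<psi>F: "\<psi> \<in> F k" unfolding \<psi>_def
          by (intro fun_space.subspace_diff fun_space.subspace_sum fun_space.subspace_scale F_subspace less.prems(2))
            (use f True in simp)
        have "\<psi> (v # replicate m w) = 0" for v unfolding \<psi>v \<beta> using f by simp
        then have 1: "(\<lambda>v. \<psi> (replicate k (v + w))) \<in> reg.ideal_plus_tail c (Suc p)" by (rule rel[OF \<psi>F])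
        \<comment> \<open>The factor \<open>m + 1\<close> undoes the normalization in
          \<open>f\<close>.\<close>
        have 2: "(\<Sum>j<c. fun_scale (of_nat (Suc m) * \<beta> j) (f j)) \<in> reg.ideal_plus_tail c (Suc p)"
        proof (rule reg.ideal_plus_tail_sum[OF c])
          fix j assume "j \<in> {..<c}"
          then have "f j \<in> reg.germ_ideal c" using reg.f_germ_ideal[of j c] c by simp
          then have "fun_scale (of_nat (Suc m) * \<beta> j) (f j) \<in> reg.germ_ideal c"
            by (rule ideal_scale[OF reg.ideal_germ_ideal[OF c]])
          then show "fun_scale (of_nat (Suc m) * \<beta> j) (f j) \<in> reg.ideal_plus_tail c (Suc p)"
            unfolding reg.germ_ideal_iff by blast
        qed
        have "(\<lambda>v. \<chi> (replicate k (v + w)))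
          = (\<lambda>v. \<psi> (replicate k (v + w))) + (\<Sum>j<c. fun_scale (of_nat (Suc m) * \<beta> j) (f j))"
        proof (rule ext)
          fix v
          have summand: "of_nat (Suc m) * \<beta> j * f j v = \<beta> j * \<phi> j (replicate k (v + w))" if "j < c" for j
            using f[OF that] True by (simp del: of_nat_Suc replicate_Suc)
          have "(\<Sum>j<c. of_nat (Suc m) * \<beta> j * f j v) = (\<Sum>j<c. \<beta> j * \<phi> j (replicate k (v + w)))"
            by (rule sum.cong[OF refl], rule summand) simp
          then show "\<chi> (replicate k (v + w))
            = ((\<lambda>v. \<psi> (replicate k (v + w))) + (\<Sum>j<c. fun_scale (of_nat (Suc m) * \<beta> j) (f j))) v"
            by (simp add: fun_apply sum_fun_apply \<psi>v del: of_nat_Suc)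
        qed
        then show ?thesis using reg.ideal_plus_tail_add[OF c 1 2] by simp
      qed
    qed
  qed
  then show ?thesis unfolding reg.germ_ideal_iff using k \<chi> by blast
qed

text \<open>Some \<open>c\<close> equations from \<open>F (m + 1)\<close> with independent
  differentials leave a tangent space of dimension at most \<open>card B - c\<close>. Completed by
  linear forms vanishing at \<open>w\<close> to a system with common kernel in the line of
  \<open>w\<close>, they give a chain of length \<open>N - c\<close> with
  \<open>N + 1 \<ge> card B\<close>. Comparison with the general bound \<open>local_dim_le\<close>
  forces equality.\<close>

lemma base_locus_regular:
  assumes dimT: "VF.dim T \<le> card B + 1" and x: "span {w} \<in> base_locus s F (Suc m)"
  shows "enat (dim (affine_tangent_space s UNIV (base_locus s F (Suc m)) (span {w})))
    = local_dim s UNIV (base_locus s F (Suc m)) (span {w}) + 1"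
proof -
  let ?Y = "base_locus s F (Suc m)"
  define \<Theta> where "\<Theta> = {l. \<exists>\<phi>\<in>F (Suc m). l = (\<lambda>u. \<phi> (u # replicate m w))}"
  have \<Theta>_hom: "hom W.X 1 \<theta>" if \<theta>: "\<theta> \<in> \<Theta>" for \<theta>
  proof -
    obtain \<phi> where \<phi>: "\<phi> \<in> F (Suc m)" "\<theta> = (\<lambda>u. \<phi> (u # replicate m w))" using \<theta> unfolding \<Theta>_def by blast
    have "\<theta> = (\<Sum>b\<in>B. fun_scale (\<phi> (b # replicate m w)) (\<lambda>v. representation B v b))"
      by (rule ext) (simp add: \<phi>(2) sum_fun_apply fun_apply mult.commute W.form_expand[OF F_form[OF \<phi>(1)]])
    moreover have "hom W.X 1 (\<Sum>b\<in>B. fun_scale (\<phi> (b # replicate m w)) (\<lambda>v. representation B v b))"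
      by (intro hom_sum hom_scale hom_gen) auto
    ultimately show ?thesis by simp
  qed
  have \<Theta>_sub: "fun_space.subspace \<Theta>"
  proof (rule fun_space.subspaceI)
    show "0 \<in> \<Theta>" unfolding \<Theta>_def
      using fun_space.subspace_0[OF F_subspace, of "Suc m"]
      by (intro CollectI bexI[of _ 0]) (simp_all add: fun_eq_iff fun_apply)
  next
    fix g h assume "g \<in> \<Theta>" "h \<in> \<Theta>"
    then obtain \<phi> \<psi> where "\<phi> \<in> F (Suc m)" "g = (\<lambda>u. \<phi> (u # replicate m w))"
      "\<psi> \<in> F (Suc m)" "h = (\<lambda>u. \<psi> (u # replicate m w))" unfolding \<Theta>_def by blast
    then show "g + h \<in> \<Theta>" unfolding \<Theta>_def
      using fun_space.subspace_add[OF F_subspace, of \<phi> "Suc m" \<psi>]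
      by (intro CollectI bexI[of _ "\<phi> + \<psi>"]) (simp_all add: fun_eq_iff fun_apply)
  next
    fix a g assume "g \<in> \<Theta>"
    then obtain \<phi> where "\<phi> \<in> F (Suc m)" "g = (\<lambda>u. \<phi> (u # replicate m w))" unfolding \<Theta>_def by blast
    then show "fun_scale a g \<in> \<Theta>" unfolding \<Theta>_def
      using fun_space.subspace_scale[OF F_subspace, of \<phi> "Suc m" a]
      by (intro CollectI bexI[of _ "fun_scale a \<phi>"]) (simp_all add: fun_eq_iff fun_apply)
  qed
  have d0: "W.dual_system 0 (\<lambda>_ _. 0) (\<lambda>_. 0)" unfolding W.dual_system_def by simp
  have "\<exists>c l u. W.dual_system c l u \<and> (\<forall>i<c. l i \<in> \<Theta>) \<and> (\<forall>v. (\<forall>i<c. l i v = 0) \<longrightarrow> (\<forall>\<theta>\<in>\<Theta>. \<theta> v = 0))"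
  proof (rule W.dual_system_extend[OF \<Theta>_sub \<Theta>_hom d0])
    fix c l u
    assume 1: "W.dual_system c l u" and 2: "\<And>i. i < c \<Longrightarrow> l i \<in> \<Theta>"
      and 3: "\<And>v \<theta>. v \<in> UNIV \<Longrightarrow> (\<And>i. i < c \<Longrightarrow> l i v = 0) \<Longrightarrow> \<theta> \<in> \<Theta> \<Longrightarrow> \<theta> v = 0"
    have "\<theta> v = 0" if "\<forall>i<c. l i v = 0" "\<theta> \<in> \<Theta>" for v \<theta>
      by (rule 3[OF UNIV_I _ that(2)]) (use that(1) in blast)
    then show ?thesis using 1 2 by (intro exI[of _ c] exI[of _ l] exI[of _ u]) blast
  qed (assumption, simp)
  then obtain c l0 u0 where d: "W.dual_system c l0 u0" and l0: "\<And>i. i < c \<Longrightarrow> l0 i \<in> \<Theta>"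
    and ker: "\<And>v \<theta>. (\<forall>i<c. l0 i v = 0) \<Longrightarrow> \<theta> \<in> \<Theta> \<Longrightarrow> \<theta> v = 0" by blast
  have "\<forall>i. \<exists>\<phi>. i < c \<longrightarrow> \<phi> \<in> F (Suc m) \<and> l0 i = (\<lambda>u. \<phi> (u # replicate m w))" using l0 unfolding \<Theta>_def by blast
  then obtain \<phi> where \<phi>: "\<And>i. i < c \<Longrightarrow> \<phi> i \<in> F (Suc m)" "\<And>i. i < c \<Longrightarrow> l0 i = (\<lambda>u. \<phi> i (u # replicate m w))" by metis
  \<comment> \<open>At \<open>w\<close> a polarized form takes the value of the form itself, which
    is 0; so all \<open>l0 i\<close> lie in this space, whose common kernel is the line of
    \<open>w\<close>.\<close>
  define \<Theta>' where "\<Theta>' = {l. hom W.X 1 l \<and> l w = 0}"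
  have \<Theta>'_sub: "fun_space.subspace \<Theta>'"
    by (rule fun_space.subspaceI) (auto simp: \<Theta>'_def fun_apply intro: hom.zero hom.add hom_scale)
  have \<Theta>'_hom: "hom W.X 1 \<theta>" if "\<theta> \<in> \<Theta>'" for \<theta> using that unfolding \<Theta>'_def by blast
  have l0': "l0 i \<in> \<Theta>'" if i: "i < c" for i
    unfolding \<Theta>'_def using W.dual_systemD(1)[OF d i] \<phi>(2)[OF i] base[OF \<phi>(1)[OF i]] by simp
  have "\<exists>N l u. c \<le> N \<and> W.dual_system N l u \<and> (\<forall>i<c. l i = l0 i \<and> u i = u0 i) \<and> (\<forall>i<N. l i \<in> \<Theta>')
      \<and> {v \<in> UNIV. \<forall>i<N. l i v = 0} \<subseteq> span {w}"
  proof (rule W.dual_system_extend[OF \<Theta>'_sub \<Theta>'_hom d l0'])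
    fix N l u
    assume 1: "c \<le> N" "W.dual_system N l u" "\<And>i. i < c \<Longrightarrow> l i = l0 i \<and> u i = u0 i" "\<And>i. i < N \<Longrightarrow> l i \<in> \<Theta>'"
      and 3: "\<And>v \<theta>. v \<in> UNIV \<Longrightarrow> (\<And>i. i < N \<Longrightarrow> l i v = 0) \<Longrightarrow> \<theta> \<in> \<Theta>' \<Longrightarrow> \<theta> v = 0"
    have "v \<in> span {w}" if v: "\<forall>i<N. l i v = 0" for v
    proof (rule W.vanishing_at_line[OF UNIV_I w0 UNIV_I])
      fix \<theta> assume "hom W.X 1 \<theta>" "\<theta> w = 0"
      then have "\<theta> \<in> \<Theta>'" unfolding \<Theta>'_def by blast
      show "\<theta> v = 0" by (rule 3[OF UNIV_I _ \<open>\<theta> \<in> \<Theta>'\<close>]) (use v in blast)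
    qed
    then show ?thesis using 1 by (intro exI[of _ N] exI[of _ l] exI[of _ u]) blast
  qed
  then obtain N l u where c: "c \<le> N" and dN: "W.dual_system N l u" and ll0: "\<And>i. i < c \<Longrightarrow> l i = l0 i"
    and l\<Theta>': "\<And>i. i < N \<Longrightarrow> l i \<in> \<Theta>'" and kerN: "{v \<in> UNIV. \<forall>i<N. l i v = 0} \<subseteq> span {w}" by blast
  have N: "card B \<le> N + 1"
  proof -
    have "dim {v \<in> UNIV. \<forall>i<N. l i v = 0} \<le> dim (span {w})" by (rule W.dim_mono_V[OF kerN]) simp
    also have "\<dots> \<le> 1" using dim_le_card[of "span {w}" "{w}"] by simp
    finally show ?thesis using W.dim_kernel[OF dN] by simp
  qed
  \<comment> \<open>Division by \<open>m + 1\<close> removes the factor in the differential of a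
    form of that degree, so that the linear part is \<open>l i\<close>.\<close>
  define f where "f i = (if i < c then (\<lambda>v. \<phi> i (replicate (Suc m) (v + w)) / of_nat (Suc m)) else l i)" for i
  have reg: "regular_sequence s W.X N f l u"
  proof unfold_locales
    fix i assume i: "i < N"
    show "f i - l i \<in> tail W.X 2"
    proof (cases "i < c")
      case False
      then have "f i - l i = 0" by (simp add: f_def)
      then show ?thesis using tail_zero by simp
    next
      case True
      note \<phi>i = \<phi>(1)[OF True]
      obtain g l' where g: "\<And>v. v \<in> UNIV \<Longrightarrow> g v = \<phi> i (replicate (Suc m) (v + w))"
        "g - (\<lambda>_. \<phi> i (replicate (Suc m) w)) - l' \<in> tail W.X 2"
        "\<And>v. v \<in> UNIV \<Longrightarrow> l' v = of_nat (Suc m) * \<phi> i (v # replicate m w)"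
        by (rule W.differential[OF F_form[OF \<phi>i] UNIV_I[of w]]) blast
      have "fun_scale (1 / of_nat (Suc m)) (g - (\<lambda>_. \<phi> i (replicate (Suc m) w)) - l') \<in> tail W.X 2"
        by (rule ideal_scale[OF ideal_tail g(2)])
      moreover have "f i - l i = fun_scale (1 / of_nat (Suc m)) (g - (\<lambda>_. \<phi> i (replicate (Suc m) w)) - l')"
        using True g(1,3) base[OF \<phi>i] ll0[OF True] \<phi>(2)[OF True]
        by (auto simp: fun_eq_iff f_def minus_apply fun_apply field_simps simp del: of_nat_Suc replicate_Suc)
      ultimately show ?thesis by simp
    qed
  qed (use W.dual_systemD[OF dN] in auto)
  have lower: "enat (N - c) \<le> local_dim s UNIV ?Y (span {w})"
  proof (rule W.local_dim_ge[OF reg c refl refl w0])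
    fix i assume i: "i < N"
    show "\<exists>d. \<exists>\<psi>\<in>sym_forms s UNIV d. \<forall>v. f i v = \<psi> (replicate d (v + w))"
    proof (cases "i < c")
      case True
      have "fun_scale (1 / of_nat (Suc m)) (\<phi> i) \<in> sym_forms s UNIV (Suc m)"
        by (rule F_form[OF fun_space.subspace_scale[OF F_subspace \<phi>(1)[OF True]]])
      then show ?thesis using True
        by (intro exI[of _ "Suc m"] bexI[of _ "fun_scale (1 / of_nat (Suc m)) (\<phi> i)"]) (simp_all add: f_def fun_apply)
    next
      case False
      have li: "hom W.X 1 (l i)" "l i w = 0" using l\<Theta>'[OF i] unfolding \<Theta>'_def by auto
      obtain \<psi> where \<psi>: "\<psi> \<in> sym_forms s UNIV 1" "\<forall>v\<in>UNIV. l i v = \<psi> (replicate 1 v)" using W.hom_to_form[OF li(1)] by blast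
      have "f i v = \<psi> (replicate 1 (v + w))" for v
        using W.hom_1_linear(1)[OF li(1), of v w] li(2) \<psi>(2) False by (simp add: f_def)
      then show ?thesis using \<psi>(1) by blast
    qed
  next
    fix y assume y: "y \<in> proj_space s UNIV"
      "\<And>d \<chi>. \<chi> \<in> sym_forms s UNIV d \<Longrightarrow> (\<lambda>v. \<chi> (replicate d (v + w))) \<in> regular_sequence.germ_ideal W.X f c \<Longrightarrow>
        \<forall>v\<in>y. \<chi> (replicate d v) = 0"
    have "\<forall>v\<in>y. \<chi> (replicate (Suc m) v) = 0" if \<chi>: "\<chi> \<in> F (Suc m)" for \<chi>
    proof (rule y(2)[OF F_form[OF \<chi>]], rule translate_in_ideal[OF dimT reg c _ _ _ \<chi>])
      show "\<phi> j \<in> F (Suc m) \<and> (\<forall>v. f j v = \<phi> j (replicate (Suc m) (v + w)) / of_nat (Suc m))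
          \<and> (\<forall>v. l j v = \<phi> j (v # replicate m w))" if "j < c" for j
        using that \<phi> ll0[OF that] by (simp add: f_def)
      fix \<psi> assume "\<psi> \<in> F (Suc m)"
      then have \<psi>: "(\<lambda>u. \<psi> (u # replicate m w)) \<in> \<Theta>" unfolding \<Theta>_def by blast
      have "\<psi> (v # replicate m w) = (\<Sum>j<c. \<psi> (u0 j # replicate m w) * l0 j v)" for v
      proof (rule W.dual_system_expand[OF d \<Theta>_hom[OF \<psi>] UNIV_I])
        fix v assume "\<And>i. i < c \<Longrightarrow> l0 i v = 0"
        then have "\<forall>i<c. l0 i v = 0" by simp
        then show "\<psi> (v # replicate m w) = 0" by (rule ker[OF _ \<psi>])
      qed
      moreover have "(\<Sum>j<c. \<psi> (u0 j # replicate m w) * l0 j v) = (\<Sum>j<c. \<psi> (u0 j # replicate m w) * l j v)" for v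
        by (rule sum.cong) (simp_all add: ll0)
      ultimately have "\<psi> (v # replicate m w) = (\<Sum>j<c. \<psi> (u0 j # replicate m w) * l j v)" for v by (rule trans)
      then show "\<exists>\<beta>. \<forall>v. \<psi> (v # replicate m w) = (\<Sum>j<c. \<beta> j * l j v)"
        by (intro exI[of _ "\<lambda>j. \<psi> (u0 j # replicate m w)"] allI)
    qed simp
    then show "y \<in> ?Y" using y(1) unfolding base_locus_def proj_zeros_def by blast
  qed
  have "dim (affine_tangent_space s UNIV ?Y (span {w})) + c \<le> card B"
  proof -
    have "affine_tangent_space s UNIV ?Y (span {w}) \<subseteq> {v \<in> UNIV. \<forall>i<c. l0 i v = 0}"
    proof
      fix z assume z: "z \<in> affine_tangent_space s UNIV ?Y (span {w})"
      have "l0 i z = 0" if i: "i < c" for i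
      proof -
        have "\<forall>y\<in>?Y. \<forall>v\<in>y. \<phi> i (replicate (Suc m) v) = 0"
          using \<phi>(1)[OF i] unfolding base_locus_def proj_zeros_def by blast
        then have "\<phi> i (z # replicate m w) = 0"
          using z F_form[OF \<phi>(1)[OF i]] unfolding W.affine_tangent_space_at[OF UNIV_I] by blast
        then show ?thesis unfolding \<phi>(2)[OF i] .
      qed
      then show "z \<in> {v \<in> UNIV. \<forall>i<c. l0 i v = 0}" by blast
    qed
    then have "dim (affine_tangent_space s UNIV ?Y (span {w})) \<le> dim {v \<in> UNIV. \<forall>i<c. l0 i v = 0}"
      by (rule W.dim_mono_V) simp
    then show ?thesis using W.dim_kernel[OF d] by simp
  qed
  then have "dim (affine_tangent_space s UNIV ?Y (span {w})) \<le> N - c + 1" using N c by linarith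
  then have "enat (dim (affine_tangent_space s UNIV ?Y (span {w}))) \<le> enat (N - c) + 1" by (simp add: one_enat_def)
  also have "\<dots> \<le> local_dim s UNIV ?Y (span {w}) + 1" by (rule add_right_mono[OF lower])
  finally have "enat (dim (affine_tangent_space s UNIV ?Y (span {w}))) \<le> local_dim s UNIV ?Y (span {w}) + 1" .
  moreover have "local_dim s UNIV ?Y (span {w}) + 1 \<le> enat (dim (affine_tangent_space s UNIV ?Y (span {w})))"
    by (rule W.local_dim_le[OF _ x]) (auto simp: base_locus_def proj_zeros_def)
  ultimately show ?thesis by (rule order_antisym)
qed

end

theorem proposition4p4:
  fixes s :: "complex \<Rightarrow> 'w::ab_group_add \<Rightarrow> 'w"
    and B :: "'w set"
    and F :: "nat \<Rightarrow> ('w list \<Rightarrow> complex) set"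
    and r :: nat
  assumes "finite_dimensional_vector_space s B"
    and "symbol_system s F r"
    and "nonsingular (symbol_scale s) (symbol_space F r) (euler_symmetric_variety s F r)"
  shows "nonsingular s UNIV (base_loci s F)"
  unfolding nonsingular_def
proof
  interpret symbol_setup s B F r
    using assms(1,2) by (simp add: symbol_setup_def symbol_setup_axioms_def)
  define m where "m = symbol_order s F"
  have loci: "base_loci s F = base_locus s F (Suc m)" unfolding base_loci_def m_def by simp
  fix x assume "x \<in> base_loci s F"
  then have x: "x \<in> base_locus s F (Suc m)" unfolding loci .
  then have xP: "x \<in> proj_space s UNIV" unfolding base_locus_def proj_zeros_def by simp
  then obtain w where w: "w \<noteq> 0" "x = span {w}" by (rule W.proj_spaceE)
  have wx: "w \<in> x" unfolding w(2) by (rule span_base) simp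
  have empty0: "base_locus s F 0 = {}"
  proof -
    have "(\<lambda>vs. if vs = [] then 1 else 0) \<in> F 0"
      unfolding F_0 by (auto intro!: sym_formsI split: if_splits)
    then show ?thesis unfolding base_locus_def proj_zeros_def proj_space_def
      using span_base by fastforce
  qed
  \<comment> \<open>Above \<open>r\<close> the base locus is all of projective space, which contains
    \<open>x\<close>; so the greatest \<open>m\<close> exists.\<close>
  have bound: "k \<le> r" if "base_locus s F k = {}" for k
  proof (rule ccontr)
    assume "\<not> k \<le> r"
    then have "F k = {0}" by (simp add: F_gt)
    then have "x \<in> base_locus s F k" using xP unfolding base_locus_def proj_zeros_def by (simp add: fun_apply)
    then show False using that by simp
  qed
  have "base_locus s F m = {}"
    unfolding m_def symbol_order_def by (rule GreatestI_nat[of "\<lambda>m. base_locus s F m = {}" 0 r, OF empty0 bound])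
  then have "x \<notin> base_locus s F m" by simp
  then obtain \<psi> where \<psi>: "\<psi> \<in> F m" "\<not> (\<forall>v\<in>x. \<psi> (replicate m v) = 0)"
    using xP unfolding base_locus_def proj_zeros_def by blast
  interpret base_point s B F r m w
  proof unfold_locales
    show "w \<noteq> 0" by (rule w(1))
    show "\<phi> (replicate (Suc m) w) = 0" if "\<phi> \<in> F (Suc m)" for \<phi>
      using x wx that unfolding base_locus_def proj_zeros_def by blast
    have "\<psi> (replicate m w) \<noteq> 0"
      using \<psi>(2) unfolding w(2) W.form_zero_on_line[OF F_form[OF \<psi>(1)] UNIV_I] .
    then show "\<exists>\<psi>\<in>F m. \<psi> (replicate m w) \<noteq> 0" using \<psi>(1) by blast
  qed
  \<comment> \<open>Nonsingularity at the single point of \<open>limit_vec\<close>, combined with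
    the bound on the dimension of \<open>M\<close>.\<close>
  have "enat (VF.dim T) = local_dim (symbol_scale s) (symbol_space F r) M (VF.span {limit_vec}) + 1"
    using assms(3) limit_point_in_M unfolding nonsingular_def by blast
  also have "\<dots> \<le> enat (card B) + 1" by (rule add_right_mono[OF local_dim_M_le])
  finally have "VF.dim T \<le> card B + 1" by (simp add: one_enat_def)
  then show "enat (dim (affine_tangent_space s UNIV (base_loci s F) x)) = local_dim s UNIV (base_loci s F) x + 1"
    unfolding loci w(2) by (rule base_locus_regular) (use x w(2) in simp)
qed

end
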